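(* Let $F$ be a nonreal field with $\mathrm{char}\,F\ne2$ and $u(F)<\infty$. Let $\alpha\in\mathrm{Br}_2(F)$ with $\mathrm{ind}\,\alpha=8$. Then $$u^+(\alpha)\le\Big\lfloor\tfrac{87}{64}u(F)\Big\rfloor+\Big\lfloor\tfrac{63}{32}u(F)\Big\rfloor\le\tfrac{213}{64}u(F).$$
   Context: A field $F$ is nonreal if $-1$ is a sum of squares; then $u(F)$ is the supremum of dimensions of anisotropic quadratic forms over $F$. $\mathrm{Br}_2(F)$ is the $2$-torsion of the Brauer group. For $\alpha\in\mathrm{Br}_2(F)$ with $D$ the division algebra of class $\alpha$, $u^+(\alpha)$ is the supremum of the ranks (= $\dim_D V$) of anisotropic hermitian forms over $(D,\gamma)$ for any orthogonal involution $\gamma$ on $D$ (independent of the choice); here a hermitian form over $(D,\gamma)$ is a biadditive $h:V\times V\to D$ with $h(v\alpha,w\beta)=\gamma(\alpha)h(v,w)\beta$ and $h(w,v)=\gamma(h(v,w))$, anisotropic if $h(v,v)\ne0$ for $v\ne0$, and an $F$-linear involution is orthogonal if over a splitting field it is adjoint to a symmetric (non-alternating) bilinear form. *)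

theory Defs
  imports "HOL-Analysis.Analysis" "HOL-Library.Extended_Nat"
begin

definition qf_eval :: "nat \<Rightarrow> (nat \<Rightarrow> nat \<Rightarrow> 'a::field) \<Rightarrow> (nat \<Rightarrow> 'a) \<Rightarrow> 'a" where
  "qf_eval n a x = (\<Sum>i<n. \<Sum>j<n. a i j * x i * x j)"

definition anisotropic_qf :: "nat \<Rightarrow> (nat \<Rightarrow> nat \<Rightarrow> 'a::field) \<Rightarrow> bool" where
  "anisotropic_qf n a \<longleftrightarrow> (\<forall>x. qf_eval n a x = 0 \<longrightarrow> (\<forall>i<n. x i = 0))"

definition u_inv :: "'a::field itself \<Rightarrow> enat" where
  "u_inv _ = Sup {enat n | n. \<exists>a :: nat \<Rightarrow> nat \<Rightarrow> 'a. anisotropic_qf n a}"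

definition nonreal_field :: "'a::field itself \<Rightarrow> bool" where
  "nonreal_field _ \<longleftrightarrow> (\<exists>(x :: nat \<Rightarrow> 'a) m. (\<Sum>i<m. x i ^ 2) = - 1)"

definition central_algebra_hom :: "('a::field \<Rightarrow> 'd::division_ring) \<Rightarrow> bool" where
  "central_algebra_hom \<iota> \<longleftrightarrow>
     \<iota> 1 = 1 \<and> (\<forall>x y. \<iota> (x + y) = \<iota> x + \<iota> y) \<and> (\<forall>x y. \<iota> (x * y) = \<iota> x * \<iota> y) \<and>
     {z. \<forall>d. z * d = d * z} = range \<iota>"

definition algebra_dim :: "('a::field \<Rightarrow> 'd::division_ring) \<Rightarrow> nat \<Rightarrow> bool" where
  "algebra_dim \<iota> m \<longleftrightarrow> (\<exists>e :: nat \<Rightarrow> 'd. \<forall>d. \<exists>!c :: nat \<Rightarrow> 'a.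
      (\<forall>i\<ge>m. c i = 0) \<and> d = (\<Sum>i<m. \<iota> (c i) * e i))"

text \<open>Central division F-algebra of degree 8 (index 8), i.e. of dimension 64.\<close>
definition central_division_algebra_deg8 :: "('a::field \<Rightarrow> 'd::division_ring) \<Rightarrow> bool" where
  "central_division_algebra_deg8 \<iota> \<longleftrightarrow> central_algebra_hom \<iota> \<and> algebra_dim \<iota> 64"

definition F_linear_involution :: "('a::field \<Rightarrow> 'd::division_ring) \<Rightarrow> ('d \<Rightarrow> 'd) \<Rightarrow> bool" where
  "F_linear_involution \<iota> \<gamma> \<longleftrightarrow>
     (\<forall>x y. \<gamma> (x + y) = \<gamma> x + \<gamma> y) \<and> (\<forall>x y. \<gamma> (x * y) = \<gamma> y * \<gamma> x) \<and>
     (\<forall>x. \<gamma> (\<gamma> x) = x) \<and> (\<forall>c x. \<gamma> (\<iota> c * x) = \<iota> c * \<gamma> x)"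

text \<open>A splitting of D (of degree 8) over an extension field K of F (embedded by kappa):
  an F-algebra homomorphism phi : D -> M_8(K) whose K-span is all of M_8(K), i.e. the
  induced map D (x)_F K -> M_8(K) is a K-algebra isomorphism.\<close>
definition splitting_deg8 ::
  "('a::field \<Rightarrow> 'd::division_ring) \<Rightarrow> ('a \<Rightarrow> 'k::field) \<Rightarrow> ('d \<Rightarrow> 'k^8^8) \<Rightarrow> bool" where
  "splitting_deg8 \<iota> \<kappa> \<phi> \<longleftrightarrow>
     \<kappa> 1 = 1 \<and> (\<forall>x y. \<kappa> (x + y) = \<kappa> x + \<kappa> y) \<and> (\<forall>x y. \<kappa> (x * y) = \<kappa> x * \<kappa> y) \<and>
     (\<forall>x y. \<phi> (x + y) = \<phi> x + \<phi> y) \<and> (\<forall>x y. \<phi> (x * y) = \<phi> x ** \<phi> y) \<and>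
     (\<forall>c. \<phi> (\<iota> c) = mat (\<kappa> c)) \<and>
     (\<forall>M :: 'k^8^8. \<exists>N (k :: nat \<Rightarrow> 'k) (d :: nat \<Rightarrow> 'd). M = (\<Sum>i<N. mat (k i) ** \<phi> (d i)))"

text \<open>gamma is orthogonal (w.r.t. the splitting phi): after extending scalars, gamma is the
  adjoint involution of a nondegenerate symmetric bilinear form b(x,y) = x^T S y,
  i.e. phi(gamma d) = S^{-1} phi(d)^T S.\<close>
definition orthogonal_wrt ::
  "('d::division_ring \<Rightarrow> 'k::field^8^8) \<Rightarrow> ('d \<Rightarrow> 'd) \<Rightarrow> bool" where
  "orthogonal_wrt \<phi> \<gamma> \<longleftrightarrow> (\<exists>S :: 'k^8^8. transpose S = S \<and> invertible S \<and>
     (\<forall>d. \<phi> (\<gamma> d) = matrix_inv S ** transpose (\<phi> d) ** S))"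

text \<open>The right D-vector space D^n, realised as functions nat => D vanishing from n on;
  right scalar multiplication is componentwise (v a)_i = v_i * a.\<close>
definition Dspace :: "nat \<Rightarrow> (nat \<Rightarrow> 'd::division_ring) set" where
  "Dspace n = {v. \<forall>i\<ge>n. v i = 0}"

definition hermitian_form ::
  "('d::division_ring \<Rightarrow> 'd) \<Rightarrow> nat \<Rightarrow> ((nat \<Rightarrow> 'd) \<Rightarrow> (nat \<Rightarrow> 'd) \<Rightarrow> 'd) \<Rightarrow> bool" where
  "hermitian_form \<gamma> n h \<longleftrightarrow>
     (\<forall>v\<in>Dspace n. \<forall>v'\<in>Dspace n. \<forall>w\<in>Dspace n.
        h (\<lambda>i. v i + v' i) w = h v w + h v' w \<and> h w (\<lambda>i. v i + v' i) = h w v + h w v') \<and>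
     (\<forall>v\<in>Dspace n. \<forall>w\<in>Dspace n. \<forall>a b.
        h (\<lambda>i. v i * a) (\<lambda>i. w i * b) = \<gamma> a * h v w * b) \<and>
     (\<forall>v\<in>Dspace n. \<forall>w\<in>Dspace n. h w v = \<gamma> (h v w))"

definition anisotropic_hermitian ::
  "('d::division_ring \<Rightarrow> 'd) \<Rightarrow> nat \<Rightarrow> ((nat \<Rightarrow> 'd) \<Rightarrow> (nat \<Rightarrow> 'd) \<Rightarrow> 'd) \<Rightarrow> bool" where
  "anisotropic_hermitian \<gamma> n h \<longleftrightarrow> hermitian_form \<gamma> n h \<and>
     (\<forall>v\<in>Dspace n. v \<noteq> (\<lambda>_. 0) \<longrightarrow> h v v \<noteq> 0)"

text \<open>u^+ computed with the orthogonal involution gamma on D (independent of gamma).\<close>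
definition u_plus :: "('d::division_ring \<Rightarrow> 'd) \<Rightarrow> enat" where
  "u_plus \<gamma> = Sup {enat n | n. \<exists>h. anisotropic_hermitian \<gamma> n h}"

end

theory Submission
  imports Defs "HOL-Algebra.Algebraic_Closure_Type" "HOL-Library.Function_Algebras"
begin

text \<open>
  First, \<open>D\<close> contains a biquadratic field \<open>F(i, j)\<close> with \<open>i\<^sup>2, j\<^sup>2 \<in> F\<close>. For a symplectic involution on
  \<open>D\<close> there are at least 36 dimensions of skew elements, so a symmetric \<open>s\<close> commutes with at least 8
  of them. Choose a field \<open>E\<close> maximal among the extensions of \<open>F\<close> in an algebraically closed field
  for which \<open>D\<^sub>E\<close> remains a division algebra without symmetric elements of degree 2. A descent along
  quadratic extensions shows that \<open>E\<close> is quadratically closed; then three quadratic forms on the skew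
  elements commuting with \<open>s\<close> have a common zero, which is an element of degree 2 of \<open>D\<^sub>E\<close>, a
  contradiction. So \<open>D\<close> itself contains \<open>i\<close>, and \<open>j\<close> is found in the centralizer of \<open>i\<close>.

  After conjugating \<open>\<gamma>\<close> into an orthogonal involution \<open>\<sigma>\<close> fixing \<open>i\<close> and \<open>j\<close>, the trace turns a
  hermitian form into a symmetric \<open>F\<close>-bilinear form \<open>\<beta>\<close> with \<open>\<beta> (v d) w = \<beta> v (w \<sigma>(d))\<close>, and \<open>v\<close> is
  isotropic iff \<open>\<beta> (v x) v = 0\<close> for all \<open>x \<in> D\<close>. This system of quadratic forms is solved in layers: if
  the forms with \<open>x \<in> B e\<close> have a common zero on every \<open>B\<close>-subspace of \<open>F\<close>-dimension more than \<open>c\<close>, then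
  a \<open>B\<close>-subspace of dimension more than \<open>c + 2 c'\<close> has a \<open>B\<close>-subspace of dimension more than \<open>c'\<close> on
  which all of them vanish. Let \<open>Q\<close> be the centralizer of \<open>F(i, j)\<close> and \<open>D = Q + Q w\<^sub>1 + Q w\<^sub>2 + Q w\<^sub>3\<close> the
  decomposition under conjugation by \<open>i\<close> and \<open>j\<close>. The layers give \<open>45u\<close> for \<open>Q\<close> and \<open>21u\<close> for each
  \<open>Q w\<^sub>k\<close>, hence \<open>45u + 2 \<cdot> 21u = 87u\<close> for the centralizer \<open>Q + Q w\<^sub>1\<close> of \<open>i\<close> and \<open>63u\<close> for
  \<open>Q w\<^sub>2 + Q w\<^sub>3\<close>. Since \<open>D\<^sup>n\<close> has \<open>F\<close>-dimension \<open>64n\<close> and subspaces over the centralizer of \<open>i\<close> have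
  dimension divisible by \<open>32\<close>, the bound follows.
\<close>

no_notation Polynomials.var (\<open>X\<index>\<close>)

section \<open>Dimension over division subrings\<close>

text \<open>The given involution is of orthogonal type, and its symmetric elements may have degree
  8. Twisting by an invertible skew element makes its symmetric elements, of dimension at least 36,
  the source of skew elements of a new involution, whose symmetric elements have degree at most 4.
  The obstacle to solving quadratic equations after a scalar extension is that zero divisors may
  appear. Adjoining a root of \<open>e\<close> creates them only if \<open>e\<close> already has a
  root in the algebra, and such a root is an element of the kind sought.

  The constants have two sources. The form \<open>\<beta> (v x) v\<close> vanishes identically for
  skew \<open>x\<close>, so only symmetric directions cost anything. And adjoining a square root
  that commutes with the ring of scalars turns a cost \<open>c\<close> into \<open>c + 2 c\<close>:
  this gives \<open>u\<close>, \<open>3u\<close>, \<open>9u\<close>, \<open>27u\<close>. For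
  \<open>Q\<close> one line over \<open>F(i, j)\<close> is then added, \<open>27u + 2 * 9u\<close>.
  Each \<open>Q w\<close> has four symmetric directions over \<open>F(i)\<close>, of cost
  \<open>3u\<close> each, whence \<open>3u\<close>, \<open>9u\<close>, \<open>15u\<close>,
  \<open>21u\<close>. The two floors arise separately because the intermediate subspace is itself a
  space over the centralizer of \<open>i\<close>, so that both of its estimates are rounded.\<close>

definition divring :: "'r::ring_1 set \<Rightarrow> bool" where
  "divring B \<longleftrightarrow> 1 \<in> B \<and> (\<forall>x\<in>B. \<forall>y\<in>B. x - y \<in> B \<and> x * y \<in> B) \<and>
     (\<forall>x\<in>B. x \<noteq> 0 \<longrightarrow> (\<exists>y\<in>B. x * y = 1 \<and> y * x = 1))"

lemma divring_1: "divring B \<Longrightarrow> 1 \<in> B"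
  and divring_diff: "divring B \<Longrightarrow> x \<in> B \<Longrightarrow> y \<in> B \<Longrightarrow> x - y \<in> B"
  and divring_mult: "divring B \<Longrightarrow> x \<in> B \<Longrightarrow> y \<in> B \<Longrightarrow> x * y \<in> B"
  unfolding divring_def by auto

lemma divring_inv:
  assumes "divring B" "x \<in> B" "x \<noteq> 0"
  obtains y where "y \<in> B" "x * y = 1" "y * x = 1"
  using assms unfolding divring_def by auto

lemma divring_0: "divring B \<Longrightarrow> 0 \<in> B"
  using divring_diff[of B 1 1] divring_1[of B] by simp

lemma divring_uminus: "divring B \<Longrightarrow> x \<in> B \<Longrightarrow> - x \<in> B"
  using divring_diff[of B 0 x] divring_0[of B] by simp

lemma divring_add: "divring B \<Longrightarrow> x \<in> B \<Longrightarrow> y \<in> B \<Longrightarrow> x + y \<in> B"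
  using divring_diff[of B x "- y"] divring_uminus[of B y] by simp

lemma divring_sum: "divring B \<Longrightarrow> (\<And>i. i \<in> I \<Longrightarrow> f i \<in> B) \<Longrightarrow> sum f I \<in> B"
  by (induction I rule: infinite_finite_induct) (auto simp: divring_0 divring_add)

lemma divring_power: "divring B \<Longrightarrow> x \<in> B \<Longrightarrow> x ^ n \<in> B"
  by (induction n) (auto simp: divring_1 divring_mult)

lemmas divring_closed = divring_0 divring_1 divring_add divring_diff divring_uminus divring_mult
  divring_power divring_sum

lemma divring_no_zero_div:
  assumes "divring B" "x \<in> B" "x \<noteq> 0" "x * y = 0"
  shows "y = 0"
proof -
  obtain z where "z * x = 1" using divring_inv[OF assms(1-3)] .
  then have "y = z * (x * y)" by (simp flip: mult.assoc)
  then show ?thesis using assms(4) by simp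
qed

lemma divring_no_zero_div_right:
  assumes "divring B" "x \<in> B" "x \<noteq> 0" "y * x = 0"
  shows "y = 0"
proof -
  obtain z where "x * z = 1" using divring_inv[OF assms(1-3)] .
  then have "y = (y * x) * z" by (simp add: mult.assoc)
  then show ?thesis using assms(4) by simp
qed

definition submod :: "('v::ab_group_add \<Rightarrow> 'r::ring_1 \<Rightarrow> 'v) \<Rightarrow> 'r set \<Rightarrow> 'v set \<Rightarrow> bool" where
  "submod act B W \<longleftrightarrow> 0 \<in> W \<and> (\<forall>v\<in>W. \<forall>w\<in>W. v + w \<in> W) \<and> (\<forall>v\<in>W. \<forall>b\<in>B. act v b \<in> W)"

definition flag_step :: "('v::ab_group_add \<Rightarrow> 'r::ring_1 \<Rightarrow> 'v) \<Rightarrow> 'r set \<Rightarrow> 'v set \<Rightarrow> 'v \<Rightarrow> 'v set" where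
  "flag_step act B W v = {w + act v b | w b. w \<in> W \<and> b \<in> B}"

text \<open>Dimension is read off from a complete flag, because division subrings and submodules are plain sets here.\<close>

inductive fdim :: "('v::ab_group_add \<Rightarrow> 'r::ring_1 \<Rightarrow> 'v) \<Rightarrow> 'r set \<Rightarrow> nat \<Rightarrow> 'v set \<Rightarrow> bool"
  for act :: "'v::ab_group_add \<Rightarrow> 'r::ring_1 \<Rightarrow> 'v" and B :: "'r set" where
  fdim_0: "fdim act B 0 {0}"
| fdim_Suc: "fdim act B n W \<Longrightarrow> v \<notin> W \<Longrightarrow> fdim act B (Suc n) (flag_step act B W v)"

lemma submod_mono: "submod act B W \<Longrightarrow> B' \<subseteq> B \<Longrightarrow> submod act B' W"
  unfolding submod_def by blast

lemma submod_0: "submod act B W \<Longrightarrow> 0 \<in> W"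
  and submod_add: "submod act B W \<Longrightarrow> v \<in> W \<Longrightarrow> w \<in> W \<Longrightarrow> v + w \<in> W"
  and submod_act: "submod act B W \<Longrightarrow> v \<in> W \<Longrightarrow> b \<in> B \<Longrightarrow> act v b \<in> W"
  unfolding submod_def by auto

lemma submod_sum: "submod act B W \<Longrightarrow> (\<And>i. i \<in> I \<Longrightarrow> f i \<in> W) \<Longrightarrow> sum f I \<in> W"
  by (induction I rule: infinite_finite_induct) (auto simp: submod_0 submod_add)

lemma submod_inter: "submod act B W \<Longrightarrow> submod act B W' \<Longrightarrow> submod act B (W \<inter> W')"
  unfolding submod_def by blast

lemma fdim_0_iff: "fdim act B 0 W \<longleftrightarrow> W = {0}"
  by (subst fdim.simps) auto

lemma fdim_SucE:
  assumes "fdim act B (Suc n) W"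
  obtains W0 v where "W = flag_step act B W0 v" "fdim act B n W0" "v \<notin> W0"
  using assms by (cases rule: fdim.cases) auto

text \<open>Scalars act from the right, as on the spaces of hermitian forms. Which scalars count is
  decided by the set \<open>B\<close> given to \<open>submod\<close> and \<open>fdim\<close>, so a
  single action serves \<open>F\<close>, its extensions and \<open>D\<close> at the same
  time.\<close>

locale rmod =
  fixes act :: "'v::ab_group_add \<Rightarrow> 'r::ring_1 \<Rightarrow> 'v" (infixl "\<cdot>" 80)
  assumes act_add_left: "(v + w) \<cdot> b = v \<cdot> b + w \<cdot> b"
    and act_add_right: "v \<cdot> (a + b) = v \<cdot> a + v \<cdot> b"
    and act_mult: "v \<cdot> (a * b) = v \<cdot> a \<cdot> b"
    and act_1 [simp]: "v \<cdot> 1 = v"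
begin

lemma act_0_left [simp]: "0 \<cdot> b = 0"
  using act_add_left[of 0 0 b] by simp

lemma act_0_right [simp]: "v \<cdot> 0 = 0"
  using act_add_right[of v 0 0] by simp

lemma act_minus_left: "(- v) \<cdot> b = - (v \<cdot> b)"
  using act_add_left[of v "- v" b] by (simp add: eq_neg_iff_add_eq_0 add.commute)

lemma act_minus_right: "v \<cdot> (- b) = - (v \<cdot> b)"
  using act_add_right[of v b "- b"] by (simp add: eq_neg_iff_add_eq_0 add.commute)

lemma act_diff_left: "(v - w) \<cdot> b = v \<cdot> b - w \<cdot> b"
  using act_add_left[of v "- w" b] by (simp add: act_minus_left)

lemma act_diff_right: "v \<cdot> (a - b) = v \<cdot> a - v \<cdot> b"
  using act_add_right[of v a "- b"] by (simp add: act_minus_right)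

lemma act_sum_left: "(\<Sum>i\<in>I. f i) \<cdot> b = (\<Sum>i\<in>I. f i \<cdot> b)"
  by (induction I rule: infinite_finite_induct) (auto simp: act_add_left)

lemma submod_minus: "divring B \<Longrightarrow> submod (\<cdot>) B W \<Longrightarrow> v \<in> W \<Longrightarrow> - v \<in> W"
  using submod_act[of "(\<cdot>)" B W v "- 1"] by (simp add: act_minus_right divring_closed)

lemma submod_diff: "divring B \<Longrightarrow> submod (\<cdot>) B W \<Longrightarrow> v \<in> W \<Longrightarrow> w \<in> W \<Longrightarrow> v - w \<in> W"
  using submod_add[of "(\<cdot>)" B W v "- w"] submod_minus[of B W w] by simp

lemma submod_act_cancel:
  assumes "divring B" "submod (\<cdot>) B W" "b \<in> B" "b \<noteq> 0" "v \<cdot> b \<in> W"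
  shows "v \<in> W"
proof -
  obtain c where c: "c \<in> B" "b * c = 1" using divring_inv[OF assms(1,3,4)] .
  then have "v = v \<cdot> b \<cdot> c" by (simp flip: act_mult)
  then show ?thesis using submod_act[OF assms(2,5) c(1)] by simp
qed

lemma submod_zero: "submod (\<cdot>) B {0}"
  by (simp add: submod_def)

lemma flag_step_superset: "divring B \<Longrightarrow> W \<subseteq> flag_step (\<cdot>) B W v"
proof
  fix w assume "divring B" "w \<in> W"
  then have "w = w + v \<cdot> 0" "0 \<in> B" by (simp_all add: divring_0)
  then show "w \<in> flag_step (\<cdot>) B W v" unfolding flag_step_def using \<open>w \<in> W\<close> by blast
qed

lemma flag_step_mem: "divring B \<Longrightarrow> submod (\<cdot>) B W \<Longrightarrow> v \<in> flag_step (\<cdot>) B W v"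
proof -
  assume "divring B" "submod (\<cdot>) B W"
  then have "v = 0 + v \<cdot> 1" "0 \<in> W" "1 \<in> B" by (simp_all add: divring_1 submod_0[of "(\<cdot>)" B])
  then show "v \<in> flag_step (\<cdot>) B W v" unfolding flag_step_def by blast
qed

lemma flag_step_least:
  "submod (\<cdot>) B U \<Longrightarrow> W \<subseteq> U \<Longrightarrow> v \<in> U \<Longrightarrow> flag_step (\<cdot>) B W v \<subseteq> U"
  unfolding flag_step_def by (auto intro!: submod_add[of "(\<cdot>)" B U] submod_act[of "(\<cdot>)" B U])

lemma flag_step_submod:
  assumes "divring B" "submod (\<cdot>) B W"
  shows "submod (\<cdot>) B (flag_step (\<cdot>) B W v)"
  unfolding submod_def
proof (intro conjI ballI)
  show "0 \<in> flag_step (\<cdot>) B W v"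
    using flag_step_superset[OF assms(1)] submod_0[OF assms(2)] by blast
next
  fix x y assume "x \<in> flag_step (\<cdot>) B W v" "y \<in> flag_step (\<cdot>) B W v"
  then obtain w b w' b' where *: "x = w + v \<cdot> b" "y = w' + v \<cdot> b'" "w \<in> W" "w' \<in> W" "b \<in> B" "b' \<in> B"
    unfolding flag_step_def by blast
  then have "x + y = (w + w') + v \<cdot> (b + b')" by (simp add: act_add_right)
  moreover have "w + w' \<in> W" "b + b' \<in> B"
    using * assms by (auto simp: divring_closed submod_add)
  ultimately show "x + y \<in> flag_step (\<cdot>) B W v" unfolding flag_step_def by blast
next
  fix x c assume "x \<in> flag_step (\<cdot>) B W v" "c \<in> B"
  then obtain w b where *: "x = w + v \<cdot> b" "w \<in> W" "b \<in> B"
    unfolding flag_step_def by blast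
  then have "x \<cdot> c = w \<cdot> c + v \<cdot> (b * c)" by (simp add: act_add_left act_mult)
  moreover have "w \<cdot> c \<in> W" "b * c \<in> B"
    using * assms \<open>c \<in> B\<close> by (auto simp: divring_closed submod_act)
  ultimately show "x \<cdot> c \<in> flag_step (\<cdot>) B W v" unfolding flag_step_def by blast
qed

text \<open>The coefficient of \<open>v\<close> in \<open>x\<close> is nonzero, hence invertible in
  \<open>B\<close>, so \<open>v\<close> can be recovered from \<open>x\<close> modulo
  \<open>W\<close>.\<close>

lemma flag_step_exchange:
  assumes "divring B" "submod (\<cdot>) B W" "x \<in> flag_step (\<cdot>) B W v" "x \<notin> W"
  shows "flag_step (\<cdot>) B W v = flag_step (\<cdot>) B W x"
proof
  obtain w b where *: "x = w + v \<cdot> b" "w \<in> W" "b \<in> B"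
    using assms(3) unfolding flag_step_def by blast
  show "flag_step (\<cdot>) B W x \<subseteq> flag_step (\<cdot>) B W v"
    by (intro flag_step_least flag_step_submod flag_step_superset assms)
  have "b \<noteq> 0" using * assms(4) by auto
  have "v \<cdot> b = x - w" using * by simp
  also have "\<dots> \<in> flag_step (\<cdot>) B W x"
    by (intro submod_diff[OF assms(1)] flag_step_submod flag_step_mem assms
        subsetD[OF flag_step_superset[OF assms(1)] *(2)])
  finally have "v \<in> flag_step (\<cdot>) B W x"
    using submod_act_cancel[OF assms(1) flag_step_submod[OF assms(1,2)] *(3) \<open>b \<noteq> 0\<close>] by blast
  then show "flag_step (\<cdot>) B W v \<subseteq> flag_step (\<cdot>) B W x"
    by (intro flag_step_least flag_step_submod flag_step_superset assms)
qed

text \<open>Modular law for one step: after exchanging \<open>v\<close> for \<open>x\<close>, the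
  \<open>W\<close>-component of an element of \<open>U\<close> differs from it by a multiple of
  \<open>x\<close>, and therefore lies in \<open>U\<close> as well.\<close>

lemma flag_step_inter:
  assumes "divring B" "submod (\<cdot>) B W" "submod (\<cdot>) B U" "U \<subseteq> flag_step (\<cdot>) B W v" "x \<in> U" "x \<notin> W"
  shows "U = flag_step (\<cdot>) B (U \<inter> W) x"
proof
  show "flag_step (\<cdot>) B (U \<inter> W) x \<subseteq> U"
    by (intro flag_step_least assms) auto
  show "U \<subseteq> flag_step (\<cdot>) B (U \<inter> W) x"
  proof
    fix y assume "y \<in> U"
    then have "y \<in> flag_step (\<cdot>) B W x"
      using flag_step_exchange[OF assms(1,2), of x v] assms by blast
    then obtain w b where *: "y = w + x \<cdot> b" "w \<in> W" "b \<in> B" unfolding flag_step_def by blast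
    then have "w = y - x \<cdot> b" by simp
    also have "\<dots> \<in> U"
      by (intro submod_diff[OF assms(1,3)] \<open>y \<in> U\<close> submod_act[OF assms(3,5)] *(3))
    finally show "y \<in> flag_step (\<cdot>) B (U \<inter> W) x" unfolding flag_step_def using * by blast
  qed
qed

lemma fdim_submod: "fdim (\<cdot>) B n W \<Longrightarrow> divring B \<Longrightarrow> submod (\<cdot>) B W"
  by (induction rule: fdim.induct) (auto intro: flag_step_submod simp: submod_zero)

text \<open>Intersecting the flag of \<open>W\<close> with \<open>U\<close> gives a flag of
  \<open>U\<close> with repetitions: by \<open>flag_step_inter\<close> every step either stands
  still or adds one vector. If no step stands still, then \<open>U = W\<close>.\<close>

lemma fdim_submodule_strict:
  assumes "fdim (\<cdot>) B n W" "divring B" "submod (\<cdot>) B U" "U \<subseteq> W"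
  shows "\<exists>m\<le>n. fdim (\<cdot>) B m U \<and> (U \<noteq> W \<longrightarrow> m < n)"
  using assms
proof (induction arbitrary: U rule: fdim.induct)
  case fdim_0
  then have "U = {0}" using submod_0 by blast
  then show ?case using fdim.fdim_0 by blast
next
  case (fdim_Suc n W v)
  note W = fdim_submod[OF fdim_Suc.hyps(1) \<open>divring B\<close>]
  obtain m where m: "m \<le> n" "fdim (\<cdot>) B m (U \<inter> W)" "U \<inter> W \<noteq> W \<longrightarrow> m < n"
    using fdim_Suc.IH[OF \<open>divring B\<close> submod_inter[OF \<open>submod (\<cdot>) B U\<close> W]] by auto
  show ?case
  proof (cases "U \<subseteq> W")
    case True
    then have "U \<inter> W = U" by blast
    then show ?thesis using m by (metis le_imp_less_Suc le_SucI)
  next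
    case False
    then obtain x where x: "x \<in> U" "x \<notin> W" by blast
    have U: "U = flag_step (\<cdot>) B (U \<inter> W) x"
      by (rule flag_step_inter[OF \<open>divring B\<close> W fdim_Suc.prems(2,3) x])
    have "fdim (\<cdot>) B (Suc m) U"
      using fdim.fdim_Suc[OF m(2), of x] x U by auto
    moreover have "m < n" if "U \<noteq> flag_step (\<cdot>) B W v"
    proof -
      have "U \<inter> W \<noteq> W"
      proof
        assume "U \<inter> W = W"
        then have "U = flag_step (\<cdot>) B W x" using U by simp
        also have "\<dots> = flag_step (\<cdot>) B W v"
          using flag_step_exchange[OF \<open>divring B\<close> W _ x(2)] fdim_Suc.prems(3) x(1) by blast
        finally show False using that by simp
      qed
      then show ?thesis using m by simp
    qed
    ultimately show ?thesis using m by (metis Suc_le_mono Suc_less_eq)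
  qed
qed

lemma fdim_submodule:
  assumes "fdim (\<cdot>) B n W" "divring B" "submod (\<cdot>) B U" "U \<subseteq> W"
  obtains m where "m \<le> n" "fdim (\<cdot>) B m U"
  using fdim_submodule_strict[OF assms] by blast

text \<open>Jordan-Hoelder argument: if the penultimate members \<open>W0\<close> and
  \<open>W1\<close> of the two flags differ, both exceed their intersection by exactly one step, and
  the induction hypothesis compares the lengths through it.\<close>

lemma fdim_unique:
  assumes "fdim (\<cdot>) B n W" "fdim (\<cdot>) B m W" "divring B"
  shows "m = n"
  using assms(1,2)
proof (induction n arbitrary: m W)
  case 0
  then have "W = {0}" by (simp add: fdim_0_iff)
  show ?case
  proof (cases m)
    case (Suc k)
    then obtain W0 v where "W = flag_step (\<cdot>) B W0 v" "fdim (\<cdot>) B k W0" "v \<notin> W0"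
      using 0 fdim_SucE by metis
    then have "v \<in> {0}" "W0 \<subseteq> {0}" "0 \<in> W0"
      using flag_step_mem[OF assms(3)] flag_step_superset[OF assms(3)] fdim_submod[OF _ assms(3)]
        \<open>W = {0}\<close> submod_0 by metis+
    then show ?thesis using \<open>v \<notin> W0\<close> by auto
  qed simp
next
  case (Suc n)
  obtain W0 v where W: "W = flag_step (\<cdot>) B W0 v" and dW0: "fdim (\<cdot>) B n W0" and v: "v \<notin> W0"
    using Suc.prems(1) by (rule fdim_SucE)
  note sW0 = fdim_submod[OF dW0 assms(3)]
  have vW: "v \<in> W" using flag_step_mem[OF assms(3) sW0] W by simp
  have W0W: "W0 \<subseteq> W" using flag_step_superset[OF assms(3)] W by simp
  show ?case
  proof (cases m)
    case 0
    then have "W = {0}" using Suc.prems by (simp add: fdim_0_iff)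
    then show ?thesis using vW v submod_0[OF sW0] by auto
  next
    case (Suc k)
    then obtain W1 w where W': "W = flag_step (\<cdot>) B W1 w" and dW1: "fdim (\<cdot>) B k W1" and w: "w \<notin> W1"
      using Suc.prems(2) fdim_SucE by metis
    note sW1 = fdim_submod[OF dW1 assms(3)]
    have W1W: "W1 \<subseteq> W" using flag_step_superset[OF assms(3)] W' by simp
    have wW: "w \<in> W" using flag_step_mem[OF assms(3) sW1] W' by simp
    have "k = n"
    proof (cases "W0 = W1")
      case True
      then show ?thesis using Suc.IH dW0 dW1 by simp
    next
      case False
      have "\<not> W1 \<subseteq> W0"
      proof
        assume sub: "W1 \<subseteq> W0"
        then obtain x where x: "x \<in> W0" "x \<notin> W1" using False by blast
        have "W = flag_step (\<cdot>) B W1 x"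
          using flag_step_exchange[OF assms(3) sW1 _ x(2)] W' W0W x(1) by blast
        also have "\<dots> \<subseteq> W0" by (rule flag_step_least[OF sW0 sub x(1)])
        finally show False using vW v by blast
      qed
      then obtain x where x: "x \<in> W1" "x \<notin> W0" by blast
      have "\<not> W0 \<subseteq> W1"
      proof
        assume sub: "W0 \<subseteq> W1"
        have "W = flag_step (\<cdot>) B W0 x"
          using flag_step_exchange[OF assms(3) sW0 _ x(2)] W W1W x(1) by blast
        also have "\<dots> \<subseteq> W1" by (rule flag_step_least[OF sW1 sub x(1)])
        finally show False using wW w by blast
      qed
      then obtain y where y: "y \<in> W0" "y \<notin> W1" by blast
      obtain l where l: "fdim (\<cdot>) B l (W0 \<inter> W1)"
        using fdim_submodule[OF dW0 assms(3) submod_inter[OF sW0 sW1]] by blast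
      have "W1 = flag_step (\<cdot>) B (W1 \<inter> W0) x"
        using flag_step_inter[OF assms(3) sW0 sW1 _ x] W W1W by blast
      then have 1: "fdim (\<cdot>) B (Suc l) W1"
        using fdim_Suc[OF l, of x] x by (simp add: Int_commute)
      have "W0 = flag_step (\<cdot>) B (W0 \<inter> W1) y"
        using flag_step_inter[OF assms(3) sW1 sW0 _ y] W' W0W by blast
      then have 2: "fdim (\<cdot>) B (Suc l) W0"
        using fdim_Suc[OF l, of y] y by simp
      have "Suc l = n" using Suc.IH[OF dW0 2] .
      then show ?thesis using Suc.IH[of W1 k] 1 dW1 by simp
    qed
    then show ?thesis using Suc by simp
  qed
qed

lemma fdim_mono:
  assumes "fdim (\<cdot>) B n W" "fdim (\<cdot>) B m U" "divring B" "U \<subseteq> W"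
  shows "m \<le> n"
  using fdim_submodule[OF assms(1,3) fdim_submod[OF assms(2,3)] assms(4)]
    fdim_unique[OF assms(2) _ assms(3)] by metis

lemma fdim_eq_imp_eq:
  assumes "fdim (\<cdot>) B n W" "fdim (\<cdot>) B m U" "divring B" "U \<subseteq> W" "n \<le> m"
  shows "U = W"
  using fdim_submodule_strict[OF assms(1,3) fdim_submod[OF assms(2,3)] assms(4)]
    fdim_unique[OF assms(2) _ assms(3)] assms(5) by (metis not_less)

lemma fdim_hyperplane:
  assumes "fdim (\<cdot>) B n W" "divring B" "submod (\<cdot>) B H" "H \<subseteq> W"
    and codim: "\<And>x y. x \<in> W \<Longrightarrow> y \<in> W \<Longrightarrow> y \<notin> H \<Longrightarrow> \<exists>b\<in>B. x - y \<cdot> b \<in> H"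
  obtains m where "fdim (\<cdot>) B m H" "n \<le> Suc m"
proof -
  obtain m where m: "m \<le> n" "fdim (\<cdot>) B m H" using fdim_submodule[OF assms(1-4)] .
  show thesis
  proof (cases "H = W")
    case True
    then show ?thesis using that m fdim_unique[OF assms(1) _ assms(2)] by (metis le_SucI le_refl)
  next
    case False
    then obtain y where y: "y \<in> W" "y \<notin> H" using assms(4) by blast
    have "W \<subseteq> flag_step (\<cdot>) B H y"
    proof
      fix x assume "x \<in> W"
      then obtain b where b: "b \<in> B" "x - y \<cdot> b \<in> H" using codim y by blast
      then have "x = (x - y \<cdot> b) + y \<cdot> b" by simp
      then show "x \<in> flag_step (\<cdot>) B H y" unfolding flag_step_def using b by blast
    qed
    then have "n \<le> Suc m"
      using fdim_mono[OF fdim_Suc[OF m(2) y(2)] assms(1,2)] by blast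
    then show ?thesis using that m by blast
  qed
qed

lemma fdim_direct_sum:
  assumes "fdim (\<cdot>) B m U" "fdim (\<cdot>) B n W" "divring B" "U \<inter> W \<subseteq> {0}"
  shows "fdim (\<cdot>) B (n + m) {w + u | w u. w \<in> W \<and> u \<in> U}"
  using assms
proof (induction arbitrary: rule: fdim.induct)
  case fdim_0
  then show ?case by simp
next
  case (fdim_Suc m U v)
  let ?S = "{w + u | w u. w \<in> W \<and> u \<in> U}"
  note sU = fdim_submod[OF fdim_Suc.hyps(1) \<open>divring B\<close>]
  note sW = fdim_submod[OF \<open>fdim (\<cdot>) B n W\<close> \<open>divring B\<close>]
  have "fdim (\<cdot>) B (n + m) ?S"
    using fdim_Suc flag_step_superset[OF \<open>divring B\<close>] by blast
  moreover have "v \<notin> ?S"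
  proof
    assume "v \<in> ?S"
    then obtain w u where *: "v = w + u" "w \<in> W" "u \<in> U" by blast
    then have "w = v - u" by simp
    also have "\<dots> \<in> flag_step (\<cdot>) B U v"
      using submod_diff[OF \<open>divring B\<close> flag_step_submod[OF \<open>divring B\<close> sU]
          flag_step_mem[OF \<open>divring B\<close> sU] subsetD[OF flag_step_superset[OF \<open>divring B\<close>] *(3)]] .
    finally have "w = 0" using fdim_Suc.prems(3) *(2) by blast
    then show False using * \<open>v \<notin> U\<close> by simp
  qed
  ultimately have "fdim (\<cdot>) B (Suc (n + m)) (flag_step (\<cdot>) B ?S v)" by (rule fdim.fdim_Suc)
  moreover have "flag_step (\<cdot>) B ?S v = {w + u | w u. w \<in> W \<and> u \<in> flag_step (\<cdot>) B U v}"
  proof (intro equalityI subsetI)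
    fix x assume "x \<in> flag_step (\<cdot>) B ?S v"
    then obtain w u b where *: "x = w + u + v \<cdot> b" "w \<in> W" "u \<in> U" "b \<in> B" unfolding flag_step_def by blast
    then have "x = w + (u + v \<cdot> b)" "u + v \<cdot> b \<in> flag_step (\<cdot>) B U v"
      unfolding flag_step_def by (auto simp: add.assoc)
    then show "x \<in> {w + u | w u. w \<in> W \<and> u \<in> flag_step (\<cdot>) B U v}" using *(2) by blast
  next
    fix x assume "x \<in> {w + u | w u. w \<in> W \<and> u \<in> flag_step (\<cdot>) B U v}"
    then obtain w u b where *: "x = w + (u + v \<cdot> b)" "w \<in> W" "u \<in> U" "b \<in> B" unfolding flag_step_def by blast
    then have "x = (w + u) + v \<cdot> b" by (simp add: add.assoc)
    then show "x \<in> flag_step (\<cdot>) B ?S v" using * unfolding flag_step_def by blast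
  qed
  ultimately show ?case by simp
qed

text \<open>Induction along the flag of \<open>U\<close>. If \<open>T\<close> stays below the last
  step, the new vector joins the complement. Otherwise \<open>T\<close> itself contains a vector
  that can replace \<open>v\<close>, and the previous complement still works.\<close>

lemma fdim_complement:
  assumes "fdim (\<cdot>) B n U" "divring B" "submod (\<cdot>) B T" "T \<subseteq> U"
  shows "\<exists>T'. submod (\<cdot>) B T' \<and> T' \<subseteq> U \<and> T \<inter> T' = {0} \<and> U \<subseteq> {t + t' | t t'. t \<in> T \<and> t' \<in> T'}"
  using assms
proof (induction arbitrary: T rule: fdim.induct)
  case fdim_0
  then have "T = {0}" using submod_0 by blast
  then show ?case by (intro exI[of _ "{0}"]) (auto simp: submod_zero)
next
  case (fdim_Suc n U v)
  note B = \<open>divring B\<close>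
  note sU = fdim_submod[OF fdim_Suc.hyps(1) B]
  obtain T' where T': "submod (\<cdot>) B T'" "T' \<subseteq> U" "T \<inter> U \<inter> T' = {0}"
    "U \<subseteq> {t + t' | t t'. t \<in> T \<inter> U \<and> t' \<in> T'}"
    using fdim_Suc.IH[OF B submod_inter[OF fdim_Suc.prems(2) sU]] by blast
  show ?case
  proof (cases "T \<subseteq> U")
    case True
    have "T \<inter> flag_step (\<cdot>) B T' v \<subseteq> {0}"
    proof
      fix x assume x: "x \<in> T \<inter> flag_step (\<cdot>) B T' v"
      then obtain t b where *: "x = t + v \<cdot> b" "t \<in> T'" "b \<in> B" unfolding flag_step_def by blast
      have "v \<cdot> b = x - t" using * by simp
      also have "\<dots> \<in> U" using submod_diff[OF B sU] x True *(2) T'(2) by blast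
      finally have "b = 0"
        using submod_act_cancel[OF B sU *(3)] \<open>v \<notin> U\<close> by blast
      then show "x \<in> {0}" using * x T'(3) True by auto
    qed
    moreover have "flag_step (\<cdot>) B U v \<subseteq> {t + t' | t t'. t \<in> T \<and> t' \<in> flag_step (\<cdot>) B T' v}"
    proof
      fix x assume "x \<in> flag_step (\<cdot>) B U v"
      then obtain y b where *: "x = y + v \<cdot> b" "y \<in> U" "b \<in> B" unfolding flag_step_def by blast
      then obtain t t' where "y = t + t'" "t \<in> T" "t' \<in> T'" using T'(4) by blast
      then have "x = t + (t' + v \<cdot> b)" "t' + v \<cdot> b \<in> flag_step (\<cdot>) B T' v"
        using * by (auto simp: add.assoc flag_step_def)
      then show "x \<in> {t + t' | t t'. t \<in> T \<and> t' \<in> flag_step (\<cdot>) B T' v}" using \<open>t \<in> T\<close> by blast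
    qed
    moreover have "flag_step (\<cdot>) B T' v \<subseteq> flag_step (\<cdot>) B U v"
      using T'(2) unfolding flag_step_def by blast
    moreover have "0 \<in> T \<inter> flag_step (\<cdot>) B T' v"
      using submod_0[OF fdim_Suc.prems(2)] submod_0[OF flag_step_submod[OF B T'(1)]] by blast
    ultimately show ?thesis
      by (intro exI[of _ "flag_step (\<cdot>) B T' v"]) (use flag_step_submod[OF B T'(1)] in blast)
  next
    case False
    then obtain t where t: "t \<in> T" "t \<notin> U" by blast
    have eq: "flag_step (\<cdot>) B U v = flag_step (\<cdot>) B U t"
      using flag_step_exchange[OF B sU _ t(2)] t fdim_Suc.prems(3) by blast
    have "flag_step (\<cdot>) B U t \<subseteq> {t + t' | t t'. t \<in> T \<and> t' \<in> T'}"
    proof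
      fix x assume "x \<in> flag_step (\<cdot>) B U t"
      then obtain y b where *: "x = y + t \<cdot> b" "y \<in> U" "b \<in> B" unfolding flag_step_def by blast
      then obtain s t' where s: "y = s + t'" "s \<in> T" "t' \<in> T'" using T'(4) by blast
      then have "x = (s + t \<cdot> b) + t'" using * by (simp add: algebra_simps)
      moreover have "s + t \<cdot> b \<in> T"
        using submod_add[OF fdim_Suc.prems(2)] submod_act[OF fdim_Suc.prems(2) t(1) *(3)] s by blast
      ultimately show "x \<in> {t + t' | t t'. t \<in> T \<and> t' \<in> T'}" using s by blast
    qed
    moreover have "T \<inter> T' = {0}" using T' by blast
    moreover have "T' \<subseteq> flag_step (\<cdot>) B U v" using T'(2) flag_step_superset[OF B] by blast
    ultimately show ?thesis using T'(1) eq by (intro exI[of _ T']) auto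
  qed
qed

lemma fdim_basis:
  assumes "fdim (\<cdot>) B n W" "divring B"
  shows "\<exists>b. (\<forall>i<n. b i \<in> W) \<and> W = {\<Sum>i<n. b i \<cdot> c i | c. \<forall>i. c i \<in> B} \<and>
    (\<forall>c. (\<forall>i<n. c i \<in> B) \<longrightarrow> (\<Sum>i<n. b i \<cdot> c i) = 0 \<longrightarrow> (\<forall>i<n. c i = 0))"
  using assms
proof (induction rule: fdim.induct)
  case fdim_0
  show ?case using divring_0[OF fdim_0] by (auto intro!: exI[of _ "\<lambda>_. 0"])
next
  case (fdim_Suc n W v)
  note B = \<open>divring B\<close>
  note sW = fdim_submod[OF fdim_Suc.hyps(1) B]
  obtain b where b: "\<forall>i<n. b i \<in> W" "W = {\<Sum>i<n. b i \<cdot> c i | c. \<forall>i. c i \<in> B}"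
    "\<forall>c. (\<forall>i<n. c i \<in> B) \<longrightarrow> (\<Sum>i<n. b i \<cdot> c i) = 0 \<longrightarrow> (\<forall>i<n. c i = 0)"
    using fdim_Suc.IH[OF B] by blast
  let ?b = "b(n := v)"
  have sum: "(\<Sum>i<Suc n. ?b i \<cdot> c i) = (\<Sum>i<n. b i \<cdot> c i) + v \<cdot> c n" for c
    by simp
  show ?case
  proof (intro exI[of _ ?b] conjI allI impI)
    fix i assume "i < Suc n"
    then show "?b i \<in> flag_step (\<cdot>) B W v"
      using b(1) flag_step_mem[OF B sW] flag_step_superset[OF B, of W] by (auto simp: less_Suc_eq)
  next
    show "flag_step (\<cdot>) B W v = {\<Sum>i<Suc n. ?b i \<cdot> c i | c. \<forall>i. c i \<in> B}"
    proof (intro equalityI subsetI)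
      fix x assume "x \<in> flag_step (\<cdot>) B W v"
      then obtain w d where *: "x = w + v \<cdot> d" "w \<in> W" "d \<in> B" unfolding flag_step_def by blast
      then obtain c where c: "w = (\<Sum>i<n. b i \<cdot> c i)" "\<forall>i. c i \<in> B" using b(2) by blast
      then have "x = (\<Sum>i<Suc n. ?b i \<cdot> (c(n := d)) i)" unfolding sum using * by simp
      then show "x \<in> {\<Sum>i<Suc n. ?b i \<cdot> c i | c. \<forall>i. c i \<in> B}"
        using c *(3) by (intro CollectI exI[of _ "c(n := d)"]) auto
    next
      fix x assume "x \<in> {\<Sum>i<Suc n. ?b i \<cdot> c i | c. \<forall>i. c i \<in> B}"
      then obtain c where "x = (\<Sum>i<n. b i \<cdot> c i) + v \<cdot> c n" "\<forall>i. c i \<in> B" unfolding sum by blast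
      then show "x \<in> flag_step (\<cdot>) B W v" unfolding flag_step_def b(2) by blast
    qed
  next
    fix c i assume c: "\<forall>i<Suc n. c i \<in> B" "(\<Sum>i<Suc n. ?b i \<cdot> c i) = 0" and i: "i < Suc n"
    have eq: "(\<Sum>i<n. b i \<cdot> c i) + v \<cdot> c n = 0" using c(2) unfolding sum .
    then have "v \<cdot> c n = - (\<Sum>i<n. b i \<cdot> c i)" by (simp add: eq_neg_iff_add_eq_0 add.commute)
    also have "\<dots> \<in> W"
      by (intro submod_minus[OF B sW] submod_sum[OF sW] submod_act[OF sW]) (use b c in auto)
    finally have cn: "c n = 0"
      using submod_act_cancel[OF B sW, of "c n" v] \<open>v \<notin> W\<close> c(1) by blast
    then show "c i = 0" using eq b(3) c(1) i by (auto simp: less_Suc_eq)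
  qed
qed

lemma fdim_basisE:
  assumes "fdim (\<cdot>) B n W" "divring B"
  obtains b where "\<forall>i<n. b i \<in> W" "W = {\<Sum>i<n. b i \<cdot> c i | c. \<forall>i. c i \<in> B}"
    "\<forall>c. (\<forall>i<n. c i \<in> B) \<longrightarrow> (\<Sum>i<n. b i \<cdot> c i) = 0 \<longrightarrow> (\<forall>i<n. c i = 0)"
  using fdim_basis[OF assms] by (elim exE conjE) (rule that)

lemma fdim_of_basis:
  assumes "divring B"
    and "\<And>c. (\<forall>i<n. c i \<in> B) \<Longrightarrow> (\<Sum>i<n. b i \<cdot> c i) = 0 \<Longrightarrow> (\<forall>i<n. c i = 0)"
  shows "fdim (\<cdot>) B n {\<Sum>i<n. b i \<cdot> c i | c. \<forall>i. c i \<in> B}"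
  using assms(2)
proof (induction n)
  case 0
  then show ?case using divring_0[OF assms(1)] by (auto simp: fdim_0_iff)
next
  case (Suc n)
  let ?W = "\<lambda>n. {\<Sum>i<n. b i \<cdot> c i | c. \<forall>i. c i \<in> B}"
  have W: "fdim (\<cdot>) B n (?W n)"
  proof (rule Suc.IH)
    fix c assume "\<forall>i<n. c i \<in> B" "(\<Sum>i<n. b i \<cdot> c i) = 0"
    then show "\<forall>i<n. c i = 0" using Suc.prems[of "c(n := 0)"] divring_0[OF assms(1)] by (auto simp: less_Suc_eq)
  qed
  have bn: "b n \<notin> ?W n"
  proof
    assume "b n \<in> ?W n"
    then obtain c where c: "b n = (\<Sum>i<n. b i \<cdot> c i)" "\<forall>i. c i \<in> B" by blast
    then have "(\<Sum>i<Suc n. b i \<cdot> (c(n := - 1)) i) = 0" by (simp add: act_minus_right)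
    then show False using Suc.prems[of "c(n := - 1)"] c(2) assms(1) by (auto simp: less_Suc_eq divring_closed)
  qed
  have eq: "flag_step (\<cdot>) B (?W n) (b n) = ?W (Suc n)"
  proof (intro equalityI subsetI)
    fix x assume "x \<in> flag_step (\<cdot>) B (?W n) (b n)"
    then obtain c d where "x = (\<Sum>i<n. b i \<cdot> c i) + b n \<cdot> d" "\<forall>i. c i \<in> B" "d \<in> B"
      unfolding flag_step_def by blast
    then show "x \<in> ?W (Suc n)" by (intro CollectI exI[of _ "c(n := d)"]) auto
  next
    fix x assume "x \<in> ?W (Suc n)"
    then show "x \<in> flag_step (\<cdot>) B (?W n) (b n)" unfolding flag_step_def by auto
  qed
  show ?case using fdim_Suc[OF W bn] unfolding eq .
qed

lemma fdim_functional_kernel: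
  assumes "fdim (\<cdot>) B n W" "divring B"
    and f: "\<And>x. x \<in> W \<Longrightarrow> f x \<in> B"
    and add: "\<And>x y. x \<in> W \<Longrightarrow> y \<in> W \<Longrightarrow> f (x + y) = f x + f y"
    and scale: "\<And>x b. x \<in> W \<Longrightarrow> b \<in> B \<Longrightarrow> f (x \<cdot> b) = f x * b"
  obtains m where "fdim (\<cdot>) B m {x \<in> W. f x = 0}" "n \<le> Suc m"
proof (rule fdim_hyperplane[OF assms(1,2), of "{x \<in> W. f x = 0}"])
  note sW = fdim_submod[OF assms(1,2)]
  have "f 0 = 0" using scale[OF submod_0[OF sW] divring_0[OF assms(2)]] by simp
  then show "submod (\<cdot>) B {x \<in> W. f x = 0}"
    using sW unfolding submod_def by (auto simp: add scale)
  show "\<exists>b\<in>B. x - y \<cdot> b \<in> {x \<in> W. f x = 0}"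
    if x: "x \<in> W" and y: "y \<in> W" "y \<notin> {x \<in> W. f x = 0}" for x y
  proof -
    obtain z where z: "z \<in> B" "f y * z = 1"
      using divring_inv[OF assms(2) f[OF y(1)]] y by blast
    let ?b = "z * f x"
    have b: "?b \<in> B" using z f x by (simp add: divring_closed assms(2))
    have y': "y \<cdot> (- ?b) \<in> W" using submod_act[OF sW y(1)] b by (simp add: divring_closed assms(2))
    have eq: "x - y \<cdot> ?b = x + y \<cdot> (- ?b)" by (simp add: act_minus_right)
    have "f (x + y \<cdot> (- ?b)) = 0"
    proof -
      have "f (x + y \<cdot> (- ?b)) = f x + f y * (- ?b)"
        using add[OF x y'] scale[OF y(1), of "- ?b"] b by (simp add: divring_closed assms(2))
      also have "\<dots> = f x - (f y * z) * f x" by (simp add: mult.assoc)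
      finally show ?thesis using z by simp
    qed
    moreover have "x + y \<cdot> (- ?b) \<in> W" using submod_add[OF sW x y'] .
    ultimately have "x - y \<cdot> ?b \<in> {x \<in> W. f x = 0}" unfolding eq by blast
    then show ?thesis using b by blast
  qed
qed (use that in auto)

text \<open>Each step of a \<open>B'\<close>-flag strictly enlarges the \<open>B\<close>-dimension,
  which bounds the length of \<open>B'\<close>-flags inside \<open>W\<close>.\<close>

lemma fdim_over_larger_le:
  assumes "fdim (\<cdot>) B n W" "divring B" "divring B'" "B \<subseteq> B'" "fdim (\<cdot>) B' t T" "T \<subseteq> W"
  shows "\<exists>m. fdim (\<cdot>) B m T \<and> t \<le> m"
  using assms(5,6)
proof (induction rule: fdim.induct)
  case fdim_0
  then show ?case using fdim.fdim_0 by blast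
next
  case (fdim_Suc t T v)
  note sT = fdim_submod[OF fdim_Suc.hyps(1) assms(3)]
  have "T \<subseteq> W" using fdim_Suc.prems flag_step_superset[OF assms(3)] by blast
  then obtain m where m: "fdim (\<cdot>) B m T" "t \<le> m" using fdim_Suc.IH by blast
  have "submod (\<cdot>) B (flag_step (\<cdot>) B' T v)"
    using submod_mono[OF flag_step_submod[OF assms(3) sT] assms(4)] .
  then obtain m' where m': "fdim (\<cdot>) B m' (flag_step (\<cdot>) B' T v)"
    using fdim_submodule[OF assms(1,2)] fdim_Suc.prems by metis
  have "\<not> m' \<le> m"
  proof
    assume "m' \<le> m"
    then have "T = flag_step (\<cdot>) B' T v"
      using fdim_eq_imp_eq[OF m' m(1) assms(2) flag_step_superset[OF assms(3)]] by blast
    then show False using flag_step_mem[OF assms(3) sT, of v] \<open>v \<notin> T\<close> by simp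
  qed
  then show ?case using m m' by (intro exI[of _ m']) auto
qed

text \<open>A \<open>B'\<close>-flag of maximal length inside \<open>W\<close> cannot miss a vector
  of \<open>W\<close>.\<close>

lemma fdim_over_larger:
  assumes "fdim (\<cdot>) B n W" "divring B" "divring B'" "B \<subseteq> B'" "submod (\<cdot>) B' W"
  obtains t where "fdim (\<cdot>) B' t W"
proof -
  let ?P = "\<lambda>t. \<exists>T\<subseteq>W. fdim (\<cdot>) B' t T"
  have P0: "?P 0" using fdim_0 submod_0[OF assms(5)] by blast
  have bound: "t \<le> n" if t: "?P t" for t
  proof -
    obtain T where T: "T \<subseteq> W" "fdim (\<cdot>) B' t T" using t by blast
    then obtain m where m: "fdim (\<cdot>) B m T" "t \<le> m"
      using fdim_over_larger_le[OF assms(1-4)] by blast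
    show ?thesis using fdim_mono[OF assms(1) m(1) assms(2) T(1)] m(2) by simp
  qed
  define t where "t = Greatest ?P"
  have t: "?P t" "\<And>s. ?P s \<Longrightarrow> s \<le> t"
    using GreatestI_nat[of ?P, OF P0 bound] Greatest_le_nat[of ?P, OF _ bound] unfolding t_def by blast+
  then obtain T where T: "T \<subseteq> W" "fdim (\<cdot>) B' t T" by blast
  have "T = W"
  proof (rule ccontr)
    assume "T \<noteq> W"
    then obtain v where v: "v \<in> W" "v \<notin> T" using T by blast
    have "?P (Suc t)"
      using fdim_Suc[OF T(2) v(2)] flag_step_least[OF assms(5) T(1) v(1)] by blast
    then show False using t(2)[of "Suc t"] by simp
  qed
  then show thesis using that T by blast
qed

end

lemma fdim_image:
  assumes "fdim act B n W" "rmod act" "rmod act'" "divring B"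
    and add: "\<And>x y. x \<in> W \<Longrightarrow> y \<in> W \<Longrightarrow> f (x + y) = f x + f y"
    and scale: "\<And>x b. x \<in> W \<Longrightarrow> b \<in> B \<Longrightarrow> f (act x b) = act' (f x) b"
    and inj: "\<And>x. x \<in> W \<Longrightarrow> f x = 0 \<Longrightarrow> x = 0"
  shows "fdim act' B n (f ` W)"
  using assms
proof (induction rule: fdim.induct)
  case fdim_0
  interpret M': rmod act' by fact
  interpret M: rmod act by fact
  have "f 0 = 0" using fdim_0(5)[of 0 0] divring_0[OF fdim_0(3)] M'.act_0_right M.act_0_right by force
  then show ?case by (simp add: fdim.fdim_0)
next
  case (fdim_Suc n W v)
  interpret M: rmod act by fact
  interpret M': rmod act' by fact
  note B = \<open>divring B\<close>
  note sW = M.fdim_submod[OF fdim_Suc.hyps(1) B]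
  have sub: "W \<subseteq> flag_step act B W v" by (rule M.flag_step_superset[OF B])
  have v: "v \<in> flag_step act B W v" by (rule M.flag_step_mem[OF B sW])
  note sE = M.flag_step_submod[OF B sW, of v]
  have IH: "fdim act' B n (f ` W)"
    by (rule fdim_Suc.IH) (use fdim_Suc.prems sub in blast)+
  have neg: "f (x - y) = f x - f y" if "x \<in> flag_step act B W v" "y \<in> flag_step act B W v" for x y
    using fdim_Suc.prems(4)[OF M.submod_diff[OF B sE that] that(2)] by simp
  have "f v \<notin> f ` W"
  proof
    assume "f v \<in> f ` W"
    then obtain w where w: "w \<in> W" "f v = f w" by blast
    then have "f (v - w) = 0" using neg[OF v] sub by auto
    then have "v - w = 0" using fdim_Suc.prems(6) M.submod_diff[OF B sE v] w sub by blast
    then show False using w \<open>v \<notin> W\<close> by simp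
  qed
  then have "fdim act' B (Suc n) (flag_step act' B (f ` W) (f v))" by (rule fdim.fdim_Suc[OF IH])
  moreover have "flag_step act' B (f ` W) (f v) = f ` flag_step act B W v"
  proof -
    have *: "f (w + act v b) = f w + act' (f v) b" if "w \<in> W" "b \<in> B" for w b
      using fdim_Suc.prems(4)[OF subsetD[OF sub that(1)] submod_act[OF sE v that(2)]]
        fdim_Suc.prems(5)[OF v that(2)] by simp
    show ?thesis
    proof (intro equalityI subsetI)
      fix x assume "x \<in> flag_step act' B (f ` W) (f v)"
      then obtain w b where "x = f w + act' (f v) b" "w \<in> W" "b \<in> B" unfolding flag_step_def by blast
      then have "x = f (w + act v b)" "w + act v b \<in> flag_step act B W v" using * unfolding flag_step_def by auto
      then show "x \<in> f ` flag_step act B W v" by blast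
    next
      fix x assume "x \<in> f ` flag_step act B W v"
      then obtain w b where "x = f (w + act v b)" "w \<in> W" "b \<in> B" unfolding flag_step_def by blast
      then show "x \<in> flag_step act' B (f ` W) (f v)" using * unfolding flag_step_def by blast
    qed
  qed
  ultimately show ?case by simp
qed

lemma rmod_times: "rmod ((*) :: 'r::ring_1 \<Rightarrow> 'r \<Rightarrow> 'r)"
  by unfold_locales (auto simp: algebra_simps)

text \<open>A flag step over \<open>B'\<close> adds the copy \<open>v B'\<close> of
  \<open>B'\<close>, which has dimension \<open>k\<close> over \<open>B\<close> and meets the
  earlier part only in zero.\<close>

lemma (in rmod) fdim_tower:
  assumes "fdim (*) B k B'" "divring B" "divring B'" "B \<subseteq> B'" "fdim (\<cdot>) B' t T"
  shows "fdim (\<cdot>) B (k * t) T"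
  using assms(5)
proof (induction rule: fdim.induct)
  case fdim_0
  then show ?case by (simp add: fdim_0_iff)
next
  case (fdim_Suc t T v)
  note sT = fdim_submod[OF fdim_Suc.hyps(1) assms(3)]
  have inj: "b = 0" if "b \<in> B'" "v \<cdot> b \<in> T" for b
    using submod_act_cancel[OF assms(3) sT that(1) _ that(2)] \<open>v \<notin> T\<close> by blast
  have vB: "fdim (\<cdot>) B k ((\<cdot>) v ` B')"
    by (rule fdim_image[OF assms(1) rmod_times rmod_axioms assms(2)])
      (use inj submod_0[OF sT] in \<open>auto simp: act_add_right act_mult\<close>)
  have "(\<cdot>) v ` B' \<inter> T \<subseteq> {0}" using inj act_0_right by force
  from fdim_direct_sum[OF vB fdim_Suc.IH assms(2) this]
  have "fdim (\<cdot>) B (k * t + k) {w + u |w u. w \<in> T \<and> u \<in> (\<cdot>) v ` B'}" .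
  moreover have "{w + u |w u. w \<in> T \<and> u \<in> (\<cdot>) v ` B'} = flag_step (\<cdot>) B' T v"
    unfolding flag_step_def by blast
  ultimately show ?case by (simp add: add.commute)
qed

text \<open>Induction on the target: forcing \<open>f x\<close> into the previous member of the flag
  of \<open>U\<close> costs at most one dimension.\<close>

lemma (in rmod) fdim_kernel:
  assumes "fdim (\<cdot>) B n W" "divring B"
    and "fdim act' B r U" "rmod act'"
    and add: "\<And>x y. x \<in> W \<Longrightarrow> y \<in> W \<Longrightarrow> f (x + y) = f x + f y"
    and scale: "\<And>x b. x \<in> W \<Longrightarrow> b \<in> B \<Longrightarrow> f (x \<cdot> b) = act' (f x) b"
    and U: "\<And>x. x \<in> W \<Longrightarrow> f x \<in> U"
  shows "\<exists>m. fdim (\<cdot>) B m {x \<in> W. f x = 0} \<and> n \<le> m + r"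
  using assms(3,1,5,6,7)
proof (induction arbitrary: n W rule: fdim.induct)
  case fdim_0
  then have "{x \<in> W. f x = 0} = W" by blast
  then show ?case using fdim_0 by auto
next
  case (fdim_Suc r U v)
  interpret M': rmod act' by fact
  note B = \<open>divring B\<close>
  note sW = fdim_submod[OF fdim_Suc.prems(1) B]
  note sU = M'.fdim_submod[OF fdim_Suc.hyps(1) B]
  have neg: "f (x - y) = f x - f y" if "x \<in> W" "y \<in> W" for x y
    using fdim_Suc.prems(2)[OF submod_diff[OF B sW that] that(2)] by simp
  let ?H = "{x \<in> W. f x \<in> U}"
  have f0: "f 0 = 0" using fdim_Suc.prems(2)[of 0 0] submod_0[OF sW] by simp
  have sH: "submod (\<cdot>) B ?H"
    using sW sU f0 unfolding submod_def by (auto simp: fdim_Suc.prems(2,3))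
  have "\<exists>b\<in>B. x - y \<cdot> b \<in> ?H" if x: "x \<in> W" and y: "y \<in> W" "y \<notin> ?H" for x y
  proof -
    have "f x \<in> flag_step act' B U (f y)"
      using M'.flag_step_exchange[OF B sU, of "f y" v] fdim_Suc.prems(4) x y by blast
    then obtain u b where *: "f x = u + act' (f y) b" "u \<in> U" "b \<in> B" unfolding flag_step_def by blast
    then have "f (x - y \<cdot> b) = u"
      using neg[OF x submod_act[OF sW y(1) *(3)]] fdim_Suc.prems(3)[OF y(1) *(3)] by simp
    then show ?thesis using * submod_diff[OF B sW x submod_act[OF sW y(1) *(3)]] by blast
  qed
  then obtain m where m: "fdim (\<cdot>) B m ?H" "n \<le> Suc m"
    using fdim_hyperplane[OF fdim_Suc.prems(1) B sH] by blast
  have "\<exists>l. fdim (\<cdot>) B l {x \<in> ?H. f x = 0} \<and> m \<le> l + r"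
    by (rule fdim_Suc.IH[OF m(1)]) (use fdim_Suc.prems in auto)
  moreover have "{x \<in> ?H. f x = 0} = {x \<in> W. f x = 0}" using submod_0[OF sU] by auto
  ultimately show ?case using m(2) by auto
qed

section \<open>Totally isotropic subspaces of reflexive forms\<close>

context rmod
begin

text \<open>Every flag step of \<open>T\<close> imposes one linear condition. As \<open>g\<close> is
  homogeneous on the right only, \<open>refl\<close> is needed to pass from \<open>g v w = 0\<close>
  to \<open>g (v \<cdot> c) w = 0\<close>.\<close>

lemma perp_dim:
  assumes "divring F" "fdim (\<cdot>) F m W" "fdim (\<cdot>) F d T" "T \<subseteq> W"
    and val: "\<And>x y. x \<in> W \<Longrightarrow> y \<in> W \<Longrightarrow> g x y \<in> F"
    and addl: "\<And>x y z. x \<in> W \<Longrightarrow> y \<in> W \<Longrightarrow> z \<in> W \<Longrightarrow> g (x + y) z = g x z + g y z"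
    and addr: "\<And>x y z. x \<in> W \<Longrightarrow> y \<in> W \<Longrightarrow> z \<in> W \<Longrightarrow> g x (y + z) = g x y + g x z"
    and scale: "\<And>x y c. x \<in> W \<Longrightarrow> y \<in> W \<Longrightarrow> c \<in> F \<Longrightarrow> g x (y \<cdot> c) = g x y * c"
    and refl: "\<And>x y. x \<in> W \<Longrightarrow> y \<in> W \<Longrightarrow> g x y = 0 \<Longrightarrow> g y x = 0"
  shows "\<exists>k. fdim (\<cdot>) F k {w \<in> W. \<forall>t\<in>T. g t w = 0} \<and> m \<le> k + d"
  using assms(3,4)
proof (induction rule: fdim.induct)
  case fdim_0
  note sW = fdim_submod[OF assms(2,1)]
  have "g 0 w = 0" if "w \<in> W" for w
    using addl[of 0 0 w] submod_0[OF sW] that by simp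
  then have "{w \<in> W. \<forall>t\<in>{0}. g t w = 0} = W" by auto
  then show ?case using assms(2) by auto
next
  case (fdim_Suc d T v)
  note F = assms(1)
  note sW = fdim_submod[OF assms(2) F]
  note sT = fdim_submod[OF fdim_Suc.hyps(1) F]
  have TW: "T \<subseteq> W" using fdim_Suc.prems flag_step_superset[OF F] by blast
  have vW: "v \<in> W" using fdim_Suc.prems flag_step_mem[OF F sT] by blast
  let ?P = "{w \<in> W. \<forall>t\<in>T. g t w = 0}"
  obtain k where k: "fdim (\<cdot>) F k ?P" "m \<le> k + d" using fdim_Suc.IH TW by blast
  have "\<exists>l. fdim (\<cdot>) F l {w \<in> ?P. g v w = 0} \<and> k \<le> Suc l"
    by (rule fdim_functional_kernel[OF k(1) F, of "g v"])
      (use vW val addr scale in blast)+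
  then obtain l where l: "fdim (\<cdot>) F l {w \<in> ?P. g v w = 0}" "k \<le> Suc l" by blast
  have "{w \<in> ?P. g v w = 0} = {w \<in> W. \<forall>t\<in>flag_step (\<cdot>) F T v. g t w = 0}"
  proof (intro equalityI subsetI)
    fix w assume w: "w \<in> {w \<in> ?P. g v w = 0}"
    have "g t w = 0" if t: "t \<in> flag_step (\<cdot>) F T v" for t
    proof -
      obtain s c where *: "t = s + v \<cdot> c" "s \<in> T" "c \<in> F" using t unfolding flag_step_def by blast
      have vc: "v \<cdot> c \<in> W" using submod_act[OF sW vW *(3)] .
      have "g w v = 0" using refl[OF vW] w by blast
      then have "g w (v \<cdot> c) = 0" using scale[of w v c] w vW * by simp
      then have "g (v \<cdot> c) w = 0" using refl vc w by blast
      then show ?thesis using addl[of s "v \<cdot> c" w] * TW vc w by auto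
    qed
    then show "w \<in> {w \<in> W. \<forall>t\<in>flag_step (\<cdot>) F T v. g t w = 0}" using w by blast
  next
    fix w assume w: "w \<in> {w \<in> W. \<forall>t\<in>flag_step (\<cdot>) F T v. g t w = 0}"
    then show "w \<in> {w \<in> ?P. g v w = 0}"
      using flag_step_mem[OF F sT, of v] flag_step_superset[OF F, of T v] by blast
  qed
  then show ?case using l k(2) by (intro exI[of _ l]) auto
qed

text \<open>Take \<open>T\<close> maximal among the totally isotropic \<open>B\<close>-subspaces. By
  \<open>adj\<close> its orthogonal space is again a \<open>B\<close>-subspace, and a complement of
  \<open>T\<close> in it has \<open>F\<close>-dimension at least \<open>m - 2 * d\<close>. If this
  exceeded \<open>c\<close>, the complement would contain a vector \<open>v\<close> as in
  \<open>iso\<close>, and \<open>T + v B\<close> would be larger.\<close>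

lemma totally_isotropic_exists:
  assumes F: "divring F" and B: "divring B" and FB: "F \<subseteq> B"
    and W: "fdim (\<cdot>) F m W" and sW: "submod (\<cdot>) B W"
    and val: "\<And>x y. x \<in> W \<Longrightarrow> y \<in> W \<Longrightarrow> g x y \<in> F"
    and addl: "\<And>x y z. x \<in> W \<Longrightarrow> y \<in> W \<Longrightarrow> z \<in> W \<Longrightarrow> g (x + y) z = g x z + g y z"
    and addr: "\<And>x y z. x \<in> W \<Longrightarrow> y \<in> W \<Longrightarrow> z \<in> W \<Longrightarrow> g x (y + z) = g x y + g x z"
    and scale: "\<And>x y c. x \<in> W \<Longrightarrow> y \<in> W \<Longrightarrow> c \<in> F \<Longrightarrow> g x (y \<cdot> c) = g x y * c"
    and refl: "\<And>x y. x \<in> W \<Longrightarrow> y \<in> W \<Longrightarrow> g x y = 0 \<Longrightarrow> g y x = 0"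
    and adj: "\<And>b. b \<in> B \<Longrightarrow> \<exists>b'\<in>B. \<forall>x\<in>W. \<forall>y\<in>W. g (x \<cdot> b) y = g x (y \<cdot> b')"
    and iso: "\<And>U k. U \<subseteq> W \<Longrightarrow> submod (\<cdot>) B U \<Longrightarrow> fdim (\<cdot>) F k U \<Longrightarrow> c < k \<Longrightarrow>
      \<exists>v\<in>U. v \<noteq> 0 \<and> (\<forall>b\<in>B. g (v \<cdot> b) v = 0)"
  obtains T d where "T \<subseteq> W" "submod (\<cdot>) B T" "fdim (\<cdot>) F d T"
    "\<And>x y. x \<in> T \<Longrightarrow> y \<in> T \<Longrightarrow> g x y = 0" "m \<le> c + 2 * d"
proof -
  let ?P = "\<lambda>d. \<exists>T\<subseteq>W. submod (\<cdot>) B T \<and> fdim (\<cdot>) F d T \<and> (\<forall>x\<in>T. \<forall>y\<in>T. g x y = 0)"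
  have sWF: "submod (\<cdot>) F W" using submod_mono[OF sW FB] .
  have g0: "g 0 0 = 0" using addl[of 0 0 0] submod_0[OF sW] by simp
  have P0: "?P 0" using fdim_0[of "(\<cdot>)" F] submod_0[OF sW] g0 submod_zero[of B]
    by (intro exI[of _ "{0}"]) auto
  have bound: "d \<le> m" if "?P d" for d
    using that fdim_mono[OF W _ F] by blast
  define d where "d = Greatest ?P"
  have "?P d" and max: "\<And>e. ?P e \<Longrightarrow> e \<le> d"
    using GreatestI_nat[of ?P, OF P0 bound] Greatest_le_nat[of ?P, OF _ bound] unfolding d_def by blast+
  then obtain T where T: "T \<subseteq> W" "submod (\<cdot>) B T" "fdim (\<cdot>) F d T" "\<forall>x\<in>T. \<forall>y\<in>T. g x y = 0"
    by blast
  have "m \<le> c + 2 * d"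
  proof (rule ccontr)
    assume small: "\<not> m \<le> c + 2 * d"
    let ?U = "{w \<in> W. \<forall>t\<in>T. g t w = 0}"
    obtain k where k: "fdim (\<cdot>) F k ?U" "m \<le> k + d"
      using perp_dim[OF F W T(3,1) val addl addr scale refl] by blast
    have TU: "T \<subseteq> ?U" using T by blast
    have act_perp: "g t (w \<cdot> b) = 0" if tw: "t \<in> T" "w \<in> ?U" "b \<in> B" for t w b
    proof -
      obtain b' where b': "b' \<in> B" "\<forall>x\<in>W. \<forall>y\<in>W. g (x \<cdot> b) y = g x (y \<cdot> b')" using adj[OF tw(3)] by blast
      have tb: "t \<cdot> b' \<in> T" using submod_act[OF T(2) tw(1) b'(1)] .
      then have "g (t \<cdot> b') w = 0" using tw(2) by blast
      then have "g w (t \<cdot> b') = 0" using refl tb tw(2) T(1) by blast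
      then have "g (w \<cdot> b) t = 0" using b'(2) tw T(1) by auto
      then show ?thesis using refl tw submod_act[OF sW _ tw(3)] T(1) by blast
    qed
    have sU: "submod (\<cdot>) B ?U"
      unfolding submod_def using fdim_submod[OF k(1) F] act_perp submod_act[OF sW]
      by (auto simp: submod_def)
    obtain e where e: "fdim (\<cdot>) B e ?U" using fdim_over_larger[OF k(1) F B FB sU] .
    obtain T' where T': "submod (\<cdot>) B T'" "T' \<subseteq> ?U" "T \<inter> T' = {0}"
      "?U \<subseteq> {t + t' | t t'. t \<in> T \<and> t' \<in> T'}"
      using fdim_complement[OF e B T(2) TU] by blast
    obtain k' where k': "fdim (\<cdot>) F k' T'"
      using fdim_submodule[OF k(1) F submod_mono[OF T'(1) FB] T'(2)] by blast
    have "fdim (\<cdot>) F (d + k') {t + t' | t t'. t \<in> T \<and> t' \<in> T'}"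
      by (rule fdim_direct_sum[OF k' T(3) F]) (use T'(3) in blast)
    then have "k \<le> d + k'" using fdim_mono[OF _ k(1) F T'(4)] by blast
    then have "c < k'" using small k(2) by linarith
    then obtain v where v: "v \<in> T'" "v \<noteq> 0" "\<forall>b\<in>B. g (v \<cdot> b) v = 0"
      using iso[OF _ T'(1) k'] T'(2) by blast
    have vU: "v \<in> ?U" and vW: "v \<in> W" using v T'(2) by blast+
    have vT: "v \<notin> T" using v T'(3) by blast
    have vbW: "v \<cdot> b \<in> W" if "b \<in> B" for b using submod_act[OF sW vW that] .
    let ?T = "flag_step (\<cdot>) B T v"
    have sT: "submod (\<cdot>) B ?T" by (rule flag_step_submod[OF B T(2)])
    have TW: "?T \<subseteq> W" by (rule flag_step_least[OF sW T(1) vW])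
    have "g x y = 0" if "x \<in> ?T" "y \<in> ?T" for x y
    proof -
      obtain t b t' b' where *: "x = t + v \<cdot> b" "y = t' + v \<cdot> b'" "t \<in> T" "t' \<in> T" "b \<in> B" "b' \<in> B"
        using \<open>x \<in> ?T\<close> \<open>y \<in> ?T\<close> unfolding flag_step_def by blast
      obtain a where a: "a \<in> B" "\<forall>x\<in>W. \<forall>y\<in>W. g (x \<cdot> b) y = g x (y \<cdot> a)" using adj[OF *(5)] by blast
      have tt: "t \<in> W" "t' \<in> W" using * T(1) by auto
      have 1: "g t t' = 0" using T(4) * by blast
      have 2: "g t (v \<cdot> b') = 0" using act_perp[OF *(3) vU *(6)] .
      have 3: "g (v \<cdot> b) t' = 0"
        using refl[OF tt(2) vbW[OF *(5)] act_perp[OF *(4) vU *(5)]] .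
      \<comment> \<open>Here \<open>iso\<close> is used for all of \<open>B\<close>: once
        \<open>b\<close> is moved to the other side, every product along \<open>v B\<close> has the
        form \<open>g v (v \<cdot> x)\<close> with \<open>x\<close> in \<open>B\<close>.\<close>
      have "g (v \<cdot> b) (v \<cdot> b') = g v (v \<cdot> (b' * a))"
        using a vW vbW[OF *(6)] by (simp add: act_mult)
      moreover have ba: "b' * a \<in> B" using *(6) a(1) B by (simp add: divring_closed)
      ultimately have 4: "g (v \<cdot> b) (v \<cdot> b') = 0"
        using refl[OF vbW[OF ba] vW] v(3) by simp
      have "g x y = (g t t' + g t (v \<cdot> b')) + (g (v \<cdot> b) t' + g (v \<cdot> b) (v \<cdot> b'))"
        unfolding * using tt vbW * submod_add[OF sW] by (simp add: addl addr)
      then show ?thesis using 1 2 3 4 by simp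
    qed
    moreover obtain l where l: "fdim (\<cdot>) F l ?T"
      using fdim_submodule[OF W F submod_mono[OF sT FB] TW] by blast
    ultimately have "l \<le> d" using max sT TW by blast
    then have "T = ?T"
      using fdim_eq_imp_eq[OF l T(3) F flag_step_superset[OF B]] by blast
    then show False using flag_step_mem[OF B T(2), of v] vT by blast
  qed
  then show thesis using that[of T d] T by blast
qed

end

section \<open>Central division algebras of dimension 64\<close>

lemma fdim_self:
  fixes M :: "'r::ring_1 set"
  assumes "divring M" shows "fdim (*) M 1 M"
proof -
  have "fdim (*) M 1 (flag_step (*) M {0} 1)" using fdim_Suc[OF fdim_0[of "(*)" M], of 1] by simp
  moreover have "flag_step (*) M {0} 1 = M" unfolding flag_step_def by auto
  ultimately show ?thesis by simp
qed

definition centralizer :: "'r::ring_1 set \<Rightarrow> 'r set \<Rightarrow> 'r set" where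
  "centralizer D S = {x \<in> D. \<forall>s\<in>S. x * s = s * x}"

text \<open>Closing under differences and products is enough: \<open>gen\<close> puts
  \<open>E\<close> among the generators, and \<open>subring_divring\<close> then supplies the
  inverses.\<close>

inductive_set ring_gen :: "'r::ring_1 set \<Rightarrow> 'r set" for G where
  gen_base: "x \<in> G \<Longrightarrow> x \<in> ring_gen G"
| gen_diff: "x \<in> ring_gen G \<Longrightarrow> y \<in> ring_gen G \<Longrightarrow> x - y \<in> ring_gen G"
| gen_mult: "x \<in> ring_gen G \<Longrightarrow> y \<in> ring_gen G \<Longrightarrow> x * y \<in> ring_gen G"

lemma ring_gen_subset:
  assumes "x \<in> ring_gen G" "G \<subseteq> S" "\<And>x y. x \<in> S \<Longrightarrow> y \<in> S \<Longrightarrow> x - y \<in> S"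
    "\<And>x y. x \<in> S \<Longrightarrow> y \<in> S \<Longrightarrow> x * y \<in> S"
  shows "x \<in> S"
  using assms(1) by induction (use assms in auto)

lemma commutes_diff: "(x::'r::ring_1) * z = z * x \<Longrightarrow> y * z = z * y \<Longrightarrow> (x - y) * z = z * (x - y)"
  by (simp add: algebra_simps)

lemma commutes_add: "(x::'r::ring_1) * z = z * x \<Longrightarrow> y * z = z * y \<Longrightarrow> (x + y) * z = z * (x + y)"
  by (simp add: algebra_simps)

lemma commutes_mult: "(x::'r::ring_1) * z = z * x \<Longrightarrow> y * z = z * y \<Longrightarrow> x * y * z = z * (x * y)"
  by (metis mult.assoc)

lemma ring_gen_commutes:
  assumes "x \<in> ring_gen G" "\<And>g. g \<in> G \<Longrightarrow> g * z = z * g"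
  shows "x * z = z * x"
  using assms(1) by induction (auto simp: assms(2) intro: commutes_diff commutes_mult)

lemma ring_gen_comm:
  assumes "\<And>g h. g \<in> G \<Longrightarrow> h \<in> G \<Longrightarrow> g * h = h * g" "x \<in> ring_gen G" "y \<in> ring_gen G"
  shows "x * y = y * x"
  by (rule ring_gen_commutes[OF assms(2)], rule sym, rule ring_gen_commutes[OF assms(3)])
    (use assms(1) in auto)

text \<open>Gaussian elimination with the coefficients to the right of the unknowns: the last
  equation is solved for a pivot unknown \<open>p\<close>, and the induction hypothesis handles the
  system left after substitution.\<close>

lemma linear_system_solvable:
  fixes a :: "nat \<Rightarrow> nat \<Rightarrow> 'r::ring_1"
  assumes "divring D" "finite I" "n < card I" "\<And>j b. j < n \<Longrightarrow> b \<in> I \<Longrightarrow> a j b \<in> D"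
  shows "\<exists>x. (\<forall>b. x b \<in> D) \<and> (\<exists>b\<in>I. x b \<noteq> 0) \<and> (\<forall>j<n. (\<Sum>b\<in>I. x b * a j b) = 0)"
  using assms(2-4)
proof (induction n arbitrary: I a)
  case 0
  then have "I \<noteq> {}" by auto
  then show ?case using divring_1[OF assms(1)] by (intro exI[of _ "\<lambda>_. 1"]) auto
next
  case (Suc n)
  note D = assms(1)
  show ?case
  proof (cases "\<exists>b\<in>I. a n b \<noteq> 0")
    case False
    obtain x where "\<forall>b. x b \<in> D" "\<exists>b\<in>I. x b \<noteq> 0" "\<forall>j<n. (\<Sum>b\<in>I. x b * a j b) = 0"
      using Suc.IH[of I a] Suc.prems by auto
    then show ?thesis using False by (intro exI[of _ x]) (auto simp: less_Suc_eq)
  next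
    case True
    then obtain p where p: "p \<in> I" "a n p \<noteq> 0" by blast
    have "a n p \<in> D" using Suc.prems(3)[of n p] p(1) by simp
    then obtain z where z: "z \<in> D" "z * a n p = 1" using divring_inv[OF D _ p(2)] by metis
    let ?I = "I - {p}"
    let ?a = "\<lambda>j b. a j b - a n b * z * a j p"
    have "\<exists>x. (\<forall>b. x b \<in> D) \<and> (\<exists>b\<in>?I. x b \<noteq> 0) \<and> (\<forall>j<n. (\<Sum>b\<in>?I. x b * ?a j b) = 0)"
      by (rule Suc.IH) (use Suc.prems p z D in \<open>auto simp: divring_closed card_Diff_singleton\<close>)
    then obtain x where x: "\<forall>b. x b \<in> D" "\<exists>b\<in>?I. x b \<noteq> 0" "\<forall>j<n. (\<Sum>b\<in>?I. x b * ?a j b) = 0"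
      by blast
    let ?s = "- (\<Sum>b\<in>?I. x b * a n b) * z"
    let ?x = "x(p := ?s)"
    have s: "?s \<in> D"
      using x(1) z D Suc.prems(3) by (intro divring_mult divring_uminus divring_sum) auto
    have split: "(\<Sum>b\<in>I. ?x b * a j b) = ?s * a j p + (\<Sum>b\<in>?I. x b * a j b)" for j
      using p(1) Suc.prems(1) by (subst sum.remove[of _ p]) (auto intro!: sum.cong)
    have "(\<Sum>b\<in>I. ?x b * a j b) = 0" if "j < Suc n" for j
    proof (cases "j = n")
      case True
      then show ?thesis unfolding split using z by (simp add: mult.assoc)
    next
      case False
      then have "(\<Sum>b\<in>?I. x b * ?a j b) = 0" using x(3) that by auto
      moreover have "(\<Sum>b\<in>?I. x b * ?a j b) = (\<Sum>b\<in>?I. x b * a j b) - (\<Sum>b\<in>?I. x b * a n b) * z * a j p"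
        by (simp add: algebra_simps sum_subtractf sum_distrib_left sum_distrib_right)
      ultimately show ?thesis unfolding split by simp
    qed
    then show ?thesis using x s by (intro exI[of _ ?x]) auto
  qed
qed

text \<open>Dimension 64 is degree 8. Both \<open>E\<close> and \<open>D\<close> are subsets of an
  ambient ring, so that the same lemmas apply to the given division algebra and to its scalar
  extensions inside a matrix ring.\<close>

locale csa64 =
  fixes E D :: "'r::ring_1 set"
  assumes E: "divring E" and D: "divring D" and E_sub: "E \<subseteq> D"
    and E_central: "\<And>e x. e \<in> E \<Longrightarrow> x \<in> D \<Longrightarrow> e * x = x * e"
    and center: "\<And>z. z \<in> D \<Longrightarrow> (\<And>x. x \<in> D \<Longrightarrow> z * x = x * z) \<Longrightarrow> z \<in> E"
    and dim_D: "fdim (*) E 64 D"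
    and two: "(2::'r) \<noteq> 0"
begin

interpretation R: rmod "(*) :: 'r \<Rightarrow> 'r \<Rightarrow> 'r" by (rule rmod_times)

lemma half_ex: obtains h where "h \<in> E" "h + h = 1"
proof -
  have "(2::'r) \<in> E" using divring_add[OF E divring_1[OF E] divring_1[OF E]] by simp
  then obtain h where "h \<in> E" "2 * h = 1" using divring_inv[OF E _ two] by metis
  then show thesis using that by (simp add: mult_2)
qed

lemma double_0:
  assumes "(x::'r) + x = 0" shows "x = 0"
proof -
  obtain h where h: "h \<in> E" "h + h = 1" using half_ex .
  then have "x = (h + h) * x" by simp
  also have "\<dots> = h * (x + x)" by (simp add: algebra_simps)
  finally show ?thesis using assms by simp
qed

lemma submod_fdim:
  assumes "submod (*) E U" "U \<subseteq> D"
  obtains m where "fdim (*) E m U"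
  using R.fdim_submodule[OF dim_D E assms] by blast

lemma divring_submod: "divring M \<Longrightarrow> E \<subseteq> M \<Longrightarrow> submod (*) E M"
  unfolding submod_def by (auto simp: divring_closed)

text \<open>Left multiplication by a nonzero \<open>x\<close> is injective and
  \<open>E\<close>-linear on the finite-dimensional \<open>M\<close>, hence onto, and so it reaches
  1.\<close>

lemma subring_divring:
  assumes "E \<subseteq> M" "M \<subseteq> D" "\<And>x y. x \<in> M \<Longrightarrow> y \<in> M \<Longrightarrow> x - y \<in> M"
    "\<And>x y. x \<in> M \<Longrightarrow> y \<in> M \<Longrightarrow> x * y \<in> M"
  shows "divring M"
  unfolding divring_def
proof (intro conjI ballI impI)
  show one: "1 \<in> M" using assms(1) divring_1[OF E] by blast
  fix x assume x: "x \<in> M" "x \<noteq> 0"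
  have zero: "0 \<in> M" using assms(3)[OF one one] by simp
  have add: "u + v \<in> M" if "u \<in> M" "v \<in> M" for u v
    using assms(3)[OF that(1) assms(3)[OF zero that(2)]] by simp
  have sM: "submod (*) E M" unfolding submod_def using zero add assms(1,4) by blast
  obtain m where m: "fdim (*) E m M" using submod_fdim[OF sM assms(2)] .
  have "fdim (*) E m ((*) x ` M)"
    by (rule fdim_image[OF m rmod_times rmod_times E])
      (use divring_no_zero_div[OF D _ x(2)] x(1) assms(2) in \<open>auto simp: algebra_simps\<close>)
  then have "(*) x ` M = M"
    using R.fdim_eq_imp_eq[OF m _ E] assms(4) x(1) by blast
  then obtain y where y: "y \<in> M" "x * y = 1" using one by (metis imageE)
  obtain z where z: "z * x = 1" using divring_inv[OF D _ x(2)] x(1) assms(2) by blast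
  have "z = z * (x * y)" using y by simp
  also have "\<dots> = y" using z by (simp flip: mult.assoc)
  finally show "\<exists>y\<in>M. x * y = 1 \<and> y * x = 1" using y z by blast
qed (use assms in auto)

lemma centralizer_divring:
  assumes "S \<subseteq> D"
  shows "divring (centralizer D S)" "E \<subseteq> centralizer D S" "centralizer D S \<subseteq> D"
proof -
  show 1: "E \<subseteq> centralizer D S" using E_central assms E_sub unfolding centralizer_def by blast
  show 2: "centralizer D S \<subseteq> D" unfolding centralizer_def by blast
  show "divring (centralizer D S)"
    by (rule subring_divring[OF 1 2])
      (auto simp: centralizer_def divring_closed D commutes_diff commutes_mult)
qed

text \<open>Argument by a shortest relation. Scale one coefficient to 1. The commutator of the
  relation with any \<open>y\<close> loses that term, so by minimality all coefficients commute with
  \<open>y\<close> and are central. Then \<open>x = 1\<close> contradicts the independence of the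
  \<open>m b\<close>.\<close>

lemma shortest_relation:
  fixes m d :: "nat \<Rightarrow> 'r"
  assumes m: "\<And>b. b < n \<Longrightarrow> m b \<in> D"
    and indep: "\<And>c. (\<forall>b<n. c b \<in> E) \<Longrightarrow> (\<Sum>b<n. m b * c b) = 0 \<Longrightarrow> (\<forall>b<n. c b = 0)"
    and "\<And>b. b < n \<Longrightarrow> d b \<in> D" "\<And>x. x \<in> D \<Longrightarrow> (\<Sum>b<n. d b * x * m b) = 0"
  shows "\<forall>b<n. d b = 0"
  using assms(3,4)
proof (induction "card {b. b < n \<and> d b \<noteq> 0}" arbitrary: d rule: less_induct)
  case less
  show ?case
  proof (rule ccontr)
    assume "\<not> ?thesis"
    then obtain p where p: "p < n" "d p \<noteq> 0" by blast
    obtain z where z: "z \<in> D" "z * d p = 1" "d p * z = 1" using divring_inv[OF D less.prems(1)[OF p(1)] p(2)] by metis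
    let ?d = "\<lambda>b. z * d b"
    have dD: "?d b \<in> D" if "b < n" for b using that z less.prems(1) D by (simp add: divring_closed)
    have rel: "(\<Sum>b<n. ?d b * x * m b) = 0" if "x \<in> D" for x
      using less.prems(2)[OF that] by (simp add: mult.assoc flip: sum_distrib_left)
    have comm: "y * ?d b = ?d b * y" if y: "y \<in> D" and b: "b < n" for y b
    proof -
      let ?e = "\<lambda>b. y * ?d b - ?d b * y"
      have "{b. b < n \<and> ?e b \<noteq> 0} \<subset> {b. b < n \<and> d b \<noteq> 0}"
      proof -
        have "?e p = 0" using z by simp
        moreover have "?e b = 0" if "d b = 0" for b using that by simp
        ultimately show ?thesis using p by blast
      qed
      then have "card {b. b < n \<and> ?e b \<noteq> 0} < card {b. b < n \<and> d b \<noteq> 0}"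
        by (intro psubset_card_mono) auto
      moreover have "(\<Sum>b<n. ?e b * x * m b) = 0" if x: "x \<in> D" for x
      proof -
        have "(\<Sum>b<n. ?e b * x * m b) = y * (\<Sum>b<n. ?d b * x * m b) - (\<Sum>b<n. ?d b * (y * x) * m b)"
          by (simp add: algebra_simps sum_subtractf sum_distrib_left)
        then show ?thesis using rel x y D by (simp add: divring_closed)
      qed
      moreover have "?e b \<in> D" if "b < n" for b using dD[OF that] y D by (simp add: divring_closed)
      ultimately have "\<forall>b<n. ?e b = 0" using less.hyps[of ?e] by blast
      then show ?thesis using b by auto
    qed
    have dE: "?d b \<in> E" if "b < n" for b using center[OF dD[OF that]] comm[OF _ that] by auto
    have "(\<Sum>b<n. m b * ?d b) = (\<Sum>b<n. ?d b * 1 * m b)"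
      by (intro sum.cong refl) (use E_central[OF dE m] in auto)
    also have "\<dots> = 0" by (rule rel[OF divring_1[OF D]])
    finally have "?d p = 0" using indep[of ?d] dE p by blast
    then show False using z by simp
  qed
qed

lemma dim_dvd:
  assumes "divring M" "E \<subseteq> M" "fdim (*) E m M" "submod (*) M U" "U \<subseteq> D" "fdim (*) E k U"
  shows "m dvd k"
proof -
  obtain t where "fdim (*) M t U" using R.fdim_over_larger[OF assms(6) E assms(1,2,4)] .
  then have "fdim (*) E (m * t) U" by (rule R.fdim_tower[OF assms(3) E assms(1,2)])
  then show ?thesis using R.fdim_unique[OF assms(6) _ E] by auto
qed

text \<open>One half of the centralizer theorem. Over the centralizer, \<open>D\<close> has
  dimension \<open>n = 64 / q\<close>. If \<open>m\<close> were larger than \<open>n\<close>, there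
  would be coefficients \<open>x i\<close>, not all zero, with
  \<open>(\<Sum>i<m. x i * (y j * b i)) = 0\<close> at all \<open>n\<close> basis vectors
  \<open>y j\<close>. As the centralizer commutes with the \<open>b i\<close>, the relation extends
  to all of \<open>D\<close> and contradicts \<open>shortest_relation\<close>.\<close>

lemma centralizer_bound:
  assumes M: "divring M" "E \<subseteq> M" "M \<subseteq> D" "fdim (*) E m M"
    and C: "fdim (*) E q (centralizer D M)"
  shows "m * q \<le> 64"
proof -
  let ?C = "centralizer D M"
  note C' = centralizer_divring[OF M(3)]
  have "submod (*) ?C D"
    unfolding submod_def using C'(3) by (auto intro!: divring_closed[OF D])
  then obtain n where n: "fdim (*) ?C n D" using R.fdim_over_larger[OF dim_D E C'(1,2)] by blast
  have 64: "64 = q * n" using R.fdim_unique[OF dim_D R.fdim_tower[OF C E C'(1,2) n] E] by simp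
  obtain y where y: "\<forall>i<n. y i \<in> D" "D = {\<Sum>i<n. y i * c i | c. \<forall>i. c i \<in> ?C}"
    by (rule R.fdim_basisE[OF n C'(1)])
  obtain b where b: "\<forall>i<m. b i \<in> M"
    "\<forall>c. (\<forall>i<m. c i \<in> E) \<longrightarrow> (\<Sum>i<m. b i * c i) = 0 \<longrightarrow> (\<forall>i<m. c i = 0)"
    by (rule R.fdim_basisE[OF M(4) E])
  have "m \<le> n"
  proof (rule ccontr)
    assume "\<not> m \<le> n"
    then have "\<exists>x. (\<forall>i. x i \<in> D) \<and> (\<exists>i\<in>{..<m}. x i \<noteq> 0) \<and> (\<forall>j<n. (\<Sum>i<m. x i * (y j * b i)) = 0)"
      using y(1) b(1) M(3) by (intro linear_system_solvable[OF D]) (auto intro!: divring_mult[OF D])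
    then obtain x where x: "\<forall>i. x i \<in> D" "\<exists>i\<in>{..<m}. x i \<noteq> 0" "\<forall>j<n. (\<Sum>i<m. x i * (y j * b i)) = 0"
      by blast
    have "\<forall>i<m. x i = 0"
    proof (rule shortest_relation[of m b x])
      fix w assume "w \<in> D"
      then have "w \<in> {\<Sum>i<n. y i * c i | c. \<forall>i. c i \<in> ?C}" by (rule subsetD[OF equalityD1[OF y(2)]])
      then obtain c where c: "w = (\<Sum>j<n. y j * c j)" "\<forall>j. c j \<in> ?C" by (elim CollectE exE conjE)
      have "(\<Sum>i<m. x i * w * b i) = (\<Sum>i<m. \<Sum>j<n. x i * (y j * b i) * c j)"
      proof (intro sum.cong refl)
        fix i assume "i \<in> {..<m}"
        then have "c j * b i = b i * c j" for j using c(2) b(1) unfolding centralizer_def by auto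
        then show "x i * w * b i = (\<Sum>j<n. x i * (y j * b i) * c j)"
          unfolding c(1) by (simp add: sum_distrib_left sum_distrib_right mult.assoc)
      qed
      also have "\<dots> = (\<Sum>j<n. (\<Sum>i<m. x i * (y j * b i)) * c j)"
        by (subst sum.swap) (simp add: sum_distrib_right)
      also have "\<dots> = 0" using x(3) by simp
      finally show "(\<Sum>i<m. x i * w * b i) = 0" .
    qed (use x b M(3) in auto)
    then show False using x(2) by auto
  qed
  then show ?thesis using 64 by (metis mult.commute mult_le_mono1)
qed

definition gen :: "'r set \<Rightarrow> 'r set" where "gen S = ring_gen (E \<union> S)"

lemma gen_props:
  assumes "S \<subseteq> D" "\<And>x y. x \<in> S \<Longrightarrow> y \<in> S \<Longrightarrow> x * y = y * x"
  shows "divring (gen S)" "E \<subseteq> gen S" "gen S \<subseteq> D" "S \<subseteq> gen S"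
    "\<And>x y. x \<in> gen S \<Longrightarrow> y \<in> gen S \<Longrightarrow> x * y = y * x"
    "centralizer D (gen S) = centralizer D S"
proof -
  show 1: "E \<subseteq> gen S" and 2: "S \<subseteq> gen S" unfolding gen_def using gen_base by blast+
  show 3: "gen S \<subseteq> D"
    unfolding gen_def using ring_gen_subset[of _ "E \<union> S" D] assms(1) E_sub D
    by (auto simp: divring_closed)
  show "divring (gen S)"
    by (rule subring_divring[OF 1 3]) (auto simp: gen_def intro: gen_diff gen_mult)
  show "\<And>x y. x \<in> gen S \<Longrightarrow> y \<in> gen S \<Longrightarrow> x * y = y * x"
  proof -
    have "g * h = h * g" if "g \<in> E \<union> S" "h \<in> E \<union> S" for g h
    proof -
      have "g \<in> D" "h \<in> D" using that E_sub assms(1) by blast+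
      then show ?thesis using that E_central[of g h] E_central[of h g] assms(2) by auto
    qed
    then show "\<And>x y. x \<in> gen S \<Longrightarrow> y \<in> gen S \<Longrightarrow> x * y = y * x"
      unfolding gen_def by (rule ring_gen_comm)
  qed
  show "centralizer D (gen S) = centralizer D S"
  proof
    show "centralizer D (gen S) \<subseteq> centralizer D S" using 2 unfolding centralizer_def by blast
    show "centralizer D S \<subseteq> centralizer D (gen S)"
    proof
      fix x assume x: "x \<in> centralizer D S"
      have "s * x = x * s" if "s \<in> gen S" for s
        using that x E_central unfolding gen_def centralizer_def
        by (intro ring_gen_commutes[of s "E \<union> S"]) auto
      then show "x \<in> centralizer D (gen S)" using x unfolding centralizer_def by auto
    qed
  qed
qed

text \<open>\<open>M\<close> lies in its own centralizer, so \<open>centralizer_bound\<close> gives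
  \<open>m * m \<le> 64\<close>; besides, \<open>m\<close> divides 64 since \<open>D\<close> is a
  space over \<open>M\<close>.\<close>

lemma comm_dim:
  assumes "divring M" "E \<subseteq> M" "M \<subseteq> D" "\<And>x y. x \<in> M \<Longrightarrow> y \<in> M \<Longrightarrow> x * y = y * x"
    "fdim (*) E m M"
  shows "m \<in> {1, 2, 4, 8}"
proof -
  note C = centralizer_divring[OF assms(3)]
  obtain q where q: "fdim (*) E q (centralizer D M)"
    using submod_fdim[OF divring_submod[OF C(1,2)] C(3)] .
  have "M \<subseteq> centralizer D M" using assms(3,4) unfolding centralizer_def by blast
  then have "m \<le> q" using R.fdim_mono[OF q assms(5) E] by blast
  then have "m * m \<le> 64" using centralizer_bound[OF assms(1,2,3,5) q]
    by (meson le_trans mult_le_mono2)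
  then have m8: "m \<le> 8"
  proof (rule contrapos_pp)
    assume "\<not> m \<le> 8"
    then have "9 * 9 \<le> m * m" by (intro mult_le_mono) auto
    then show "\<not> m * m \<le> 64" by simp
  qed
  have "m dvd 64"
    by (rule dim_dvd[OF assms(1,2,5) _ order_refl dim_D])
      (use assms(3) in \<open>auto simp: submod_def intro!: divring_closed[OF D]\<close>)
  moreover have "m \<in> {0, 1, 2, 3, 4, 5, 6, 7, 8}" using m8 by auto
  ultimately show ?thesis by auto
qed

lemma maximal_comm:
  assumes "divring M" "E \<subseteq> M" "M \<subseteq> D" "\<And>x y. x \<in> M \<Longrightarrow> y \<in> M \<Longrightarrow> x * y = y * x"
    "fdim (*) E 8 M"
  shows "centralizer D M = M"
proof -
  note C = centralizer_divring[OF assms(3)]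
  obtain q where q: "fdim (*) E q (centralizer D M)"
    using submod_fdim[OF divring_submod[OF C(1,2)] C(3)] .
  have "q \<le> 8" using centralizer_bound[OF assms(1,2,3,5) q] by simp
  moreover have "M \<subseteq> centralizer D M" using assms(3,4) unfolding centralizer_def by blast
  ultimately show ?thesis using R.fdim_eq_imp_eq[OF q assms(5) E] by blast
qed

lemma dim_1_eq:
  assumes "E \<subseteq> M" "fdim (*) E 1 M"
  shows "M = E"
  using R.fdim_eq_imp_eq[OF assms(2) fdim_self[OF E] E assms(1)] by auto

text \<open>\<open>M'\<close> has dimension 2 over \<open>M\<close>, so
  \<open>x * x = a + x * b\<close> with \<open>a\<close> and \<open>b\<close> in \<open>M\<close>,
  and \<open>t\<close> is half of \<open>b\<close>.\<close>

lemma complete_square: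
  assumes M: "divring M" "E \<subseteq> M" "fdim (*) E m M"
    and M': "divring M'" "M \<subseteq> M'" "fdim (*) E (2 * m) M'"
    and comm: "\<And>x y. x \<in> M' \<Longrightarrow> y \<in> M' \<Longrightarrow> x * y = y * x"
    and x: "x \<in> M'" "x \<notin> M"
  shows "\<exists>t\<in>M. (x - t) * (x - t) \<in> M"
proof -
  have "fdim (*) M 1 M" by (rule fdim_self[OF M(1)])
  then have "fdim (*) M 2 (flag_step (*) M M x)" using fdim_Suc[OF _ x(2)] by (metis Suc_1)
  then have "fdim (*) E (m * 2) (flag_step (*) M M x)" by (rule R.fdim_tower[OF M(3) E M(1,2)])
  moreover have "flag_step (*) M M x \<subseteq> M'"
    unfolding flag_step_def using M'(1,2) x(1) by (auto intro!: divring_closed[OF M'(1)])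
  ultimately have eq: "flag_step (*) M M x = M'"
    using R.fdim_eq_imp_eq[OF M'(3) _ E] by (simp add: mult.commute)
  have "x * x \<in> flag_step (*) M M x" unfolding eq using x(1) M'(1) by (simp add: divring_closed)
  then obtain a b where ab: "x * x = a + x * b" "a \<in> M" "b \<in> M" unfolding flag_step_def by blast
  obtain h where h: "h \<in> E" "h + h = 1" using half_ex .
  have hM: "h \<in> M" using h M(2) by blast
  let ?t = "h * b"
  have t: "?t \<in> M" using hM ab M(1) by (simp add: divring_closed)
  have bt: "b = ?t + ?t" using h(2) by (metis distrib_right mult_1)
  have xt: "?t * x = x * ?t" using comm[of x ?t] x(1) t M'(2) by auto
  have "(x - ?t) * (x - ?t) = x * x - x * ?t - ?t * x + ?t * ?t" by (simp add: algebra_simps)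
  also have "\<dots> = a + x * b - x * ?t - x * ?t + ?t * ?t" unfolding xt ab(1) ..
  also have "\<dots> = a + ?t * ?t" by (subst bt) (simp add: algebra_simps)
  finally have "(x - ?t) * (x - ?t) \<in> M" using ab t M(1) by (simp add: divring_closed)
  then show ?thesis using t by blast
qed

definition quad :: "'r \<Rightarrow> bool" where "quad x \<longleftrightarrow> x \<in> D \<and> x \<notin> E \<and> x * x \<in> E"

end

section \<open>Involutions of the first kind and of symplectic type\<close>

locale csa_inv = csa64 E D for E D :: "'r::ring_1 set" +
  fixes J :: "'r \<Rightarrow> 'r"
  assumes J_D: "\<And>x. x \<in> D \<Longrightarrow> J x \<in> D"
    and J_add: "\<And>x y. x \<in> D \<Longrightarrow> y \<in> D \<Longrightarrow> J (x + y) = J x + J y"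
    and J_mult: "\<And>x y. x \<in> D \<Longrightarrow> y \<in> D \<Longrightarrow> J (x * y) = J y * J x"
    and J_J: "\<And>x. x \<in> D \<Longrightarrow> J (J x) = x"
    and J_E: "\<And>e. e \<in> E \<Longrightarrow> J e = e"
begin

interpretation R: rmod "(*) :: 'r \<Rightarrow> 'r \<Rightarrow> 'r" by (rule rmod_times)

definition Sym :: "'r set" where "Sym = {x \<in> D. J x = x}"
definition Skew :: "'r set" where "Skew = {x \<in> D. J x = - x}"

lemma J_diff: "x \<in> D \<Longrightarrow> y \<in> D \<Longrightarrow> J (x - y) = J x - J y"
  using J_add[of "x - y" y] D by (simp add: divring_closed)

lemma J_0: "J 0 = 0"
  using J_add[of 0 0] D by (simp add: divring_closed)

lemma J_minus: "x \<in> D \<Longrightarrow> J (- x) = - J x"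
  using J_diff[of 0 x] D by (simp add: divring_closed J_0)

lemma Sym_D: "x \<in> Sym \<Longrightarrow> x \<in> D" and Skew_D: "x \<in> Skew \<Longrightarrow> x \<in> D"
  and Sym_J: "x \<in> Sym \<Longrightarrow> J x = x" and Skew_J: "x \<in> Skew \<Longrightarrow> J x = - x"
  unfolding Sym_def Skew_def by auto

lemma E_Sym: "E \<subseteq> Sym"
  using E_sub J_E unfolding Sym_def by auto

lemma Sym_submod: "submod (*) E Sym"
  unfolding submod_def Sym_def using E_sub
  by (auto simp: divring_closed D J_0 J_add J_mult J_E E_central subset_iff)

lemma Skew_submod: "submod (*) E Skew"
  unfolding submod_def Skew_def using E_sub
  by (auto simp: divring_closed D J_0 J_add J_mult J_E E_central subset_iff)

lemma Sym_Skew_zero: "x \<in> Sym \<Longrightarrow> x \<in> Skew \<Longrightarrow> x = 0"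
  unfolding Sym_def Skew_def using double_0[of x] by (auto simp: eq_neg_iff_add_eq_0)

lemma Sym_square: "x \<in> Sym \<Longrightarrow> x * x \<in> Sym" and Skew_square: "x \<in> Skew \<Longrightarrow> x * x \<in> Sym"
  unfolding Sym_def Skew_def by (auto simp: divring_closed D J_mult)

lemma Sym_diff: "x \<in> Sym \<Longrightarrow> y \<in> Sym \<Longrightarrow> x - y \<in> Sym"
  unfolding Sym_def by (auto simp: divring_closed D J_diff)

lemma Sym_Skew_sum: "D = {x + y | x y. x \<in> Sym \<and> y \<in> Skew}"
proof (intro equalityI subsetI)
  fix d assume d: "d \<in> D"
  obtain h where h: "h \<in> E" "h + h = 1" using half_ex .
  have hD: "h \<in> D" using h E_sub by blast
  have Jh: "J (h * x) = h * J x" if "x \<in> D" for x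
    using that hD h J_mult[OF hD that] J_E E_central[of h "J x"] J_D by simp
  have "h * (d + J d) \<in> Sym" "h * (d - J d) \<in> Skew"
    unfolding Sym_def Skew_def using d hD D J_D[OF d]
    by (auto simp: divring_closed Jh J_add J_diff J_J algebra_simps)
  moreover have "h * (d + J d) + h * (d - J d) = (h + h) * d" by (simp add: algebra_simps)
  ultimately show "d \<in> {x + y | x y. x \<in> Sym \<and> y \<in> Skew}" using h(2) by force
qed (auto simp: Sym_def Skew_def divring_closed D)

lemma gen_Sym:
  assumes "S \<subseteq> Sym" "\<And>x y. x \<in> S \<Longrightarrow> y \<in> S \<Longrightarrow> x * y = y * x"
  shows "gen S \<subseteq> Sym"
proof
  fix x assume "x \<in> gen S"
  have S: "S \<subseteq> D" using assms(1) Sym_D by blast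
  note G = gen_props[OF S assms(2)]
  have "x \<in> gen S \<and> x \<in> Sym"
  proof (rule ring_gen_subset[of x "E \<union> S" "{x. x \<in> gen S \<and> x \<in> Sym}", simplified])
    show "x \<in> ring_gen (E \<union> S)" using \<open>x \<in> gen S\<close> unfolding gen_def .
    show "E \<subseteq> {x \<in> gen S. x \<in> Sym} \<and> S \<subseteq> {x \<in> gen S. x \<in> Sym}"
      using G(2,4) E_Sym assms(1) by blast
    show "x - y \<in> gen S \<and> x - y \<in> Sym" if "x \<in> gen S \<and> x \<in> Sym" "y \<in> gen S \<and> y \<in> Sym" for x y
      using that G(1) Sym_diff by (auto simp: divring_closed)
    show "x * y \<in> gen S \<and> x * y \<in> Sym" if "x \<in> gen S \<and> x \<in> Sym" "y \<in> gen S \<and> y \<in> Sym" for x y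
      using that G(1) G(5)[of x y] unfolding Sym_def by (auto simp: divring_closed D J_mult)
  qed
  then show "x \<in> Sym" ..
qed

text \<open>A commutator \<open>w\<close> with \<open>x\<close> anticommutes with \<open>x\<close>,
  and so do \<open>J w\<close> and all \<open>c * w\<close> with \<open>c\<close> in the centralizer
  of \<open>x\<close>. If no such element had a nonzero symmetrization, \<open>J\<close> would act
  on the centralizer as conjugation by \<open>w\<close>, making it commutative. But the centralizer
  and its translate by \<open>w\<close> fill \<open>D\<close>, so it has dimension 32, and a
  commutative one has at most 8.\<close>

lemma skew_involution_type:
  assumes x: "x \<in> D" "x \<notin> E" "x * x \<in> E" "J x = - x"
  obtains w where "w \<in> Sym" "w \<noteq> 0" "w * x = - (x * w)"
proof -
  let ?C = "centralizer D {x}"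
  have xE: "x * x * y = y * (x * x)" if "y \<in> D" for y using E_central[OF x(3) that] .
  obtain d where d: "d \<in> D" "x * d \<noteq> d * x" using center[OF x(1)] x(2) by blast
  define w where "w = d * x - x * d"
  have w: "w \<in> D" "w \<noteq> 0" unfolding w_def using d x(1) D by (auto simp: divring_closed)
  have wx: "w * x = - (x * w)"
    unfolding w_def using xE[OF d(1)] by (simp add: algebra_simps mult.assoc)
  show thesis
  proof (cases "w + J w = 0")
    case False
    have "J w * x = - (x * J w)"
    proof -
      have "J (w * x) = J (- (x * w))" using wx by simp
      then have "J x * J w = - (J w * J x)" using w x(1) D by (simp add: J_mult J_minus divring_closed)
      then show ?thesis using x(4) by simp
    qed
    then have "(w + J w) * x = - (x * (w + J w))" using wx by (simp add: algebra_simps)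
    moreover have "w + J w \<in> Sym"
      unfolding Sym_def using w J_D D by (auto simp: divring_closed J_add J_J add.commute)
    ultimately show ?thesis using that False by blast
  next
    case True
    then have Jw: "J w = - w" by (simp add: eq_neg_iff_add_eq_0 add.commute)
    show ?thesis
    proof (cases "\<exists>c\<in>?C. c * w + J (c * w) \<noteq> 0")
      case True
      then obtain c where c: "c \<in> ?C" "c * w + J (c * w) \<noteq> 0" by blast
      have cD: "c \<in> D" "c * x = x * c" using c unfolding centralizer_def by auto
      have cw: "c * w \<in> D" using cD w D by (simp add: divring_closed)
      have 1: "c * w * x = - (x * (c * w))"
        using wx cD by (metis mult.assoc mult_minus_right)
      have "J x * J (c * w) = - (J (c * w) * J x)"
        using arg_cong[OF 1, of J] cw x(1) D by (simp add: J_mult J_minus divring_closed)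
      then have "J (c * w) * x = - (x * J (c * w))" using x(4) by simp
      then have "(c * w + J (c * w)) * x = - (x * (c * w + J (c * w)))" using 1 by (simp add: algebra_simps)
      moreover have "c * w + J (c * w) \<in> Sym"
        unfolding Sym_def using cw J_D D by (auto simp: divring_closed J_add J_J add.commute)
      ultimately show ?thesis using that c by blast
    next
      case False
      have xD: "{x} \<subseteq> D" using x by simp
      note C = centralizer_divring[OF xD]
      have cw: "c * w = w * J c" if c: "c \<in> ?C" for c
      proof -
        have cD: "c \<in> D" using c C(3) by blast
        have "c * w + J (c * w) = 0" using False c by blast
        then show ?thesis using cD w Jw by (simp add: J_mult eq_neg_iff_add_eq_0)
      qed
      have comm: "c * c' = c' * c" if c: "c \<in> ?C" "c' \<in> ?C" for c c'
      proof -
        have cD: "c \<in> D" "c' \<in> D" using c C(3) by blast+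
        have "c * c' * w = w * J (c * c')" using cw C(1) c by (simp add: divring_closed)
        also have "\<dots> = w * J c' * J c" using cD by (simp add: J_mult mult.assoc)
        also have "\<dots> = c' * (w * J c)" using cw[OF c(2)] by (metis mult.assoc)
        also have "\<dots> = c' * c * w" using cw[OF c(1)] by (simp add: mult.assoc)
        finally have "(c * c' - c' * c) * w = 0" by (simp add: left_diff_distrib)
        then have "c * c' - c' * c = 0" using divring_no_zero_div_right[OF D w] by blast
        then show ?thesis by simp
      qed
      obtain q where q: "fdim (*) E q ?C" using submod_fdim[OF divring_submod[OF C(1,2)] C(3)] .
      have "q \<in> {1, 2, 4, 8}" using comm_dim[OF C comm q] by blast
      obtain wi where wi: "wi \<in> D" "w * wi = 1" "wi * w = 1" using divring_inv[OF D w] .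
      obtain e where e: "e \<in> E" "x * x * e = 1"
      proof -
        have "x * x \<noteq> 0" using divring_no_zero_div[OF D x(1), of x] x divring_0[OF E] by auto
        then show thesis using divring_inv[OF E x(3)] that by metis
      qed
      obtain h where h: "h \<in> E" "h + h = 1" using half_ex .
      have Cw: "fdim (*) E q ((\<lambda>c. c * w) ` ?C)"
      proof (rule fdim_image[OF q rmod_times rmod_times E])
        show "a * w = 0 \<Longrightarrow> a = 0" for a using divring_no_zero_div_right[OF D w] by blast
        show "a * b * w = a * w * b" if "b \<in> E" for a b using E_central[OF that w(1)] by (simp add: mult.assoc)
      qed (simp add: algebra_simps)
      have "(\<lambda>c. c * w) ` ?C \<inter> ?C \<subseteq> {0}"
      proof
        fix y assume "y \<in> (\<lambda>c. c * w) ` ?C \<inter> ?C"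
        then obtain c where c: "c \<in> ?C" "y = c * w" "y \<in> ?C" by blast
        have cx: "c * x = x * c" using c(1) unfolding centralizer_def by auto
        have "y * x = c * (w * x)" unfolding c(2) by (simp add: mult.assoc)
        also have "\<dots> = - (c * x * w)" unfolding wx by (simp add: mult.assoc)
        also have "\<dots> = - (x * y)" unfolding c(2) cx by (simp add: mult.assoc)
        finally have "y * x = - (x * y)" .
        moreover have "y * x = x * y" using c(3) unfolding centralizer_def by auto
        ultimately have "y * x = 0" using double_0[of "y * x"] by (simp add: eq_neg_iff_add_eq_0)
        moreover have "x \<noteq> 0" using x(2) divring_0[OF E] by auto
        ultimately show "y \<in> {0}" using divring_no_zero_div_right[OF D x(1)] by blast
      qed
      then have "fdim (*) E (q + q) {c + u | c u. c \<in> ?C \<and> u \<in> (\<lambda>c. c * w) ` ?C}"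
        by (rule R.fdim_direct_sum[OF Cw q E])
      moreover have "D \<subseteq> {c + u | c u. c \<in> ?C \<and> u \<in> (\<lambda>c. c * w) ` ?C}"
      proof
        fix y assume y: "y \<in> D"
        \<comment> \<open>This is \<open>x * y * inverse x\<close>, because \<open>e * x\<close> is
          the inverse of \<open>x\<close>. Half the sum and half the difference of \<open>y\<close>
          and \<open>?z\<close> commute and anticommute with \<open>x\<close>.\<close>
        let ?z = "e * (x * y * x)"
        have eD: "e \<in> D" and hD: "h \<in> D" using e h E_sub by auto
        have zD: "?z \<in> D" using eD x y D by (simp add: divring_closed)
        have hc: "h * u = u * h" if "u \<in> D" for u using E_central[OF h(1) that] .
        have ec: "e * u = u * e" if "u \<in> D" for u using E_central[OF e(1) that] .
        have xz: "x * ?z = y * x"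
        proof -
          have "x * ?z = e * (x * x) * (y * x)" using ec[OF x(1)] by (metis mult.assoc)
          also have "e * (x * x) = 1" using e ec[of "x * x"] x(1) D by (simp add: divring_closed)
          finally show ?thesis by simp
        qed
        have zx: "?z * x = x * y"
        proof -
          have "?z * x = e * (x * y * (x * x))" by (simp add: mult.assoc)
          also have "x * y * (x * x) = x * x * (x * y)" using xE[of "x * y"] x(1) y D by (simp add: divring_closed)
          also have "e * (x * x * (x * y)) = (e * (x * x)) * (x * y)" by (simp add: mult.assoc)
          also have "e * (x * x) = 1" using e ec[of "x * x"] x(1) D by (simp add: divring_closed)
          finally show ?thesis by simp
        qed
        let ?c = "h * (y + ?z)" and ?u = "h * (y - ?z)"
        have c: "?c \<in> ?C"
        proof -
          have "?c * x = h * (y * x + x * y)" using zx by (simp add: algebra_simps)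
          also have "\<dots> = h * (x * (y + ?z))" using xz by (simp add: algebra_simps)
          also have "\<dots> = x * ?c" using hc[OF x(1)] by (metis mult.assoc)
          finally show ?thesis unfolding centralizer_def using y zD hD D by (simp add: divring_closed)
        qed
        have ux: "?u * x = - (x * ?u)"
        proof -
          have "?u * x = h * (y * x - x * y)" using zx by (simp add: algebra_simps)
          also have "\<dots> = - (h * (x * (y - ?z)))" using xz by (simp add: algebra_simps)
          also have "\<dots> = - (x * ?u)" using hc[OF x(1)] by (metis mult.assoc)
          finally show ?thesis .
        qed
        have uD: "?u \<in> D" using y zD hD D by (simp add: divring_closed)
        have wix: "wi * x = - (x * wi)"
        proof -
          have "wi * x = wi * (x * w) * wi" using wi by (simp add: mult.assoc)
          also have "x * w = - (w * x)" using wx by simp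
          also have "wi * (- (w * x)) * wi = - (wi * w * (x * wi))" by (simp add: mult.assoc)
          finally show ?thesis using wi by simp
        qed
        have "?u * wi * x = x * (?u * wi)"
          using ux wix by (metis (no_types, lifting) minus_mult_commute mult.assoc mult_minus_right minus_minus)
        then have "?u * wi \<in> ?C" unfolding centralizer_def using uD wi D by (simp add: divring_closed)
        moreover have "?u = ?u * wi * w" using wi by (simp add: mult.assoc)
        ultimately have "?u \<in> (\<lambda>c. c * w) ` ?C" by blast
        moreover have "y = ?c + ?u"
        proof -
          have "?c + ?u = (h + h) * y" by (simp add: algebra_simps)
          then show ?thesis using h by simp
        qed
        ultimately show "y \<in> {c + u | c u. c \<in> ?C \<and> u \<in> (\<lambda>c. c * w) ` ?C}" using c by blast
      qed
      ultimately have "64 \<le> q + q" using R.fdim_mono[OF _ dim_D E] by blast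
      then show ?thesis using \<open>q \<in> {1, 2, 4, 8}\<close> by auto
    qed
  qed
qed

end

text \<open>In degree 8 a symplectic involution has skew elements of dimension 8 * 9 / 2 = 36. The
  inequality alone expresses the type here: at most 28 dimensions remain for the symmetric
  elements.\<close>

locale csa_symp = csa_inv E D J for E D :: "'r::ring_1 set" and J +
  fixes p :: nat
  assumes dim_Skew: "fdim (*) E p Skew" and p: "36 \<le> p"
begin

interpretation R: rmod "(*) :: 'r \<Rightarrow> 'r \<Rightarrow> 'r" by (rule rmod_times)

lemma dim_Sym: obtains r where "fdim (*) E r Sym" "r + p = 64"
proof -
  obtain r where r: "fdim (*) E r Sym" using submod_fdim[OF Sym_submod] Sym_D by blast
  have "fdim (*) E (r + p) {x + y | x y. x \<in> Sym \<and> y \<in> Skew}"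
    by (rule R.fdim_direct_sum[OF dim_Skew r E]) (use Sym_Skew_zero in blast)
  then have "fdim (*) E (r + p) D" using Sym_Skew_sum by simp
  then show thesis using that r R.fdim_unique[OF dim_D _ E] by blast
qed

text \<open>The inner derivation of a symmetric element maps skew elements to symmetric ones, and
  there are more skew than symmetric elements.\<close>

lemma skew_centralizer_dim:
  assumes s: "s \<in> Sym"
  obtains k where "fdim (*) E k (Skew \<inter> centralizer D {s})" "8 \<le> k"
proof -
  obtain r where r: "fdim (*) E r Sym" "r + p = 64" using dim_Sym .
  have "\<exists>k. fdim (*) E k {x \<in> Skew. s * x - x * s = 0} \<and> p \<le> k + r"
  proof (rule R.fdim_kernel[OF dim_Skew E r(1) rmod_times])
    show "s * (x * b) - x * b * s = (s * x - x * s) * b" if "b \<in> E" for x b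
      using E_central[OF that Sym_D[OF s]] by (simp add: algebra_simps)
    show "s * x - x * s \<in> Sym" if "x \<in> Skew" for x
      using that s unfolding Sym_def Skew_def by (auto simp: divring_closed D J_diff J_mult)
  qed (simp add: algebra_simps)
  moreover have "{x \<in> Skew. s * x - x * s = 0} = Skew \<inter> centralizer D {s}"
    unfolding centralizer_def using Skew_D by auto
  ultimately show thesis using that r(2) p by force
qed

lemma Sym_gen:
  assumes "s \<in> Sym"
  shows "gen {s} \<subseteq> Sym"
  using gen_Sym[of "{s}"] assms by auto

text \<open>In degree 8 the field \<open>gen {s}\<close> would be its own centralizer. It consists
  of symmetric elements, whereas at least 8 dimensions of skew elements commute with
  \<open>s\<close>.\<close>

lemma sym_degree:
  assumes s: "s \<in> Sym" and m: "fdim (*) E m (gen {s})"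
  shows "m \<in> {1, 2, 4}"
proof -
  have sD: "{s} \<subseteq> D" using Sym_D[OF s] by simp
  note G = gen_props[OF sD]
  have "m \<in> {1, 2, 4, 8}" by (rule comm_dim[OF G(1,2,3,5) m]) auto
  moreover have "m \<noteq> 8"
  proof
    assume "m = 8"
    then have "centralizer D (gen {s}) = gen {s}" using maximal_comm[OF G(1,2,3,5)] m by auto
    then have C: "centralizer D {s} = gen {s}" using G(6) by auto
    obtain k where k: "fdim (*) E k (Skew \<inter> centralizer D {s})" "8 \<le> k"
      using skew_centralizer_dim[OF s] .
    have "Skew \<inter> centralizer D {s} \<subseteq> {0}" using C Sym_gen[OF s] Sym_Skew_zero by blast
    then have "k \<le> 0" using R.fdim_mono[OF fdim_0 k(1) E] by blast
    then show False using k(2) by simp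
  qed
  ultimately show ?thesis by auto
qed

lemma quad_of_dim_2:
  assumes s: "s \<in> Sym" "s \<notin> E" and m: "fdim (*) E 2 (gen {s})"
  shows "\<exists>x\<in>Sym. quad x"
proof -
  have sD: "{s} \<subseteq> D" using Sym_D[OF s(1)] by simp
  note G = gen_props[OF sD]
  have "\<exists>t\<in>E. (s - t) * (s - t) \<in> E"
    by (rule complete_square[OF E order_refl fdim_self[OF E] G(1,2) _ G(5) _ s(2)]) (use m G(4) in auto)
  then obtain t where t: "t \<in> E" "(s - t) * (s - t) \<in> E" by blast
  have "s - t \<in> Sym" using Sym_diff s(1) t(1) E_Sym by blast
  moreover have "s - t \<notin> E"
  proof
    assume "s - t \<in> E"
    then have "(s - t) + t \<in> E" using divring_add[OF E] t by blast
    then show False using s(2) by simp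
  qed
  ultimately show ?thesis using t Sym_D unfolding quad_def by blast
qed

text \<open>If \<open>s2\<close> were outside \<open>gen {s}\<close>, the two would generate a
  maximal subfield \<open>?M2\<close> of symmetric elements, and it would contain some
  \<open>r\<close> outside \<open>gen {s}\<close> with \<open>r * r\<close> in
  \<open>gen {s}\<close>. For skew \<open>x\<close> commuting with \<open>s\<close>, the element
  \<open>x * r + r * x\<close> lies in \<open>?M2\<close> and is skew, so it is 0 and
  \<open>r * x\<close> is symmetric. A dimension count then fills the centralizer of
  \<open>s\<close> with symmetric elements and leaves no room for the skew ones.\<close>

lemma sym_centralizer:
  assumes s: "s \<in> Sym" and m: "fdim (*) E 4 (gen {s})"
  shows "Sym \<inter> centralizer D {s} \<subseteq> gen {s}"
proof
  fix s2 assume s2: "s2 \<in> Sym \<inter> centralizer D {s}"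
  let ?M = "gen {s}" and ?Q = "centralizer D {s}"
  let ?K = "Skew \<inter> ?Q"
  have sD: "{s} \<subseteq> D" using Sym_D[OF s] by simp
  note G = gen_props[OF sD, simplified]
  note Q = centralizer_divring[OF sD]
  have MQ: "?M \<subseteq> ?Q"
    using G(3,4,5) unfolding centralizer_def by auto
  obtain q where q: "fdim (*) E q ?Q" using submod_fdim[OF divring_submod[OF Q(1,2)] Q(3)] .
  have "4 * q \<le> 64" using centralizer_bound[OF G(1,2,3) m] q G(6) by simp
  then have q16: "q \<le> 16" by simp
  obtain k where k: "fdim (*) E k ?K" "8 \<le> k" using skew_centralizer_dim[OF s] .
  show "s2 \<in> ?M"
  proof (rule ccontr)
    assume nM: "s2 \<notin> ?M"
    have s2D: "s2 \<in> D" and s2s: "s2 * s = s * s2" using s2 Sym_D unfolding centralizer_def by auto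
    have S: "{s, s2} \<subseteq> D" "\<And>x y. x \<in> {s, s2} \<Longrightarrow> y \<in> {s, s2} \<Longrightarrow> x * y = y * x"
      using s2D s2s sD by auto
    let ?M2 = "gen {s, s2}"
    note G2 = gen_props[OF S]
    have M2Sym: "?M2 \<subseteq> Sym" by (rule gen_Sym[OF _ S(2)]) (use s s2 in auto)
    have MM2: "?M \<subseteq> ?M2"
      unfolding gen_def using ring_gen_subset[of _ "E \<union> {s}" "ring_gen (E \<union> {s, s2})"]
      by (auto intro: gen_diff gen_mult gen_base)
    obtain m2 where m2: "fdim (*) E m2 ?M2" using submod_fdim[OF divring_submod[OF G2(1,2)] G2(3)] .
    have "m2 \<in> {1, 2, 4, 8}" by (rule comm_dim[OF G2(1,2,3,5) m2])
    moreover have "\<not> m2 \<le> 4"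
      using R.fdim_eq_imp_eq[OF m2 m E MM2] nM G2(4) by auto
    ultimately have m2: "fdim (*) E 8 ?M2" using m2 by auto
    have CM2: "centralizer D {s, s2} = ?M2" using maximal_comm[OF G2(1,2,3,5) m2] G2(6) by simp
    have "\<exists>t\<in>?M. (s2 - t) * (s2 - t) \<in> ?M"
      by (rule complete_square[OF G(1,2) m G2(1) MM2 _ G2(5) _ nM]) (use m2 G2(4) in auto)
    then obtain t where t: "t \<in> ?M" "(s2 - t) * (s2 - t) \<in> ?M" by blast
    define r where "r = s2 - t"
    have rM2: "r \<in> ?M2" unfolding r_def using G2(1,4) t(1) MM2 by (auto intro!: divring_diff)
    have rM: "r \<notin> ?M"
    proof
      assume "r \<in> ?M"
      then have "r + t \<in> ?M" using divring_add[OF G(1)] t(1) by blast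
      then show False using nM unfolding r_def by simp
    qed
    have r0: "r \<noteq> 0" using rM divring_0[OF G(1)] by auto
    have rSym: "r \<in> Sym" and rD: "r \<in> D" using rM2 M2Sym Sym_D by auto
    have Mcomm: "a * x = x * a" if "a \<in> ?M" "x \<in> ?Q" for a x
    proof -
      have "centralizer D ?M = ?Q" using G(6) by simp
      then have "x \<in> centralizer D ?M" using that(2) by simp
      then show ?thesis using that(1) unfolding centralizer_def by auto
    qed
    have anti: "x * r = - (r * x)" if x: "x \<in> ?K" for x
    proof -
      have xQ: "x \<in> ?Q" and xS: "x \<in> Skew" and xD: "x \<in> D" using x Skew_D by auto
      let ?y = "x * r + r * x"
      have rr: "r * r * x = x * (r * r)" using Mcomm[OF _ xQ] t(2) unfolding r_def by blast
      have yr: "?y * r = r * ?y" using rr by (simp add: algebra_simps)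
      have xs: "x * s = s * x" using xQ unfolding centralizer_def by auto
      have rs: "r * s = s * r" by (rule G2(5)) (use rM2 G2(4) in auto)
      have ys: "?y * s = s * ?y" by (intro commutes_add commutes_mult xs rs)
      have yD: "?y \<in> D" using xD rD D by (simp add: divring_closed)
      have yt: "?y * t = t * ?y"
        using Mcomm[OF t(1), of ?y] ys yD unfolding centralizer_def by auto
      have "?y * s2 = s2 * ?y"
      proof -
        have s2: "s2 = r + t" unfolding r_def by simp
        show ?thesis unfolding s2 by (rule sym, rule commutes_add) (rule yr[symmetric], rule yt[symmetric])
      qed
      then have "?y \<in> centralizer D {s, s2}" using ys yD unfolding centralizer_def by auto
      then have "?y \<in> Sym" using CM2 M2Sym by blast
      moreover have "?y \<in> Skew"
        using xS rSym yD xD rD D unfolding Skew_def Sym_def by (auto simp: J_add J_mult divring_closed)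
      ultimately have "?y = 0" by (rule Sym_Skew_zero)
      then show ?thesis by (simp add: eq_neg_iff_add_eq_0)
    qed
    have rK: "fdim (*) E k ((*) r ` ?K)"
      by (rule fdim_image[OF k(1) rmod_times rmod_times E])
        (use divring_no_zero_div[OF D rD r0] in \<open>auto simp: algebra_simps\<close>)
    have rKSym: "(*) r ` ?K \<subseteq> Sym"
      using anti rSym unfolding Sym_def Skew_def by (auto simp: J_mult divring_closed D)
    obtain ri where ri: "ri \<in> ?M2" "ri * r = 1" using divring_inv[OF G2(1) rM2 r0] .
    have disj: "(*) r ` ?K \<inter> ?M2 \<subseteq> {0}"
    proof
      fix z assume "z \<in> (*) r ` ?K \<inter> ?M2"
      then obtain x where x: "x \<in> ?K" "z = r * x" "z \<in> ?M2" by blast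
      have "x = ri * z" using ri x by (simp flip: mult.assoc)
      then have "x \<in> ?M2" using divring_mult[OF G2(1) ri(1) x(3)] by simp
      then have "x = 0" using M2Sym x Sym_Skew_zero by blast
      then show "z \<in> {0}" using x by simp
    qed
    \<comment> \<open>Its dimension \<open>8 + k\<close> is at least 16, the largest dimension that
      the centralizer of \<open>s\<close> can have.\<close>
    let ?U = "{w + u | w u. w \<in> ?M2 \<and> u \<in> (*) r ` ?K}"
    have U: "fdim (*) E (8 + k) ?U" by (rule R.fdim_direct_sum[OF rK m2 E disj])
    have M2Q: "?M2 \<subseteq> ?Q" using CM2 unfolding centralizer_def by blast
    have "?U \<subseteq> ?Q"
      using M2Q rM2 by (auto intro!: divring_add[OF Q(1)] divring_mult[OF Q(1)])
    then have "?U = ?Q" using R.fdim_eq_imp_eq[OF q U E] q16 k(2) by simp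
    moreover have "?U \<subseteq> Sym" using M2Sym rKSym Sym_submod by (auto intro!: submod_add[of _ E Sym])
    ultimately have "?K \<subseteq> {0}" using Sym_Skew_zero by blast
    then have "k \<le> 0" using R.fdim_mono[OF fdim_0 k(1) E] by blast
    then show False using k(2) by simp
  qed
qed

text \<open>\<open>y * y\<close> commutes with \<open>z\<close> while \<open>y\<close> does not. So
  it generates a proper subfield of \<open>gen {y}\<close>, and since \<open>gen {y}\<close> has
  degree at most 4, the degree of \<open>y * y\<close> is at most 2.\<close>

lemma quad_of_anticommuting:
  assumes y: "y \<in> Sym" "y \<noteq> 0" and z: "z \<in> D" "z \<noteq> 0" and yz: "y * z = - (z * y)"
  shows "\<exists>x\<in>Sym. quad x"
proof -
  have yD: "y \<in> D" using y Sym_D by blast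
  have nc: "y * z \<noteq> z * y"
  proof
    assume "y * z = z * y"
    then have "y * z + y * z = 0" using yz by (metis add.right_inverse)
    then have "y * z = 0" by (rule double_0)
    then show False using divring_no_zero_div[OF D yD y(2)] z by blast
  qed
  have yE: "y \<notin> E" using E_central[of y z] z nc by auto
  show ?thesis
  proof (cases "y * y \<in> E")
    case True
    then show ?thesis using y yD yE unfolding quad_def by blast
  next
    case False
    have y2: "y * y \<in> Sym" using Sym_square y by blast
    have y2D: "{y * y} \<subseteq> D" and yD': "{y} \<subseteq> D" using y2 Sym_D yD by auto
    note G1 = gen_props[OF y2D, simplified]
    note G = gen_props[OF yD', simplified]
    have sub: "gen {y * y} \<subseteq> gen {y}"
      unfolding gen_def using ring_gen_subset[of _ "E \<union> {y * y}" "ring_gen (E \<union> {y})"]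
      by (auto intro: gen_diff gen_mult gen_base)
    have "y * y * z = z * (y * y)" using yz by (metis minus_mult_commute minus_mult_minus mult.assoc)
    then have comm: "x * z = z * x" if "x \<in> gen {y * y}" for x
      using that E_central z(1) unfolding gen_def
      by (intro ring_gen_commutes[of x "E \<union> {y * y}"]) auto
    then have "y \<notin> gen {y * y}" using nc by blast
    obtain m where m: "fdim (*) E m (gen {y})" using submod_fdim[OF divring_submod[OF G(1,2)] G(3)] .
    obtain m1 where m1: "fdim (*) E m1 (gen {y * y})" using submod_fdim[OF divring_submod[OF G1(1,2)] G1(3)] .
    have "m \<in> {1, 2, 4}" using sym_degree[OF y(1) m] .
    moreover have "m1 \<in> {1, 2, 4}" using sym_degree[OF y2 m1] .
    moreover have "\<not> m \<le> m1"
      using R.fdim_eq_imp_eq[OF m m1 E sub] \<open>y \<notin> gen {y * y}\<close> G(4) by auto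
    moreover have "m1 \<noteq> 1" using dim_1_eq[OF G1(2)] m1 False G1(4) by auto
    ultimately have "m1 = 2" by auto
    then show ?thesis using quad_of_dim_2[OF y2 False] m1 by blast
  qed
qed

text \<open>\<open>J x\<close> has the same square as \<open>x\<close>, so \<open>x + J x\<close>
  and \<open>x - J x\<close> anticommute. This settles the case where \<open>x\<close> is neither
  symmetric nor skew; for skew \<open>x\<close>, \<open>skew_involution_type\<close> supplies the
  anticommuting element.\<close>

lemma sym_quad_of_quad:
  assumes x: "quad x"
  shows "\<exists>x\<in>Sym. quad x"
proof -
  have xD: "x \<in> D" "x \<notin> E" "x * x \<in> E" using x unfolding quad_def by auto
  have x0: "x \<noteq> 0" using xD divring_0[OF E] by auto
  show ?thesis
  proof (cases "J x = - x")
    case True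
    obtain w where w: "w \<in> Sym" "w \<noteq> 0" "w * x = - (x * w)"
      using skew_involution_type[OF xD True] .
    show ?thesis by (rule quad_of_anticommuting[OF w(1,2) xD(1) x0 w(3)])
  next
    case False
    show ?thesis
    proof (cases "J x = x")
      case True
      then show ?thesis using x xD unfolding Sym_def by blast
    next
      case 2: False
      have JD: "J x \<in> D" using J_D xD by blast
      have JJ: "J x * J x = x * x" using J_mult[OF xD(1) xD(1)] J_E[OF xD(3)] by simp
      show ?thesis
      proof (rule quad_of_anticommuting)
        show "x + J x \<in> Sym" unfolding Sym_def using xD JD D by (auto simp: J_add J_J divring_closed add.commute)
        show "x + J x \<noteq> 0" using False by (simp add: eq_neg_iff_add_eq_0 add.commute)
        show "x - J x \<in> D" using xD JD D by (simp add: divring_closed)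
        show "x - J x \<noteq> 0" using 2 by auto
        show "(x + J x) * (x - J x) = - ((x - J x) * (x + J x))"
          using JJ by (simp add: algebra_simps)
      qed
    qed
  qed
qed

text \<open>The assumptions express that \<open>u + s * v\<close>, where \<open>s * s = a\<close>,
  has its square in \<open>E + s * E\<close>. The key element is \<open>z = u * u\<close>, which
  commutes with \<open>u\<close> and \<open>v\<close>. If \<open>z\<close> has degree 4,
  \<open>sym_centralizer\<close> puts \<open>u\<close> and \<open>v\<close> into
  \<open>gen {z}\<close>; so they commute, \<open>a * (u * v + v * u)\<close> times
  \<open>u * v + v * u\<close> is \<open>4 * z * (d - z)\<close>, and completing the square shows
  that \<open>z - d / 2\<close> is square-central.\<close>

lemma quad_descent:
  assumes u: "u \<in> Sym" and v: "v \<in> Sym" and a: "a \<in> E" "a \<noteq> 0"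
    and 1: "u * u + a * (v * v) \<in> E" and 2: "u * v + v * u \<in> E" and n: "\<not> (u \<in> E \<and> v \<in> E)"
  shows "\<exists>x\<in>Sym. quad x"
proof -
  have uD: "u \<in> D" and vD: "v \<in> D" and aD: "a \<in> D" using u v a Sym_D E_sub by auto
  obtain b where b: "b \<in> E" "b * a = 1" using divring_inv[OF E a] .
  define z where "z = u * u"
  define d where "d = z + a * (v * v)"
  have dE: "d \<in> E" using 1 unfolding d_def z_def .
  have av: "a * (v * v) = d - z" unfolding d_def by simp
  have zSym: "z \<in> Sym" and zD: "z \<in> D" unfolding z_def using Sym_square u Sym_D by auto
  show ?thesis
  proof (cases "z \<in> E")
    case True
    have "v * v = b * (d - z)" using av b by (metis mult.assoc mult_1)
    then have "v * v \<in> E" using b dE True E by (simp add: divring_closed)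
    then show ?thesis using n u v uD vD True unfolding quad_def z_def by blast
  next
    case False
    have zD': "{z} \<subseteq> D" using zD by simp
    note G = gen_props[OF zD', simplified]
    obtain m where m: "fdim (*) E m (gen {z})" using submod_fdim[OF divring_submod[OF G(1,2)] G(3)] .
    have "m \<noteq> 1" using dim_1_eq[OF G(2)] m False G(4) by auto
    then consider "m = 2" | "m = 4" using sym_degree[OF zSym m] by auto
    then show ?thesis
    proof cases
      case 1
      then show ?thesis using quad_of_dim_2[OF zSym False] m by blast
    next
      case 2
      have "u * z = z * u" unfolding z_def by (simp add: mult.assoc)
      moreover have "v * z = z * v"
      proof -
        have z: "z = d - a * (v * v)" using av by simp
        have "v * d = d * v" using E_central[OF dE vD] by simp
        moreover have "v * (a * (v * v)) = a * (v * v) * v"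
          using E_central[OF a(1) vD] by (metis mult.assoc)
        ultimately show ?thesis unfolding z right_diff_distrib left_diff_distrib by simp
      qed
      ultimately have "u \<in> gen {z}" "v \<in> gen {z}"
        using sym_centralizer[OF zSym] m 2 u v uD vD unfolding centralizer_def by auto
      then have uv: "u * v = v * u" using G(5) by blast
      define c where "c = u * v + v * u"
      have cE: "c \<in> E" using \<open>u * v + v * u \<in> E\<close> unfolding c_def .
      have cc: "c * c = z * (v * v) + z * (v * v) + z * (v * v) + z * (v * v)"
      proof -
        define e where "e = u * v"
        have "c = e + e" unfolding c_def e_def uv ..
        then have "c * c = e * e + e * e + e * e + e * e" by (simp only: distrib_left distrib_right add.assoc)
        moreover have "e * e = z * (v * v)" unfolding z_def e_def using uv by (metis mult.assoc)
        ultimately show ?thesis by simp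
      qed
      define t where "t = z * (d - z)"
      have "a * (z * (v * v)) = t"
        unfolding t_def using E_central[OF a(1) zD] av by (metis mult.assoc)
      then have eq: "a * (c * c) = t + t + t + t" unfolding cc distrib_left by simp
      obtain h where h: "h \<in> E" "h + h = 1" using half_ex .
      \<comment> \<open>Half of \<open>d\<close>, so that
        \<open>(z - f) * (z - f) = f * f - z * (d - z)\<close>.\<close>
      define f where "f = h * d"
      have fE: "f \<in> E" unfolding f_def using h dE E by (simp add: divring_closed)
      have df: "d = f + f" unfolding f_def using h by (metis distrib_right mult_1)
      have fz: "f * z = z * f" using E_central[OF fE zD] .
      have "h * h * (a * (c * c)) = (h + h) * (h + h) * t"
        unfolding eq by (simp only: distrib_left distrib_right add.assoc)
      then have "z * (d - z) = h * h * (a * (c * c))" using h unfolding t_def by simp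
      moreover have "(z - f) * (z - f) = f * f - z * (d - z)"
        unfolding df using fz by (simp add: algebra_simps)
      ultimately have "(z - f) * (z - f) \<in> E" using fE h a cE E by (simp add: divring_closed)
      moreover have "z - f \<in> Sym" using Sym_diff zSym fE E_Sym by blast
      moreover have "z - f \<notin> E" using False fE divring_add[OF E, of "z - f" f] by auto
      ultimately show ?thesis using Sym_D unfolding quad_def by blast
    qed
  qed
qed

end

text \<open>The \<open>f i\<close> are the coordinates along a complement of \<open>N\<close> in
  \<open>M\<close>. Coordinate vectors are selected by choice, and their uniqueness modulo
  \<open>N\<close> makes the selection linear.\<close>

lemma (in rmod) functionals_exist:
  assumes B: "divring B" and M: "fdim (\<cdot>) B k M" and N: "fdim (\<cdot>) B l N" "N \<subseteq> M"
  shows "\<exists>f :: nat \<Rightarrow> 'v \<Rightarrow> 'r.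
    (\<forall>i<k - l. (\<forall>x\<in>M. f i x \<in> B) \<and> (\<forall>x\<in>M. \<forall>y\<in>M. f i (x + y) = f i x + f i y) \<and>
      (\<forall>x\<in>M. \<forall>c\<in>B. f i (x \<cdot> c) = f i x * c)) \<and>
    (\<forall>x\<in>M. (\<forall>i<k - l. f i x = 0) \<longleftrightarrow> x \<in> N)"
proof -
  note sM = fdim_submod[OF M B] and sN = fdim_submod[OF N(1) B]
  obtain T where T: "submod (\<cdot>) B T" "T \<subseteq> M" "N \<inter> T = {0}" "M \<subseteq> {x + t | x t. x \<in> N \<and> t \<in> T}"
    using fdim_complement[OF M B sN N(2)] by blast
  obtain j where j: "fdim (\<cdot>) B j T" using fdim_submodule[OF M B T(1,2)] by blast
  have "fdim (\<cdot>) B (l + j) {x + t | x t. x \<in> N \<and> t \<in> T}"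
    by (rule fdim_direct_sum[OF j N(1) B]) (use T(3) in blast)
  moreover have "{x + t | x t. x \<in> N \<and> t \<in> T} = M" using T(2,4) N(2) submod_add[OF sM] by blast
  ultimately have "k = l + j" using fdim_unique[OF _ M B] by metis
  then have jk: "j = k - l" by simp
  obtain b where b: "\<forall>i<j. b i \<in> T" "T = {\<Sum>i<j. b i \<cdot> c i | c. \<forall>i. c i \<in> B}"
    "\<forall>c. (\<forall>i<j. c i \<in> B) \<longrightarrow> (\<Sum>i<j. b i \<cdot> c i) = 0 \<longrightarrow> (\<forall>i<j. c i = 0)"
    by (rule fdim_basisE[OF j B])
  let ?P = "\<lambda>x c. (\<forall>i. c i \<in> B) \<and> x - (\<Sum>i<j. b i \<cdot> c i) \<in> N"
  define c where "c = (\<lambda>x. SOME c. ?P x c)"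
  have c: "?P x (c x)" if x: "x \<in> M" for x
  proof -
    obtain y t where yt: "x = y + t" "y \<in> N" "t \<in> T" using T(4) x by blast
    then obtain d where "t = (\<Sum>i<j. b i \<cdot> d i)" "\<forall>i. d i \<in> B" using b(2) by blast
    then have "?P x d" using yt by simp
    then show ?thesis unfolding c_def by (rule someI[of "?P x"])
  qed
  have uniq: "d i = e i" if d: "\<forall>i<j. d i \<in> B" "x - (\<Sum>i<j. b i \<cdot> d i) \<in> N"
    and e: "\<forall>i<j. e i \<in> B" "x - (\<Sum>i<j. b i \<cdot> e i) \<in> N" and i: "i < j" for d e x i
  proof -
    have "(\<Sum>i<j. b i \<cdot> (d i - e i)) = (x - (\<Sum>i<j. b i \<cdot> e i)) - (x - (\<Sum>i<j. b i \<cdot> d i))"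
      by (simp add: act_diff_right sum_subtractf)
    also have "\<dots> \<in> N" by (intro submod_diff[OF B sN] d e)
    finally have "(\<Sum>i<j. b i \<cdot> (d i - e i)) \<in> N" .
    moreover have "(\<Sum>i<j. b i \<cdot> (d i - e i)) \<in> T"
      by (intro submod_sum[OF T(1)] submod_act[OF T(1)]) (use b d e B in \<open>auto simp: divring_closed\<close>)
    ultimately have "(\<Sum>i<j. b i \<cdot> (d i - e i)) = 0" using T(3) by blast
    moreover have "\<forall>i<j. d i - e i \<in> B" using d(1) e(1) divring_diff[OF B] by blast
    ultimately have "\<forall>i<j. d i - e i = 0" using spec[OF b(3), of "\<lambda>i. d i - e i"] by blast
    then show ?thesis using i by simp
  qed
  show ?thesis unfolding jk[symmetric]
  proof (intro exI[of _ "\<lambda>i x. c x i"] conjI allI impI ballI)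
    show "c x i \<in> B" if "x \<in> M" for x i using c[OF that] by blast
    show "c (x + y) i = c x i + c y i" if x: "x \<in> M" and y: "y \<in> M" and i: "i < j" for x y i
    proof (rule uniq[of "c (x + y)" "x + y" "\<lambda>i. c x i + c y i"])
      show "x + y - (\<Sum>i<j. b i \<cdot> (c x i + c y i)) \<in> N"
      proof -
        have "x + y - (\<Sum>i<j. b i \<cdot> (c x i + c y i)) = (x - (\<Sum>i<j. b i \<cdot> c x i)) + (y - (\<Sum>i<j. b i \<cdot> c y i))"
          by (simp add: act_add_right sum.distrib)
        then show ?thesis using submod_add[OF sN] c[OF x] c[OF y] by metis
      qed
    qed (use c[OF x] c[OF y] c[OF submod_add[OF sM x y]] i B in \<open>auto simp: divring_closed\<close>)
    show "c (x \<cdot> d) i = c x i * d" if x: "x \<in> M" and d: "d \<in> B" and i: "i < j" for x d i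
    proof (rule uniq[of "c (x \<cdot> d)" "x \<cdot> d" "\<lambda>i. c x i * d"])
      show "x \<cdot> d - (\<Sum>i<j. b i \<cdot> (c x i * d)) \<in> N"
      proof -
        have "x \<cdot> d - (\<Sum>i<j. b i \<cdot> (c x i * d)) = (x - (\<Sum>i<j. b i \<cdot> c x i)) \<cdot> d"
          by (simp add: act_diff_left act_sum_left act_mult)
        then show ?thesis using submod_act[OF sN _ d] c[OF x] by metis
      qed
    qed (use c[OF x] c[OF submod_act[OF sM x d]] i d B in \<open>auto simp: divring_closed\<close>)
    show "(\<forall>i<j. c x i = 0) \<longleftrightarrow> x \<in> N" if x: "x \<in> M" for x
    proof
      assume 0: "\<forall>i<j. c x i = 0"
      then have "(\<Sum>i<j. b i \<cdot> c x i) = 0" by (intro sum.neutral) auto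
      then show "x \<in> N" using c[OF x] by simp
    next
      assume "x \<in> N"
      then show "\<forall>i<j. c x i = 0" using uniq[of "c x" x "\<lambda>_. 0"] c[OF x] divring_0[OF B] by auto
    qed
  qed
qed

context csa_symp
begin

interpretation R: rmod "(*) :: 'r \<Rightarrow> 'r \<Rightarrow> 'r" by (rule rmod_times)

text \<open>Unless \<open>v\<close> is isotropic itself, the value at \<open>v * t + w\<close> is a
  quadratic polynomial in \<open>t\<close>, and its discriminant has a square root in
  \<open>E\<close>.\<close>

lemma binary_form_isotropic:
  assumes sqrt: "\<And>e. e \<in> E \<Longrightarrow> \<exists>f\<in>E. f * f = e"
    and U: "fdim (*) E k U" "2 \<le> k" "U \<subseteq> D"
    and val: "\<And>x y. x \<in> U \<Longrightarrow> y \<in> U \<Longrightarrow> g x y \<in> E"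
    and add: "\<And>x y z. x \<in> U \<Longrightarrow> y \<in> U \<Longrightarrow> z \<in> U \<Longrightarrow> g x (y + z) = g x y + g x z"
    and scale: "\<And>x y c. x \<in> U \<Longrightarrow> y \<in> U \<Longrightarrow> c \<in> E \<Longrightarrow> g x (y * c) = g x y * c"
    and sym: "\<And>x y. x \<in> U \<Longrightarrow> y \<in> U \<Longrightarrow> g x y = g y x"
  shows "\<exists>v\<in>U. v \<noteq> 0 \<and> g v v = 0"
proof -
  note sU = R.fdim_submod[OF U(1) E]
  obtain b where b: "\<forall>i<k. b i \<in> U"
    "\<forall>c. (\<forall>i<k. c i \<in> E) \<longrightarrow> (\<Sum>i<k. b i * c i) = 0 \<longrightarrow> (\<forall>i<k. c i = 0)"
    by (rule R.fdim_basisE[OF U(1) E])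
  define v w where "v = b 0" and "w = b 1"
  have vU: "v \<in> U" and wU: "w \<in> U" using b U(2) unfolding v_def w_def by auto
  have indep: "v * t + w \<noteq> 0" if "t \<in> E" for t
  proof
    assume 0: "v * t + w = 0"
    let ?c = "\<lambda>i. if i = 0 then t else if i = 1 then 1 else (0::'r)"
    have "(\<Sum>i<k. b i * ?c i) = (\<Sum>i\<in>{0,1}. b i * ?c i)"
      using U(2) by (intro sum.mono_neutral_right) auto
    also have "\<dots> = 0" using 0 unfolding v_def w_def by simp
    finally have "(\<Sum>i<k. b i * ?c i) = 0" .
    moreover have "\<forall>i<k. ?c i \<in> E" using that E by (simp add: divring_closed)
    ultimately have "\<forall>i<k. ?c i = 0" using spec[OF b(2), of ?c] by blast
    then show False using U(2) by (auto dest!: spec[of _ 1])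
  qed
  show ?thesis
  proof (cases "g v v = 0")
    case True
    have "v \<noteq> 0"
    proof
      assume v0: "v = 0"
      let ?c = "\<lambda>i. if i = 0 then 1 else (0::'r)"
      have "(\<Sum>i<k. b i * ?c i) = (\<Sum>i\<in>{0}. b i * ?c i)"
        using U(2) by (intro sum.mono_neutral_right) auto
      also have "\<dots> = 0" using v0 unfolding v_def by simp
      finally have "(\<Sum>i<k. b i * ?c i) = 0" .
      moreover have "\<forall>i<k. ?c i \<in> E" using E by (simp add: divring_closed)
      ultimately have "\<forall>i<k. ?c i = 0" using spec[OF b(2), of ?c] by blast
      then show False using U(2) by (auto dest!: spec[of _ 0])
    qed
    then show ?thesis using True vU by blast
  next
    case False
    define p q r where "p = g v v" and "q = g v w" and "r = g w w"
    have pqr: "p \<in> E" "q \<in> E" "r \<in> E" unfolding p_def q_def r_def using val vU wU by auto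
    obtain p' where p': "p' \<in> E" "p * p' = 1" using divring_inv[OF E pqr(1)] False unfolding p_def by metis
    have comm: "x * y = y * x" if "x \<in> E" "y \<in> E" for x y using E_central[OF that(1)] that(2) E_sub by blast
    obtain f where f: "f \<in> E" "f * f = q * q - p * r" using sqrt[of "q * q - p * r"] pqr E by (auto simp: divring_closed)
    define t where "t = p' * (f - q)"
    have t: "t \<in> E" unfolding t_def using p' f pqr E by (simp add: divring_closed)
    have pt: "p * t = f - q" unfolding t_def using p' by (simp flip: mult.assoc)
    let ?x = "v * t + w"
    have vt: "v * t \<in> U" using submod_act[OF sU vU t] .
    have xU: "?x \<in> U" using submod_add[OF sU vt wU] .
    have gxv: "g ?x v = p * t + q"
      using sym[OF xU vU] add[OF vU vt wU] scale[OF vU vU t] unfolding p_def q_def by simp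
    have gxw: "g ?x w = q * t + r"
      using sym[OF xU wU] add[OF wU vt wU] scale[OF wU vU t] sym[OF wU vU] unfolding q_def r_def by simp
    have "g ?x ?x = g ?x v * t + g ?x w"
      using add[OF xU vt wU] scale[OF xU vU t] by simp
    also have "\<dots> = f * t + (q * t + r)" unfolding gxv gxw pt by simp
    finally have g: "g ?x ?x = (f + q) * t + r" by (simp add: algebra_simps)
    have "p * g ?x ?x = (f + q) * (p * t) + p * r"
      unfolding g using comm[of p "f + q"] f pqr E by (simp add: divring_closed distrib_left flip: mult.assoc)
    also have "\<dots> = f * f - q * q + p * r"
      unfolding pt using comm[of f q] f pqr by (simp add: algebra_simps)
    finally have "p * g ?x ?x = 0" using f by simp
    then have "g ?x ?x = 0" using divring_no_zero_div[OF E pqr(1)] False unfolding p_def by blast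
    then show ?thesis using indep[OF t] xU by blast
  qed
qed

text \<open>Take a symmetric \<open>s\<close> of degree 4. Squares of skew elements commuting with
  \<open>s\<close> are symmetric and commute with \<open>s\<close>, so they lie in the 4-dimensional
  \<open>gen {s}\<close>. For such a square, lying in \<open>E\<close> amounts to three quadratic
  equations, to be solved in at least 8 variables.\<close>

lemma quad_of_quad_closed:
  assumes sqrt: "\<And>e. e \<in> E \<Longrightarrow> \<exists>f\<in>E. f * f = e"
  shows "\<exists>x\<in>Sym. quad x"
proof (cases "Sym \<subseteq> E")
  case True
  have "\<not> Skew \<subseteq> {0}" using R.fdim_mono[OF fdim_0 dim_Skew E] p by auto
  then obtain x where x: "x \<in> Skew" "x \<noteq> 0" by blast
  then have "x * x \<in> E" "x \<notin> E" using True Skew_square E_Sym Sym_Skew_zero by blast+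
  then show ?thesis using sym_quad_of_quad x Skew_D unfolding quad_def by blast
next
  case False
  then obtain s where s: "s \<in> Sym" "s \<notin> E" by blast
  have sD: "{s} \<subseteq> D" using Sym_D[OF s(1)] by simp
  let ?M = "gen {s}" and ?K = "Skew \<inter> centralizer D {s}"
  note G = gen_props[OF sD, simplified]
  note Q = centralizer_divring[OF sD]
  obtain m where m: "fdim (*) E m ?M" using submod_fdim[OF divring_submod[OF G(1,2)] G(3)] .
  have "m \<noteq> 1" using dim_1_eq[OF G(2)] m s(2) G(4) by auto
  then consider "m = 2" | "m = 4" using sym_degree[OF s(1) m] by auto
  then show ?thesis
  proof cases
    case 1
    then show ?thesis using quad_of_dim_2[OF s] m by blast
  next
    case 2
    then have m: "fdim (*) E 4 ?M" using m by simp
    obtain k where k: "fdim (*) E k ?K" "8 \<le> k" using skew_centralizer_dim[OF s(1)] .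
    note sK = R.fdim_submod[OF k(1) E]
    have KD: "?K \<subseteq> D" using Skew_D by blast
    obtain f :: "nat \<Rightarrow> 'r \<Rightarrow> 'r" where
      f0: "\<forall>i<4 - 1. (\<forall>x\<in>?M. f i x \<in> E) \<and> (\<forall>x\<in>?M. \<forall>y\<in>?M. f i (x + y) = f i x + f i y) \<and>
        (\<forall>x\<in>?M. \<forall>c\<in>E. f i (x * c) = f i x * c)"
      and f4: "\<forall>x\<in>?M. (\<forall>i<4 - 1. f i x = 0) \<longleftrightarrow> x \<in> E"
      using R.functionals_exist[OF E m fdim_self[OF E] G(2)] by blast
    have sq: "x * x \<in> ?M" if "x \<in> ?K" for x
    proof -
      have "x * x \<in> Sym" using Skew_square that by blast
      moreover have "x * x \<in> centralizer D {s}" using that Q(1) by (auto intro: divring_mult)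
      ultimately show ?thesis using sym_centralizer[OF s(1) m] by blast
    qed
    have mM: "x * y + y * x \<in> ?M" if "x \<in> ?K" "y \<in> ?K" for x y
    proof -
      have "x * y + y * x = (x + y) * (x + y) - x * x - y * y" by (simp add: algebra_simps)
      also have "\<dots> \<in> ?M"
        by (intro divring_diff[OF G(1)] sq that submod_add[OF sK])
      finally show ?thesis .
    qed
    \<comment> \<open>The polar form of the \<open>i\<close>-th coordinate of the square; on the
      diagonal it gives twice that coordinate.\<close>
    define g where "g = (\<lambda>i x y. f i (x * y + y * x))"
    have val: "g i x y \<in> E" if "i < 3" "x \<in> ?K" "y \<in> ?K" for i x y
      unfolding g_def using f0 mM[OF that(2,3)] that(1) by simp
    have addr: "g i x (y + z) = g i x y + g i x z" if "i < 3" "x \<in> ?K" "y \<in> ?K" "z \<in> ?K" for i x y z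
    proof -
      have "x * (y + z) + (y + z) * x = (x * y + y * x) + (x * z + z * x)" by (simp add: algebra_simps)
      then show ?thesis unfolding g_def using f0 mM[OF that(2,3)] mM[OF that(2,4)] that(1) by simp
    qed
    have sym: "g i x y = g i y x" for i x y unfolding g_def by (simp add: add.commute)
    have scale: "g i x (y * c) = g i x y * c" if "i < 3" "x \<in> ?K" "y \<in> ?K" "c \<in> E" for i x y c
    proof -
      have "x * (y * c) + y * c * x = (x * y + y * x) * c"
        using E_central[OF that(4), of x] that(2) KD by (simp add: algebra_simps subset_iff)
      then show ?thesis unfolding g_def using f0 mM[OF that(2,3)] that(1,4) by simp
    qed
    have addl: "g i (x + y) z = g i x z + g i y z" if "i < 3" "x \<in> ?K" "y \<in> ?K" "z \<in> ?K" for i x y z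
      using addr[OF that(1,4,2,3)] sym[of i] by simp
    have half: "\<exists>T d'. T \<subseteq> U \<and> fdim (*) E d' T \<and> (\<forall>x\<in>T. \<forall>y\<in>T. g i x y = 0) \<and> d \<le> 1 + 2 * d'"
      if i: "i < 3" and U: "U \<subseteq> ?K" "fdim (*) E d U" for i U d
    proof (rule R.totally_isotropic_exists[OF E E order_refl U(2) R.fdim_submod[OF U(2) E], of "g i" 1])
      fix b assume "b \<in> E"
      then show "\<exists>b'\<in>E. \<forall>x\<in>U. \<forall>y\<in>U. g i (x * b) y = g i x (y * b')"
        using U(1) scale[OF i] sym[of i] by (intro bexI[of _ b]) (auto simp: subset_iff)
    next
      fix V k assume V: "V \<subseteq> U" "submod (*) E V" "fdim (*) E k V" "1 < k"
      have VK: "V \<subseteq> ?K" using V U by blast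
      have "\<exists>v\<in>V. v \<noteq> 0 \<and> g i v v = 0"
        by (rule binary_form_isotropic[OF sqrt V(3)])
          (use V(4) VK KD val[OF i] addr[OF i] scale[OF i] sym[of i] in \<open>auto simp: subset_iff\<close>)
      then obtain v where v: "v \<in> V" "v \<noteq> 0" "g i v v = 0" by blast
      have "g i (v * b) v = 0" if "b \<in> E" for b
        using scale[OF i _ _ that, of v v] v VK sym[of i "v * b" v] by auto
      then show "\<exists>v\<in>V. v \<noteq> 0 \<and> (\<forall>b\<in>E. g i (v * b) v = 0)" using v by blast
    next
      fix x y assume "g i x y = 0"
      then show "g i y x = 0" using sym[of i] by simp
    next
      show "g i x y \<in> E" if "x \<in> U" "y \<in> U" for x y
        by (rule val[OF i]) (use that U(1) in auto)
      show "g i (x + y) z = g i x z + g i y z" if "x \<in> U" "y \<in> U" "z \<in> U" for x y z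
        by (rule addl[OF i]) (use that U(1) in auto)
      show "g i x (y + z) = g i x y + g i x z" if "x \<in> U" "y \<in> U" "z \<in> U" for x y z
        by (rule addr[OF i]) (use that U(1) in auto)
      show "g i x (y * c) = g i x y * c" if "x \<in> U" "y \<in> U" "c \<in> E" for x y c
        by (rule scale[OF i]) (use that U(1) in auto)
    next
      fix T d' assume "T \<subseteq> U" "fdim (*) E d' T" "\<And>x y. x \<in> T \<Longrightarrow> y \<in> T \<Longrightarrow> g i x y = 0" "d \<le> 1 + 2 * d'"
      then show ?thesis by (intro exI[of _ T] exI[of _ d']) simp
    qed
    obtain T d where T: "T \<subseteq> ?K" "fdim (*) E d T" "\<forall>x\<in>T. \<forall>y\<in>T. g 0 x y = 0" "k \<le> 1 + 2 * d"
      using half[of 0 ?K k] k(1) by auto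
    obtain S e where S: "S \<subseteq> T" "fdim (*) E e S" "\<forall>x\<in>S. \<forall>y\<in>S. g 1 x y = 0" "d \<le> 1 + 2 * e"
      using half[of 1 T d] T by auto
    have SK: "S \<subseteq> ?K" using S T by blast
    \<comment> \<open>From \<open>8 \<le> 1 + 2 * d\<close> follows \<open>4 \<le> d\<close>, and
      then \<open>4 \<le> 1 + 2 * e\<close> gives 2: just enough for the third form.\<close>
    have e: "2 \<le> e" using k T S by linarith
    have "\<exists>v\<in>S. v \<noteq> 0 \<and> g 2 v v = 0"
      by (rule binary_form_isotropic[OF sqrt S(2) e])
        (use SK KD val[of 2] addr[of 2] scale[of 2] sym[of 2] in \<open>auto simp: subset_iff\<close>)
    then obtain v where v: "v \<in> S" "v \<noteq> 0" "g 2 v v = 0" by blast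
    have vK: "v \<in> ?K" using v SK by blast
    have "\<forall>i<4 - 1. f i (v * v + v * v) = 0"
    proof (intro allI impI)
      fix i :: nat assume "i < 4 - 1"
      then consider "i = 0" | "i = 1" | "i = 2" by linarith
      then show "f i (v * v + v * v) = 0"
        by cases (use v S T in \<open>auto simp: g_def\<close>)
    qed
    then have vv: "v * v + v * v \<in> E" using f4 mM[OF vK vK] by blast
    obtain h where h: "h \<in> E" "h + h = 1" using half_ex .
    have "v * v = h * (v * v + v * v)" using h by (metis distrib_left distrib_right mult_1)
    then have "v * v \<in> E" using vv h E by (metis divring_mult)
    moreover have "v \<notin> E" using vK v E_Sym Sym_Skew_zero by blast
    ultimately have "quad v" using vK KD unfolding quad_def by blast
    then show ?thesis by (rule sym_quad_of_quad)
  qed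
qed

end

section \<open>Scalar extension and reduction to quadratically closed fields\<close>

lemma (in rmod) fdim_span_le:
  assumes B: "divring B"
  shows "\<exists>m\<le>n. fdim (\<cdot>) B m {\<Sum>i<n. b i \<cdot> c i | c. \<forall>i. c i \<in> B} \<and>
    ((\<exists>c. (\<forall>i. c i \<in> B) \<and> (\<Sum>i<n. b i \<cdot> c i) = 0 \<and> (\<exists>i<n. c i \<noteq> 0)) \<longrightarrow> m < n)"
proof -
  define S where "S = (\<lambda>n. {\<Sum>i<n. b i \<cdot> c i | c. \<forall>i. c i \<in> B})"
  define dep where "dep = (\<lambda>n. \<exists>c. (\<forall>i. c i \<in> B) \<and> (\<Sum>i<n. b i \<cdot> c i) = 0 \<and> (\<exists>i<n. c i \<noteq> 0))"
  have S_I: "(\<Sum>i<n. b i \<cdot> c i) \<in> S n" if "\<forall>i. c i \<in> B" for n c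
    unfolding S_def using that by blast
  have "\<exists>m\<le>n. fdim (\<cdot>) B m (S n) \<and> (dep n \<longrightarrow> m < n)"
  proof (induction n)
    case 0
    have "S 0 = {0}" unfolding S_def using divring_0[OF B] by auto
    moreover have "\<not> dep 0" unfolding dep_def by simp
    ultimately show ?case using fdim_0[of "(\<cdot>)" B] by auto
  next
    case (Suc n)
    obtain m where m: "m \<le> n" "fdim (\<cdot>) B m (S n)" "dep n \<longrightarrow> m < n"
      using Suc.IH by blast
    note sS = fdim_submod[OF m(2) B]
    have eq: "flag_step (\<cdot>) B (S n) (b n) = S (Suc n)"
    proof (intro equalityI subsetI)
      fix x assume "x \<in> flag_step (\<cdot>) B (S n) (b n)"
      then obtain w d where x: "x = w + b n \<cdot> d" "w \<in> S n" "d \<in> B" unfolding flag_step_def by blast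
      then obtain c where c: "w = (\<Sum>i<n. b i \<cdot> c i)" "\<forall>i. c i \<in> B" unfolding S_def by blast
      have "(\<Sum>i<Suc n. b i \<cdot> (c(n := d)) i) \<in> S (Suc n)" using c x by (intro S_I) auto
      then show "x \<in> S (Suc n)" using x c by simp
    next
      fix x assume "x \<in> S (Suc n)"
      then obtain c where c: "x = (\<Sum>i<n. b i \<cdot> c i) + b n \<cdot> c n" "\<forall>i. c i \<in> B" unfolding S_def by auto
      then show "x \<in> flag_step (\<cdot>) B (S n) (b n)" unfolding flag_step_def using S_I[OF c(2)] by blast
    qed
    show ?case
    proof (cases "b n \<in> S n")
      case True
      then have "S (Suc n) \<subseteq> S n" using flag_step_least[OF sS order_refl] eq by blast
      then have "S (Suc n) = S n" using eq flag_step_superset[OF B, of "S n" "b n"] by blast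
      then show ?thesis using m by (intro exI[of _ m]) auto
    next
      case False
      have d: "fdim (\<cdot>) B (Suc m) (S (Suc n))" using fdim_Suc[OF m(2) False] unfolding eq .
      have "dep n" if "dep (Suc n)"
      proof -
        obtain c where c: "\<forall>i. c i \<in> B" "(\<Sum>i<Suc n. b i \<cdot> c i) = 0" "\<exists>i<Suc n. c i \<noteq> 0"
          using \<open>dep (Suc n)\<close> unfolding dep_def by blast
        have "b n \<cdot> c n = - (\<Sum>i<n. b i \<cdot> c i)" using c(2) by (simp add: eq_neg_iff_add_eq_0 add.commute)
        also have "\<dots> \<in> S n" by (rule submod_minus[OF B sS S_I[OF c(1)]])
        finally have "c n = 0" using submod_act_cancel[OF B sS, of "c n" "b n"] False c(1) by blast
        then have "(\<Sum>i<n. b i \<cdot> c i) = 0" "\<exists>i<n. c i \<noteq> 0" using c by (auto simp: less_Suc_eq)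
        then show ?thesis unfolding dep_def using c(1) by blast
      qed
      then show ?thesis using d m by (intro exI[of _ "Suc m"]) auto
    qed
  qed
  then show ?thesis unfolding S_def dep_def .
qed

lemma (in rmod) spanning_independent:
  assumes B: "divring B" and W: "fdim (\<cdot>) B n W" "W \<subseteq> {\<Sum>i<n. b i \<cdot> c i | c. \<forall>i. c i \<in> B}"
    and c: "\<And>i. c i \<in> B" "(\<Sum>i<n. b i \<cdot> c i) = 0" and i: "i < n"
  shows "c i = 0"
proof (rule ccontr)
  assume "c i \<noteq> 0"
  then have ex: "\<exists>c. (\<forall>i. c i \<in> B) \<and> (\<Sum>i<n. b i \<cdot> c i) = 0 \<and> (\<exists>i<n. c i \<noteq> 0)"
    using c i by (intro exI[of _ c]) auto
  obtain m where "m \<le> n \<and> fdim (\<cdot>) B m {\<Sum>i<n. b i \<cdot> c i | c. \<forall>i. c i \<in> B} \<and>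
    ((\<exists>c. (\<forall>i. c i \<in> B) \<and> (\<Sum>i<n. b i \<cdot> c i) = 0 \<and> (\<exists>i<n. c i \<noteq> 0)) \<longrightarrow> m < n)"
    using fdim_span_le[OF B, of n b] ..
  then have m: "fdim (\<cdot>) B m {\<Sum>i<n. b i \<cdot> c i | c. \<forall>i. c i \<in> B}" "m < n" using ex by simp_all
  show False using fdim_mono[OF m(1) W(1) B W(2)] m(2) by simp
qed

text \<open>A division algebra over \<open>F\<close> inside a split algebra over an extension field, given by a basis
  \<open>b\<close> of skew and symmetric elements. Subfields of the extension field are plain sets, and \<open>DE E\<close>
  is the scalar extension of the algebra to \<open>E\<close>.\<close>

locale split_algebra =
  fixes sc :: "'w::field \<Rightarrow> 'r::ring_1" and b :: "nat \<Rightarrow> 'r" and F :: "'w set"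
    and J :: "'r \<Rightarrow> 'r" and p :: nat
  assumes sc_add: "sc (x + y) = sc x + sc y" and sc_mult: "sc (x * y) = sc x * sc y"
    and sc_1: "sc 1 = 1" and sc_central: "sc x * X = X * sc x"
    and span: "\<exists>c. X = (\<Sum>i<64. b i * sc (c i))"
    and indep: "(\<Sum>i<64. b i * sc (c i)) = 0 \<Longrightarrow> i < 64 \<Longrightarrow> c i = 0"
    and F: "divring F"
    and F_mult: "i < 64 \<Longrightarrow> j < 64 \<Longrightarrow> \<exists>c. (\<forall>k. c k \<in> F) \<and> b i * b j = (\<Sum>k<64. b k * sc (c k))"
    and F_one: "\<exists>c. (\<forall>k. c k \<in> F) \<and> 1 = (\<Sum>k<64. b k * sc (c k))"
    and center_sc: "(\<And>X. Z * X = X * Z) \<Longrightarrow> \<exists>x. Z = sc x"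
    and J_add: "J (X + Y) = J X + J Y" and J_mult: "J (X * Y) = J Y * J X"
    and J_J: "J (J X) = X" and J_sc: "J (sc x) = sc x"
    and J_skew: "i < p \<Longrightarrow> J (b i) = - b i" and J_sym: "p \<le> i \<Longrightarrow> i < 64 \<Longrightarrow> J (b i) = b i"
    and p_ge: "36 \<le> p" and p_le: "p \<le> 64"
    and two: "(2::'r) \<noteq> 0"
    and sqrt: "\<exists>y::'w. y * y = x"
begin

interpretation R: rmod "(*) :: 'r \<Rightarrow> 'r \<Rightarrow> 'r" by (rule rmod_times)

definition DE :: "'w set \<Rightarrow> 'r set" where
  "DE E = {\<Sum>i<64. b i * sc (c i) | c. \<forall>i. c i \<in> E}"

lemma DE_I: "(\<And>i. c i \<in> E) \<Longrightarrow> (\<Sum>i<64. b i * sc (c i)) \<in> DE E"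
  unfolding DE_def by blast

lemma DE_E:
  assumes "x \<in> DE E"
  obtains c where "x = (\<Sum>i<64. b i * sc (c i))" "\<forall>i. c i \<in> E"
  using assms unfolding DE_def by blast

lemma sc_0: "sc 0 = 0" using sc_add[of 0 0] by simp
lemma sc_diff: "sc (x - y) = sc x - sc y" using sc_add[of "x - y" y] by simp
lemma sc_minus: "sc (- x) = - sc x" using sc_diff[of 0 x] sc_0 by simp

lemma sc_eq_0:
  assumes "sc x = 0" shows "x = 0"
proof (rule ccontr)
  assume "x \<noteq> 0"
  then have "sc (x * inverse x) = 1" by (simp add: sc_1)
  then show False using assms by (simp add: sc_mult)
qed

lemma sc_inj: "sc x = sc y \<Longrightarrow> x = y"
  using sc_eq_0[of "x - y"] by (simp add: sc_diff)

lemma coord_unique: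
  assumes "(\<Sum>i<64. b i * sc (c i)) = (\<Sum>i<64. b i * sc (d i))" "i < 64"
  shows "c i = d i"
proof -
  have "(\<Sum>i<64. b i * sc (c i - d i)) = 0"
    using assms(1) by (simp add: sc_diff right_diff_distrib sum_subtractf)
  then show ?thesis using indep[of "\<lambda>i. c i - d i" i] assms(2) by simp
qed

lemma DE_mono: "E \<subseteq> E' \<Longrightarrow> DE E \<subseteq> DE E'"
  by (auto elim!: DE_E intro!: DE_I)

lemma sc_divring:
  assumes "divring E" shows "divring (sc ` E)"
  unfolding divring_def
proof (intro conjI ballI impI)
  show "1 \<in> sc ` E" using divring_1[OF assms] sc_1 by (metis imageI)
  show "x - y \<in> sc ` E" if "x \<in> sc ` E" "y \<in> sc ` E" for x y
    using that assms by (auto simp: divring_closed simp flip: sc_diff)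
  show "x * y \<in> sc ` E" if "x \<in> sc ` E" "y \<in> sc ` E" for x y
    using that assms by (auto simp: divring_closed simp flip: sc_mult)
  show "\<exists>y\<in>sc ` E. x * y = 1 \<and> y * x = 1" if x: "x \<in> sc ` E" "x \<noteq> 0" for x
  proof -
    obtain e where e: "e \<in> E" "x = sc e" using x by blast
    then have "e \<noteq> 0" using x(2) sc_0 by auto
    then obtain f where "f \<in> E" "e * f = 1" "f * e = 1" using divring_inv[OF assms e(1)] by metis
    then show ?thesis using e sc_1 sc_mult by (metis imageI)
  qed
qed

lemma DE_diff: "divring E \<Longrightarrow> x \<in> DE E \<Longrightarrow> y \<in> DE E \<Longrightarrow> x - y \<in> DE E"
proof -
  assume E: "divring E" and x: "x \<in> DE E" and y: "y \<in> DE E"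
  obtain c where c: "x = (\<Sum>i<64. b i * sc (c i))" "\<forall>i. c i \<in> E" using x by (rule DE_E)
  obtain d where d: "y = (\<Sum>i<64. b i * sc (d i))" "\<forall>i. d i \<in> E" using y by (rule DE_E)
  note * = c d
  then have eq: "x - y = (\<Sum>i<64. b i * sc (c i - d i))" by (simp add: sc_diff right_diff_distrib sum_subtractf)
  show ?thesis unfolding eq by (rule DE_I) (use c d divring_diff[OF E] in auto)
qed

lemma DE_0: "divring E \<Longrightarrow> 0 \<in> DE E"
  using DE_I[of "\<lambda>_. 0" E] divring_0[of E] by (simp add: sc_0)

lemma DE_add: "divring E \<Longrightarrow> x \<in> DE E \<Longrightarrow> y \<in> DE E \<Longrightarrow> x + y \<in> DE E"
  using DE_diff[of E x "0 - y"] DE_diff[of E 0 y] DE_0[of E] by simp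

lemma DE_sum: "divring E \<Longrightarrow> (\<And>i. i \<in> I \<Longrightarrow> f i \<in> DE E) \<Longrightarrow> sum f I \<in> DE E"
  by (induction I rule: infinite_finite_induct) (auto simp: DE_0 DE_add)

lemma DE_scale:
  assumes "divring E" "x \<in> DE E" "e \<in> E"
  shows "x * sc e \<in> DE E"
proof -
  obtain c where *: "x = (\<Sum>i<64. b i * sc (c i))" "\<forall>i. c i \<in> E" using assms(2) by (rule DE_E)
  then have eq: "x * sc e = (\<Sum>i<64. b i * sc (c i * e))" by (simp add: sc_mult sum_distrib_right mult.assoc)
  show ?thesis unfolding eq by (rule DE_I) (use * divring_mult[OF assms(1)] assms(3) in auto)
qed

lemma DE_mult:
  assumes E: "divring E" "F \<subseteq> E" and x: "x \<in> DE E" and y: "y \<in> DE E"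
  shows "x * y \<in> DE E"
proof -
  obtain c where c: "x = (\<Sum>i<64. b i * sc (c i))" "\<forall>i. c i \<in> E" using x by (rule DE_E)
  obtain d where d: "y = (\<Sum>i<64. b i * sc (d i))" "\<forall>i. d i \<in> E" using y by (rule DE_E)
  note * = c d
  have "x * y = (\<Sum>i<64. \<Sum>j<64. b i * sc (c i) * (b j * sc (d j)))"
    unfolding * by (simp add: sum_product)
  also have "\<dots> = (\<Sum>i<64. \<Sum>j<64. b i * b j * sc (c i * d j))"
    by (intro sum.cong refl) (metis sc_central sc_mult mult.assoc)
  also have "\<dots> \<in> DE E"
  proof (intro DE_sum E DE_scale)
    fix i j :: nat assume "i \<in> {..<64}" "j \<in> {..<64}"
    then obtain c where "\<forall>k. c k \<in> F" "b i * b j = (\<Sum>k<64. b k * sc (c k))" using F_mult[of i j] by auto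
    then have "b i * b j \<in> DE F" using DE_I[of c F] by simp
    then show "b i * b j \<in> DE E" using DE_mono[OF E(2)] by blast
  next
    fix i j show "c i * d j \<in> E" using * E by (simp add: divring_closed)
  qed
  finally show ?thesis .
qed

lemma DE_1: "F \<subseteq> E \<Longrightarrow> 1 \<in> DE E"
proof -
  assume "F \<subseteq> E"
  moreover obtain c where "\<forall>k. c k \<in> F" "1 = (\<Sum>k<64. b k * sc (c k))" using F_one by blast
  then have "1 \<in> DE F" using DE_I[of c F] by simp
  ultimately show ?thesis using DE_mono by blast
qed

lemma sc_DE:
  assumes "divring E" "F \<subseteq> E" shows "sc ` E \<subseteq> DE E"
proof
  fix x assume "x \<in> sc ` E"
  then obtain e where "x = 1 * sc e" "e \<in> E" by auto
  then show "x \<in> DE E" using DE_scale[OF assms(1) DE_1[OF assms(2)]] by blast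
qed

lemma fdim_span:
  assumes E: "divring E" and n: "n \<le> 64"
  shows "fdim (*) (sc ` E) n {\<Sum>i<n. b i * sc (c i) | c. \<forall>i. c i \<in> E}"
proof -
  have "fdim (*) (sc ` E) n {\<Sum>i<n. b i * c i | c. \<forall>i. c i \<in> sc ` E}"
  proof (rule R.fdim_of_basis[OF sc_divring[OF E], of n b])
    fix c assume c: "\<forall>i<n. c i \<in> sc ` E" "(\<Sum>i<n. b i * c i) = 0"
    define d where "d = (\<lambda>i. SOME x. c i = sc x)"
    have d: "c i = sc (d i)" if "i < n" for i
      unfolding d_def using c(1) that by (intro someI_ex[of "\<lambda>x. c i = sc x"]) auto
    let ?d = "\<lambda>i. if i < n then d i else 0"
    have "(\<Sum>i<64. b i * sc (?d i)) = (\<Sum>i<n. b i * sc (?d i))"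
      using n by (intro sum.mono_neutral_right) (auto simp: sc_0)
    also have "\<dots> = (\<Sum>i<n. b i * c i)" using d by (intro sum.cong) auto
    finally have "(\<Sum>i<64. b i * sc (?d i)) = 0" using c by simp
    then have "?d i = 0" if "i < n" for i using indep[of ?d i] that n by auto
    then show "\<forall>i<n. c i = 0" using d sc_0 by auto
  qed
  moreover have "{\<Sum>i<n. b i * c i | c. \<forall>i. c i \<in> sc ` E} = {\<Sum>i<n. b i * sc (c i) | c. \<forall>i. c i \<in> E}"
  proof (intro equalityI subsetI)
    fix x assume "x \<in> {\<Sum>i<n. b i * c i | c. \<forall>i. c i \<in> sc ` E}"
    then obtain c where c: "x = (\<Sum>i<n. b i * c i)" "\<forall>i. c i \<in> sc ` E" by blast
    define d where "d = (\<lambda>i. SOME x. c i = sc x \<and> x \<in> E)"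
    have d: "c i = sc (d i) \<and> d i \<in> E" for i
      unfolding d_def using c(2) by (intro someI_ex[of "\<lambda>x. c i = sc x \<and> x \<in> E"]) auto
    then have "x = (\<Sum>i<n. b i * sc (d i))" unfolding c(1) by auto
    then show "x \<in> {\<Sum>i<n. b i * sc (c i) | c. \<forall>i. c i \<in> E}" using d by (intro CollectI exI[of _ d]) auto
  next
    fix x assume "x \<in> {\<Sum>i<n. b i * sc (c i) | c. \<forall>i. c i \<in> E}"
    then obtain c where c: "x = (\<Sum>i<n. b i * sc (c i))" "\<forall>i. c i \<in> E" by blast
    then show "x \<in> {\<Sum>i<n. b i * c i | c. \<forall>i. c i \<in> sc ` E}"
      by (intro CollectI exI[of _ "\<lambda>i. sc (c i)"]) auto
  qed
  ultimately show ?thesis by simp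
qed

text \<open>The coordinates of \<open>sc x\<close> are \<open>x\<close> times those of 1, which lie
  in \<open>F\<close> and are not all zero.\<close>

lemma sc_mem_DE:
  assumes E: "divring E" "F \<subseteq> E" and x: "sc x \<in> DE E"
  shows "x \<in> E"
proof -
  obtain f where f: "\<forall>k. f k \<in> F" "1 = (\<Sum>k<64. b k * sc (f k))" using F_one by blast
  obtain e where e: "sc x = (\<Sum>k<64. b k * sc (e k))" "\<forall>k. e k \<in> E" using x by (rule DE_E)
  have "sc x = (\<Sum>k<64. b k * sc (f k)) * sc x" by (simp flip: f(2))
  also have "\<dots> = (\<Sum>k<64. b k * sc (f k * x))" by (simp add: sum_distrib_right sc_mult mult.assoc)
  finally have eq: "e k = f k * x" if "k < 64" for k
    using coord_unique[of e "\<lambda>k. f k * x" k] e(1) that by simp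
  have "\<exists>k<64. f k \<noteq> 0"
  proof (rule ccontr)
    assume "\<not> ?thesis"
    then have "(\<Sum>k<64. b k * sc (f k)) = 0" by (intro sum.neutral) (auto simp: sc_0)
    then show False using f(2) by simp
  qed
  then obtain k where k: "k < 64" "f k \<noteq> 0" by blast
  obtain g where g: "g \<in> E" "f k * g = 1" using divring_inv[OF E(1) _ k(2)] f(1) E(2) by blast
  have "x = e k * g" using eq[OF k(1)] g(2) by (simp add: mult.commute mult.left_commute)
  then show ?thesis using e(2) g(1) E(1) by (simp add: divring_closed)
qed

text \<open>An element commuting with \<open>DE E\<close> commutes with the basis \<open>b\<close>,
  hence with the whole split algebra, and is a scalar. By \<open>sc_mem_DE\<close> this scalar comes
  from \<open>E\<close>.\<close>

lemma DE_csa: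
  assumes E: "divring E" "F \<subseteq> E" and D: "divring (DE E)"
  shows "csa64 (sc ` E) (DE E)"
proof
  show "divring (sc ` E)" by (rule sc_divring[OF E(1)])
  show "divring (DE E)" by (rule D)
  show "sc ` E \<subseteq> DE E" by (rule sc_DE[OF E])
  show "e * x = x * e" if "e \<in> sc ` E" for e x using that sc_central by auto
  show "fdim (*) (sc ` E) 64 (DE E)" unfolding DE_def by (rule fdim_span[OF E(1) order_refl])
  show "(2::'r) \<noteq> 0" by (rule two)
  show "z \<in> sc ` E" if z: "z \<in> DE E" and comm: "\<And>x. x \<in> DE E \<Longrightarrow> z * x = x * z" for z
  proof -
    have bi: "b i \<in> DE E" if "i < 64" for i
    proof -
      have "b i = (\<Sum>k<64. b k * sc (if k = i then 1 else 0))"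
      proof -
        have "(\<Sum>k<64. b k * sc (if k = i then 1 else 0)) = (\<Sum>k<64. if k = i then b k else 0)"
          by (intro sum.cong) (auto simp: sc_0 sc_1)
        also have "\<dots> = b i" using that by simp
        finally show ?thesis by simp
      qed
      moreover have "\<dots> \<in> DE E" by (rule DE_I) (use divring_0[OF E(1)] divring_1[OF E(1)] in auto)
      ultimately show ?thesis by simp
    qed
    have "z * X = X * z" for X
    proof -
      obtain c where c: "X = (\<Sum>i<64. b i * sc (c i))" using span by blast
      have "z * (b i * sc (c i)) = b i * sc (c i) * z" if "i < 64" for i
        using comm[OF bi[OF that]] sc_central[of "c i" z] by (metis mult.assoc)
      then show ?thesis unfolding c by (simp add: sum_distrib_left sum_distrib_right)
    qed
    then obtain x where "z = sc x" using center_sc by blast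
    then show ?thesis using sc_mem_DE[OF E] z by blast
  qed
qed

lemma J_0: "J 0 = 0" using J_add[of 0 0] by simp
lemma J_sum: "J (sum f I) = (\<Sum>i\<in>I. J (f i))"
  by (induction I rule: infinite_finite_induct) (auto simp: J_0 J_add)

lemma J_coord:
  "J (\<Sum>i<64. b i * sc (c i)) = (\<Sum>i<64. b i * sc (if i < p then - c i else c i))"
  unfolding J_sum
proof (intro sum.cong refl)
  fix i :: nat assume i: "i \<in> {..<64}"
  have "J (b i * sc (c i)) = J (b i) * sc (c i)" by (simp add: J_mult J_sc sc_central)
  also have "\<dots> = b i * sc (if i < p then - c i else c i)"
    using J_skew[of i] J_sym[of i] i by (auto simp: sc_minus)
  finally show "J (b i * sc (c i)) = b i * sc (if i < p then - c i else c i)" .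
qed

text \<open>\<open>J\<close> changes basis vectors only by a sign. So over every \<open>E\<close>
  the skew elements are spanned by the first \<open>p\<close> basis vectors, and the type of the
  involution survives scalar extension.\<close>

lemma DE_symp:
  assumes E: "divring E" "F \<subseteq> E" and D: "divring (DE E)"
  shows "csa_symp (sc ` E) (DE E) J p"
proof -
  interpret C: csa64 "sc ` E" "DE E" by (rule DE_csa[OF assms])
  interpret I: csa_inv "sc ` E" "DE E" J
  proof
    fix x assume "x \<in> DE E"
    then obtain c where c: "x = (\<Sum>i<64. b i * sc (c i))" "\<forall>i. c i \<in> E" by (rule DE_E)
    show "J x \<in> DE E" unfolding c J_coord by (rule DE_I) (use c(2) divring_uminus[OF E(1)] in auto)
  qed (auto simp: J_add J_mult J_J J_sc)
  have two': "(2::'w) \<noteq> 0"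
  proof
    assume "(2::'w) = 0"
    then have "sc (1 + 1) = 0" using sc_0 by simp
    then have "(1::'r) + 1 = 0" unfolding sc_add sc_1 .
    then show False using two by simp
  qed
  have "I.Skew = {\<Sum>i<p. b i * sc (c i) | c. \<forall>i. c i \<in> E}"
  proof (intro equalityI subsetI)
    fix x assume x: "x \<in> I.Skew"
    obtain c where c: "x = (\<Sum>i<64. b i * sc (c i))" "\<forall>i. c i \<in> E" using I.Skew_D[OF x] by (rule DE_E)
    have "J x = - x" using x I.Skew_J by blast
    moreover have "- x = (\<Sum>i<64. b i * sc (- c i))" unfolding c by (simp add: sc_minus sum_negf)
    ultimately have "(\<Sum>i<64. b i * sc (if i < p then - c i else c i)) = (\<Sum>i<64. b i * sc (- c i))"
      using J_coord[of c] c(1) by simp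
    then have eq: "(if i < p then - c i else c i) = - c i" if "i < 64" for i
      using coord_unique[of "\<lambda>i. if i < p then - c i else c i" "\<lambda>i. - c i" i] that by simp
    have "c i = 0" if "i < 64" "\<not> i < p" for i
    proof -
      have "c i + c i = 0" using eq[OF that(1)] that(2) by (simp add: eq_neg_iff_add_eq_0)
      then have "2 * c i = 0" by simp
      then show ?thesis using two' by (metis mult_eq_0_iff)
    qed
    then have "x = (\<Sum>i<p. b i * sc (c i))"
      unfolding c(1) using p_le by (intro sum.mono_neutral_right) (auto simp: sc_0)
    then show "x \<in> {\<Sum>i<p. b i * sc (c i) | c. \<forall>i. c i \<in> E}" using c by blast
  next
    fix x assume "x \<in> {\<Sum>i<p. b i * sc (c i) | c. \<forall>i. c i \<in> E}"
    then obtain c where c: "x = (\<Sum>i<p. b i * sc (c i))" "\<forall>i. c i \<in> E" by blast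
    let ?c = "\<lambda>i. if i < p then c i else 0"
    have x: "x = (\<Sum>i<64. b i * sc (?c i))"
    proof -
      have "(\<Sum>i<64. b i * sc (?c i)) = (\<Sum>i<p. b i * sc (?c i))"
        using p_le by (intro sum.mono_neutral_right) (auto simp: sc_0)
      also have "\<dots> = x" unfolding c(1) by (intro sum.cong) auto
      finally show ?thesis by simp
    qed
    have "x \<in> DE E" unfolding x by (rule DE_I) (use c(2) divring_0[OF E(1)] in auto)
    moreover have "J x = - x" unfolding x J_coord sum_negf[symmetric]
      by (intro sum.cong) (auto simp: sc_minus sc_0)
    ultimately show "x \<in> I.Skew" unfolding I.Skew_def by blast
  qed
  then have "fdim (*) (sc ` E) p I.Skew" using fdim_span[OF E(1) p_le] by simp
  then show ?thesis using p_ge by unfold_locales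
qed

definition sym_quad :: "'w set \<Rightarrow> bool" where
  "sym_quad E \<longleftrightarrow> (\<exists>x\<in>DE E. J x = x \<and> x \<notin> sc ` E \<and> x * x \<in> sc ` E)"

text \<open>The family for Zorn's lemma. That \<open>DE E\<close> is a division ring has to be part
  of it, since a scalar extension may create zero divisors.\<close>

definition good :: "'w set \<Rightarrow> bool" where
  "good E \<longleftrightarrow> divring E \<and> F \<subseteq> E \<and> divring (DE E) \<and> \<not> sym_quad E"

lemma sym_quadI:
  assumes E: "divring E" "F \<subseteq> E" "divring (DE E)"
    and x: "x \<in> DE E" "x \<notin> sc ` E" "x * x \<in> sc ` E"
  shows "sym_quad E"
proof -
  interpret S: csa_symp "sc ` E" "DE E" J p by (rule DE_symp[OF E])
  have "S.quad x" unfolding S.quad_def using x by blast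
  then obtain y where "y \<in> S.Sym" "S.quad y" using S.sym_quad_of_quad by blast
  then show ?thesis unfolding sym_quad_def S.quad_def S.Sym_def by blast
qed

text \<open>Every condition concerns finitely many scalars at a time, and these lie in one member of
  the chain.\<close>

lemma good_chain:
  assumes ne: "C \<noteq> {}" and chain: "subset.chain {E. good E} C"
  shows "good (\<Union>C)"
proof -
  have good: "good E" if "E \<in> C" for E using chain that unfolding subset.chain_def by auto
  have chain': "subset.chain UNIV C" using chain unfolding subset.chain_def by blast
  have fin: "\<exists>E\<in>C. A \<subseteq> E" if "finite A" "A \<subseteq> \<Union>C" for A
    using finite_subset_Union_chain[OF that ne chain'] by blast
  have F: "F \<subseteq> \<Union>C" using ne good unfolding good_def by blast
  have div: "divring (\<Union>C)"
    unfolding divring_def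
  proof (intro conjI ballI impI)
    show "1 \<in> \<Union>C" using ne good divring_1 unfolding good_def by blast
    fix x assume x: "x \<in> \<Union>C"
    show "\<exists>y\<in>\<Union>C. x * y = 1 \<and> y * x = 1" if "x \<noteq> 0"
    proof -
      obtain E where E: "E \<in> C" "x \<in> E" using x by blast
      then have "divring E" using good unfolding good_def by blast
      then show ?thesis using divring_inv[OF _ E(2) that] E(1) by (metis UnionI)
    qed
    fix y assume y: "y \<in> \<Union>C"
    obtain E where E: "E \<in> C" "{x, y} \<subseteq> E" using fin[of "{x, y}"] x y by blast
    then have "divring E" using good unfolding good_def by blast
    then have "x - y \<in> E" "x * y \<in> E" using E by (auto simp: divring_closed)
    then show "x - y \<in> \<Union>C" "x * y \<in> \<Union>C" using E by blast+
  qed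
  have DE: "\<exists>E\<in>C. x \<in> DE E \<and> A \<subseteq> E" if xA: "x \<in> DE (\<Union>C)" "finite A" "A \<subseteq> \<Union>C" for x A
  proof -
    obtain c where c: "x = (\<Sum>i<64. b i * sc (c i))" "\<forall>i. c i \<in> \<Union>C" using xA(1) by (rule DE_E)
    have "finite (A \<union> c ` {..<64})" "A \<union> c ` {..<64} \<subseteq> \<Union>C" using xA c by auto
    then obtain E where E: "E \<in> C" "A \<union> c ` {..<64} \<subseteq> E" using fin by blast
    have "divring E" using good[OF E(1)] unfolding good_def by blast
    then have "0 \<in> E" by (rule divring_0)
    have eq: "x = (\<Sum>i<64. b i * sc (if i < 64 then c i else 0))" unfolding c(1) by (intro sum.cong) auto
    have "x \<in> DE E" unfolding eq by (rule DE_I) (use E \<open>0 \<in> E\<close> in auto)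
    then show ?thesis using E by blast
  qed
  have "divring (DE (\<Union>C))"
    unfolding divring_def
  proof (intro conjI ballI impI)
    show "1 \<in> DE (\<Union>C)" by (rule DE_1[OF F])
    fix x assume x: "x \<in> DE (\<Union>C)"
    show "\<exists>y\<in>DE (\<Union>C). x * y = 1 \<and> y * x = 1" if x0: "x \<noteq> 0"
    proof -
      obtain E where E: "E \<in> C" "x \<in> DE E" using DE[OF x, of "{}"] by blast
      then have "divring (DE E)" using good unfolding good_def by blast
      then obtain y where "y \<in> DE E" "x * y = 1" "y * x = 1" using divring_inv[OF _ E(2) x0] by metis
      moreover have "DE E \<subseteq> DE (\<Union>C)" using DE_mono E(1) by blast
      ultimately show ?thesis by blast
    qed
    fix y assume y: "y \<in> DE (\<Union>C)"
    show "x - y \<in> DE (\<Union>C)" by (rule DE_diff[OF div x y])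
    show "x * y \<in> DE (\<Union>C)" by (rule DE_mult[OF div F x y])
  qed
  moreover have "\<not> sym_quad (\<Union>C)"
  proof
    assume "sym_quad (\<Union>C)"
    then obtain x e where x: "x \<in> DE (\<Union>C)" "J x = x" "x \<notin> sc ` \<Union>C" "x * x = sc e" "e \<in> \<Union>C"
      unfolding sym_quad_def by blast
    obtain E where E: "E \<in> C" "x \<in> DE E" "{e} \<subseteq> E" using DE[OF x(1), of "{e}"] x(5) by blast
    have "sym_quad E" unfolding sym_quad_def using x E by blast
    then show False using good[OF E(1)] unfolding good_def by blast
  qed
  ultimately show ?thesis unfolding good_def using div F by blast
qed

text \<open>Adjoin a root \<open>s\<close> of \<open>e\<close>. A root of \<open>e\<close> inside
  \<open>DE E\<close> would be square-central, so there is none, and for this reason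
  \<open>DE E1\<close> is still a division ring. By maximality \<open>E1\<close> must then admit a
  symmetric square-central \<open>u + s * v\<close>, which \<open>quad_descent\<close> converts into
  one over \<open>E\<close>.\<close>

lemma good_maximal_sqrt:
  assumes good: "good E" and max: "\<And>E'. good E' \<Longrightarrow> E \<subseteq> E' \<Longrightarrow> E' = E" and e: "e \<in> E"
  shows "\<exists>s\<in>E. s * s = e"
proof (rule ccontr)
  assume no: "\<not> ?thesis"
  have E: "divring E" "F \<subseteq> E" "divring (DE E)" and nq: "\<not> sym_quad E" using good unfolding good_def by auto
  interpret S: csa_symp "sc ` E" "DE E" J p by (rule DE_symp[OF E])
  obtain s where s: "s * s = e" using sqrt by blast
  have sE: "s \<notin> E" using no s by blast
  have e0: "e \<noteq> 0" using s sE divring_0[OF E(1)] by auto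
  define E1 where "E1 = {x + s * y | x y. x \<in> E \<and> y \<in> E}"
  have EE1: "E \<subseteq> E1"
  proof
    fix x assume "x \<in> E"
    then show "x \<in> E1" unfolding E1_def using divring_0[OF E(1)] by (intro CollectI exI[of _ x] exI[of _ 0]) auto
  qed
  have sE1: "s \<in> E1" unfolding E1_def using divring_0[OF E(1)] divring_1[OF E(1)]
    by (intro CollectI exI[of _ 0] exI[of _ 1]) auto
  have ind: "x = 0 \<and> y = 0" if xy: "x \<in> E" "y \<in> E" "x + s * y = 0" for x y
  proof -
    have "y = 0"
    proof (rule ccontr)
      assume "y \<noteq> 0"
      then obtain z where z: "z \<in> E" "y * z = 1" using divring_inv[OF E(1) xy(2)] by metis
      have "s = s * (y * z)" using z by simp
      also have "\<dots> = s * y * z" by simp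
      also have "s * y = - x" using xy(3) by (simp add: eq_neg_iff_add_eq_0 add.commute)
      finally show False using sE z xy E(1) by (simp add: divring_closed)
    qed
    then show ?thesis using xy by simp
  qed
  have E1: "divring E1"
    unfolding divring_def
  proof (intro conjI ballI impI)
    show "1 \<in> E1" using EE1 divring_1[OF E(1)] by blast
    fix x assume "x \<in> E1"
    then obtain x1 x2 where x: "x = x1 + s * x2" "x1 \<in> E" "x2 \<in> E" unfolding E1_def by blast
    show "\<exists>y\<in>E1. x * y = 1 \<and> y * x = 1" if "x \<noteq> 0"
    proof -
      let ?n = "x1 * x1 - e * (x2 * x2)"
      have xx: "x * (x1 - s * x2) = ?n" unfolding x s[symmetric] by (simp add: algebra_simps)
      have "x1 - s * x2 \<noteq> 0"
        using ind[of x1 "- x2"] x that E(1) by (auto simp: divring_closed)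
      then have "?n \<noteq> 0" using xx that by auto
      moreover have "?n \<in> E" using x e E(1) by (simp add: divring_closed)
      ultimately obtain z where z: "z \<in> E" "?n * z = 1" using divring_inv[OF E(1)] by metis
      let ?y = "x1 * z + s * (- x2 * z)"
      have "?y = (x1 - s * x2) * z" by (simp add: algebra_simps)
      then have "x * ?y = 1" using xx z by (simp flip: mult.assoc)
      moreover have "?y \<in> E1" unfolding E1_def using x z E(1)
        by (intro CollectI exI[of _ "x1 * z"] exI[of _ "- x2 * z"]) (auto simp: divring_closed)
      ultimately show ?thesis by (metis mult.commute)
    qed
    fix y assume "y \<in> E1"
    then obtain y1 y2 where y: "y = y1 + s * y2" "y1 \<in> E" "y2 \<in> E" unfolding E1_def by blast
    have "x - y = (x1 - y1) + s * (x2 - y2)" unfolding x y by (simp add: algebra_simps)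
    then show "x - y \<in> E1" unfolding E1_def using x y divring_diff[OF E(1)] by blast
    have "x * y = (x1 * y1 + e * (x2 * y2)) + s * (x1 * y2 + x2 * y1)" unfolding x y s[symmetric] by (simp add: algebra_simps)
    moreover have "x1 * y1 + e * (x2 * y2) \<in> E" "x1 * y2 + x2 * y1 \<in> E" using x y e E(1) by (auto simp: divring_closed)
    ultimately show "x * y \<in> E1" unfolding E1_def by blast
  qed
  have FE1: "F \<subseteq> E1" using E(2) EE1 by blast
  have nsq: "x * x \<noteq> sc e" if x: "x \<in> DE E" for x
  proof
    assume xx: "x * x = sc e"
    have "x \<notin> sc ` E"
    proof
      assume "x \<in> sc ` E"
      then obtain f where f: "x = sc f" "f \<in> E" by blast
      then have "sc (f * f) = sc e" using xx by (simp add: sc_mult)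
      then have "f * f = e" by (rule sc_inj)
      then show False using no f by blast
    qed
    then show False using sym_quadI[OF E x] xx e nq by auto
  qed
  have DE1: "\<exists>u\<in>DE E. \<exists>v\<in>DE E. X = u + sc s * v" if X: "X \<in> DE E1" for X
  proof -
    obtain c where c: "X = (\<Sum>i<64. b i * sc (c i))" "\<forall>i. c i \<in> E1" using X by (rule DE_E)
    then have "\<forall>i. \<exists>x y. c i = x + s * y \<and> x \<in> E \<and> y \<in> E" unfolding E1_def by blast
    then obtain x y where xy: "\<And>i. c i = x i + s * y i" "\<And>i. x i \<in> E" "\<And>i. y i \<in> E" by metis
    have "X = (\<Sum>i<64. b i * sc (x i)) + sc s * (\<Sum>i<64. b i * sc (y i))"
      unfolding c(1) xy(1) sum_distrib_left sum.distrib[symmetric]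
      by (intro sum.cong refl) (simp add: sc_add sc_mult distrib_left, metis sc_central mult.assoc)
    then show ?thesis using DE_I[of x E] DE_I[of y E] xy by blast
  qed
  have DEind: "u = 0 \<and> v = 0" if uv0: "u \<in> DE E" "v \<in> DE E" "u + sc s * v = 0" for u v
  proof -
    obtain x where x: "u = (\<Sum>i<64. b i * sc (x i))" "\<forall>i. x i \<in> E" using uv0(1) by (rule DE_E)
    obtain y where y: "v = (\<Sum>i<64. b i * sc (y i))" "\<forall>i. y i \<in> E" using uv0(2) by (rule DE_E)
    note xy = x y
    have "u + sc s * v = (\<Sum>i<64. b i * sc (x i + s * y i))"
      unfolding xy sum_distrib_left sum.distrib[symmetric]
      by (intro sum.cong refl) (simp add: sc_add sc_mult distrib_left, metis sc_central mult.assoc)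
    then have "x i + s * y i = 0" if "i < 64" for i
      using indep[of "\<lambda>i. x i + s * y i" i] \<open>u + sc s * v = 0\<close> that by simp
    then have "x i = 0 \<and> y i = 0" if "i < 64" for i using ind xy that by blast
    then show ?thesis unfolding xy by (auto simp: sc_0)
  qed
  have DD: "divring (DE E)" by (rule E(3))
  have sub: "DE E \<subseteq> DE E1" by (rule DE_mono[OF EE1])
  have scs: "sc s \<in> DE E1" using sc_DE[OF E1 FE1] sE1 by blast
  have div1: "divring (DE E1)"
    unfolding divring_def
  proof (intro conjI ballI impI)
    show "1 \<in> DE E1" by (rule DE_1[OF FE1])
    fix X assume X: "X \<in> DE E1"
    show "\<exists>Y\<in>DE E1. X * Y = 1 \<and> Y * X = 1" if X0: "X \<noteq> 0"
    proof -
      obtain u v where uv: "u \<in> DE E" "v \<in> DE E" "X = u + sc s * v" using DE1[OF X] by blast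
      show ?thesis
      proof (cases "v = 0")
        case True
        then obtain y where "y \<in> DE E" "X * y = 1" "y * X = 1" using divring_inv[OF DD uv(1)] uv X0 by (metis add.right_neutral mult_zero_right)
        then show ?thesis using sub by blast
      next
        case False
        obtain w where w: "w \<in> DE E" "v * w = 1" "w * v = 1" using divring_inv[OF DD uv(2) False] .
        \<comment> \<open>Splitting off \<open>v\<close>, it remains to invert
          \<open>z + sc s\<close>. Its product with \<open>z - sc s\<close> is
          \<open>z * z - sc e\<close>, which is nonzero by \<open>nsq\<close>.\<close>
        define z where "z = u * w"
        have z: "z \<in> DE E" unfolding z_def using uv w DD by (simp add: divring_closed)
        have "z * z - sc e \<in> DE E" "z * z - sc e \<noteq> 0"
          using z DD nsq[OF z] S.E_sub e by (auto simp: divring_closed)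
        then obtain t where t: "t \<in> DE E" "(z * z - sc e) * t = 1" "t * (z * z - sc e) = 1" using divring_inv[OF DD] by metis
        have Xz: "X = (z + sc s) * v"
        proof -
          have "z * v = u" unfolding z_def using w by (simp add: mult.assoc)
          then show ?thesis using uv(3) by (simp add: distrib_right)
        qed
        have p1: "(z + sc s) * (z - sc s) = z * z - sc e" and p2: "(z - sc s) * (z + sc s) = z * z - sc e"
          using sc_central[of s z] unfolding s[symmetric] sc_mult by (simp_all add: algebra_simps)
        let ?Y = "w * (z - sc s) * t"
        have cm: "(z - sc s) * (z * z - sc e) = (z * z - sc e) * (z - sc s)"
          using p1 p2 by (metis mult.assoc)
        have YD: "?Y \<in> DE E1"
          using w t z sub scs DE_mult[OF E1 FE1] DE_diff[OF E1] by (meson subsetD)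
        have "X * ?Y = (z + sc s) * (v * w) * (z - sc s) * t" unfolding Xz by (simp add: mult.assoc)
        also have "\<dots> = 1" using w p1 t by simp
        finally have XY: "X * ?Y = 1" .
        have ct: "(z - sc s) * t = t * (z - sc s)"
        proof -
          have "t * (z - sc s) = t * ((z - sc s) * (z * z - sc e)) * t" using t by (simp add: mult.assoc)
          also have "\<dots> = (t * (z * z - sc e)) * (z - sc s) * t" unfolding cm by (simp add: mult.assoc)
          finally show ?thesis using t by simp
        qed
        have "?Y * X = w * ((z - sc s) * t) * ((z + sc s) * v)" unfolding Xz by (simp add: mult.assoc)
        also have "\<dots> = w * (t * ((z - sc s) * (z + sc s))) * v" unfolding ct by (simp add: mult.assoc)
        also have "\<dots> = 1" unfolding p2 using t w by simp
        finally show ?thesis using XY YD by blast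
      qed
    qed
    fix Y assume Y: "Y \<in> DE E1"
    show "X - Y \<in> DE E1" by (rule DE_diff[OF E1 X Y])
    show "X * Y \<in> DE E1" by (rule DE_mult[OF E1 FE1 X Y])
  qed
  have "\<not> good E1" using max[OF _ EE1] sE sE1 by blast
  then have "sym_quad E1" unfolding good_def using E1 FE1 div1 by blast
  then obtain X f where X: "X \<in> DE E1" "J X = X" "X \<notin> sc ` E1" "X * X = sc f" "f \<in> E1"
    unfolding sym_quad_def by blast
  obtain u v where uv: "u \<in> DE E" "v \<in> DE E" "X = u + sc s * v" using DE1[OF X(1)] by blast
  obtain f1 f2 where f: "f = f1 + s * f2" "f1 \<in> E" "f2 \<in> E" using X(5) unfolding E1_def by blast
  have JX: "J X = J u + sc s * J v" unfolding uv by (simp add: J_add J_mult J_sc sc_central)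
  \<comment> \<open>Since 1 and \<open>sc s\<close> are independent over \<open>DE E\<close>, the
    symmetry of \<open>X\<close> passes to both components.\<close>
  have "(J u - u) + sc s * (J v - v) = 0" using JX X(2) uv(3) by (simp add: algebra_simps)
  moreover have "J u - u \<in> DE E" "J v - v \<in> DE E" using uv S.J_D DD by (auto simp: divring_closed)
  ultimately have "J u - u = 0 \<and> J v - v = 0" by (intro DEind)
  then have uS: "u \<in> S.Sym" and vS: "v \<in> S.Sym" using uv unfolding S.Sym_def by auto
  have XX: "X * X = (u * u + sc e * (v * v)) + sc s * (u * v + v * u)"
  proof -
    have "u * (sc s * v) = sc s * (u * v)" using sc_central[of s u] by (metis mult.assoc)
    moreover have "sc s * v * (sc s * v) = sc e * (v * v)"
      using sc_central[of s v] unfolding s[symmetric] sc_mult by (metis mult.assoc)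
    ultimately show ?thesis unfolding uv(3) by (simp add: algebra_simps)
  qed
  have "(u * u + sc e * (v * v) - sc f1) + sc s * (u * v + v * u - sc f2) = 0"
  proof -
    have "sc f = sc f1 + sc s * sc f2" unfolding f by (simp only: sc_add sc_mult)
    then show ?thesis using XX unfolding X(4) by (simp add: algebra_simps)
  qed
  moreover have "u * u + sc e * (v * v) - sc f1 \<in> DE E" "u * v + v * u - sc f2 \<in> DE E"
    using uv f e S.E_sub DD by (auto simp: divring_closed image_subset_iff)
  ultimately have "u * u + sc e * (v * v) - sc f1 = 0 \<and> u * v + v * u - sc f2 = 0" by (intro DEind)
  then have 1: "u * u + sc e * (v * v) \<in> sc ` E" and 2: "u * v + v * u \<in> sc ` E" using f by auto
  have "\<not> (u \<in> sc ` E \<and> v \<in> sc ` E)"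
  proof
    assume "u \<in> sc ` E \<and> v \<in> sc ` E"
    then obtain x y where "u = sc x" "v = sc y" "x \<in> E" "y \<in> E" by blast
    then have "X = sc (x + s * y)" "x + s * y \<in> E1" unfolding uv(3) E1_def by (auto simp: sc_add sc_mult)
    then show False using X(3) by blast
  qed
  moreover have "sc e \<in> sc ` E" "sc e \<noteq> 0" using e e0 sc_eq_0 by auto
  ultimately obtain x where "x \<in> S.Sym" "S.quad x" using S.quad_descent[OF uS vS _ _ 1 2] by blast
  then have "sym_quad E" unfolding sym_quad_def S.quad_def S.Sym_def by blast
  then show False using nq by blast
qed

text \<open>A maximal good \<open>E\<close> contains the square roots of all its elements, and then
  \<open>quad_of_quad_closed\<close> yields what a good field excludes.\<close>

theorem sym_quad_exists:
  assumes "divring (DE F)"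
  shows "sym_quad F"
proof (rule ccontr)
  assume "\<not> sym_quad F"
  then have "good F" unfolding good_def using F assms by blast
  then have "{E. good E} \<noteq> {}" by blast
  then obtain E where E: "good E" "\<And>E'. good E' \<Longrightarrow> E \<subseteq> E' \<Longrightarrow> E' = E"
    using subset_Zorn_nonempty[of "{E. good E}"] good_chain by (metis (no_types, lifting) mem_Collect_eq)
  have E': "divring E" "F \<subseteq> E" "divring (DE E)" and nq: "\<not> sym_quad E" using E(1) unfolding good_def by auto
  interpret S: csa_symp "sc ` E" "DE E" J p by (rule DE_symp[OF E'])
  have "\<exists>f\<in>sc ` E. f * f = e" if e: "e \<in> sc ` E" for e
  proof -
    obtain x where x: "x \<in> E" "e = sc x" using e by blast
    then obtain s where "s \<in> E" "s * s = x" using good_maximal_sqrt[OF E x(1)] by blast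
    then show ?thesis using x by (intro bexI[of _ "sc s"]) (auto simp flip: sc_mult)
  qed
  then obtain x where "x \<in> S.Sym" "S.quad x" using S.quad_of_quad_closed by blast
  then have "sym_quad E" unfolding sym_quad_def S.quad_def S.Sym_def by blast
  then show False using nq by blast
qed

end

section \<open>Square matrices as a ring\<close>

text \<open>A copy of the matrix type on which \<open>*\<close> is the matrix product, so that
  matrices form a \<open>ring_1\<close> and the results on division subrings apply to them.\<close>

typedef ('k, 'n::finite) sqmat = "UNIV :: ('k^'n^'n) set" ..

setup_lifting type_definition_sqmat

instantiation sqmat :: (field, finite) ring_1
begin
lift_definition zero_sqmat :: "('a, 'b) sqmat" is 0 .
lift_definition one_sqmat :: "('a, 'b) sqmat" is "mat 1" .
lift_definition plus_sqmat :: "('a, 'b) sqmat \<Rightarrow> ('a, 'b) sqmat \<Rightarrow> ('a, 'b) sqmat" is "(+)" .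
lift_definition minus_sqmat :: "('a, 'b) sqmat \<Rightarrow> ('a, 'b) sqmat \<Rightarrow> ('a, 'b) sqmat" is "(-)" .
lift_definition uminus_sqmat :: "('a, 'b) sqmat \<Rightarrow> ('a, 'b) sqmat" is "uminus" .
lift_definition times_sqmat :: "('a, 'b) sqmat \<Rightarrow> ('a, 'b) sqmat \<Rightarrow> ('a, 'b) sqmat" is "(**)" .
instance
proof
  have "(mat 1 :: 'a^'b^'b) \<noteq> 0"
  proof
    assume "(mat 1 :: 'a^'b^'b) = 0"
    then have "vec_nth (vec_nth (mat 1 :: 'a^'b^'b) undefined) undefined = 0" by simp
    then show False by (simp add: mat_def)
  qed
  then show "(0::('a, 'b) sqmat) \<noteq> 1" by transfer auto
  fix a b c :: "('a, 'b) sqmat"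
  show "a * b * c = a * (b * c)" by transfer (simp add: matrix_mul_assoc)
  show "(a + b) * c = a * c + b * c"
    by transfer (simp add: matrix_matrix_mult_def vec_eq_iff sum.distrib distrib_right)
  show "a * (b + c) = a * b + a * c" by transfer (simp add: matrix_add_ldistrib)
  show "a + b + c = a + (b + c)" by transfer (simp add: add.assoc)
  show "a + b = b + a" by transfer (simp add: add.commute)
qed (transfer; simp)+
end

lift_definition scal :: "'k::field \<Rightarrow> ('k, 'n::finite) sqmat" is mat .
lift_definition ent :: "('k::field, 'n::finite) sqmat \<Rightarrow> 'n \<Rightarrow> 'n \<Rightarrow> 'k" is "\<lambda>A i j. vec_nth (vec_nth A i) j" .
lift_definition tr :: "('k::field, 'n::finite) sqmat \<Rightarrow> ('k, 'n) sqmat" is transpose .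
lift_definition unit :: "'n \<Rightarrow> 'n \<Rightarrow> ('k::field, 'n::finite) sqmat" is
  "\<lambda>a b. \<chi> i j. if i = a \<and> j = b then 1 else 0" .

lemma sqmat_eqI: "(\<And>i j. ent A i j = ent B i j) \<Longrightarrow> A = B"
  by transfer (simp add: vec_eq_iff)

lemma ent_simps [simp]:
  "ent 0 i j = 0" "ent (A + B) i j = ent A i j + ent B i j" "ent (A - B) i j = ent A i j - ent B i j"
  "ent (- A) i j = - ent A i j" "ent (tr A) i j = ent A j i"
  "ent (unit a b) i j = (if i = a \<and> j = b then 1 else 0)" "ent (scal c) i j = (if i = j then c else 0)"
  by (transfer, simp add: transpose_def mat_def)+

lemma ent_mult: "ent (A * B) i j = (\<Sum>k\<in>UNIV. ent A i k * ent B k j)"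
  by transfer (simp add: matrix_matrix_mult_def)

lemma ent_sum: "ent (sum f I) i j = (\<Sum>x\<in>I. ent (f x) i j)"
  by (induction I rule: infinite_finite_induct) auto

lemma ent_scal_left: "ent (scal c * A) i j = c * ent A i j"
  unfolding ent_mult by (simp add: if_distrib[of "\<lambda>x. x * _"] sum.delta cong: if_cong)

lemma ent_scal_right: "ent (A * scal c) i j = ent A i j * c"
  unfolding ent_mult by (simp add: if_distrib[of "\<lambda>x. _ * x"] sum.delta' cong: if_cong)

lemma scal_central: "scal c * A = A * scal c"
  by (rule sqmat_eqI) (simp add: ent_scal_left ent_scal_right mult.commute)

lemma scal_add: "scal (x + y) = scal x + scal y"
  by (rule sqmat_eqI) auto

lemma scal_mult: "scal (x * y) = scal x * scal y"
  by (rule sqmat_eqI) (auto simp: ent_scal_left)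

lemma scal_1: "scal 1 = 1"
  by transfer simp

lemma scal_0: "scal 0 = 0"
  by (rule sqmat_eqI) auto

lemma ent_1: "ent 1 i j = (if i = j then 1 else 0)"
  unfolding scal_1[symmetric] by simp

lemma scal_divring: "divring (range (scal :: 'k::field \<Rightarrow> ('k, 'n::finite) sqmat))"
  unfolding divring_def
proof (intro conjI ballI impI)
  show "1 \<in> range (scal :: 'k \<Rightarrow> ('k, 'n) sqmat)" using scal_1 by (metis rangeI)
  fix x assume "x \<in> range (scal :: 'k \<Rightarrow> ('k, 'n) sqmat)"
  then obtain c where c: "x = scal c" by blast
  show "\<exists>y\<in>range scal. x * y = 1 \<and> y * x = 1" if "x \<noteq> 0"
  proof -
    have "c \<noteq> 0" using that c scal_0 by auto
    then show ?thesis unfolding c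
      by (intro bexI[of _ "scal (inverse c)"]) (simp_all add: scal_1 flip: scal_mult)
  qed
  fix y assume "y \<in> range (scal :: 'k \<Rightarrow> ('k, 'n) sqmat)"
  then obtain d where d: "y = scal d" by blast
  have "x - y = scal (c - d)" unfolding c d by (rule sqmat_eqI) auto
  then show "x - y \<in> range scal" by blast
  show "x * y \<in> range scal" unfolding c d scal_mult[symmetric] by blast
qed

lemma tr_mult: "tr (A * B) = tr B * tr A"
  by transfer (rule matrix_transpose_mul)

lemma tr_tr: "tr (tr A) = A" by (rule sqmat_eqI) auto
lemma tr_scal: "tr (scal c) = scal c" by (rule sqmat_eqI) auto
lemma tr_add: "tr (A + B) = tr A + tr B" by (rule sqmat_eqI) auto
lemma tr_1: "tr 1 = 1" using tr_scal[of 1] by (simp add: scal_1)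

text \<open>Commuting with the matrix units kills the off-diagonal entries and makes the diagonal
  constant.\<close>

lemma sqmat_center:
  fixes Z :: "('k::field, 'n::finite) sqmat"
  assumes "\<And>X. Z * X = X * Z"
  shows "\<exists>x. Z = scal x"
proof -
  have *: "ent Z i a = (if i = a then ent Z b b else 0)" for i a b
  proof -
    have "ent (Z * unit a b) i b = ent Z i a"
      unfolding ent_mult by (simp add: if_distrib[of "\<lambda>x. _ * x"] cong: if_cong)
    moreover have "ent (unit a b * Z) i b = (if i = a then ent Z b b else 0)"
      unfolding ent_mult by (simp add: if_distrib[of "\<lambda>x. x * _"] cong: if_cong conj_cong)
    ultimately show ?thesis using assms[of "unit a b"] by simp
  qed
  have "Z = scal (ent Z undefined undefined)" by (rule sqmat_eqI) (subst *[of _ _ undefined], simp)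
  then show ?thesis by blast
qed

interpretation SQ: rmod "(*) :: ('k::field, 'n::finite) sqmat \<Rightarrow> ('k, 'n) sqmat \<Rightarrow> ('k, 'n) sqmat"
  by (rule rmod_times)

lemma sqmat_dim:
  "fdim (*) (range scal) (CARD('n) * CARD('n)) (UNIV :: ('k::field, 'n::finite) sqmat set)"
proof -
  let ?N = "CARD('n) * CARD('n)"
  have "card (UNIV :: ('n \<times> 'n) set) = ?N" by (simp flip: UNIV_Times_UNIV add: card_cartesian_product)
  then obtain f where f: "bij_betw f {..<?N} (UNIV :: ('n \<times> 'n) set)"
    using ex_bij_betw_nat_finite[of "UNIV :: ('n \<times> 'n) set"] by (auto simp: atLeast0LessThan)
  let ?u = "\<lambda>i. unit (fst (f i)) (snd (f i)) :: ('k, 'n) sqmat"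
  have ent: "ent (\<Sum>i<?N. ?u i * scal (c (f i))) a b = c (a, b)" for c :: "'n \<times> 'n \<Rightarrow> 'k" and a b
  proof -
    have "ent (\<Sum>i<?N. ?u i * scal (c (f i))) a b = (\<Sum>i<?N. if f i = (a, b) then c (f i) else 0)"
      unfolding ent_sum ent_scal_right by (intro sum.cong) (auto simp: prod_eq_iff)
    also have "\<dots> = (\<Sum>x\<in>UNIV. if x = (a, b) then c x else 0)"
      by (rule sum.reindex_bij_betw[OF f, of "\<lambda>x. if x = (a, b) then c x else 0"])
    finally show ?thesis by simp
  qed
  have "fdim (*) (range scal) ?N {\<Sum>i<?N. ?u i * c i | c. \<forall>i. c i \<in> range scal}"
  proof (rule SQ.fdim_of_basis[OF scal_divring])
    fix c assume c: "\<forall>i<?N. c i \<in> (range scal :: ('k, 'n) sqmat set)" "(\<Sum>i<?N. ?u i * c i) = 0"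
    define d where "d = (\<lambda>i. SOME x. c i = scal x)"
    have d: "c i = scal (d i)" if "i < ?N" for i
      unfolding d_def using c(1) that by (intro someI_ex[of "\<lambda>x. c i = scal x"]) auto
    define e where "e = (\<lambda>x. d (inv_into {..<?N} f x))"
    have e: "e (f i) = d i" if "i < ?N" for i
      unfolding e_def using f that by (simp add: bij_betw_inv_into_left)
    have "(\<Sum>i<?N. ?u i * scal (e (f i))) = 0"
      unfolding c(2)[symmetric] by (intro sum.cong) (auto simp: d e)
    then have "e x = 0" for x using ent[of e "fst x" "snd x"] by simp
    then show "\<forall>i<?N. c i = 0" using d e by (metis scal_0)
  qed
  moreover have "{\<Sum>i<?N. ?u i * c i | c. \<forall>i. c i \<in> range scal} = UNIV"
  proof -
    have "X \<in> {\<Sum>i<?N. ?u i * c i | c. \<forall>i. c i \<in> range scal}" for X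
    proof -
      have "X = (\<Sum>i<?N. ?u i * scal ((\<lambda>x. ent X (fst x) (snd x)) (f i)))"
        by (rule sqmat_eqI) (subst ent, simp)
      then show ?thesis by (intro CollectI exI[of _ "\<lambda>i. scal ((\<lambda>x. ent X (fst x) (snd x)) (f i))"]) auto
    qed
    then show ?thesis by blast
  qed
  ultimately show ?thesis by simp
qed

lemma ent_alternating_unit:
  "ent ((unit p q - unit q p) * scal c) a b = (if (p, q) = (a, b) then c else 0) - (if (p, q) = (b, a) then c else 0)"
proof -
  have *: "((if P then 1 else 0) - (if Q then 1 else 0)) * c = (if P then c else 0) - (if Q then c else 0)" for P Q
    by simp
  have "(a = p \<and> b = q) = ((p, q) = (a, b))" "(a = q \<and> b = p) = ((p, q) = (b, a))" by blast+
  then show ?thesis unfolding ent_scal_right ent_simps(3,6) * by (simp only:)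
qed

text \<open>As 2 is invertible the diagonal vanishes, and the 8 * 7 / 2 = 28 entries above it
  determine the matrix. "Above" refers to the numbering \<open>g\<close> of the index type.\<close>

lemma alternating_dim:
  assumes two: "(2::'k::field) \<noteq> 0"
  shows "\<exists>m\<le>28. fdim (*) (range scal) m {X :: ('k, 8) sqmat. tr X = - X}"
proof -
  obtain g :: "8 \<Rightarrow> nat" where g: "bij_betw g (UNIV :: 8 set) {0..<8}"
    using ex_bij_betw_finite_nat[of "UNIV :: 8 set"] by auto
  have ginj: "g a = g b \<Longrightarrow> a = b" for a b using g by (auto simp: bij_betw_def inj_on_def)
  let ?P = "{x :: 8 \<times> 8. g (fst x) < g (snd x)}"
  have "bij_betw (\<lambda>x. (g (snd x), g (fst x))) ?P (SIGMA y:{0..<8}. {0..<y})"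
  proof (rule bij_betwI')
    show "(g (snd x), g (fst x)) = (g (snd y), g (fst y)) \<longleftrightarrow> x = y" for x y
      using ginj by (auto simp: prod_eq_iff)
    show "(g (snd x), g (fst x)) \<in> (SIGMA y:{0..<8}. {0..<y})" if "x \<in> ?P" for x
      using that g by (auto simp: bij_betw_def)
    show "\<exists>x\<in>?P. y = (g (snd x), g (fst x))" if y: "y \<in> (SIGMA y:{0..<8}. {0..<y})" for y
    proof -
      have "fst y \<in> range g" "snd y \<in> range g" using y g by (auto simp: bij_betw_def)
      then obtain a b where "fst y = g a" "snd y = g b" by blast
      then show ?thesis using y by (intro bexI[of _ "(b, a)"]) (auto simp: prod_eq_iff)
    qed
  qed
  then have "card ?P = card (SIGMA y:{0..<8::nat}. {0..<y})" by (rule bij_betw_same_card)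
  also have "\<dots> = 28" by (simp add: card_SigmaI eval_nat_numeral)
  finally have P: "card ?P = 28" .
  then obtain f :: "nat \<Rightarrow> 8 \<times> 8" where f: "bij_betw f {..<28} ?P"
    using ex_bij_betw_nat_finite[of ?P] by (auto simp: atLeast0LessThan)
  let ?u = "\<lambda>i. unit (fst (f i)) (snd (f i)) - unit (snd (f i)) (fst (f i)) :: ('k, 8) sqmat"
  let ?S = "{\<Sum>i<28. ?u i * c i | c. \<forall>i. c i \<in> range scal}"
  have sub: "{X :: ('k, 8) sqmat. tr X = - X} \<subseteq> ?S"
  proof
    fix X :: "('k, 8) sqmat" assume "X \<in> {X. tr X = - X}"
    then have X: "tr X = - X" by simp
    have skew: "ent X j i = - ent X i j" for i j using arg_cong[OF X, of "\<lambda>A. ent A i j"] by simp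
    have diag: "ent X i i = 0" for i
    proof -
      have "2 * ent X i i = 0" using skew[of i i] by (simp add: eq_neg_iff_add_eq_0)
      then show ?thesis using two by simp
    qed
    let ?c = "\<lambda>x. ent X (fst x) (snd x)"
    have "X = (\<Sum>i<28. ?u i * scal (?c (f i)))"
    proof (rule sqmat_eqI)
      fix a b
      have "ent (\<Sum>i<28. ?u i * scal (?c (f i))) a b
        = (\<Sum>i<28. (\<lambda>x. (if x = (a, b) then ?c x else 0) - (if x = (b, a) then ?c x else 0)) (f i))"
        unfolding ent_sum by (intro sum.cong refl) (simp only: ent_alternating_unit prod.collapse)
      also have "\<dots> = (\<Sum>x\<in>?P. (if x = (a, b) then ?c x else 0) - (if x = (b, a) then ?c x else 0))"
        by (rule sum.reindex_bij_betw[OF f, of "\<lambda>x. (if x = (a, b) then ?c x else 0) - (if x = (b, a) then ?c x else 0)"])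
      also have "\<dots> = (if g a < g b then ent X a b else 0) - (if g b < g a then ent X b a else 0)"
        by (simp add: sum_subtractf)
      also have "\<dots> = ent X a b"
      proof (cases "a = b")
        case False
        then have "g a \<noteq> g b" using ginj by blast
        then show ?thesis using skew[of b a] by auto
      qed (simp add: diag)
      finally show "ent X a b = ent (\<Sum>i<28. ?u i * scal (?c (f i))) a b" by simp
    qed
    then show "X \<in> ?S" by (intro CollectI exI[of _ "\<lambda>i. scal (?c (f i))"]) auto
  qed
  obtain m where m: "m \<le> 28" "fdim (*) (range scal) m ?S"
    using SQ.fdim_span_le[OF scal_divring, of 28 ?u] by (elim exE conjE) (rule that)
  have sm: "submod (*) (range scal) {X :: ('k, 8) sqmat. tr X = - X}"
    unfolding submod_def by (auto simp: tr_mult tr_scal tr_add scal_central intro!: sqmat_eqI)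
  obtain m' where "m' \<le> m" "fdim (*) (range scal) m' {X :: ('k, 8) sqmat. tr X = - X}"
    using SQ.fdim_submodule[OF m(2) scal_divring sm sub] .
  then show ?thesis using m(1) by (intro exI[of _ m']) simp
qed

section \<open>Existence of a square-central element\<close>

locale deg8 =
  fixes \<iota> :: "'a::field \<Rightarrow> 'd::division_ring"
    and \<gamma> :: "'d \<Rightarrow> 'd"
    and \<kappa> :: "'a \<Rightarrow> 'k::field"
    and \<phi> :: "'d \<Rightarrow> 'k^8^8"
  assumes char: "(2::'a) \<noteq> 0"
    and D: "central_division_algebra_deg8 \<iota>"
    and inv: "F_linear_involution \<iota> \<gamma>"
    and split: "splitting_deg8 \<iota> \<kappa> \<phi>"
    and orth: "orthogonal_wrt \<phi> \<gamma>"
begin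

abbreviation F :: "'d set" where "F \<equiv> range \<iota>"

lemma iota_1: "\<iota> 1 = 1" and iota_add: "\<iota> (x + y) = \<iota> x + \<iota> y" and iota_mult: "\<iota> (x * y) = \<iota> x * \<iota> y"
  and F_center: "{z. \<forall>d. z * d = d * z} = F"
  using D unfolding central_division_algebra_deg8_def central_algebra_hom_def by auto

lemma iota_0: "\<iota> 0 = 0" using iota_add[of 0 0] by simp
lemma iota_diff: "\<iota> (x - y) = \<iota> x - \<iota> y" using iota_add[of "x - y" y] by simp

lemma iota_eq_0:
  assumes "\<iota> x = 0" shows "x = 0"
proof (rule ccontr)
  assume "x \<noteq> 0"
  then have "\<iota> (x * inverse x) = 1" by (simp add: iota_1)
  then show False using assms by (simp add: iota_mult)
qed

lemma F_comm: "c \<in> F \<Longrightarrow> c * x = x * c" using F_center by blast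

lemma F_divring: "divring F"
  unfolding divring_def
proof (intro conjI ballI impI)
  show "1 \<in> F" using iota_1 by (metis rangeI)
  fix x assume "x \<in> F"
  then obtain c where c: "x = \<iota> c" by blast
  show "\<exists>y\<in>F. x * y = 1 \<and> y * x = 1" if "x \<noteq> 0"
  proof -
    have "c \<noteq> 0" using that c iota_0 by auto
    then show ?thesis unfolding c
      by (intro bexI[of _ "\<iota> (inverse c)"]) (simp_all add: iota_1 flip: iota_mult)
  qed
  fix y assume "y \<in> F"
  then obtain d where d: "y = \<iota> d" by blast
  show "x - y \<in> F" unfolding c d iota_diff[symmetric] by blast
  show "x * y \<in> F" unfolding c d iota_mult[symmetric] by blast
qed

interpretation R: rmod "(*) :: 'd \<Rightarrow> 'd \<Rightarrow> 'd" by (rule rmod_times)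

lemma F_select:
  fixes c :: "nat \<Rightarrow> 'd"
  obtains d where "\<And>i. c i \<in> F \<Longrightarrow> c i = \<iota> (d i)"
proof -
  have "\<forall>i. \<exists>x. c i \<in> F \<longrightarrow> c i = \<iota> x" by blast
  then show thesis using that by metis
qed

lemma dim_D: "fdim (*) F 64 (UNIV :: 'd set)"
proof -
  obtain e :: "nat \<Rightarrow> 'd" where e: "\<forall>d. \<exists>!c. (\<forall>i\<ge>64. c i = 0) \<and> d = (\<Sum>i<64. \<iota> (c i) * e i)"
    using D unfolding central_division_algebra_deg8_def algebra_dim_def by blast
  have sw: "(\<Sum>i<64. \<iota> (c i) * e i) = (\<Sum>i<64. e i * \<iota> (c i))" for c
    by (intro sum.cong refl F_comm) auto
  have "fdim (*) F 64 {\<Sum>i<64. e i * c i | c. \<forall>i. c i \<in> F}"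
  proof (rule R.fdim_of_basis[OF F_divring])
    fix c assume c: "\<forall>i<64. c i \<in> F" "(\<Sum>i<64. e i * c i) = 0"
    obtain d where d: "\<And>i. c i \<in> F \<Longrightarrow> c i = \<iota> (d i)" using F_select[of c] by blast
    let ?d = "\<lambda>i. if i < 64 then d i else 0"
    have "(\<Sum>i<64. \<iota> (?d i) * e i) = (\<Sum>i<64. e i * c i)"
      unfolding sw by (intro sum.cong refl) (use c(1) d in auto)
    moreover define P where "P = (\<lambda>c :: nat \<Rightarrow> 'a. (\<forall>i\<ge>64. c i = 0) \<and> 0 = (\<Sum>i<64. \<iota> (c i) * e i))"
    ultimately have "P ?d" "P (\<lambda>_. 0)" using c(2) by (simp_all add: iota_0)
    moreover have "\<exists>!c. P c" using e unfolding P_def by blast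
    ultimately have "?d = (\<lambda>_. 0)" by blast
    then have "?d i = 0" for i by (rule fun_cong)
    then have "d i = 0" if "i < 64" for i using that by (metis (full_types))
    then show "\<forall>i<64. c i = 0" using c(1) d iota_0 by metis
  qed
  moreover have "x \<in> {\<Sum>i<64. e i * c i | c. \<forall>i. c i \<in> F}" for x
  proof -
    obtain c where "x = (\<Sum>i<64. \<iota> (c i) * e i)" using e by metis
    then show ?thesis unfolding sw by (intro CollectI exI[of _ "\<lambda>i. \<iota> (c i)"]) auto
  qed
  then have "{\<Sum>i<64. e i * c i | c. \<forall>i. c i \<in> F} = UNIV" by blast
  ultimately show ?thesis by simp
qed

lemma two_D: "(2::'d) \<noteq> 0"
proof
  assume "(2::'d) = 0"
  then have "\<iota> (1 + 1) = 0" unfolding iota_add iota_1 by simp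
  then have "(1::'a) + 1 = 0" by (rule iota_eq_0)
  then show False using char by simp
qed

sublocale C: csa64 F "UNIV :: 'd set"
proof
  show "divring F" by (rule F_divring)
  have "\<exists>y. x * y = 1 \<and> y * x = 1" if "x \<noteq> 0" for x :: 'd
    using that by (intro exI[of _ "inverse x"]) simp
  then show "divring (UNIV :: 'd set)" unfolding divring_def by simp
  show "z \<in> F" if "\<And>x. x \<in> UNIV \<Longrightarrow> z * x = x * z" for z using that F_center by blast
qed (use F_comm dim_D two_D in auto)

lemma gamma_add: "\<gamma> (x + y) = \<gamma> x + \<gamma> y" and gamma_mult: "\<gamma> (x * y) = \<gamma> y * \<gamma> x"
  and gamma_gamma: "\<gamma> (\<gamma> x) = x" and gamma_iota_mult: "\<gamma> (\<iota> c * x) = \<iota> c * \<gamma> x"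
  using inv unfolding F_linear_involution_def by auto

lemma gamma_1: "\<gamma> 1 = 1"
proof -
  have "\<gamma> (\<gamma> 1 * 1) = \<gamma> 1 * \<gamma> (\<gamma> 1)" by (rule gamma_mult)
  then show ?thesis by (simp add: gamma_gamma)
qed

lemma gamma_F: "e \<in> F \<Longrightarrow> \<gamma> e = e"
  using gamma_iota_mult[of _ 1] by (auto simp: gamma_1)

sublocale G: csa_inv F "UNIV :: 'd set" \<gamma>
  by unfold_locales (auto simp: gamma_add gamma_mult gamma_gamma gamma_F)

lemma kappa_1: "\<kappa> 1 = 1" and kappa_add: "\<kappa> (a + b) = \<kappa> a + \<kappa> b" and kappa_mult: "\<kappa> (a * b) = \<kappa> a * \<kappa> b"
  and phi_add: "\<phi> (x + y) = \<phi> x + \<phi> y" and phi_mult: "\<phi> (x * y) = \<phi> x ** \<phi> y"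
  and phi_iota: "\<phi> (\<iota> a) = mat (\<kappa> a)"
  and phi_span: "\<exists>N (k :: nat \<Rightarrow> 'k) (d :: nat \<Rightarrow> 'd). M = (\<Sum>i<N. mat (k i) ** \<phi> (d i))"
  using split unfolding splitting_deg8_def by auto

lemma kappa_0: "\<kappa> 0 = 0" using kappa_add[of 0 0] by (metis add.right_neutral add_left_cancel)

lemma kappa_eq_0:
  assumes "\<kappa> x = 0" shows "x = 0"
proof (rule ccontr)
  assume "x \<noteq> 0"
  then have "\<kappa> (x * inverse x) = 1" by (simp add: kappa_1)
  then show False using assms by (simp add: kappa_mult)
qed

lemma two_K: "(2::'k) \<noteq> 0"
proof
  assume "(2::'k) = 0"
  then have "\<kappa> (1 + 1) = 0" unfolding kappa_add kappa_1 by simp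
  then have "(1::'a) + 1 = 0" by (rule kappa_eq_0)
  then show False using char by simp
qed

lemma two_ac: "(2::'k alg_closure) \<noteq> 0"
proof -
  have "(2::'k alg_closure) = to_ac 2" by simp
  then show ?thesis using two_K by (simp only: to_ac_eq_0_iff not_False_eq_True)
qed

text \<open>Entries move to the algebraic closure of the splitting field, where all square roots
  exist, as \<open>split_algebra\<close> demands.\<close>

definition mapm :: "'k^8^8 \<Rightarrow> ('k alg_closure, 8) sqmat" where
  "mapm A = Abs_sqmat (\<chi> i j. to_ac (vec_nth (vec_nth A i) j))"

lemma ent_mapm: "ent (mapm A) i j = to_ac (vec_nth (vec_nth A i) j)"
  unfolding mapm_def ent.rep_eq by (simp add: Abs_sqmat_inverse)

lemma mapm_add: "mapm (A + B) = mapm A + mapm B"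
  by (rule sqmat_eqI) (simp add: ent_mapm)

lemma mapm_mult: "mapm (A ** B) = mapm A * mapm B"
  by (rule sqmat_eqI) (simp add: ent_mapm ent_mult matrix_matrix_mult_def to_ac_sum)

lemma mapm_mat: "mapm (mat c) = scal (to_ac c)"
  by (rule sqmat_eqI) (simp add: ent_mapm mat_def)

lemma mapm_transpose: "mapm (transpose A) = tr (mapm A)"
  by (rule sqmat_eqI) (simp add: ent_mapm transpose_def)

lemma mapm_0: "mapm 0 = 0" using mapm_add[of 0 0] by simp

lemma mapm_sum: "mapm (sum f I) = (\<Sum>i\<in>I. mapm (f i))"
  by (induction I rule: infinite_finite_induct) (auto simp: mapm_0 mapm_add)

definition \<Psi> :: "'d \<Rightarrow> ('k alg_closure, 8) sqmat" where "\<Psi> d = mapm (\<phi> d)"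

lemma Psi_add: "\<Psi> (x + y) = \<Psi> x + \<Psi> y" and Psi_mult: "\<Psi> (x * y) = \<Psi> x * \<Psi> y"
  and Psi_iota: "\<Psi> (\<iota> a) = scal (to_ac (\<kappa> a))"
  unfolding \<Psi>_def by (simp_all add: phi_add phi_mult phi_iota mapm_add mapm_mult mapm_mat)

lemma Psi_0: "\<Psi> 0 = 0" using Psi_add[of 0 0] by simp
lemma Psi_1: "\<Psi> 1 = 1" using Psi_iota[of 1] by (simp add: iota_1 kappa_1 scal_1)
lemma Psi_minus: "\<Psi> (- x) = - \<Psi> x"
  using Psi_add[of x "- x"] by (simp add: Psi_0 eq_neg_iff_add_eq_0 add.commute)
lemma Psi_sum: "\<Psi> (sum f I) = (\<Sum>i\<in>I. \<Psi> (f i))"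
  by (induction I rule: infinite_finite_induct) (auto simp: Psi_0 Psi_add)

lemma Psi_inj:
  assumes "\<Psi> x = 0" shows "x = 0"
proof (rule ccontr)
  assume "x \<noteq> 0"
  then have "\<Psi> (x * inverse x) = 1" by (simp add: Psi_1)
  then show False using assms by (simp add: Psi_mult)
qed

lemma Psi_comb: "\<Psi> (\<Sum>i<n. z i * \<iota> (c i)) = (\<Sum>i<n. \<Psi> (z i) * scal (to_ac (\<kappa> (c i))))"
  by (simp add: Psi_sum Psi_mult Psi_iota)

text \<open>The images of \<open>D\<close> already span over the splitting field, so the matrix
  units are combinations of the \<open>\<Psi> (z i)\<close>; and the matrix units span over the
  closure.\<close>

lemma Psi_span:
  fixes z :: "nat \<Rightarrow> 'd"
  assumes z: "\<And>x. \<exists>c. x = (\<Sum>i<64. z i * \<iota> (c i))"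
  shows "\<exists>c. X = (\<Sum>i<64. \<Psi> (z i) * scal (c i))"
proof -
  define S where "S = {\<Sum>i<64::nat. \<Psi> (z i) * scal (c i) | c. True}"
  have S_I: "(\<Sum>i<64. \<Psi> (z i) * scal (c i)) \<in> S" for c unfolding S_def by blast
  have S_add: "x + y \<in> S" if xy: "x \<in> S" "y \<in> S" for x y
  proof -
    obtain c d where "x = (\<Sum>i<64. \<Psi> (z i) * scal (c i))" "y = (\<Sum>i<64. \<Psi> (z i) * scal (d i))"
      using xy unfolding S_def by auto
    then have "x + y = (\<Sum>i<64. \<Psi> (z i) * scal (c i + d i))"
      by (simp add: scal_add distrib_left sum.distrib)
    then show ?thesis using S_I by simp
  qed
  have S_scal: "x * scal a \<in> S" if x: "x \<in> S" for x a
  proof -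
    obtain c where "x = (\<Sum>i<64. \<Psi> (z i) * scal (c i))" using x unfolding S_def by auto
    then have "x * scal a = (\<Sum>i<64. \<Psi> (z i) * scal (c i * a))"
      by (simp add: scal_mult sum_distrib_right mult.assoc)
    then show ?thesis using S_I by simp
  qed
  have S_0: "0 \<in> S" using S_I[of "\<lambda>_. 0"] by (simp add: scal_0)
  have S_sum: "sum f I \<in> S" if "\<And>i. i \<in> I \<Longrightarrow> f i \<in> S" for f and I :: "'i set"
    using that by (induction I rule: infinite_finite_induct) (auto simp: S_0 S_add)
  have S_Psi: "\<Psi> d \<in> S" for d
  proof -
    obtain c where c: "d = (\<Sum>i<64. z i * \<iota> (c i))" using z by blast
    show ?thesis unfolding c Psi_comb by (rule S_I)
  qed
  have S_mapm: "mapm M \<in> S" for M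
  proof -
    obtain N and k :: "nat \<Rightarrow> 'k" and d :: "nat \<Rightarrow> 'd" where M: "M = (\<Sum>i<N. mat (k i) ** \<phi> (d i))"
      using phi_span by blast
    have "mapm M = (\<Sum>i<N. \<Psi> (d i) * scal (to_ac (k i)))"
      unfolding M mapm_sum mapm_mult mapm_mat \<Psi>_def by (simp add: scal_central)
    then show ?thesis using S_sum[of "{..<N}" "\<lambda>i. \<Psi> (d i) * scal (to_ac (k i))"] S_scal[OF S_Psi] by simp
  qed
  have S_unit: "unit a b \<in> S" for a b
  proof -
    have "unit a b = mapm (\<chi> i j. if i = a \<and> j = b then 1 else 0)"
      by (rule sqmat_eqI) (simp add: ent_mapm)
    then show ?thesis using S_mapm by simp
  qed
  have "X = (\<Sum>a\<in>UNIV. \<Sum>b\<in>UNIV. unit a b * scal (ent X a b))"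
  proof (rule sqmat_eqI)
    fix i j
    have "ent (\<Sum>a\<in>UNIV. \<Sum>b\<in>UNIV. unit a b * scal (ent X a b)) i j
      = (\<Sum>a\<in>UNIV. \<Sum>b\<in>UNIV. if a = i then (if b = j then ent X a b else 0) else 0)"
      unfolding ent_sum ent_scal_right by (intro sum.cong refl) simp
    also have "\<dots> = (\<Sum>a\<in>UNIV. if a = i then ent X a j else 0)"
      by (intro sum.cong refl) simp
    also have "\<dots> = ent X i j" by simp
    finally show "ent X i j = ent (\<Sum>a\<in>UNIV. \<Sum>b\<in>UNIV. unit a b * scal (ent X a b)) i j" by simp
  qed
  also have "\<dots> \<in> S" by (intro S_sum S_scal S_unit)
  finally show ?thesis unfolding S_def by auto
qed

text \<open>By \<open>Psi_span\<close> these 64 elements span a space of dimension 64.\<close>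

lemma Psi_indep:
  fixes z :: "nat \<Rightarrow> 'd"
  assumes z: "\<And>x. \<exists>c. x = (\<Sum>i<64. z i * \<iota> (c i))" and c: "(\<Sum>i<64. \<Psi> (z i) * scal (c i)) = 0" and i: "i < 64"
  shows "c i = 0"
proof -
  have dim: "fdim (*) (range scal) 64 (UNIV :: ('k alg_closure, 8) sqmat set)"
    using sqmat_dim[where ?'k = "'k alg_closure" and ?'n = 8] by simp
  have "X \<in> {\<Sum>i<64. \<Psi> (z i) * c i | c. \<forall>i. c i \<in> range scal}" for X
  proof -
    obtain c where "X = (\<Sum>i<64. \<Psi> (z i) * scal (c i))" using Psi_span[OF z] by blast
    then show ?thesis by (intro CollectI exI[of _ "\<lambda>i. scal (c i)"]) auto
  qed
  then have sub: "UNIV \<subseteq> {\<Sum>i<64. \<Psi> (z i) * c i | c. \<forall>i. c i \<in> range scal}" by blast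
  have "(scal (c i) :: ('k alg_closure, 8) sqmat) = 0"
    using SQ.spanning_independent[OF scal_divring dim sub, of "\<lambda>i. scal (c i)" i] c i by simp
  then have "ent (scal (c i) :: ('k alg_closure, 8) sqmat) 0 0 = 0" by simp
  then show ?thesis by simp
qed

lemma form_matrix:
  obtains S T where "tr S = S" "S * T = 1" "T * S = 1" "\<forall>d. \<Psi> (\<gamma> d) = T * tr (\<Psi> d) * S"
proof -
  obtain S :: "'k^8^8" where S: "transpose S = S" "invertible S" "\<forall>d. \<phi> (\<gamma> d) = matrix_inv S ** transpose (\<phi> d) ** S"
    using orth unfolding orthogonal_wrt_def by blast
  have "S ** matrix_inv S = mat 1 \<and> matrix_inv S ** S = mat 1"
    using S(2) unfolding invertible_def matrix_inv_def by (rule someI_ex)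
  then have "mapm S * mapm (matrix_inv S) = 1" "mapm (matrix_inv S) * mapm S = 1"
    by (simp_all add: mapm_mat scal_1 flip: mapm_mult)
  moreover have "tr (mapm S) = mapm S" using S(1) by (simp flip: mapm_transpose)
  moreover have "\<Psi> (\<gamma> d) = mapm (matrix_inv S) * tr (\<Psi> d) * mapm S" for d
    unfolding \<Psi>_def using S(3) by (simp add: mapm_mult mapm_transpose)
  ultimately show thesis using that by blast
qed

lemma sym_skew_basis:
  obtains z r where "r \<le> 64" "\<forall>i<r. z i \<in> G.Sym" "\<forall>i. r \<le> i \<longrightarrow> i < 64 \<longrightarrow> z i \<in> G.Skew"
    "\<forall>x. \<exists>c. x = (\<Sum>i<64. z i * \<iota> (c i))" "fdim (*) F r G.Sym" "fdim (*) F (64 - r) G.Skew"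
proof -
  obtain r where r: "fdim (*) F r G.Sym" using C.submod_fdim[OF G.Sym_submod] by blast
  obtain k where k: "fdim (*) F k G.Skew" using C.submod_fdim[OF G.Skew_submod] by blast
  have "fdim (*) F (r + k) {x + y | x y. x \<in> G.Sym \<and> y \<in> G.Skew}"
    by (rule R.fdim_direct_sum[OF k r F_divring]) (use G.Sym_Skew_zero in blast)
  then have "fdim (*) F (r + k) UNIV" using G.Sym_Skew_sum by simp
  then have rk: "r + k = 64" using R.fdim_unique[OF dim_D _ F_divring] by blast
  obtain x where x: "\<forall>i<r. x i \<in> G.Sym" "G.Sym = {\<Sum>i<r. x i * c i | c. \<forall>i. c i \<in> F}"
    by (rule R.fdim_basisE[OF r F_divring])
  obtain y where y: "\<forall>i<k. y i \<in> G.Skew" "G.Skew = {\<Sum>i<k. y i * c i | c. \<forall>i. c i \<in> F}"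
    by (rule R.fdim_basisE[OF k F_divring])
  let ?z = "\<lambda>i. if i < r then x i else y (i - r)"
  have "\<exists>c. w = (\<Sum>i<64. ?z i * \<iota> (c i))" for w
  proof -
    have "w \<in> {x + y | x y. x \<in> G.Sym \<and> y \<in> G.Skew}" using G.Sym_Skew_sum by blast
    then obtain u v where w: "w = u + v" "u \<in> G.Sym" "v \<in> G.Skew" by blast
    obtain c where c: "u = (\<Sum>i<r. x i * c i)" "\<forall>i. c i \<in> F" using w(2) unfolding x(2) by auto
    obtain d where d: "v = (\<Sum>i<k. y i * d i)" "\<forall>i. d i \<in> F" using w(3) unfolding y(2) by auto
    obtain c' where c': "\<And>i. c i \<in> F \<Longrightarrow> c i = \<iota> (c' i)" using F_select[of c] by blast
    obtain d' where d': "\<And>i. d i \<in> F \<Longrightarrow> d i = \<iota> (d' i)" using F_select[of d] by blast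
    let ?c = "\<lambda>i. if i < r then c' i else d' (i - r)"
    have "(\<Sum>i<64. ?z i * \<iota> (?c i)) = (\<Sum>i<r. ?z i * \<iota> (?c i)) + (\<Sum>i=r..<r + k. ?z i * \<iota> (?c i))"
      unfolding rk[symmetric] by (subst sum.atLeastLessThan_concat[of 0 r "r + k", symmetric, unfolded atLeast0LessThan]) auto
    also have "(\<Sum>i<r. ?z i * \<iota> (?c i)) = u" unfolding c(1) using c(2) c' by (intro sum.cong) auto
    also have "(\<Sum>i=r..<r + k. ?z i * \<iota> (?c i)) = (\<Sum>i<k. ?z (i + r) * \<iota> (?c (i + r)))"
      using sum.shift_bounds_nat_ivl[of "\<lambda>i. ?z i * \<iota> (?c i)" 0 r k] by (simp add: atLeast0LessThan add.commute)
    also have "\<dots> = v" unfolding d(1) using d(2) d' by (intro sum.cong) auto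
    finally show ?thesis using w(1) by (intro exI[of _ ?c]) simp
  qed
  moreover have "k = 64 - r" "r \<le> 64" using rk by auto
  moreover have "?z i \<in> G.Sym" if "i < r" for i using x(1) that by simp
  moreover have "?z i \<in> G.Skew" if "r \<le> i" "i < 64" for i using y(1) that rk by simp
  ultimately show thesis using that[of r ?z] r k by blast
qed

text \<open>For skew \<open>d\<close> the matrix \<open>S * \<Psi> d\<close> is alternating, because
  \<open>\<gamma>\<close> is adjoint to the symmetric \<open>S\<close>. A basis of the skew elements
  stays independent over the closure by \<open>Psi_indep\<close>, and alternating matrices have
  dimension at most 28.\<close>

lemma skew_dim_le: "fdim (*) F k G.Skew \<Longrightarrow> k \<le> 28"
proof -
  assume k: "fdim (*) F k G.Skew"
  obtain z r where z: "r \<le> 64" "\<forall>i<r. z i \<in> G.Sym" "\<forall>i. r \<le> i \<longrightarrow> i < 64 \<longrightarrow> z i \<in> G.Skew"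
    "\<forall>x. \<exists>c. x = (\<Sum>i<64. z i * \<iota> (c i))" "fdim (*) F r G.Sym" "fdim (*) F (64 - r) G.Skew"
    by (rule sym_skew_basis)
  have kr: "k = 64 - r" using R.fdim_unique[OF z(6) k F_divring] .
  obtain S T where S: "tr S = S" "S * T = 1" "T * S = 1" "\<forall>d. \<Psi> (\<gamma> d) = T * tr (\<Psi> d) * S"
    by (rule form_matrix)
  let ?b = "\<lambda>i. S * \<Psi> (z (i + r))"
  have "fdim (*) (range scal) k {\<Sum>i<k. ?b i * c i | c. \<forall>i. c i \<in> range scal}"
  proof (rule SQ.fdim_of_basis[OF scal_divring])
    fix c assume c: "\<forall>i<k. c i \<in> range scal" "(\<Sum>i<k. ?b i * c i) = 0"
    define d where "d = (\<lambda>i. SOME x. c i = scal x)"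
    have d: "c i = scal (d i)" if "i < k" for i
      unfolding d_def using c(1) that by (intro someI_ex[of "\<lambda>x. c i = scal x"]) auto
    let ?d = "\<lambda>i. if i < r then 0 else d (i - r)"
    have "(\<Sum>i<64. \<Psi> (z i) * scal (?d i)) = (\<Sum>i=r..<r + k. \<Psi> (z i) * scal (?d i))"
      using z(1) kr by (intro sum.mono_neutral_right) (auto simp: scal_0)
    also have "\<dots> = (\<Sum>i<k. \<Psi> (z (i + r)) * scal (?d (i + r)))"
      using sum.shift_bounds_nat_ivl[of "\<lambda>i. \<Psi> (z i) * scal (?d i)" 0 r k] by (simp add: atLeast0LessThan add.commute)
    also have "\<dots> = (\<Sum>i<k. T * (?b i * c i))"
      using d S(3) by (intro sum.cong refl) (simp flip: mult.assoc)
    also have "\<dots> = 0" using c(2) by (simp flip: sum_distrib_left)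
    finally have 0: "(\<Sum>i<64. \<Psi> (z i) * scal (?d i)) = 0" .
    have "d i = 0" if "i < k" for i
      using Psi_indep[OF spec[OF z(4)] 0, of "i + r"] that kr z(1) by simp
    then show "\<forall>i<k. c i = 0" using d scal_0 by metis
  qed
  moreover have "{\<Sum>i<k. ?b i * c i | c. \<forall>i. c i \<in> range scal} \<subseteq> {X. tr X = - X}"
  proof
    fix X assume "X \<in> {\<Sum>i<k. ?b i * c i | c. \<forall>i. c i \<in> range scal}"
    then obtain c where c: "X = (\<Sum>i<k. ?b i * c i)" "\<forall>i. c i \<in> range scal" by auto
    have tr_sum: "tr (sum f I) = (\<Sum>i\<in>I. tr (f i))" for f and I :: "nat set"
      by (rule sqmat_eqI) (simp add: ent_sum)
    have "tr (?b i * c i) = - (?b i * c i)" if i: "i < k" for i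
    proof -
      have "z (i + r) \<in> G.Skew" using z(1,3) i kr by simp
      then have "\<gamma> (z (i + r)) = - z (i + r)" by (rule G.Skew_J)
      then have "- \<Psi> (z (i + r)) = T * tr (\<Psi> (z (i + r))) * S" using spec[OF S(4), of "z (i + r)"] by (simp add: Psi_minus)
      then have "S * (- \<Psi> (z (i + r))) = (S * T) * tr (\<Psi> (z (i + r))) * S" by (simp add: mult.assoc)
      then have *: "tr (\<Psi> (z (i + r))) * S = - (S * \<Psi> (z (i + r)))" using S(2) by simp
      obtain a where a: "c i = scal a" using c(2) by blast
      have "tr (?b i * c i) = scal a * (tr (\<Psi> (z (i + r))) * S)" unfolding a tr_mult tr_scal S(1) by simp
      then show ?thesis unfolding * a by (simp add: scal_central)
    qed
    then show "X \<in> {X. tr X = - X}" unfolding c(1) by (simp add: tr_sum sum_negf)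
  qed
  moreover obtain m where "m \<le> 28" "fdim (*) (range scal) m {X :: ('k alg_closure, 8) sqmat. tr X = - X}"
    using alternating_dim[OF two_ac] by blast
  ultimately show ?thesis using SQ.fdim_mono[OF _ _ scal_divring] by (meson le_trans)
qed

end

section \<open>Matrix traces, and the twist to symplectic type\<close>

definition sqtrace :: "('k::field, 'n::finite) sqmat \<Rightarrow> 'k" where
  "sqtrace A = (\<Sum>i\<in>UNIV. ent A i i)"

lemma sqtrace_mult_comm: "sqtrace (A * B) = sqtrace (B * A)"
  unfolding sqtrace_def ent_mult by (subst sum.swap) (simp add: mult.commute)

lemma sqtrace_add: "sqtrace (A + B) = sqtrace A + sqtrace B"
  unfolding sqtrace_def by (simp add: sum.distrib)

lemma sqtrace_scal: "sqtrace (A * scal c) = sqtrace A * c"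
  unfolding sqtrace_def ent_scal_right by (simp add: sum_distrib_right)

lemma sqtrace_tr: "sqtrace (tr A) = sqtrace A"
  unfolding sqtrace_def by simp

lemma sqtrace_sum: "sqtrace (sum f I) = (\<Sum>i\<in>I. sqtrace (f i))"
  unfolding sqtrace_def ent_sum by (rule sum.swap)

lemma sqmat_two:
  assumes "(2::'k::field) \<noteq> 0"
  shows "(2 :: ('k, 'n::finite) sqmat) \<noteq> 0"
proof
  assume "(2 :: ('k, 'n) sqmat) = 0"
  then have "(1 :: ('k, 'n) sqmat) + 1 = 0" by simp
  then have "ent ((1 :: ('k, 'n) sqmat) + 1) undefined undefined = 0" by (simp only: ent_simps)
  moreover have "ent ((1 :: ('k, 'n) sqmat) + 1) undefined undefined = 1 + 1"
    by (simp only: ent_simps(2) ent_1 refl if_True)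
  ultimately show False using assms by simp
qed

context deg8
begin

interpretation R: rmod "(*) :: 'd \<Rightarrow> 'd \<Rightarrow> 'd" by (rule rmod_times)

lemma not_commutative: "\<exists>x y :: 'd. x * y \<noteq> y * x"
proof (rule ccontr)
  assume "\<not> ?thesis"
  then have "(64::nat) \<in> {1, 2, 4, 8}"
    by (intro C.comm_dim[OF C.D C.E_sub order_refl _ dim_D]) blast
  then show False by simp
qed

text \<open>Otherwise \<open>\<gamma>\<close> would be the identity, and a map that reverses
  products can be the identity only on a commutative ring.\<close>

lemma skew_nonzero: obtains c where "\<gamma> c = - c" "c \<noteq> 0"
proof -
  have "\<exists>c. \<gamma> c = - c \<and> c \<noteq> 0"
  proof (rule ccontr)
    assume no: "\<not> ?thesis"
    have id: "\<gamma> x = x" for x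
    proof -
      have "\<gamma> (\<gamma> x - x) = - (\<gamma> x - x)" using G.J_diff[of "\<gamma> x" x] by (simp add: gamma_gamma)
      then have "\<gamma> x - x = 0" using no by blast
      then show ?thesis by simp
    qed
    obtain x y :: 'd where "x * y \<noteq> y * x" using not_commutative by blast
    then show False using gamma_mult[of x y] by (simp add: id)
  qed
  then show thesis using that by blast
qed

lemma gamma_inverse: "x \<noteq> 0 \<Longrightarrow> \<gamma> (inverse x) = inverse (\<gamma> x)"
proof -
  assume x: "x \<noteq> 0"
  have "\<gamma> x * \<gamma> (inverse x) = 1" using gamma_mult[of "inverse x" x] x gamma_1 by simp
  then show ?thesis using inverse_unique by metis
qed

lemma Psi_eq_iff: "\<Psi> x = \<Psi> y \<longleftrightarrow> x = y"
proof
  assume "\<Psi> x = \<Psi> y"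
  then have "\<Psi> (x + - y) = 0" unfolding Psi_add Psi_minus by simp
  then have "x + - y = 0" by (rule Psi_inj)
  then show "x = y" by simp
qed simp

text \<open>The twisted involution \<open>d \<mapsto> inverse c * \<gamma> d * c\<close>, with
  \<open>c\<close> skew, is adjoint to the alternating matrix \<open>A = S * \<Psi> c\<close>.
  Multiplication by \<open>inverse c\<close> turns the symmetric elements of \<open>\<gamma>\<close>
  into skew elements of the twist. Their dimension \<open>r\<close> is at least 36, so
  \<open>sym_quad_exists\<close> applies to the image of \<open>D\<close>.\<close>

theorem square_central_exists: "\<exists>i. i \<notin> F \<and> i * i \<in> F"
proof -
  obtain z r where z: "r \<le> 64" "\<forall>i<r. z i \<in> G.Sym" "\<forall>i. r \<le> i \<longrightarrow> i < 64 \<longrightarrow> z i \<in> G.Skew"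
    "\<forall>x. \<exists>c. x = (\<Sum>i<64. z i * \<iota> (c i))" "fdim (*) F r G.Sym" "fdim (*) F (64 - r) G.Skew"
    by (rule sym_skew_basis)
  have r: "36 \<le> r" using skew_dim_le[OF z(6)] by simp
  obtain c where c: "\<gamma> c = - c" "c \<noteq> 0" by (rule skew_nonzero)
  define c' where "c' = inverse c"
  have cc: "c * c' = 1" "c' * c = 1" unfolding c'_def using c by auto
  have gc': "\<gamma> c' = - c'" unfolding c'_def using gamma_inverse[OF c(2)] c by simp
  obtain S T where S: "tr S = S" "S * T = 1" "T * S = 1" "\<forall>d. \<Psi> (\<gamma> d) = T * tr (\<Psi> d) * S"
    by (rule form_matrix)
  define A A' where "A = S * \<Psi> c" and "A' = \<Psi> c' * T"
  have AA: "A * A' = 1" "A' * A = 1"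
  proof -
    have "A * A' = S * \<Psi> (c * c') * T" unfolding A_def A'_def Psi_mult by (simp add: mult.assoc)
    then show "A * A' = 1" using cc S by (simp add: Psi_1)
    have "A' * A = \<Psi> c' * (T * S) * \<Psi> c" unfolding A_def A'_def by (simp add: mult.assoc)
    then show "A' * A = 1" using cc S by (simp add: Psi_1 flip: Psi_mult)
  qed
  have trA: "tr A = - A"
  proof -
    have "T * tr (\<Psi> c) * S = - \<Psi> c" using S(4) c(1) by (metis Psi_minus)
    then have "(S * T) * tr (\<Psi> c) * S = S * (- \<Psi> c)" by (simp add: mult.assoc)
    then show ?thesis unfolding A_def tr_mult S(1) using S(2) by simp
  qed
  have trA': "tr A' = - A'"
  proof -
    have "tr A' * tr A = 1" unfolding tr_mult[symmetric] AA(1) by (rule tr_1)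
    then have "- (tr A' * A) * A' = A'" unfolding trA by simp
    then have "tr A' * A * A' = - A'" by (metis minus_minus mult_minus_left)
    then show ?thesis using AA(1) by (simp add: mult.assoc)
  qed
  define J where "J = (\<lambda>X. A' * tr X * A)"
  \<comment> \<open>The first \<open>r\<close> elements are skew for \<open>J\<close> and the others
    symmetric, since \<open>c'\<close> is skew and multiplication by it exchanges the two
    kinds.\<close>
  define b where "b = (\<lambda>i. \<Psi> (c' * z i))"
  have JPsi: "J (\<Psi> d) = \<Psi> (c' * \<gamma> d * c)" for d
  proof -
    have "J (\<Psi> d) = \<Psi> c' * (T * tr (\<Psi> d) * S) * \<Psi> c" unfolding J_def A_def A'_def by (simp add: mult.assoc)
    also have "T * tr (\<Psi> d) * S = \<Psi> (\<gamma> d)" using S(4) by simp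
    finally show ?thesis by (simp add: Psi_mult)
  qed
  have comb: "\<exists>f. x = (\<Sum>i<64. c' * z i * \<iota> (f i))" for x
  proof -
    obtain f where "c * x = (\<Sum>i<64. z i * \<iota> (f i))" using z(4) by blast
    then have "c' * (c * x) = (\<Sum>i<64. c' * z i * \<iota> (f i))" by (simp add: sum_distrib_left mult.assoc)
    moreover have "c' * (c * x) = x" using cc by (simp flip: mult.assoc)
    ultimately show ?thesis by auto
  qed
  define F0 where "F0 = range (\<lambda>a. to_ac (\<kappa> a))"
  have Psib: "\<exists>f. (\<forall>k. f k \<in> F0) \<and> \<Psi> x = (\<Sum>k<64. b k * scal (f k))" for x
  proof -
    obtain f where f: "x = (\<Sum>i<64. c' * z i * \<iota> (f i))" using comb by blast
    have "\<Psi> x = (\<Sum>k<64. b k * scal (to_ac (\<kappa> (f k))))" unfolding f Psi_comb b_def ..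
    then show ?thesis unfolding F0_def by (intro exI[of _ "\<lambda>k. to_ac (\<kappa> (f k))"]) auto
  qed
  have F0: "divring F0"
    unfolding divring_def
  proof (intro conjI ballI impI)
    show "1 \<in> F0" unfolding F0_def using kappa_1 by (metis rangeI to_ac_1)
    fix x assume "x \<in> F0"
    then obtain u where u: "x = to_ac (\<kappa> u)" unfolding F0_def by blast
    show "\<exists>y\<in>F0. x * y = 1 \<and> y * x = 1" if "x \<noteq> 0"
    proof -
      have "u \<noteq> 0" using that u kappa_0 by auto
      then have "x * to_ac (\<kappa> (inverse u)) = 1" unfolding u by (simp flip: to_ac_mult kappa_mult add: kappa_1)
      then show ?thesis unfolding F0_def by (metis mult.commute rangeI)
    qed
    fix y assume "y \<in> F0"
    then obtain v where v: "y = to_ac (\<kappa> v)" unfolding F0_def by blast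
    have "\<kappa> (u - v) = \<kappa> u - \<kappa> v" using kappa_add[of "u - v" v] by simp
    then have "x - y = to_ac (\<kappa> (u - v))" unfolding u v by simp
    then show "x - y \<in> F0" unfolding F0_def by blast
    have "x * y = to_ac (\<kappa> (u * v))" unfolding u v by (simp add: kappa_mult)
    then show "x * y \<in> F0" unfolding F0_def by blast
  qed
  interpret P: split_algebra scal b F0 J r
  proof
    show "scal x * X = X * scal x" for x and X :: "('k alg_closure, 8) sqmat" by (rule scal_central)
    show "\<exists>f. X = (\<Sum>i<64. b i * scal (f i))" for X unfolding b_def by (rule Psi_span[OF comb])
    show "f i = 0" if "(\<Sum>i<64. b i * scal (f i)) = 0" "i < 64" for f i
      using Psi_indep[OF comb, of f i] that unfolding b_def by blast
    show "\<exists>f. (\<forall>k. f k \<in> F0) \<and> b i * b j = (\<Sum>k<64. b k * scal (f k))" for i j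
      unfolding b_def[THEN fun_cong, of i] b_def[THEN fun_cong, of j] Psi_mult[symmetric] by (rule Psib)
    show "\<exists>f. (\<forall>k. f k \<in> F0) \<and> 1 = (\<Sum>k<64. b k * scal (f k))" using Psib[of 1] unfolding Psi_1 .
    show "\<exists>x. Z = scal x" if "\<And>X. Z * X = X * Z" for Z :: "('k alg_closure, 8) sqmat"
      using sqmat_center that by blast
    show "J (X + Y) = J X + J Y" for X Y unfolding J_def by (simp add: tr_add algebra_simps)
    show "J (X * Y) = J Y * J X" for X Y
    proof -
      have "J Y * J X = A' * tr Y * (A * A') * tr X * A" unfolding J_def by (simp add: mult.assoc)
      then show ?thesis unfolding AA J_def tr_mult by (simp add: mult.assoc)
    qed
    show "J (J X) = X" for X
    proof -
      have "J (J X) = A' * (tr A * X * tr A') * A" unfolding J_def tr_mult tr_tr by (simp add: mult.assoc)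
      also have "\<dots> = (A' * A) * X * (A' * A)" unfolding trA trA' by (simp add: mult.assoc)
      finally show ?thesis unfolding AA by simp
    qed
    show "J (scal x) = scal x" for x
    proof -
      have "J (scal x) = scal x * (A' * A)" unfolding J_def tr_scal by (simp add: mult.assoc scal_central)
      then show ?thesis unfolding AA by simp
    qed
    show "J (b i) = - b i" if "i < r" for i
    proof -
      have "\<gamma> (z i) = z i" using z(2) that G.Sym_J by blast
      then have "\<gamma> (c' * z i) = - (z i * c')" using gc' by (simp add: gamma_mult)
      then have "J (b i) = \<Psi> (- (c' * z i * (c' * c)))" unfolding b_def JPsi by (simp add: mult.assoc)
      then show ?thesis unfolding b_def cc by (simp add: Psi_minus)
    qed
    show "J (b i) = b i" if "r \<le> i" "i < 64" for i
    proof -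
      have "\<gamma> (z i) = - z i" using z(3) that G.Skew_J by blast
      then have "\<gamma> (c' * z i) = z i * c'" using gc' by (simp add: gamma_mult)
      then have "J (b i) = \<Psi> (c' * z i * (c' * c))" unfolding b_def JPsi by (simp add: mult.assoc)
      then show ?thesis unfolding b_def cc by simp
    qed
    show "(2 :: ('k alg_closure, 8) sqmat) \<noteq> 0" by (rule sqmat_two[OF two_ac])
    show "\<exists>y::'k alg_closure. y * y = x" for x
      using nth_root_exists[of 2 x] by (auto simp: power2_eq_square)
  qed (use F0 r z(1) in \<open>auto simp: scal_add scal_mult scal_1\<close>)
  have DE: "P.DE F0 = range \<Psi>"
  proof (intro equalityI subsetI)
    fix x assume "x \<in> P.DE F0"
    then obtain f where f: "x = (\<Sum>i<64. b i * scal (f i))" "\<forall>i. f i \<in> F0" by (rule P.DE_E)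
    have "\<forall>i. \<exists>g. f i = to_ac (\<kappa> g)" using f(2) unfolding F0_def by blast
    then obtain g where g: "\<And>i. f i = to_ac (\<kappa> (g i))" by metis
    have "x = \<Psi> (\<Sum>i<64. c' * z i * \<iota> (g i))" unfolding f(1) Psi_comb b_def g ..
    then show "x \<in> range \<Psi>" by blast
  next
    fix x assume "x \<in> range \<Psi>"
    then obtain d where d: "x = \<Psi> d" by blast
    obtain f where "\<forall>k. f k \<in> F0" "\<Psi> d = (\<Sum>k<64. b k * scal (f k))" using Psib[of d] by auto
    then show "x \<in> P.DE F0" unfolding d using P.DE_I[of f F0] by simp
  qed
  have "divring (P.DE F0)"
    unfolding DE divring_def
  proof (intro conjI ballI impI)
    show "1 \<in> range \<Psi>" using Psi_1 by (metis rangeI)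
    fix x assume "x \<in> range \<Psi>"
    then obtain u where u: "x = \<Psi> u" by blast
    show "\<exists>y\<in>range \<Psi>. x * y = 1 \<and> y * x = 1" if "x \<noteq> 0"
    proof -
      have "u \<noteq> 0" using that u Psi_0 by auto
      then show ?thesis unfolding u
        by (intro bexI[of _ "\<Psi> (inverse u)"]) (simp_all add: Psi_1 flip: Psi_mult)
    qed
    fix y assume "y \<in> range \<Psi>"
    then obtain v where v: "y = \<Psi> v" by blast
    have "x - y = \<Psi> (u + - v)" unfolding u v Psi_add Psi_minus by simp
    then show "x - y \<in> range \<Psi>" by blast
    show "x * y \<in> range \<Psi>" unfolding u v Psi_mult[symmetric] by blast
  qed
  then have "P.sym_quad F0" by (rule P.sym_quad_exists)
  then obtain x where x: "x \<in> P.DE F0" "x \<notin> scal ` F0" "x * x \<in> scal ` F0"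
    unfolding P.sym_quad_def by blast
  obtain d where d: "x = \<Psi> d" using x(1) unfolding DE by blast
  obtain a where a: "x * x = scal (to_ac (\<kappa> a))" using x(3) unfolding F0_def by blast
  have "\<Psi> (d * d) = \<Psi> (\<iota> a)" unfolding Psi_mult Psi_iota d[symmetric] by (rule a)
  then have "d * d \<in> F" unfolding Psi_eq_iff by simp
  moreover have "d \<notin> F"
  proof
    assume "d \<in> F"
    then obtain e where "d = \<iota> e" by blast
    then have "x = scal (to_ac (\<kappa> e))" unfolding d by (simp add: Psi_iota)
    then show False using x(2) unfolding F0_def by blast
  qed
  ultimately show ?thesis by blast
qed

text \<open>The trace of \<open>\<Psi> d\<close> has values in the closure rather than in
  \<open>F\<close>. Its kernel is an \<open>F\<close>-subspace, and an \<open>F\<close>-linear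
  functional that vanishes on the kernel depends on the trace only. A nonzero one has values in
  \<open>F\<close> and inherits symmetry and invariance under \<open>\<gamma>\<close>.\<close>

lemma trace_functional:
  "\<exists>l :: 'd \<Rightarrow> 'd. (\<forall>x. l x \<in> F) \<and> (\<forall>x y. l (x + y) = l x + l y) \<and> (\<forall>x. \<forall>c\<in>F. l (x * c) = l x * c) \<and>
    (\<forall>x y. l (x * y) = l (y * x)) \<and> (\<forall>x. l (\<gamma> x) = l x) \<and> (\<exists>x. l x \<noteq> 0)"
proof -
  define t where "t = (\<lambda>d. sqtrace (\<Psi> d))"
  have t_add: "t (x + y) = t x + t y" for x y unfolding t_def by (simp add: Psi_add sqtrace_add)
  have t_0: "t 0 = 0" using t_add[of 0 0] by (metis add.right_neutral add_left_cancel)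
  have t_scale: "t (x * \<iota> c) = t x * to_ac (\<kappa> c)" for x c
    unfolding t_def by (simp add: Psi_mult Psi_iota sqtrace_scal)
  have t_comm: "t (x * y) = t (y * x)" for x y unfolding t_def by (simp add: Psi_mult sqtrace_mult_comm)
  have t_minus: "t (- x) = - t x" for x using t_add[of x "- x"] t_0 by (simp add: eq_neg_iff_add_eq_0 add.commute)
  have t_gamma: "t (\<gamma> x) = t x" for x
  proof -
    obtain S T where S: "tr S = S" "S * T = 1" "T * S = 1" "\<forall>d. \<Psi> (\<gamma> d) = T * tr (\<Psi> d) * S"
      by (rule form_matrix)
    have "t (\<gamma> x) = sqtrace (S * (T * tr (\<Psi> x)))" unfolding t_def using S(4) by (simp add: sqtrace_mult_comm)
    also have "S * (T * tr (\<Psi> x)) = tr (\<Psi> x)" using S(2) by (simp flip: mult.assoc)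
    finally show ?thesis unfolding t_def by (simp add: sqtrace_tr)
  qed
  let ?N = "{d. t d = 0}"
  have sN: "submod (*) F ?N" unfolding submod_def by (auto simp: t_0 t_add t_scale)
  obtain n where n: "fdim (*) F n ?N" using C.submod_fdim[OF sN] by blast
  \<comment> \<open>Otherwise the trace would vanish on all matrices, as they are spanned by the
    image of \<open>D\<close>; but a diagonal matrix unit has trace 1.\<close>
  have "\<exists>d. t d \<noteq> 0"
  proof (rule ccontr)
    assume no: "\<not> ?thesis"
    obtain z r where z: "r \<le> 64" "\<forall>i<r. z i \<in> G.Sym" "\<forall>i. r \<le> i \<longrightarrow> i < 64 \<longrightarrow> z i \<in> G.Skew"
      "\<forall>x. \<exists>c. x = (\<Sum>i<64. z i * \<iota> (c i))" "fdim (*) F r G.Sym" "fdim (*) F (64 - r) G.Skew"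
      by (rule sym_skew_basis)
    obtain c where c: "unit 0 0 = (\<Sum>i<64. \<Psi> (z i) * scal (c i))" using Psi_span[OF spec[OF z(4)]] by blast
    have "sqtrace (unit 0 0 :: ('k alg_closure, 8) sqmat) = 0"
      unfolding c sqtrace_sum sqtrace_scal using no unfolding t_def by simp
    then show False unfolding sqtrace_def by simp
  qed
  then obtain w where w: "w \<notin> ?N" by blast
  obtain f :: "nat \<Rightarrow> 'd \<Rightarrow> 'd" where
    f0: "\<forall>i<64 - n. (\<forall>x\<in>UNIV. f i x \<in> F) \<and> (\<forall>x\<in>UNIV. \<forall>y\<in>UNIV. f i (x + y) = f i x + f i y) \<and>
        (\<forall>x\<in>UNIV. \<forall>c\<in>F. f i (x * c) = f i x * c)"
    and f1: "\<forall>x\<in>UNIV. (\<forall>i<64 - n. f i x = 0) \<longleftrightarrow> x \<in> ?N"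
    using R.functionals_exist[OF F_divring dim_D n subset_UNIV] by blast
  obtain i where i: "i < 64 - n" "f i w \<noteq> 0" using f1 w by blast
  have add: "f i (x + y) = f i x + f i y" for x y using f0 i by blast
  have zero: "f i x = 0" if "t x = 0" for x using f1 that i(1) by blast
  have eq: "f i x = f i y" if "t x = t y" for x y
  proof -
    have "t (x + - y) = 0" using that unfolding t_add t_minus by simp
    then have "f i (x + - y) = 0" by (rule zero)
    moreover have "f i x = f i (x + - y) + f i y" using add[of "x + - y" y] by simp
    ultimately show ?thesis by simp
  qed
  show ?thesis using f0 i eq[OF t_comm] eq[OF t_gamma] by (intro exI[of _ "f i"]) blast
qed

end

section \<open>Biquadratic subfields\<close>

text \<open>From here on the ambient ring is the division algebra itself, so that
  \<open>inverse\<close> is available.\<close>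

locale dalg = csa64 F "UNIV :: 'd set" for F :: "'d::division_ring set"
begin

interpretation R: rmod "(*) :: 'd \<Rightarrow> 'd \<Rightarrow> 'd" by (rule rmod_times)

lemmas F_div = E

abbreviation Cent :: "'d set \<Rightarrow> 'd set" where "Cent S \<equiv> centralizer UNIV S"

lemma Cent_iff: "x \<in> Cent S \<longleftrightarrow> (\<forall>s\<in>S. x * s = s * x)"
  unfolding centralizer_def by simp

lemma Cent_props: "divring (Cent S)" "F \<subseteq> Cent S"
  using centralizer_divring[of S] by auto

lemma F_comm: "c \<in> F \<Longrightarrow> c * x = x * c" using E_central by blast

lemma fdim_exists: "submod (*) F U \<Longrightarrow> \<exists>n. fdim (*) F n U"
  using submod_fdim[of U] by blast

lemma div_dim: "divring B \<Longrightarrow> F \<subseteq> B \<Longrightarrow> \<exists>n. fdim (*) F n B"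
  using fdim_exists[OF divring_submod] by blast

lemma divring_inverse: "divring B \<Longrightarrow> (x::'d) \<in> B \<Longrightarrow> inverse x \<in> B"
proof (cases "x = 0")
  case False
  assume "divring B" "x \<in> B"
  then obtain y where "y \<in> B" "x * y = 1" using divring_inv False by metis
  then show ?thesis using inverse_unique by metis
qed (simp add: divring_0)

definition ext :: "'d set \<Rightarrow> 'd \<Rightarrow> 'd set" where "ext B v = {a + v * b | a b. a \<in> B \<and> b \<in> B}"

lemma ext_eq: "ext B v = flag_step (*) B B v"
  unfolding ext_def flag_step_def ..

lemma extI: "a \<in> B \<Longrightarrow> b \<in> B \<Longrightarrow> a + v * b \<in> ext B v"
  unfolding ext_def by blast

text \<open>As \<open>v\<close> can be moved past \<open>B\<close> and \<open>v * v\<close> lies in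
  \<open>B\<close>, a product of two elements of \<open>B + v B\<close> has this shape
  again.\<close>

lemma ext_props:
  assumes B: "divring B" "F \<subseteq> B" and vv: "v * v \<in> B" and conj: "\<And>b. b \<in> B \<Longrightarrow> \<exists>b'\<in>B. b * v = v * b'"
  shows "divring (ext B v)" "B \<subseteq> ext B v" "F \<subseteq> ext B v" "v \<in> ext B v"
proof -
  show sub: "B \<subseteq> ext B v" using extI[of _ B 0 v] divring_0[OF B(1)] by fastforce
  show Fs: "F \<subseteq> ext B v" using sub B(2) by blast
  show "v \<in> ext B v" using extI[of 0 B 1 v] divring_0[OF B(1)] divring_1[OF B(1)] by simp
  show "divring (ext B v)"
  proof (rule subring_divring[OF Fs])
    fix x y assume "x \<in> ext B v" "y \<in> ext B v"
    then obtain a b c d where x: "x = a + v * b" "a \<in> B" "b \<in> B" and y: "y = c + v * d" "c \<in> B" "d \<in> B"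
      unfolding ext_def by blast
    have eq: "x - y = (a - c) + v * (b - d)" unfolding x y by (simp add: algebra_simps)
    show "x - y \<in> ext B v" unfolding eq by (rule extI) (use x y divring_diff[OF B(1)] in auto)
    obtain a' b' where a': "a' \<in> B" "a * v = v * a'" and b': "b' \<in> B" "b * v = v * b'"
      using conj x by blast
    have "x * y = a * c + (a * v) * d + v * (b * c) + v * (b * v) * d" unfolding x y by (simp add: algebra_simps)
    also have "\<dots> = (a * c + v * v * (b' * d)) + v * (a' * d + b * c)"
      unfolding a' b' by (simp add: algebra_simps)
    finally have xy: "x * y = (a * c + v * v * (b' * d)) + v * (a' * d + b * c)" .
    show "x * y \<in> ext B v" unfolding xy
      by (rule extI) (use x y a' b' vv B(1) in \<open>auto intro!: divring_add divring_mult\<close>)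
  qed auto
qed

lemma ext_dim:
  assumes B: "divring B" "F \<subseteq> B" "fdim (*) F n B" and v: "v \<notin> B"
  shows "fdim (*) F (2 * n) (ext B v)"
proof -
  have "fdim (*) B 2 (ext B v)" using fdim_Suc[OF fdim_self[OF B(1)] v] unfolding ext_eq by (simp add: numeral_2_eq_2)
  then have "fdim (*) F (n * 2) (ext B v)" by (rule R.fdim_tower[OF B(3) F_div B(1,2)])
  then show ?thesis by (simp add: mult.commute)
qed

lemma ext_comm:
  assumes "\<And>x y. x \<in> B \<Longrightarrow> y \<in> B \<Longrightarrow> x * y = y * x" "\<And>x. x \<in> B \<Longrightarrow> x * v = v * x"
    "x \<in> ext B v" "y \<in> ext B v"
  shows "x * y = y * x"
proof -
  obtain a b c d where x: "x = a + v * b" "a \<in> B" "b \<in> B" and y: "y = c + v * d" "c \<in> B" "d \<in> B"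
    using assms(3,4) unfolding ext_def by blast
  note v = assms(2)
  have y_comm: "z * y = y * z" if "c * z = z * c" "v * z = z * v" "d * z = z * d" for z
    unfolding y(1) by (rule sym) (intro commutes_add commutes_mult that)
  have "a * y = y * a" "b * y = y * b" "v * y = y * v"
    by (rule y_comm; use assms(1) v x y in metis)+
  then show ?thesis unfolding x(1) by (intro commutes_add commutes_mult)
qed

lemma ext_commutes:
  assumes "\<And>b. b \<in> B \<Longrightarrow> b * z = z * b" "v * z = z * v" "x \<in> ext B v"
  shows "x * z = z * x"
proof -
  obtain a b where x: "x = a + v * b" "a \<in> B" "b \<in> B" using assms(3) unfolding ext_def by blast
  show ?thesis unfolding x(1) by (intro commutes_add commutes_mult assms(1,2) x(2,3))
qed

text \<open>The summands \<open>c\<close> and \<open>d * w\<close> are the components of \<open>y\<close> in the eigenspaces of conjugation by \<open>a\<close>.\<close>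

lemma conj_decomp:
  assumes B: "divring B" "F \<subseteq> B" and a: "a \<in> B" "a \<noteq> 0" and aa: "\<And>y. y \<in> B \<Longrightarrow> a * a * y = y * (a * a)"
    and w: "w \<in> B" "w \<noteq> 0" "w * a = - (a * w)" and y: "y \<in> B"
  obtains c d where "c \<in> B" "c * a = a * c" "d \<in> B" "d * a = a * d" "y = c + d * w"
proof -
  obtain h where h: "h \<in> F" "h + h = 1" using half_ex .
  have hB: "h \<in> B" using h B(2) by blast
  define z where "z = a * y * inverse a"
  have zB: "z \<in> B" unfolding z_def using a y B(1) by (simp add: divring_mult divring_inverse)
  have za: "z * a = a * y" unfolding z_def using a by (simp add: mult.assoc)
  have az: "a * z = y * a"
  proof -
    have "a * z = (a * a * y) * inverse a" unfolding z_def by (simp add: mult.assoc)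
    also have "\<dots> = y * a * (a * inverse a)" unfolding aa[OF y] by (simp add: mult.assoc)
    finally show ?thesis using a by simp
  qed
  define c where "c = h * (y + z)"
  define e where "e = h * (y - z)"
  have yce: "y = c + e"
  proof -
    have "c + e = (h + h) * y" unfolding c_def e_def by (simp add: algebra_simps)
    then show ?thesis using h by simp
  qed
  have ca: "c * a = a * c"
  proof -
    have "c * a = h * (y * a + z * a)" unfolding c_def by (simp add: algebra_simps)
    also have "\<dots> = h * (a * z + a * y)" unfolding za az ..
    also have "\<dots> = h * a * (y + z)" by (simp add: algebra_simps)
    also have "\<dots> = a * c" unfolding c_def F_comm[OF h(1), of a] by (simp add: mult.assoc)
    finally show ?thesis .
  qed
  have ea: "e * a = - (a * e)"
  proof -
    have "e * a = h * (y * a - z * a)" unfolding e_def by (simp add: algebra_simps)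
    also have "\<dots> = h * (a * z - a * y)" unfolding za az ..
    also have "\<dots> = - (h * a * (y - z))" by (simp add: algebra_simps)
    also have "\<dots> = - (a * e)" unfolding e_def F_comm[OF h(1), of a] by (simp add: mult.assoc)
    finally show ?thesis .
  qed
  define d where "d = e * inverse w"
  have iw: "inverse w * a = - (a * inverse w)"
  proof -
    have "inverse w * a = inverse w * (a * w) * inverse w" using w by (simp add: mult.assoc)
    also have "a * w = - (w * a)" using w by simp
    also have "inverse w * (- (w * a)) * inverse w = - (inverse w * w * (a * inverse w))" by (simp add: mult.assoc)
    finally show ?thesis using w by simp
  qed
  have "d * a = e * (inverse w * a)" unfolding d_def by (simp add: mult.assoc)
  also have "\<dots> = - (e * a) * inverse w" unfolding iw by (simp add: mult.assoc)
  also have "\<dots> = a * d" unfolding ea d_def by (simp add: mult.assoc)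
  finally have da: "d * a = a * d" .
  have cB: "c \<in> B" and eB: "e \<in> B" unfolding c_def e_def using hB y zB B(1) by (auto intro!: divring_mult divring_add divring_diff)
  have dB: "d \<in> B" unfolding d_def using eB w B(1) by (simp add: divring_mult divring_inverse)
  have "y = c + d * w" unfolding yce d_def using w by (simp add: mult.assoc)
  then show thesis using that cB ca dB da by blast
qed

text \<open>By \<open>conj_decomp\<close>, \<open>B\<close> is the sum of the centralizer of
  \<open>a\<close> in \<open>B\<close> and its translate by \<open>w\<close>. The two meet only in
  zero, since an element of both commutes and anticommutes with \<open>a\<close>.\<close>

lemma half_dim:
  assumes B: "divring B" "F \<subseteq> B" "fdim (*) F n B" and a: "a \<in> B" "a \<noteq> 0" and aa: "\<And>y. y \<in> B \<Longrightarrow> a * a * y = y * (a * a)"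
    and w: "w \<in> B" "w \<noteq> 0" "w * a = - (a * w)" and m: "fdim (*) F m (B \<inter> Cent {a})"
  shows "n = 2 * m"
proof -
  let ?C = "B \<inter> Cent {a}"
  have Cw: "fdim (*) F m ((\<lambda>c. c * w) ` ?C)"
  proof (rule fdim_image[OF m rmod_times rmod_times F_div])
    show "x * b * w = x * w * b" if "b \<in> F" for x b using F_comm[OF that, of w] by (simp add: mult.assoc)
  qed (use w in \<open>auto simp: algebra_simps\<close>)
  have "(\<lambda>c. c * w) ` ?C \<inter> ?C \<subseteq> {0}"
  proof
    fix y assume "y \<in> (\<lambda>c. c * w) ` ?C \<inter> ?C"
    then obtain c where c: "c \<in> ?C" "y = c * w" "y \<in> ?C" by blast
    have cx: "c * a = a * c" and yx: "y * a = a * y" using c by (auto simp: Cent_iff)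
    have "y * a = c * (w * a)" unfolding c(2) by (simp add: mult.assoc)
    also have "\<dots> = - (c * a * w)" unfolding w(3) by (simp add: mult.assoc)
    also have "\<dots> = - (a * y)" unfolding c(2) cx by (simp add: mult.assoc)
    finally have neg: "y * a = - (a * y)" .
    have "y * a + y * a = 0" by (subst (2) yx) (simp add: neg)
    then have "y * a = 0" by (rule double_0)
    then show "y \<in> {0}" using a by simp
  qed
  then have "fdim (*) F (m + m) {c + u | c u. c \<in> ?C \<and> u \<in> (\<lambda>c. c * w) ` ?C}"
    by (rule R.fdim_direct_sum[OF Cw m F_div])
  moreover have "{c + u | c u. c \<in> ?C \<and> u \<in> (\<lambda>c. c * w) ` ?C} = B"
  proof (intro equalityI subsetI)
    fix y assume y: "y \<in> B"
    obtain c d where cd: "c \<in> B" "c * a = a * c" "d \<in> B" "d * a = a * d" "y = c + d * w"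
      by (rule conj_decomp[OF B(1,2) a aa w y])
    then have "c \<in> ?C" "d * w \<in> (\<lambda>c. c * w) ` ?C" by (auto simp: Cent_iff)
    then show "y \<in> {c + u | c u. c \<in> ?C \<and> u \<in> (\<lambda>c. c * w) ` ?C}" using cd(5) by blast
  next
    fix y assume "y \<in> {c + u | c u. c \<in> ?C \<and> u \<in> (\<lambda>c. c * w) ` ?C}"
    then show "y \<in> B" using w B(1) by (auto intro!: divring_add divring_mult)
  qed
  ultimately show ?thesis using R.fdim_unique[OF B(3) _ F_div] by fastforce
qed

lemma anticommuting_exists:
  fixes a y :: 'd
  assumes a: "a * a * y = y * (a * a)" and y: "y * a \<noteq> a * y"
  defines "w \<equiv> y * a - a * y"
  shows "w \<noteq> 0" "w * a = - (a * w)"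
proof -
  show "w \<noteq> 0" unfolding w_def using y by simp
  show "w * a = - (a * w)" unfolding w_def using a by (simp add: algebra_simps)
qed

lemma square_central_anticommuting:
  assumes "a \<notin> F" "a * a \<in> F"
  obtains w where "w \<noteq> 0" "w * a = - (a * w)"
proof -
  obtain y where y: "y * a \<noteq> a * y" using center[of a] assms(1) by (metis UNIV_I)
  show thesis
    using anticommuting_exists[of a y] F_comm[OF assms(2), of y] y that by blast
qed

lemma quadratic_dim:
  assumes i: "i \<notin> F" "i * i \<in> F"
  shows "divring (ext F i)" "F \<subseteq> ext F i" "i \<in> ext F i" "fdim (*) F 2 (ext F i)"
    "\<And>x y. x \<in> ext F i \<Longrightarrow> y \<in> ext F i \<Longrightarrow> x * y = y * x"
    "\<And>x z. x \<in> ext F i \<Longrightarrow> z * i = i * z \<Longrightarrow> x * z = z * x"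
    "fdim (*) F 32 (Cent {i})"
proof -
  have conj: "\<exists>b'\<in>F. b * i = i * b'" if "b \<in> F" for b using that F_comm by blast
  note P = ext_props[OF F_div order_refl i(2) conj]
  show "divring (ext F i)" by (rule P(1))
  show "F \<subseteq> ext F i" by (rule P(3))
  show "i \<in> ext F i" by (rule P(4))
  show "fdim (*) F 2 (ext F i)" using ext_dim[OF F_div order_refl fdim_self[OF F_div] i(1)] by simp
  show "x * y = y * x" if "x \<in> ext F i" "y \<in> ext F i" for x y
    using ext_comm[OF _ _ that] F_comm by blast
  show "x * z = z * x" if "x \<in> ext F i" "z * i = i * z" for x z
    using ext_commutes[OF _ _ that(1), of z] that(2) F_comm by auto
  obtain w where w: "w \<noteq> 0" "w * i = - (i * w)" using square_central_anticommuting[OF i] .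
  obtain m where m: "fdim (*) F m (Cent {i})" using div_dim[OF Cent_props] by blast
  have i0: "i \<noteq> 0" using i divring_0[OF F_div] by auto
  have "64 = 2 * m"
    by (rule half_dim[OF D subset_UNIV dim_D UNIV_I i0 _ UNIV_I w]) (use F_comm[OF i(2)] m in auto)
  then show "fdim (*) F 32 (Cent {i})" using m by simp
qed

text \<open>The element \<open>a * y + y * b\<close> intertwines for every \<open>y\<close>. If it
  always vanished, \<open>y = 1\<close> would give \<open>b = - a\<close>, and then \<open>a\<close>
  would be central.\<close>

lemma intertwine:
  assumes a: "a \<notin> F" "a * a \<in> F" and b: "b * b = a * a"
  obtains x where "x \<noteq> 0" "a * x = x * b"
proof -
  have "\<exists>y. a * y + y * b \<noteq> 0"
  proof (rule ccontr)
    assume "\<not> ?thesis"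
    then have all: "a * y + y * b = 0" for y by blast
    from all[of 1] have "b = - a" by (simp add: eq_neg_iff_add_eq_0 add.commute)
    then have "a * y = y * a" for y using all[of y] by simp
    then show False using center[of a] a(1) by blast
  qed
  then obtain y where y: "a * y + y * b \<noteq> 0" by blast
  have "a * (a * y + y * b) = (a * y + y * b) * b"
    using F_comm[OF a(2), of y] b by (simp add: algebra_simps)
  then show thesis using that y by blast
qed

end

section \<open>Inner twists of involutions and the second square-central element\<close>

locale dinv = dalg F + csa_inv F "UNIV :: 'd set" \<sigma> for F :: "'d::division_ring set" and \<sigma>
begin

lemma sig_add: "\<sigma> (x + y) = \<sigma> x + \<sigma> y" and sig_mult: "\<sigma> (x * y) = \<sigma> y * \<sigma> x"
  and sig_sig: "\<sigma> (\<sigma> x) = x" and sig_diff: "\<sigma> (x - y) = \<sigma> x - \<sigma> y" and sig_minus: "\<sigma> (- x) = - \<sigma> x"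
  by (simp_all add: J_add J_mult J_J J_diff J_minus)

lemma sig_1: "\<sigma> 1 = 1" using J_E divring_1[OF F_div] by blast

lemma sig_inverse: "x \<noteq> 0 \<Longrightarrow> \<sigma> (inverse x) = inverse (\<sigma> x)"
proof -
  assume x: "x \<noteq> 0"
  have "\<sigma> x * \<sigma> (inverse x) = 1" using sig_mult[of "inverse x" x] x sig_1 by simp
  then show ?thesis using inverse_unique by metis
qed

text \<open>Applying the twist twice is conjugation by \<open>x * inverse (\<sigma> x)\<close>,
  which is 1 or -1.\<close>

lemma conj_dinv:
  assumes x: "x \<noteq> 0" "\<sigma> x = x \<or> \<sigma> x = - x"
  shows "dinv F (\<lambda>d. x * \<sigma> d * inverse x)"
proof
  fix d e :: 'd
  show "x * \<sigma> (d + e) * inverse x = x * \<sigma> d * inverse x + x * \<sigma> e * inverse x" by (simp add: sig_add algebra_simps)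
  show "x * \<sigma> (d * e) * inverse x = x * \<sigma> e * inverse x * (x * \<sigma> d * inverse x)"
  proof -
    have "inverse x * (x * z) = z" for z using x by (simp flip: mult.assoc)
    then show ?thesis by (simp add: sig_mult mult.assoc)
  qed
  show "x * \<sigma> (x * \<sigma> d * inverse x) * inverse x = d"
  proof -
    have *: "\<sigma> (x * \<sigma> d * inverse x) = inverse (\<sigma> x) * d * \<sigma> x"
      using x(1) by (simp add: sig_mult sig_sig sig_inverse mult.assoc)
    have "inverse (\<sigma> x) * d * \<sigma> x = inverse x * d * x" using x(2) by auto
    then have "x * \<sigma> (x * \<sigma> d * inverse x) * inverse x = (x * inverse x) * d * (x * inverse x)"
      unfolding * by (simp only: mult.assoc)
    then show ?thesis using x(1) by simp
  qed
  show "x * \<sigma> d * inverse x = d" if "d \<in> F"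
    using that x(1) F_comm[OF that, of x] J_E by (simp flip: F_comm[OF that] add: mult.assoc)
qed auto

lemma sym_or_skew_part:
  assumes x: "x \<in> M" "x \<noteq> 0" and M: "\<And>x. x \<in> M \<Longrightarrow> \<sigma> x \<in> M" "\<And>x y. x \<in> M \<Longrightarrow> y \<in> M \<Longrightarrow> x + y \<in> M"
  shows "\<exists>y\<in>M. y \<noteq> 0 \<and> (\<sigma> y = y \<or> \<sigma> y = - y)"
proof (cases "x + \<sigma> x = 0")
  case True
  then have "\<sigma> x = - x" by (simp add: eq_neg_iff_add_eq_0 add.commute)
  then show ?thesis using x by blast
next
  case False
  moreover have "\<sigma> (x + \<sigma> x) = x + \<sigma> x" by (simp add: sig_add sig_sig add.commute)
  ultimately show ?thesis using M x by blast
qed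

text \<open>If a module over a noncommutative division algebra had no symmetric elements, the involution
  would be given there by conjugation, which reverses products only if they commute.\<close>

lemma symmetric_element:
  assumes x: "x \<in> M" "x \<noteq> 0" and M: "\<And>x. x \<in> M \<Longrightarrow> \<sigma> x \<in> M" "\<And>x y. x \<in> M \<Longrightarrow> y \<in> M \<Longrightarrow> x + y \<in> M"
    and Q: "\<And>q x. q \<in> Q \<Longrightarrow> x \<in> M \<Longrightarrow> q * x \<in> M" "\<And>p q. p \<in> Q \<Longrightarrow> q \<in> Q \<Longrightarrow> p * q \<in> Q" "\<exists>p\<in>Q. \<exists>q\<in>Q. p * q \<noteq> q * p"
  shows "\<exists>s\<in>M. s \<noteq> 0 \<and> \<sigma> s = s"
proof (rule ccontr)
  assume no: "\<not> ?thesis"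
  have skew: "\<sigma> y = - y" if "y \<in> M" for y
  proof (rule ccontr)
    assume "\<sigma> y \<noteq> - y"
    then have "y + \<sigma> y \<noteq> 0" by (simp add: eq_neg_iff_add_eq_0 add.commute)
    moreover have "\<sigma> (y + \<sigma> y) = y + \<sigma> y" by (simp add: sig_add sig_sig add.commute)
    ultimately show False using no M that by blast
  qed
  have q: "q * x = x * \<sigma> q" if "q \<in> Q" for q
    using skew[OF Q(1)[OF that x(1)]] skew[OF x(1)] by (simp add: sig_mult)
  have "p * q = q * p" if pq: "p \<in> Q" "q \<in> Q" for p q
  proof -
    have "p * q * x = x * \<sigma> q * \<sigma> p" using q[OF Q(2)[OF pq]] by (simp add: sig_mult mult.assoc)
    also have "\<dots> = q * (x * \<sigma> p)" unfolding q[OF pq(2), symmetric] by (simp add: mult.assoc)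
    also have "\<dots> = q * p * x" unfolding q[OF pq(1), symmetric] by (simp add: mult.assoc)
    finally show ?thesis using x(2) by simp
  qed
  then show False using Q(3) by blast
qed

text \<open>The solutions of \<open>e * x = x * \<sigma> i\<close> are stable under
  \<open>\<sigma>\<close>, so one of them is symmetric or skew. The twist of \<open>\<sigma>\<close>
  by it is again an involution, and it sends \<open>i\<close> to \<open>e\<close>.\<close>

lemma involution_with:
  assumes i: "i \<notin> F" "i * i \<in> F" and e: "e = i \<or> e = - i"
  obtains x where "x \<noteq> 0" "\<sigma> x = x \<or> \<sigma> x = - x" "x * \<sigma> i * inverse x = e"
proof -
  have ee: "e \<notin> F" "e * e \<in> F" "e * e = i * i" using e i divring_uminus[OF F_div, of "- i"] by auto
  have ss: "\<sigma> i * \<sigma> i = e * e" unfolding sig_mult[symmetric] ee(3) using J_E[OF i(2)] by simp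
  obtain x where x: "x \<noteq> 0" "e * x = x * \<sigma> i" using intertwine[OF ee(1,2) ss] .
  let ?M = "{x. e * x = x * \<sigma> i}"
  have "\<exists>y\<in>?M. y \<noteq> 0 \<and> (\<sigma> y = y \<or> \<sigma> y = - y)"
  proof (rule sym_or_skew_part[OF _ x(1)])
    show "x \<in> ?M" using x by simp
    show "\<sigma> y \<in> ?M" if "y \<in> ?M" for y
    proof -
      have "\<sigma> (e * y) = \<sigma> (y * \<sigma> i)" using that by simp
      then have "\<sigma> y * \<sigma> e = i * \<sigma> y" by (simp add: sig_mult sig_sig)
      then show ?thesis using e by (auto simp: sig_minus) (metis minus_minus)
    qed
  qed (simp add: algebra_simps)
  then obtain y where y: "e * y = y * \<sigma> i" "y \<noteq> 0" "\<sigma> y = y \<or> \<sigma> y = - y" by blast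
  have "y * \<sigma> i * inverse y = e" unfolding y(1)[symmetric] using y(2) by (simp add: mult.assoc)
  then show thesis using that y by blast
qed

end

context dalg
begin

interpretation R: rmod "(*) :: 'd \<Rightarrow> 'd \<Rightarrow> 'd" by (rule rmod_times)

lemma gen_pair:
  fixes i t :: 'd
  assumes ti: "t * i = i * t"
  shows "divring (gen {i, t})" "F \<subseteq> gen {i, t}" "{i, t} \<subseteq> gen {i, t}"
    "\<And>x y. x \<in> gen {i, t} \<Longrightarrow> y \<in> gen {i, t} \<Longrightarrow> x * y = y * x" "Cent (gen {i, t}) = Cent {i, t}"
proof -
  have c: "x * y = y * x" if "x \<in> {i, t}" "y \<in> {i, t}" for x y using that ti by auto
  show "divring (gen {i, t})" by (rule gen_props(1)[OF subset_UNIV c])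
  show "F \<subseteq> gen {i, t}" by (rule gen_props(2)[OF subset_UNIV c])
  show "{i, t} \<subseteq> gen {i, t}" by (rule gen_props(4)[OF subset_UNIV c])
  show "x * y = y * x" if "x \<in> gen {i, t}" "y \<in> gen {i, t}" for x y
    by (rule gen_props(5)[OF subset_UNIV c that])
  show "Cent (gen {i, t}) = Cent {i, t}" by (rule gen_props(6)[OF subset_UNIV c])
qed

lemma comm_not_16:
  assumes "divring B" "F \<subseteq> B" "fdim (*) F n B" "16 \<le> n"
  shows "\<exists>p\<in>B. \<exists>q\<in>B. p * q \<noteq> q * p"
proof (rule ccontr)
  assume "\<not> ?thesis"
  then have "n \<in> {1, 2, 4, 8}" by (intro comm_dim[OF assms(1,2) subset_UNIV _ assms(3)]) blast
  then show False using assms(4) by auto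
qed

text \<open>\<open>\<sigma>\<close> is not the identity on the noncommutative centralizer of
  \<open>i\<close>, so some nonzero \<open>t\<close> there is skew. If \<open>t * t\<close> is
  outside \<open>F(i)\<close>, the fields \<open>F(i)\<close>, \<open>F(i, t * t)\<close>,
  \<open>F(i, t)\<close> grow strictly, as the first two consist of symmetric elements. Their
  dimensions are then 2, 4, 8, and completing the square for \<open>t * t\<close> gives the
  result.\<close>

lemma square_in_quadratic:
  assumes sig: "dinv F \<sigma>" and i: "i \<notin> F" "i * i \<in> F" and si: "\<sigma> i = i"
  obtains x where "x * i = i * x" "x \<notin> ext F i" "x * x \<in> ext F i"
proof -
  interpret S: dinv F \<sigma> by fact
  let ?K = "ext F i"
  note K = quadratic_dim[OF i]
  have fixK: "\<sigma> x = x" if xK: "x \<in> ?K" for x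
  proof -
    obtain a b where x: "x = a + i * b" "a \<in> F" "b \<in> F" using xK unfolding ext_def by blast
    show ?thesis unfolding x(1) using si F_comm[OF x(3), of i] by (simp add: S.sig_add S.sig_mult S.J_E[OF x(2)] S.J_E[OF x(3)])
  qed
  have "\<exists>t. t * i = i * t \<and> t \<noteq> 0 \<and> \<sigma> t = - t"
  proof (rule ccontr)
    assume no: "\<not> ?thesis"
    have id: "\<sigma> x = x" if "x \<in> Cent {i}" for x
    proof -
      have xi: "x * i = i * x" using that unfolding Cent_iff by simp
      have "\<sigma> (x * i) = \<sigma> (i * x)" using xi by simp
      then have "\<sigma> x * i = i * \<sigma> x" by (simp add: S.sig_mult si)
      then have "(\<sigma> x - x) * i = i * (\<sigma> x - x)" using xi by (simp add: algebra_simps)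
      moreover have "\<sigma> (\<sigma> x - x) = - (\<sigma> x - x)" by (simp add: S.sig_diff S.sig_sig)
      ultimately have "\<sigma> x - x = 0" using no by blast
      then show ?thesis by simp
    qed
    obtain p q where pq: "p \<in> Cent {i}" "q \<in> Cent {i}" "p * q \<noteq> q * p"
      using comm_not_16[OF Cent_props K(7)] by auto
    have "p * q \<in> Cent {i}" using pq Cent_props(1) by (auto intro: divring_mult)
    then show False using id[of "p * q"] id[OF pq(1)] id[OF pq(2)] pq(3) by (simp add: S.sig_mult)
  qed
  then obtain t where t: "t * i = i * t" "t \<noteq> 0" "\<sigma> t = - t" by blast
  have nfix: "t \<notin> A" if "\<And>x. x \<in> A \<Longrightarrow> \<sigma> x = x" for A
  proof
    assume "t \<in> A"
    then have "t + t = 0" using that[of t] t(3) by (metis add.right_inverse)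
    then show False using double_0 t(2) by blast
  qed
  show thesis
  proof (cases "t * t \<in> ?K")
    case True
    then show ?thesis using that t nfix[OF fixK] by blast
  next
    case False
    define u where "u = t * t"
    have ui: "u * i = i * u" unfolding u_def using t(1) by (metis mult.assoc)
    have su: "\<sigma> u = u" unfolding u_def using t(3) by (simp add: S.sig_mult)
    let ?M = "gen {i, t}" and ?M1 = "gen {i, u}"
    note M = gen_pair[OF t(1)] and M1 = gen_pair[OF ui]
    have M1Sym: "?M1 \<subseteq> S.Sym" by (rule S.gen_Sym) (use si su ui in \<open>auto simp: S.Sym_def\<close>)
    have KM1: "?K \<subseteq> ?M1"
    proof
      fix x assume "x \<in> ?K"
      then obtain a b where "x = a + i * b" "a \<in> F" "b \<in> F" unfolding ext_def by blast
      then show "x \<in> ?M1" using M1(1,2,3) by (auto intro!: divring_add divring_mult)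
    qed
    have M1M: "?M1 \<subseteq> ?M"
    proof
      fix x assume "x \<in> ?M1"
      then show "x \<in> ?M" unfolding gen_def[of "{i, u}"]
      proof (rule ring_gen_subset)
        show "F \<union> {i, u} \<subseteq> ?M" unfolding u_def using M(1,2,3) by (auto intro!: divring_mult)
      qed (use M(1) in \<open>auto intro: divring_diff divring_mult\<close>)
    qed
    obtain m where m: "fdim (*) F m ?M" using div_dim[OF M(1,2)] by blast
    obtain m1 where m1: "fdim (*) F m1 ?M1" using div_dim[OF M1(1,2)] by blast
    have "m \<in> {1, 2, 4, 8}" by (rule comm_dim[OF M(1,2) subset_UNIV M(4) m])
    moreover have "m1 \<in> {1, 2, 4, 8}" by (rule comm_dim[OF M1(1,2) subset_UNIV M1(4) m1])
    moreover have "\<not> m1 \<le> 2"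
      using R.fdim_eq_imp_eq[OF m1 K(4) F_div KM1] False M1(3) unfolding u_def by auto
    moreover have "\<not> m \<le> m1"
      using R.fdim_eq_imp_eq[OF m m1 F_div M1M] nfix[of ?M1] M1Sym M(3) unfolding S.Sym_def by auto
    ultimately have m1: "fdim (*) F 4 ?M1" using m1 by auto
    have "\<exists>s\<in>?K. (u - s) * (u - s) \<in> ?K"
      by (rule complete_square[OF K(1,2,4) M1(1) KM1 _ M1(4)]) (use m1 M1(3) False u_def in auto)
    then obtain s where s: "s \<in> ?K" "(u - s) * (u - s) \<in> ?K" by blast
    have "(u - s) * i = i * (u - s)" using ui K(6)[OF s(1), of i] by (simp add: algebra_simps)
    moreover have "u - s \<notin> ?K" using divring_add[OF K(1) _ s(1), of "u - s"] False unfolding u_def by auto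
    ultimately show ?thesis using that s by blast
  qed
qed

text \<open>Choose \<open>x\<close> commuting with \<open>i\<close> and quadratic over
  \<open>F(i)\<close>, and an involution \<open>\<tau>\<close> with \<open>\<tau> i = - i\<close>.
  For \<open>x' = \<tau> x\<close> the element \<open>m = x * x' + x' * x\<close> is fixed by
  \<open>\<tau>\<close> and commutes with \<open>i\<close>, \<open>x\<close> and \<open>x'\<close>.
  Depending on the degree of \<open>m\<close> over \<open>F(i)\<close>, the result is one of
  \<open>x + x'\<close>, \<open>i * (x - x')\<close>, \<open>m\<close> and
  \<open>m - t\<close>.\<close>

lemma second_square_central:
  assumes sig: "dinv F \<sigma>" and i: "i \<notin> F" "i * i \<in> F"
  obtains j where "j * i = i * j" "j \<notin> ext F i" "j * j \<in> F"
proof -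
  interpret G: dinv F \<sigma> by fact
  obtain a where a: "a \<noteq> 0" "\<sigma> a = a \<or> \<sigma> a = - a" "a * \<sigma> i * inverse a = i"
    using G.involution_with[OF i] by blast
  obtain x where x: "x * i = i * x" "x \<notin> ext F i" "x * x \<in> ext F i"
    using square_in_quadratic[OF G.conj_dinv[OF a(1,2)] i a(3)] by blast
  obtain b where b: "b \<noteq> 0" "\<sigma> b = b \<or> \<sigma> b = - b" "b * \<sigma> i * inverse b = - i"
    using G.involution_with[OF i, of "- i"] by blast
  define \<tau> where "\<tau> = (\<lambda>d. b * \<sigma> d * inverse b)"
  interpret T: dinv F \<tau> unfolding \<tau>_def by (rule G.conj_dinv[OF b(1,2)])
  have ti: "\<tau> i = - i" unfolding \<tau>_def by (rule b(3))
  let ?K = "ext F i"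
  note K = quadratic_dim[OF i]
  have i0: "i \<noteq> 0" using i divring_0[OF F_div] by auto
  \<comment> \<open>On \<open>F(i)\<close> the map \<open>\<tau>\<close> is the nontrivial
    automorphism over \<open>F\<close>.\<close>
  have tK: "\<tau> k \<in> ?K" and fixF: "\<tau> k = k \<Longrightarrow> k \<in> F" and trF: "k + \<tau> k \<in> F" if k: "k \<in> ?K" for k
  proof -
    obtain c d where kcd: "k = c + i * d" "c \<in> F" "d \<in> F" using k unfolding ext_def by blast
    have tk: "\<tau> k = c - i * d" unfolding kcd(1)
      using F_comm[OF kcd(3), of i] by (simp add: T.sig_add T.sig_mult T.J_E[OF kcd(2)] T.J_E[OF kcd(3)] ti)
    show "\<tau> k \<in> ?K" unfolding tk using extI[of c F "- d" i] kcd divring_uminus[OF F_div] by simp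
    have kk: "k + \<tau> k = c + c" using tk kcd(1) by simp
    show "k + \<tau> k \<in> F" unfolding kk by (rule divring_add[OF F_div kcd(2) kcd(2)])
    show "k \<in> F" if "\<tau> k = k"
    proof -
      have "i * d + i * d = k - \<tau> k" using tk kcd(1) by simp
      then have "i * d + i * d = 0" using that by simp
      then have "i * d = 0" by (rule double_0)
      then have "k = c" using kcd(1) by (simp only: add_0_right)
      then show ?thesis using kcd(2) by simp
    qed
  qed
  define x' where "x' = \<tau> x"
  define \<delta> where "\<delta> = x * x"
  have dK: "\<delta> \<in> ?K" unfolding \<delta>_def by (rule x(3))
  have xx': "x' * x' = \<tau> \<delta>" unfolding x'_def \<delta>_def by (simp add: T.sig_mult)
  have x'i: "x' * i = i * x'"
  proof -
    have "\<tau> (x * i) = \<tau> (i * x)" using x(1) by simp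
    then show ?thesis unfolding x'_def by (simp add: T.sig_mult ti)
  qed
  have Kc: "k * z = z * k" if "k \<in> ?K" "z * i = i * z" for k z by (rule K(6)[OF that])
  define m where "m = x * x' + x' * x"
  have mx: "m * x = x * m"
  proof -
    have "m * x = x * x' * x + x' * \<delta>" unfolding m_def \<delta>_def by (simp add: algebra_simps)
    also have "x' * \<delta> = \<delta> * x'" using Kc[OF dK x'i] by simp
    finally show ?thesis unfolding m_def \<delta>_def by (simp add: algebra_simps)
  qed
  have mx': "m * x' = x' * m"
  proof -
    have "m * x' = x * \<tau> \<delta> + x' * x * x'" unfolding m_def xx'[symmetric] by (simp add: algebra_simps)
    also have "x * \<tau> \<delta> = \<tau> \<delta> * x" using Kc[OF tK[OF dK] x(1)] by simp
    finally show ?thesis unfolding m_def xx'[symmetric] by (simp add: algebra_simps)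
  qed
  have mi: "m * i = i * m" unfolding m_def by (intro commutes_add commutes_mult x(1) x'i)
  have tm: "\<tau> m = m" unfolding m_def x'_def by (simp add: T.sig_add T.sig_mult T.sig_sig)
  show thesis
  proof (cases "m \<in> ?K")
    case True
    then have mF: "m \<in> F" using fixF tm by blast
    \<comment> \<open>Both \<open>y\<close> and \<open>y2\<close> have squares in \<open>F\<close>,
      since \<open>\<delta> + \<tau> \<delta>\<close> is a trace from \<open>F(i)\<close>. They
      cannot both lie in \<open>F(i)\<close>, because \<open>x\<close> does not.\<close>
    define y where "y = x + x'"
    define y2 where "y2 = i * (x - x')"
    have "y * y = (x * x + x' * x') + m" unfolding y_def m_def by (simp add: algebra_simps)
    then have "y * y = (\<delta> + \<tau> \<delta>) + m" using xx' \<delta>_def by simp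
    then have yy: "y * y \<in> F" using trF[OF dK] mF divring_add[OF F_div] by simp
    have yi: "y * i = i * y" unfolding y_def by (intro commutes_add x(1) x'i)
    have xdi: "(x - x') * i = i * (x - x')" by (intro commutes_diff x(1) x'i)
    have y2i: "y2 * i = i * y2" unfolding y2_def using xdi by (simp add: mult.assoc)
    have "y2 * y2 = i * ((x - x') * i) * (x - x')" unfolding y2_def by (simp add: mult.assoc)
    also have "\<dots> = (i * i) * ((x - x') * (x - x'))" unfolding xdi by (simp add: mult.assoc)
    also have "(x - x') * (x - x') = (x * x + x' * x') - m"
      unfolding m_def by (simp add: algebra_simps)
    also have "x * x + x' * x' = \<delta> + \<tau> \<delta>" using xx' \<delta>_def by simp
    finally have y2y2: "y2 * y2 \<in> F" using trF[OF dK] mF i(2) F_div by (simp add: divring_mult divring_diff)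
    show ?thesis
    proof (cases "y \<in> ?K")
      case False
      then show ?thesis using that yi yy by blast
    next
      case yK: True
      have "y2 \<notin> ?K"
      proof
        assume "y2 \<in> ?K"
        then have "inverse i * y2 \<in> ?K" using K(1,3) by (auto intro!: divring_mult divring_inverse)
        then have xd: "x - x' \<in> ?K" unfolding y2_def using i0 by (simp flip: mult.assoc)
        have "(x + x') + (x - x') \<in> ?K" using divring_add[OF K(1) _ xd] yK unfolding y_def by blast
        then have xxK: "x + x \<in> ?K" by (simp add: algebra_simps)
        obtain h where h: "h \<in> F" "h + h = 1" using half_ex .
        have "h * (x + x) = (h + h) * x" by (simp add: algebra_simps)
        then have "x = h * (x + x)" using h by simp
        moreover have "h * (x + x) \<in> ?K" using xxK h(1) K(1,2) by (intro divring_mult) auto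
        ultimately show False using x(2) by simp
      qed
      then show ?thesis using that y2i y2y2 by blast
    qed
  next
    case False
    let ?M = "gen {i, m}"
    note M = gen_pair[OF mi]
    have KM: "?K \<subseteq> ?M"
    proof
      fix x assume "x \<in> ?K"
      then obtain a b where "x = a + i * b" "a \<in> F" "b \<in> F" unfolding ext_def by blast
      then show "x \<in> ?M" using M(1,2,3) by (auto intro!: divring_add divring_mult)
    qed
    obtain n where n: "fdim (*) F n ?M" using div_dim[OF M(1,2)] by blast
    have "n \<in> {1, 2, 4, 8}" by (rule comm_dim[OF M(1,2) subset_UNIV M(4) n])
    moreover have "\<not> n \<le> 2" using R.fdim_eq_imp_eq[OF n K(4) F_div KM] False M(3) by auto
    ultimately consider "n = 8" | "n = 4" by auto
    then show ?thesis
    proof cases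
      case 1
      \<comment> \<open>Being its own centralizer, \<open>F(i, m)\<close> contains \<open>x\<close>
        and \<open>x'\<close>. So these commute, and \<open>m * m\<close> is 4 times the norm of
        \<open>\<delta>\<close>.\<close>
      then have "centralizer UNIV ?M = ?M" using maximal_comm[OF M(1,2) subset_UNIV M(4)] n by auto
      then have CM: "Cent {i, m} = ?M" using M(5) by simp
      have "x \<in> ?M" "x' \<in> ?M" unfolding CM[symmetric] Cent_iff using x(1) x'i mx mx' by auto
      then have xx: "x * x' = x' * x" using M(4) by blast
      define e where "e = \<delta> * \<tau> \<delta>"
      have eK: "e \<in> ?K" unfolding e_def using dK tK K(1) by (simp add: divring_mult)
      have "\<tau> e = e" unfolding e_def by (simp add: T.sig_mult T.sig_sig)
      then have eF: "e \<in> F" using fixF eK by blast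
      have "e = (x * x) * (x' * x')" unfolding e_def using xx' \<delta>_def by simp
      then have "x * x' * (x * x') = e" using xx by (metis mult.assoc)
      moreover have "m = x * x' + x * x'" unfolding m_def xx ..
      ultimately have "m * m = e + e + e + e" by (simp only: distrib_left distrib_right add.assoc)
      then have "m * m \<in> F" using eF divring_add[OF F_div] by simp
      then show ?thesis using that mi False by blast
    next
      case 2
      have "\<exists>t\<in>?K. (m - t) * (m - t) \<in> ?K"
        by (rule complete_square[OF K(1,2,4) M(1) KM _ M(4)]) (use n 2 M(3) False in auto)
      then obtain t where t: "t \<in> ?K" "(m - t) * (m - t) \<in> ?K" by blast
      define s where "s = \<tau> t"
      have sK: "s \<in> ?K" unfolding s_def by (rule tK[OF t(1)])
      have tmt: "t * m = m * t" "s * m = m * s" "s * t = t * s"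
        using Kc[OF t(1) mi] Kc[OF sK mi] K(5)[OF sK t(1)] by auto
      have "\<tau> ((m - t) * (m - t)) = (m - s) * (m - s)" unfolding s_def by (simp add: T.sig_mult T.sig_diff tm)
      then have 2: "(m - s) * (m - s) \<in> ?K" using tK[OF t(2)] by simp
      \<comment> \<open>The difference of the two squares is
        \<open>(s - t) * (2 * m - (s + t))\<close> and lies in \<open>F(i)\<close>; for
        \<open>s \<noteq> t\<close> this would put \<open>m\<close> into
        \<open>F(i)\<close>.\<close>
      have st: "s = t"
      proof (rule ccontr)
        assume "s \<noteq> t"
        have "(m - t) * (m - t) - (m - s) * (m - s) = (s - t) * (m + m - (s + t))"
          using tmt by (simp add: algebra_simps)
        moreover have "(m - t) * (m - t) - (m - s) * (m - s) \<in> ?K" using t(2) 2 K(1) by (simp add: divring_diff)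
        ultimately have "inverse (s - t) * ((s - t) * (m + m - (s + t))) \<in> ?K"
          using K(1) t(1) sK by (auto intro!: divring_mult divring_inverse divring_diff)
        then have "m + m - (s + t) \<in> ?K" using \<open>s \<noteq> t\<close> by (simp flip: mult.assoc)
        then have "(m + m - (s + t)) + (s + t) \<in> ?K" using K(1) t(1) sK by (intro divring_add)
        then have mm: "m + m \<in> ?K" by simp
        obtain h where h: "h \<in> F" "h + h = 1" using half_ex .
        have "h * (m + m) = (h + h) * m" by (simp add: algebra_simps)
        then have "m = h * (m + m)" using h by simp
        moreover have "h * (m + m) \<in> ?K" using mm h(1) K(1,2) by (intro divring_mult) auto
        ultimately show False using False by simp
      qed
      have "\<tau> ((m - t) * (m - t)) = (m - t) * (m - t)"
        using st unfolding s_def by (simp add: T.sig_mult T.sig_diff tm)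
      then have "(m - t) * (m - t) \<in> F" using fixF t(2) by blast
      moreover have "(m - t) * i = i * (m - t)" using mi K(6)[OF t(1), of i] by (simp add: algebra_simps)
      moreover have "m - t \<notin> ?K" using divring_add[OF K(1) _ t(1), of "m - t"] False by auto
      ultimately show ?thesis using that by blast
    qed
  qed
qed

end

section \<open>The centralizer of a biquadratic field\<close>

lemma (in rmod) fdim_sum_le:
  assumes U: "fdim (\<cdot>) B m U" and W: "fdim (\<cdot>) B n W" and B: "divring B"
  obtains l where "l \<le> n + m" "fdim (\<cdot>) B l {w + u | w u. w \<in> W \<and> u \<in> U}"
proof -
  note sU = fdim_submod[OF U B] and sW = fdim_submod[OF W B]
  obtain T where T: "submod (\<cdot>) B T" "T \<subseteq> U" "U \<inter> W \<inter> T = {0}"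
    "U \<subseteq> {t + t' | t t'. t \<in> U \<inter> W \<and> t' \<in> T}"
    using fdim_complement[OF U B submod_inter[OF sU sW]] by blast
  obtain k where k: "k \<le> m" "fdim (\<cdot>) B k T" using fdim_submodule[OF U B T(1,2)] .
  have "fdim (\<cdot>) B (n + k) {w + u | w u. w \<in> W \<and> u \<in> T}"
    by (rule fdim_direct_sum[OF k(2) W B]) (use T(2,3) in blast)
  moreover have "{w + u | w u. w \<in> W \<and> u \<in> T} = {w + u | w u. w \<in> W \<and> u \<in> U}"
  proof (intro equalityI subsetI)
    fix x assume "x \<in> {w + u | w u. w \<in> W \<and> u \<in> U}"
    then obtain w u where x: "x = w + u" "w \<in> W" "u \<in> U" by blast
    then obtain t t' where t: "u = t + t'" "t \<in> W" "t' \<in> T" using T(4) by blast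
    then have "x = (w + t) + t'" "w + t \<in> W" using x submod_add[OF sW] by (auto simp: add.assoc)
    then show "x \<in> {w + u | w u. w \<in> W \<and> u \<in> T}" using t(3) by blast
  qed (use T(2) in blast)
  ultimately show thesis using that[of "n + k"] k(1) by simp
qed

lemma (in dalg) gen_comm_props:
  assumes c: "\<forall>x\<in>S. \<forall>y\<in>S. x * y = y * x"
  shows "divring (gen S)" "F \<subseteq> gen S" "S \<subseteq> gen S" "\<And>x y. x \<in> gen S \<Longrightarrow> y \<in> gen S \<Longrightarrow> x * y = y * x"
proof -
  have c: "x * y = y * x" if "x \<in> S" "y \<in> S" for x y using that c by blast
  show "divring (gen S)" by (rule gen_props(1)[OF subset_UNIV c])
  show "F \<subseteq> gen S" by (rule gen_props(2)[OF subset_UNIV c])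
  show "S \<subseteq> gen S" by (rule gen_props(4)[OF subset_UNIV c])
  show "x * y = y * x" if "x \<in> gen S" "y \<in> gen S" for x y
    by (rule gen_props(5)[OF subset_UNIV c that])
qed

lemma quotient_commutes:
  fixes w :: "'d::division_ring"
  assumes w: "w \<noteq> 0"
    and h: "x * a = a * x \<and> w * a = a * w \<or> x * a = - (a * x) \<and> w * a = - (a * w)"
  shows "x * inverse w * a = a * (x * inverse w)"
proof -
  have "x * inverse w * a * w = a * (x * inverse w) * w"
    using h
  proof
    assume h: "x * a = a * x \<and> w * a = a * w"
    have "x * inverse w * a * w = x * inverse w * (w * a)" using h by (simp add: mult.assoc)
    also have "\<dots> = x * (inverse w * w) * a" by (simp only: mult.assoc)
    also have "\<dots> = a * x" using w h by simp
    also have "\<dots> = a * (x * inverse w) * w" using w by (simp add: mult.assoc)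
    finally show ?thesis .
  next
    assume h: "x * a = - (a * x) \<and> w * a = - (a * w)"
    have "x * inverse w * a * w = - (x * inverse w * (w * a))" using h by (simp add: mult.assoc)
    also have "\<dots> = - (x * (inverse w * w) * a)" by (simp only: mult.assoc)
    also have "\<dots> = a * x" using w h by simp
    also have "\<dots> = a * (x * inverse w) * w" using w by (simp add: mult.assoc)
    finally show ?thesis .
  qed
  then show ?thesis using w by simp
qed

locale bq = dalg F for F :: "'d::division_ring set" +
  fixes i j :: 'd
  assumes iF: "i \<notin> F" and ii: "i * i \<in> F" and ji: "j * i = i * j" and jK: "j \<notin> ext F i" and jj: "j * j \<in> F"
begin

interpretation R: rmod "(*) :: 'd \<Rightarrow> 'd \<Rightarrow> 'd" by (rule rmod_times)

definition K1 :: "'d set" where "K1 = ext F i"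
definition K2 :: "'d set" where "K2 = ext K1 j"
definition Q :: "'d set" where "Q = Cent {i, j}"

lemma K1: "divring K1" "F \<subseteq> K1" "i \<in> K1" "fdim (*) F 2 K1" "\<And>x z. x \<in> K1 \<Longrightarrow> z * i = i * z \<Longrightarrow> x * z = z * x"
  "\<And>x y. x \<in> K1 \<Longrightarrow> y \<in> K1 \<Longrightarrow> x * y = y * x"
  unfolding K1_def using quadratic_dim[OF iF ii] by auto

lemma i0: "i \<noteq> 0" using iF divring_0[OF F_div] by auto
lemma j0: "j \<noteq> 0" using jK divring_0[OF K1(1)] unfolding K1_def by auto

lemma K2: "divring K2" "K1 \<subseteq> K2" "F \<subseteq> K2" "j \<in> K2" "fdim (*) F 4 K2"
  "\<And>x y. x \<in> K2 \<Longrightarrow> y \<in> K2 \<Longrightarrow> x * y = y * x"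
  "\<And>x z. x \<in> K2 \<Longrightarrow> z * i = i * z \<Longrightarrow> z * j = j * z \<Longrightarrow> x * z = z * x"
proof -
  have conj: "\<exists>b'\<in>K1. b * j = j * b'" if "b \<in> K1" for b using K1(5)[OF that ji] that by blast
  have jj1: "j * j \<in> K1" using jj K1(2) by blast
  note P = ext_props[OF K1(1,2) jj1 conj]
  show "divring K2" unfolding K2_def by (rule P(1))
  show "K1 \<subseteq> K2" unfolding K2_def by (rule P(2))
  show "F \<subseteq> K2" unfolding K2_def by (rule P(3))
  show "j \<in> K2" unfolding K2_def by (rule P(4))
  show "fdim (*) F 4 K2" unfolding K2_def using ext_dim[OF K1(1,2,4)] jK unfolding K1_def by fastforce
  show "x * y = y * x" if "x \<in> K2" "y \<in> K2" for x y
    using ext_comm[OF _ _ that[unfolded K2_def]] K1(6) K1(5)[OF _ ji] by blast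
  show "x * z = z * x" if "x \<in> K2" "z * i = i * z" "z * j = j * z" for x z
    using ext_commutes[OF _ _ that(1)[unfolded K2_def], of z] K1(5)[OF _ that(2)] that(3) by auto
qed

lemma iK2: "i \<in> K2" using K1(3) K2(2) by blast

lemma Q_iff: "x \<in> Q \<longleftrightarrow> x * i = i * x \<and> x * j = j * x"
  unfolding Q_def Cent_iff by auto

lemma Q: "divring Q" "F \<subseteq> Q" unfolding Q_def by (rule Cent_props)+

lemma K2_Q: "K2 \<subseteq> Q" using K2(6)[OF _ iK2] K2(6)[OF _ K2(4)] by (auto simp: Q_iff)

lemma K2_central: "k \<in> K2 \<Longrightarrow> x \<in> Q \<Longrightarrow> k * x = x * k"
  using K2(7) by (auto simp: Q_iff)

lemma Cent_K2: "Cent K2 = Q"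
proof
  show "Cent K2 \<subseteq> Q" using iK2 K2(4) by (auto simp: Q_iff Cent_iff)
  show "Q \<subseteq> Cent K2" using K2_central by (auto simp: Cent_iff)
qed

text \<open>Otherwise the centralizer of \<open>i\<close>, of dimension 32, would centralize
  \<open>K2\<close>, whose centralizer has dimension at most 64 / 4 = 16.\<close>

lemma w_pm: obtains w where "w \<noteq> 0" "w * i = i * w" "w * j = - (j * w)"
proof -
  have "\<exists>y. y * i = i * y \<and> y * j \<noteq> j * y"
  proof (rule ccontr)
    assume "\<not> ?thesis"
    then have sub: "Cent {i} \<subseteq> Cent K2" unfolding Cent_K2 by (auto simp: Q_iff Cent_iff)
    obtain q where q: "fdim (*) F q (Cent K2)" using div_dim[OF Cent_props] by blast
    have "32 \<le> q" using R.fdim_mono[OF q quadratic_dim(7)[OF iF ii] F_div sub] .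
    moreover have "4 * q \<le> 64" by (rule centralizer_bound[OF K2(1,3) subset_UNIV K2(5) q])
    ultimately show False by simp
  qed
  then obtain y where y: "y * i = i * y" "y * j \<noteq> j * y" by blast
  have jy: "j * j * y = y * (j * j)" by (rule F_comm[OF jj])
  note w = anticommuting_exists[OF jy y(2)]
  have "(y * j - j * y) * i = i * (y * j - j * y)" by (intro commutes_diff commutes_mult y(1) ji)
  then show thesis using that w by blast
qed

lemma dim_Q: "fdim (*) F 16 Q"
proof -
  obtain w where w: "w \<noteq> 0" "w * i = i * w" "w * j = - (j * w)" using w_pm .
  have eq: "Cent {i} \<inter> Cent {j} = Q" by (auto simp: Q_iff Cent_iff)
  obtain m where m: "fdim (*) F m Q" using div_dim[OF Q] by blast
  have "32 = 2 * m"
  proof (rule half_dim[OF Cent_props quadratic_dim(7)[OF iF ii]])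
    show "j \<in> Cent {i}" "w \<in> Cent {i}" using ji w by (auto simp: Cent_iff)
    show "j * j * y = y * (j * j)" for y by (rule F_comm[OF jj])
    show "fdim (*) F m (Cent {i} \<inter> Cent {j})" unfolding eq by (rule m)
  qed (use j0 w in auto)
  then show ?thesis using m by simp
qed

lemma Q_noncomm: "\<exists>p\<in>Q. \<exists>q\<in>Q. p * q \<noteq> q * p"
  by (rule comm_not_16[OF Q dim_Q]) simp

lemma C_decomp:
  assumes w: "w \<noteq> 0" "w * i = i * w" "w * j = - (j * w)" and y: "y * i = i * y"
  obtains c d where "c \<in> Q" "d \<in> Q" "y = c + d * w"
proof -
  obtain c d where cd: "c \<in> Cent {i}" "c * j = j * c" "d \<in> Cent {i}" "d * j = j * d" "y = c + d * w"
  proof (rule conj_decomp[OF Cent_props, of j "{i}" w y])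
    show "j \<in> Cent {i}" "w \<in> Cent {i}" "y \<in> Cent {i}" using ji w y by (auto simp: Cent_iff)
    show "j * j * y = y * (j * j)" for y by (rule F_comm[OF jj])
  qed (use j0 w in auto)
  then show thesis using that by (auto simp: Q_iff Cent_iff)
qed

text \<open>\<open>F(i, j, x)\<close> is a commutative field strictly above \<open>K2\<close>, so it
  has dimension 8 and is quadratic over \<open>K2\<close>.\<close>

lemma complete_square_Q:
  assumes x: "x \<in> Q" "x \<notin> K2"
  obtains t where "t \<in> K2" "(x - t) * (x - t) \<in> K2" "x - t \<in> Q" "x - t \<notin> K2"
proof -
  let ?S = "{i, j, x}"
  have c: "\<forall>a\<in>?S. \<forall>b\<in>?S. a * b = b * a" using ji x(1) by (auto simp: Q_iff)
  note M = gen_comm_props[OF c]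
  have K2M: "K2 \<subseteq> gen ?S"
  proof
    fix k assume "k \<in> K2"
    then obtain a b where k: "k = a + j * b" "a \<in> K1" "b \<in> K1" unfolding K2_def ext_def by blast
    have K1M: "y \<in> gen ?S" if "y \<in> K1" for y
    proof -
      obtain u v where "y = u + i * v" "u \<in> F" "v \<in> F" using \<open>y \<in> K1\<close> unfolding K1_def ext_def by blast
      then show ?thesis using M(2,3) by (auto intro!: divring_add[OF M(1)] divring_mult[OF M(1)])
    qed
    show "k \<in> gen ?S" unfolding k(1)
      using M(3) K1M[OF k(2)] K1M[OF k(3)] by (auto intro!: divring_add[OF M(1)] divring_mult[OF M(1)])
  qed
  obtain m where m: "fdim (*) F m (gen ?S)" using div_dim[OF M(1,2)] by blast
  have "m \<in> {1, 2, 4, 8}" by (rule comm_dim[OF M(1,2) subset_UNIV M(4) m])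
  moreover have "\<not> m \<le> 4" using R.fdim_eq_imp_eq[OF m K2(5) F_div K2M] x(2) M(3) by auto
  ultimately have m: "fdim (*) F 8 (gen ?S)" using m by auto
  have "\<exists>t\<in>K2. (x - t) * (x - t) \<in> K2"
    by (rule complete_square[OF K2(1,3,5) M(1) K2M _ M(4)]) (use m M(3) x(2) in auto)
  then obtain t where t: "t \<in> K2" "(x - t) * (x - t) \<in> K2" by blast
  moreover have "x - t \<in> Q" using x(1) t(1) K2_Q divring_diff[OF Q(1)] by blast
  moreover have "x - t \<notin> K2" using divring_add[OF K2(1) _ t(1), of "x - t"] x(2) by auto
  ultimately show thesis using that by blast
qed

context
  fixes q assumes q: "q \<in> Q" "q \<notin> K2" "q * q \<in> K2"
begin

lemma q0: "q \<noteq> 0" using q divring_0[OF K2(1)] by auto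

lemma K3: "divring (ext K2 q)" "K2 \<subseteq> ext K2 q" "F \<subseteq> ext K2 q" "q \<in> ext K2 q" "fdim (*) F 8 (ext K2 q)"
  "\<And>x y. x \<in> ext K2 q \<Longrightarrow> y \<in> ext K2 q \<Longrightarrow> x * y = y * x"
proof -
  have conj: "\<exists>b'\<in>K2. b * q = q * b'" if "b \<in> K2" for b using K2_central[OF that q(1)] that by blast
  note P = ext_props[OF K2(1,3) q(3) conj]
  show "divring (ext K2 q)" by (rule P(1))
  show "K2 \<subseteq> ext K2 q" by (rule P(2))
  show "F \<subseteq> ext K2 q" by (rule P(3))
  show "q \<in> ext K2 q" by (rule P(4))
  show "fdim (*) F 8 (ext K2 q)" using ext_dim[OF K2(1,3,5) q(2)] by simp
  show "x * y = y * x" if "x \<in> ext K2 q" "y \<in> ext K2 q" for x y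
    using ext_comm[OF _ _ that] K2(6) K2_central[OF _ q(1)] by blast
qed

text \<open>\<open>K2(q)\<close> has dimension 8 and is therefore its own centralizer in
  \<open>D\<close>.\<close>

lemma Cent_Q: "x \<in> Q \<Longrightarrow> x * q = q * x \<Longrightarrow> x \<in> ext K2 q"
proof -
  assume x: "x \<in> Q" "x * q = q * x"
  have "y * x = x * y" if "y \<in> ext K2 q" for y
    by (rule ext_commutes[OF _ _ that]) (use x K2_central in auto)
  then have "x \<in> Cent (ext K2 q)" by (auto simp: Cent_iff)
  then show ?thesis using maximal_comm[OF K3(1,3) subset_UNIV K3(6,5)] by blast
qed

lemma anticommuting_Q: obtains v where "v \<in> Q" "v \<noteq> 0" "v * q = - (q * v)"
proof -
  have "\<exists>y\<in>Q. y * q \<noteq> q * y"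
  proof (rule ccontr)
    assume "\<not> ?thesis"
    then have "Q \<subseteq> ext K2 q" using Cent_Q by blast
    then have "(16::nat) \<le> 8" using R.fdim_mono[OF K3(5) dim_Q F_div] by blast
    then show False by simp
  qed
  then obtain y where y: "y \<in> Q" "y * q \<noteq> q * y" by blast
  note v = anticommuting_exists[OF K2_central[OF q(3) y(1)] y(2)]
  have "y * q - q * y \<in> Q" using y q Q(1) by (simp add: divring_diff divring_mult)
  then show thesis using that v by blast
qed

text \<open>So \<open>Q\<close> is a quaternion algebra over \<open>K2\<close>: the part commuting
  with \<open>q\<close> is \<open>K2(q)\<close>, and the part anticommuting with \<open>q\<close> is
  \<open>K2(q) v\<close>.\<close>

lemma quaternion_decomp:
  assumes v: "v \<in> Q" "v \<noteq> 0" "v * q = - (q * v)" and y: "y \<in> Q"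
  obtains a b c d where "a \<in> K2" "b \<in> K2" "c \<in> K2" "d \<in> K2" "y = a + q * b + (c + q * d) * v"
proof -
  obtain c d where cd: "c \<in> Q" "c * q = q * c" "d \<in> Q" "d * q = q * d" "y = c + d * v"
    by (rule conj_decomp[OF Q q(1) q0 K2_central[OF q(3)] v y])
  have "c \<in> ext K2 q" "d \<in> ext K2 q" using Cent_Q cd by auto
  then obtain a b a' b' where "c = a + q * b" "a \<in> K2" "b \<in> K2" "d = a' + q * b'" "a' \<in> K2" "b' \<in> K2"
    unfolding ext_def by blast
  then show thesis using that cd(5) by blast
qed

text \<open>\<open>v * v\<close> commutes with \<open>q\<close>, so it equals
  \<open>a + q * b\<close> with \<open>a\<close> and \<open>b\<close> in \<open>K2\<close>. It also
  commutes with \<open>v\<close>, which anticommutes with \<open>q\<close>, and this forces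
  \<open>q * b = 0\<close>.\<close>

lemma anticommuting_square:
  assumes v: "v \<in> Q" "v \<noteq> 0" "v * q = - (q * v)"
  shows "v * v \<in> K2"
proof -
  have "v * v * q = q * (v * v)"
  proof -
    have "v * v * q = v * (v * q)" by (simp add: mult.assoc)
    also have "\<dots> = v * (- (q * v))" by (simp only: v(3))
    also have "\<dots> = - ((v * q) * v)" by (simp add: mult.assoc)
    also have "\<dots> = - (- (q * v) * v)" by (simp only: v(3))
    also have "\<dots> = q * (v * v)" by (simp add: mult.assoc)
    finally show ?thesis .
  qed
  then have "v * v \<in> ext K2 q" using Cent_Q v(1) Q(1) by (simp add: divring_mult)
  then obtain a b where ab: "v * v = a + q * b" "a \<in> K2" "b \<in> K2" unfolding ext_def by blast
  have va: "v * a = a * v" "v * b = b * v" using K2_central[OF ab(2) v(1)] K2_central[OF ab(3) v(1)] by simp_all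
  have "v * (v * v) = (v * v) * v" by (simp add: mult.assoc)
  then have "v * a + v * q * b = a * v + q * b * v" unfolding ab(1) by (simp add: algebra_simps)
  then have "- (q * v) * b = q * b * v" using va v(3) by simp
  then have "- (q * b * v) = q * b * v" using va by (simp add: mult.assoc)
  then have "q * b * v + q * b * v = 0" by (metis add.right_inverse)
  then have "q * b * v = 0" by (rule double_0)
  then have "q * b = 0" using v(2) by simp
  then show ?thesis using ab by (simp only: add_0_right)
qed

end

text \<open>Exchanging the generators \<open>i\<close>, \<open>j\<close>, \<open>i * j\<close> of
  the biquadratic field permutes the nontrivial sign pairs, so that results on one graded piece
  carry over to the others.\<close>

lemma bq_swap: "bq F j i"
proof
  show "j \<notin> F" using jK K1(2) unfolding K1_def by blast
  show "i \<notin> ext F j"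
  proof
    assume "i \<in> ext F j"
    then obtain a b where ab: "i = a + j * b" "a \<in> F" "b \<in> F" unfolding ext_def by blast
    have "b \<noteq> 0" using ab iF by auto
    have "j * b = i - a" using ab(1) by simp
    then have "j = (i - a) * inverse b" using \<open>b \<noteq> 0\<close> by (metis mult.assoc right_inverse mult_1_right)
    moreover have "(i - a) * inverse b \<in> K1"
      using K1(2) ab(2,3) by (intro divring_mult[OF K1(1)] divring_diff[OF K1(1) K1(3)] divring_inverse[OF K1(1)]) auto
    ultimately show False using jK unfolding K1_def by simp
  qed
qed (use ii jj ji in auto)

lemma bq_mult: "bq F (i * j) i"
proof
  have inv: "inverse i * (i * j) = j" using i0 by (simp flip: mult.assoc)
  show "i * j \<notin> F"
  proof
    assume "i * j \<in> F"
    then have "i * j \<in> K1" using K1(2) by blast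
    then have "inverse i * (i * j) \<in> K1" by (rule divring_mult[OF K1(1) divring_inverse[OF K1(1,3)]])
    then show False using jK inv unfolding K1_def by simp
  qed
  have "i * j * (i * j) = (i * i) * (j * j)" using ji by (metis mult.assoc)
  then show "i * j * (i * j) \<in> F" using ii jj F_div by (simp add: divring_mult)
  show "i * (i * j) = i * j * i" using ji by (simp add: mult.assoc)
  show "i * i \<in> F" by (rule ii)
  show "i \<notin> ext F (i * j)"
  proof
    assume "i \<in> ext F (i * j)"
    then obtain a b where ab: "i = a + i * j * b" "a \<in> F" "b \<in> F" unfolding ext_def by blast
    have "b \<noteq> 0" using ab iF by auto
    have "i * j * b = i - a" using ab(1) by (metis add_diff_cancel_left')
    then have "i * j = (i - a) * inverse b" using \<open>b \<noteq> 0\<close> by (metis mult.assoc right_inverse mult_1_right)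
    moreover have "(i - a) * inverse b \<in> K1"
      using K1(2) ab(2,3) by (intro divring_mult[OF K1(1)] divring_diff[OF K1(1) K1(3)] divring_inverse[OF K1(1)]) auto
    ultimately have "i * j \<in> K1" by simp
    then have "inverse i * (i * j) \<in> K1" by (rule divring_mult[OF K1(1) divring_inverse[OF K1(1,3)]])
    then show False using jK inv unfolding K1_def by simp
  qed
qed

end

section \<open>Involutions that fix the biquadratic field\<close>

locale bqs = dinv F \<sigma> + bq F i j for F :: "'d::division_ring set" and \<sigma> i j
begin

text \<open>From \<open>i * x = x * \<sigma> i\<close> the element
  \<open>j * x + x * \<sigma> j\<close> intertwines both pairs. If it vanishes, \<open>x\<close> has
  the wrong sign at \<open>j\<close>, and this is corrected by a factor \<open>w\<close> that
  commutes with \<open>i\<close> and anticommutes with \<open>j\<close>. The common intertwiners are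
  a left module over the noncommutative \<open>Q\<close>, so \<open>symmetric_element\<close>
  applies.\<close>

lemma conjugator: "\<exists>e. e \<noteq> 0 \<and> \<sigma> e = e \<and> e * \<sigma> i = i * e \<and> e * \<sigma> j = j * e"
proof -
  let ?M = "{x. x * \<sigma> i = i * x \<and> x * \<sigma> j = j * x}"
  have si: "\<sigma> i * \<sigma> i = i * i" and sj: "\<sigma> j * \<sigma> j = j * j"
    unfolding sig_mult[symmetric] using J_E[OF ii] J_E[OF jj] by auto
  have sji: "\<sigma> i * \<sigma> j = \<sigma> j * \<sigma> i" unfolding sig_mult[symmetric] ji ..
  obtain x where x: "x \<noteq> 0" "i * x = x * \<sigma> i" using intertwine[OF iF ii si] .
  have "\<exists>y\<in>?M. y \<noteq> 0"
  proof (cases "j * x + x * \<sigma> j = 0")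
    case False
    let ?y = "j * x + x * \<sigma> j"
    have "?y * \<sigma> i = j * (x * \<sigma> i) + x * \<sigma> i * \<sigma> j" unfolding mult.assoc sji by (simp add: algebra_simps)
    also have "\<dots> = j * i * x + i * x * \<sigma> j" unfolding x(2)[symmetric] by (simp add: mult.assoc)
    also have "\<dots> = i * ?y" unfolding ji by (simp add: algebra_simps)
    finally have 1: "?y * \<sigma> i = i * ?y" .
    have "?y * \<sigma> j = j * x * \<sigma> j + x * (\<sigma> j * \<sigma> j)" by (simp add: algebra_simps)
    also have "x * (\<sigma> j * \<sigma> j) = j * (j * x)" unfolding sj F_comm[OF jj, of x, symmetric] by (simp add: mult.assoc)
    finally have "?y * \<sigma> j = j * ?y" by (simp add: algebra_simps)
    then show ?thesis using False 1 by blast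
  next
    case True
    obtain w where w: "w \<noteq> 0" "w * i = i * w" "w * j = - (j * w)" using w_pm .
    have xj: "x * \<sigma> j = - (j * x)" using True by (simp add: eq_neg_iff_add_eq_0 add.commute)
    have "w * x * \<sigma> i = w * i * x" using x(2) by (simp add: mult.assoc)
    then have 1: "w * x * \<sigma> i = i * (w * x)" using w(2) by (simp add: mult.assoc)
    have "w * x * \<sigma> j = - (w * j * x)" using xj by (simp add: mult.assoc)
    then have "w * x * \<sigma> j = j * (w * x)" using w(3) by (simp add: mult.assoc)
    then show ?thesis using 1 w x by (intro bexI[of _ "w * x"]) auto
  qed
  then obtain y where y: "y \<in> ?M" "y \<noteq> 0" by blast
  have "\<exists>s\<in>?M. s \<noteq> 0 \<and> \<sigma> s = s"
  proof (rule symmetric_element[OF y, of Q])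
    fix x assume x: "x \<in> ?M"
    then have "\<sigma> (x * \<sigma> i) = \<sigma> (i * x)" "\<sigma> (x * \<sigma> j) = \<sigma> (j * x)" by auto
    then show "\<sigma> x \<in> ?M" by (simp add: sig_mult sig_sig)
    fix q assume "q \<in> Q"
    then have "q * i = i * q" "q * j = j * q" by (auto simp: Q_iff)
    then show "q * x \<in> ?M" using x by (auto simp: mult.assoc) (metis mult.assoc)+
  next
    show "x + y \<in> ?M" if "x \<in> ?M" "y \<in> ?M" for x y using that by (auto simp: algebra_simps)
  qed (use Q_noncomm divring_mult[OF Q(1)] in auto)
  then show ?thesis by blast
qed

end

text \<open>The bound on \<open>r\<close> records that \<open>\<sigma>\<close> is of orthogonal
  type: 8 * 9 / 2 = 36.\<close>

locale biquad = bqs F \<sigma> i j for F :: "'d::division_ring set" and \<sigma> i j +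
  fixes r :: nat
  assumes si: "\<sigma> i = i" and sj: "\<sigma> j = j" and r: "fdim (*) F r Sym" "36 \<le> r"
begin

interpretation R: rmod "(*) :: 'd \<Rightarrow> 'd \<Rightarrow> 'd" by (rule rmod_times)

lemma biquad_swap: "biquad F \<sigma> j i r"
proof -
  interpret S: bq F j i by (rule bq_swap)
  show ?thesis by unfold_locales (use si sj r in auto)
qed

lemma biquad_mult: "biquad F \<sigma> (i * j) i r"
proof -
  interpret S: bq F "i * j" i by (rule bq_mult)
  show ?thesis by unfold_locales (use si sj r ji in \<open>auto simp: sig_mult\<close>)
qed

lemma sig_K1: "k \<in> K1 \<Longrightarrow> \<sigma> k = k"
proof -
  assume "k \<in> K1"
  then obtain a b where k: "k = a + i * b" "a \<in> F" "b \<in> F" unfolding K1_def ext_def by blast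
  show ?thesis unfolding k(1) using F_comm[OF k(3), of i] by (simp add: sig_add sig_mult si J_E[OF k(2)] J_E[OF k(3)])
qed

lemma sig_K2: "k \<in> K2 \<Longrightarrow> \<sigma> k = k"
proof -
  assume "k \<in> K2"
  then obtain a b where k: "k = a + j * b" "a \<in> K1" "b \<in> K1" unfolding K2_def ext_def by blast
  show ?thesis unfolding k(1) using K1(5)[OF k(3) ji] by (simp add: sig_add sig_mult sj sig_K1[OF k(2)] sig_K1[OF k(3)])
qed

lemma sig_Q: "x \<in> Q \<Longrightarrow> \<sigma> x \<in> Q"
proof -
  assume "x \<in> Q"
  then have "\<sigma> (x * i) = \<sigma> (i * x)" "\<sigma> (x * j) = \<sigma> (j * x)" by (auto simp: Q_iff)
  then show ?thesis by (simp add: Q_iff sig_mult si sj)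
qed

lemma sym_w_pm: obtains w where "w \<noteq> 0" "\<sigma> w = w" "w * i = i * w" "w * j = - (j * w)"
proof -
  let ?M = "{x. x * i = i * x \<and> x * j = - (j * x)}"
  obtain w where w: "w \<noteq> 0" "w * i = i * w" "w * j = - (j * w)" using w_pm .
  have "\<exists>s\<in>?M. s \<noteq> 0 \<and> \<sigma> s = s"
  proof (rule symmetric_element[of w _ Q])
    show "w \<in> ?M" "w \<noteq> 0" using w by auto
    fix x assume x: "x \<in> ?M"
    then have "\<sigma> (x * i) = \<sigma> (i * x)" "\<sigma> (x * j) = \<sigma> (- (j * x))" by auto
    then show "\<sigma> x \<in> ?M" by (simp add: sig_mult sig_minus si sj)
    fix q assume "q \<in> Q"
    then have q: "q * i = i * q" "q * j = j * q" by (auto simp: Q_iff)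
    have "q * x * i = i * (q * x)" "q * x * j = - (j * (q * x))"
      using x q by (auto simp: mult.assoc) (metis mult.assoc mult_minus_right)+
    then show "q * x \<in> ?M" by blast
  next
    show "x + y \<in> ?M" if "x \<in> ?M" "y \<in> ?M" for x y using that by (auto simp: algebra_simps)
  qed (use Q_noncomm divring_mult[OF Q(1)] in auto)
  then show thesis using that by blast
qed

text \<open>The components are half the sum and half the difference of \<open>x\<close> and
  \<open>a * x * inverse a\<close>. This conjugate is symmetric since \<open>a\<close> is symmetric
  with central square, and it keeps its relation to any \<open>b\<close> that commutes with
  \<open>a\<close>.\<close>

lemma sym_eigen:
  assumes a: "a \<noteq> 0" "a * a \<in> F" "\<sigma> a = a" and x: "\<sigma> x = x"
  shows "\<exists>c e. x = c + e \<and> \<sigma> c = c \<and> \<sigma> e = e \<and> c * a = a * c \<and> e * a = - (a * e) \<and>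
    (a * b = b * a \<longrightarrow> (x * b = b * x \<longrightarrow> c * b = b * c \<and> e * b = b * e) \<and>
      (x * b = - (b * x) \<longrightarrow> c * b = - (b * c) \<and> e * b = - (b * e)))"
proof -
  obtain h where h: "h \<in> F" "h + h = 1" using half_ex .
  define y where "y = a * x * inverse a"
  have ya: "y * a = a * x" unfolding y_def using a by (simp add: mult.assoc)
  have ay: "a * y = x * a"
  proof -
    have "a * y = (a * a * x) * inverse a" unfolding y_def by (simp add: mult.assoc)
    also have "\<dots> = x * a * (a * inverse a)" unfolding F_comm[OF a(2)] by (simp add: mult.assoc)
    finally show ?thesis using a by simp
  qed
  have sy: "\<sigma> y = y"
  proof -
    have "\<sigma> (y * a) = \<sigma> (a * x)" using ya by simp
    then have "a * \<sigma> y = a * y" using ay by (simp add: sig_mult a(3) x)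
    then show ?thesis using a(1) by simp
  qed
  have hc: "h * z = z * h" for z by (rule F_comm[OF h(1)])
  have sh: "\<sigma> (h * z) = h * \<sigma> z" for z using hc[of "\<sigma> z"] by (simp add: sig_mult J_E[OF h(1)])
  have hz: "h * z * b = h * (z * b)" "b * (h * z) = h * (b * z)" for z b
    using hc[of b] by (metis mult.assoc)+
  have inv: "inverse a * b = b * inverse a" if "a * b = b * a" for b
    using that a(1) by (metis (no_types) left_inverse mult.assoc mult_1_left mult_1_right right_inverse)
  have yb: "y * b = b * y" if "a * b = b * a" "x * b = b * x" for b
    unfolding y_def by (intro commutes_mult that inv)
  have yb': "y * b = - (b * y)" if ab: "a * b = b * a" and xb: "x * b = - (b * x)" for b
  proof -
    have "y * b = a * (x * b) * inverse a" unfolding y_def using inv[OF ab] by (simp add: mult.assoc)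
    also have "\<dots> = - (a * b * x * inverse a)" unfolding xb by (simp add: mult.assoc)
    also have "\<dots> = - (b * y)" unfolding ab y_def by (simp add: mult.assoc)
    finally show ?thesis .
  qed
  have 1: "x = h * (x + y) + h * (x - y)"
  proof -
    have "h * (x + y) + h * (x - y) = (h + h) * x" by (simp add: algebra_simps)
    then show ?thesis using h by simp
  qed
  have 2: "\<sigma> (h * (x + y)) = h * (x + y)" "\<sigma> (h * (x - y)) = h * (x - y)"
    by (simp_all add: sh sig_add sig_diff x sy)
  have 3: "h * (x + y) * a = a * (h * (x + y))" "h * (x - y) * a = - (a * (h * (x - y)))"
    unfolding hz using ya ay by (simp_all add: algebra_simps)
  have 4: "h * (x + y) * b = b * (h * (x + y)) \<and> h * (x - y) * b = b * (h * (x - y))" if "a * b = b * a" "x * b = b * x"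
    unfolding hz using yb[OF that] that(2) by (simp add: algebra_simps)
  have 5: "h * (x + y) * b = - (b * (h * (x + y))) \<and> h * (x - y) * b = - (b * (h * (x - y)))" if "a * b = b * a" "x * b = - (b * x)"
    unfolding hz using yb'[OF that] that(2) by (simp add: algebra_simps)
  show ?thesis using 1 2 3 4 5 by blast
qed

text \<open>If all symmetric elements of \<open>Q\<close> lay in \<open>K2\<close>, there would be
  at most 4 + 3 * 8 = 28 dimensions of symmetric elements in \<open>D\<close>. Indeed each of the
  other three pieces has dimension 16, and at most half of it is symmetric: multiplication by
  \<open>i\<close> or \<open>j\<close> injects its symmetric elements into its skew ones.\<close>

lemma orthogonal_basis:
  obtains k w where "k \<in> Q" "k \<notin> K2" "k * k \<in> K2" "\<sigma> k = k" "w \<in> Q" "w \<noteq> 0" "\<sigma> w = w" "w * k = - (k * w)"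
proof -
  have "\<exists>x\<in>Q. \<sigma> x = x \<and> x \<notin> K2"
  proof (rule ccontr)
    assume no: "\<not> ?thesis"
    let ?D = "\<lambda>P R. {x. P x \<and> R x \<and> \<sigma> x = x}"
    let ?ci = "\<lambda>x. x * i = i * x" and ?ai = "\<lambda>x. x * i = - (i * x)"
    let ?cj = "\<lambda>x. x * j = j * x" and ?aj = "\<lambda>x. x * j = - (j * x)"
    define S1 where "S1 = ?D ?ci ?aj"
    define S2 where "S2 = ?D ?ai ?cj"
    define S3 where "S3 = ?D ?ai ?aj"
    have comm: "submod (*) F {x. x * a = a * x}" and anti: "submod (*) F {x. x * a = - (a * x)}" for a
      unfolding submod_def using F_comm[of _ a] by (auto simp: distrib_left distrib_right mult.assoc)
        (metis mult.assoc mult_minus_left mult_minus_right)+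
    have "S1 = {x. ?ci x} \<inter> ({x. ?aj x} \<inter> Sym)" "S2 = {x. ?ai x} \<inter> ({x. ?cj x} \<inter> Sym)"
      "S3 = {x. ?ai x} \<inter> ({x. ?aj x} \<inter> Sym)"
      unfolding S1_def S2_def S3_def Sym_def by auto
    then have sub: "submod (*) F S1" "submod (*) F S2" "submod (*) F S3"
      by (auto intro!: submod_inter comm anti Sym_submod)
    obtain d1 d2 d3 where d: "fdim (*) F d1 S1" "fdim (*) F d2 S2" "fdim (*) F d3 S3"
      using fdim_exists sub by metis
    have small: "n \<le> 8" if n: "fdim (*) F n S" and S: "\<And>x. x \<in> S \<Longrightarrow> \<sigma> x = x \<and> x * a = - (a * x)"
      and a: "a \<noteq> 0" "\<sigma> a = a" and inQ: "\<And>x. x \<in> S \<Longrightarrow> x \<in> T \<and> a * x \<in> T" and T: "fdim (*) F 16 T"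
      for n S a T
    proof -
      have aS: "fdim (*) F n ((*) a ` S)"
        by (rule fdim_image[OF n rmod_times rmod_times F_div]) (use a in \<open>auto simp: algebra_simps\<close>)
      have "(*) a ` S \<inter> S \<subseteq> {0}"
      proof
        fix y assume "y \<in> (*) a ` S \<inter> S"
        then obtain x where x: "x \<in> S" "y = a * x" "y \<in> S" by blast
        have "\<sigma> y = x * a" unfolding x(2) using S[OF x(1)] a by (simp add: sig_mult)
        then have "y = - y" using S[OF x(1)] S[OF x(3)] x(2) by simp
        then have "y + y = 0" by (metis add.right_inverse)
        then show "y \<in> {0}" using double_0 by blast
      qed
      then have "fdim (*) F (n + n) {w + u | w u. w \<in> S \<and> u \<in> (*) a ` S}"
        by (rule R.fdim_direct_sum[OF aS n F_div])
      moreover have "{w + u | w u. w \<in> S \<and> u \<in> (*) a ` S} \<subseteq> T"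
        using inQ R.fdim_submod[OF T F_div] by (auto intro!: submod_add[of "(*)" F T])
      ultimately have "n + n \<le> 16" using R.fdim_mono[OF T _ F_div] by blast
      then show ?thesis by simp
    qed
    have Qw: "fdim (*) F 16 ((\<lambda>q. q * w) ` Q)" if "w \<noteq> 0" for w
    proof (rule fdim_image[OF dim_Q rmod_times rmod_times F_div])
      show "x * b * w = x * w * b" if "b \<in> F" for x b using F_comm[OF that, of w] by (simp add: mult.assoc)
    qed (use that in \<open>auto simp: algebra_simps\<close>)
    interpret B2: biquad F \<sigma> j i r by (rule biquad_swap)
    obtain w1 where w1: "w1 \<noteq> 0" "w1 * i = i * w1" "w1 * j = - (j * w1)" using w_pm .
    obtain w2 where w2: "w2 \<noteq> 0" "w2 * j = j * w2" "w2 * i = - (i * w2)" using B2.w_pm .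
    define w3 where "w3 = w1 * w2"
    have w3: "w3 \<noteq> 0" "w3 * i = - (i * w3)" "w3 * j = - (j * w3)"
      unfolding w3_def using w1 w2 by (auto simp: mult.assoc) (metis mult.assoc mult_minus_right mult_minus_left)+
    have inQw: "x \<in> (\<lambda>q. q * w) ` Q" if w: "w \<noteq> 0"
      and ii: "(x * i = i * x \<and> w * i = i * w) \<or> (x * i = - (i * x) \<and> w * i = - (i * w))"
      and jj: "(x * j = j * x \<and> w * j = j * w) \<or> (x * j = - (j * x) \<and> w * j = - (j * w))" for x w
    proof -
      have "x * inverse w \<in> Q" unfolding Q_iff using quotient_commutes[OF w] ii jj by blast
      moreover have "x = x * inverse w * w" using w by (simp add: mult.assoc)
      ultimately show ?thesis by blast
    qed
    have jix: "j * (i * x) = i * (j * x)" for x using ji by (metis mult.assoc)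
    have "d1 \<le> 8"
      by (rule small[OF d(1), of j, OF _ _ _ _ Qw[OF w1(1)]])
        (use j0 sj ji w1 in \<open>auto simp: S1_def mult.assoc jix intro!: inQw\<close>)
    moreover have "d2 \<le> 8"
      by (rule small[OF d(2), of i, OF _ _ _ _ Qw[OF w2(1)]])
        (use i0 si ji w2 in \<open>auto simp: S2_def mult.assoc jix intro!: inQw\<close>)
    moreover have "d3 \<le> 8"
      by (rule small[OF d(3), of i, OF _ _ _ _ Qw[OF w3(1)]])
        (use i0 si ji w3 in \<open>auto simp: S3_def mult.assoc jix intro!: inQw\<close>)
    moreover obtain e1 where e1: "e1 \<le> 4 + d1" "fdim (*) F e1 {w + u | w u. w \<in> K2 \<and> u \<in> S1}"
      using R.fdim_sum_le[OF d(1) K2(5) F_div] .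
    moreover obtain e2 where e2: "e2 \<le> e1 + d2"
      "fdim (*) F e2 {w + u | w u. w \<in> {w + u | w u. w \<in> K2 \<and> u \<in> S1} \<and> u \<in> S2}"
      using R.fdim_sum_le[OF d(2) e1(2) F_div] .
    moreover obtain e3 where e3: "e3 \<le> e2 + d3"
      "fdim (*) F e3 {w + u | w u. w \<in> {w + u | w u. w \<in> {w + u | w u. w \<in> K2 \<and> u \<in> S1} \<and> u \<in> S2} \<and> u \<in> S3}"
      using R.fdim_sum_le[OF d(3) e2(2) F_div] .
    moreover have "Sym \<subseteq> {w + u | w u. w \<in> {w + u | w u. w \<in> {w + u | w u. w \<in> K2 \<and> u \<in> S1} \<and> u \<in> S2} \<and> u \<in> S3}"
    proof
      fix x assume "x \<in> Sym"
      then have sx: "\<sigma> x = x" by (simp add: Sym_def)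
      obtain c e where ce: "x = c + e" "\<sigma> c = c" "\<sigma> e = e" "c * i = i * c" "e * i = - (i * e)"
        using sym_eigen[OF i0 ii si sx] by blast
      obtain c1 c2 where c: "c = c1 + c2" "\<sigma> c1 = c1" "\<sigma> c2 = c2" "c1 * j = j * c1" "c2 * j = - (j * c2)"
        "c1 * i = i * c1" "c2 * i = i * c2"
        using sym_eigen(1)[OF j0 jj sj ce(2), of i] ji ce(4) by metis
      obtain f1 f2 where f: "e = f1 + f2" "\<sigma> f1 = f1" "\<sigma> f2 = f2" "f1 * j = j * f1" "f2 * j = - (j * f2)"
        "f1 * i = - (i * f1)" "f2 * i = - (i * f2)"
        using sym_eigen(1)[OF j0 jj sj ce(3), of i] ji ce(5) by metis
      have "c1 \<in> K2" using no c by (auto simp: Q_iff)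
      moreover have "c2 \<in> S1" "f1 \<in> S2" "f2 \<in> S3" unfolding S1_def S2_def S3_def using c f by auto
      moreover have "x = ((c1 + c2) + f1) + f2" using ce(1) c(1) f(1) by (simp add: add.assoc)
      ultimately show "x \<in> {w + u | w u. w \<in> {w + u | w u. w \<in> {w + u | w u. w \<in> K2 \<and> u \<in> S1} \<and> u \<in> S2} \<and> u \<in> S3}"
        by blast
    qed
    then have "r \<le> e3" by (rule R.fdim_mono[OF e3(2) r(1) F_div])
    ultimately show False using r(2) by linarith
  qed
  then obtain x where x: "x \<in> Q" "\<sigma> x = x" "x \<notin> K2" by blast
  obtain t where t: "t \<in> K2" "(x - t) * (x - t) \<in> K2" "x - t \<in> Q" "x - t \<notin> K2"
    using complete_square_Q[OF x(1,3)] .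
  \<comment> \<open>Completing the square keeps the element symmetric, because
    \<open>\<sigma>\<close> fixes \<open>K2\<close>.\<close>
  define k where "k = x - t"
  have k: "k \<in> Q" "k \<notin> K2" "k * k \<in> K2" "\<sigma> k = k"
    unfolding k_def using t x sig_K2[OF t(1)] by (auto simp: sig_diff)
  obtain v where v: "v \<in> Q" "v \<noteq> 0" "v * k = - (k * v)" using anticommuting_Q[OF k(1-3)] .
  show thesis
  proof (cases "v + \<sigma> v = 0")
    case False
    have "\<sigma> (v * k) = \<sigma> (- (k * v))" using v(3) by simp
    then have "k * \<sigma> v = - (\<sigma> v * k)" by (simp add: sig_mult sig_minus k(4))
    then have "(v + \<sigma> v) * k = - (k * (v + \<sigma> v))" using v(3) by (simp add: algebra_simps)
    moreover have "\<sigma> (v + \<sigma> v) = v + \<sigma> v" by (simp add: sig_add sig_sig add.commute)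
    moreover have "v + \<sigma> v \<in> Q" using v(1) sig_Q divring_add[OF Q(1)] by blast
    ultimately show ?thesis using that k False by blast
  next
    case True
    \<comment> \<open>A skew \<open>v\<close> is replaced by \<open>k * v\<close>, which is
      symmetric as \<open>k\<close> and \<open>v\<close> anticommute.\<close>
    then have sv: "\<sigma> v = - v" by (simp add: eq_neg_iff_add_eq_0 add.commute)
    have "\<sigma> (k * v) = k * v" using sv v(3) by (simp add: sig_mult k(4))
    moreover have "k * v * k = - (k * (k * v))" using v(3) by (simp add: mult.assoc)
    moreover have "k * v \<noteq> 0" using v(2) q0[OF k(1-3)] by simp
    moreover have "k * v \<in> Q" using v(1) k(1) divring_mult[OF Q(1)] by blast
    ultimately show ?thesis using that k by blast
  qed
qed

text \<open>The twist \<open>\<tau>\<close> by \<open>w\<close> fixes \<open>K1\<close> and negates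
  \<open>j\<close>, so on \<open>Q\<close> it is a unitary involution over \<open>K1\<close>.
  Multiplication by \<open>j\<close> exchanges its symmetric and skew elements, which allows both
  quaternion generators to be skew. Their squares are fixed by \<open>\<tau>\<close> and thus lie in
  \<open>K1\<close>.\<close>

lemma unitary_basis:
  assumes w: "w \<noteq> 0" "\<sigma> w = w" "w * i = i * w" "w * j = - (j * w)"
  obtains q v where "q \<in> Q" "q \<notin> K2" "q * q \<in> K1" "w * \<sigma> q = - (q * w)"
    "v \<in> Q" "v \<noteq> 0" "v * q = - (q * v)" "w * \<sigma> v = - (v * w)" "v * v \<in> K1"
proof -
  define \<tau> where "\<tau> = (\<lambda>d. w * \<sigma> d * inverse w)"
  interpret T: dinv F \<tau> unfolding \<tau>_def by (rule conj_dinv) (use w in auto)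
  have ti: "\<tau> i = i" and tj: "\<tau> j = - j"
    unfolding \<tau>_def si sj using w by (auto simp: mult.assoc)
  have tK1: "\<tau> k = k" if k1: "k \<in> K1" for k
  proof -
    obtain a b where k: "k = a + i * b" "a \<in> F" "b \<in> F" using k1 unfolding K1_def ext_def by blast
    show ?thesis unfolding k(1) using F_comm[OF k(3), of i] by (simp add: T.sig_add T.sig_mult ti T.J_E[OF k(2)] T.J_E[OF k(3)])
  qed
  have tK2: "\<tau> k \<in> K2" and fix2: "\<tau> k = k \<Longrightarrow> k \<in> K1" if k2: "k \<in> K2" for k
  proof -
    obtain a b where k: "k = a + j * b" "a \<in> K1" "b \<in> K1" using k2 unfolding K2_def ext_def by blast
    have tk: "\<tau> k = a - j * b" unfolding k(1) using K1(5)[OF k(3) ji]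
      by (simp add: T.sig_add T.sig_mult tj tK1[OF k(2)] tK1[OF k(3)])
    show "\<tau> k \<in> K2" unfolding tk using k K2(1,2,4) by (auto intro!: divring_diff divring_mult)
    assume fix_k: "\<tau> k = k"
    have "j * b + j * b = k - \<tau> k" using tk k(1) by simp
    then have "j * b + j * b = 0" using fix_k by simp
    then have "j * b = 0" by (rule double_0)
    then have "k = a" using k(1) by (simp only: add_0_right)
    then show "k \<in> K1" using k(2) by simp
  qed
  have tQ: "\<tau> x \<in> Q" if "x \<in> Q" for x
  proof -
    have "\<tau> (x * i) = \<tau> (i * x)" "\<tau> (x * j) = \<tau> (j * x)" using that by (auto simp: Q_iff)
    then show ?thesis by (simp add: Q_iff T.sig_mult ti tj)
  qed
  have tw: "w * \<sigma> x = - (x * w)" if "\<tau> x = - x" for x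
  proof -
    have "\<tau> x * w = w * \<sigma> x" unfolding \<tau>_def using w(1) by (simp add: mult.assoc)
    then show ?thesis using that by simp
  qed
  have "\<not> Q \<subseteq> K2"
  proof
    assume "Q \<subseteq> K2"
    then have "(16::nat) \<le> 4" using R.fdim_mono[OF K2(5) dim_Q F_div] by blast
    then show False by simp
  qed
  then obtain y where y: "y \<in> Q" "y \<notin> K2" by blast
  have "\<exists>q\<in>Q. q \<notin> K2 \<and> \<tau> q = - q"
  proof (cases "y - \<tau> y \<in> K2")
    case False
    moreover have "\<tau> (y - \<tau> y) = - (y - \<tau> y)" by (simp add: T.sig_diff T.sig_sig)
    ultimately show ?thesis using y tQ divring_diff[OF Q(1)] by blast
  next
    case True
    let ?q = "j * (y + \<tau> y)"
    have "y + \<tau> y \<in> Q" using y tQ divring_add[OF Q(1)] by blast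
    then have "(y + \<tau> y) * j = j * (y + \<tau> y)" by (simp add: Q_iff)
    then have "\<tau> ?q = - ?q" by (simp add: T.sig_mult T.sig_add T.sig_sig tj add.commute)
    moreover have "?q \<in> Q" using y tQ K2(4) K2_Q by (auto intro!: divring_mult[OF Q(1)] divring_add[OF Q(1)])
    moreover have "?q \<notin> K2"
    proof
      assume "?q \<in> K2"
      then have "inverse j * ?q \<in> K2" using K2(1,4) by (auto intro!: divring_mult divring_inverse)
      then have s: "y + \<tau> y \<in> K2" using j0 by (simp flip: mult.assoc)
      have "(y + \<tau> y) + (y - \<tau> y) \<in> K2" by (rule divring_add[OF K2(1) s True])
      then have yy: "y + y \<in> K2" by (simp add: algebra_simps)
      obtain h where h: "h \<in> F" "h + h = 1" using half_ex .
      have "h * (y + y) = (h + h) * y" by (simp add: algebra_simps)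
      then have "y = h * (y + y)" using h by simp
      moreover have "h * (y + y) \<in> K2" using yy h(1) K2(1,3) by (intro divring_mult) auto
      ultimately show False using y(2) by simp
    qed
    ultimately show ?thesis by blast
  qed
  then obtain q1 where q1: "q1 \<in> Q" "q1 \<notin> K2" "\<tau> q1 = - q1" by blast
  obtain t where t: "t \<in> K2" "(q1 - t) * (q1 - t) \<in> K2" "q1 - t \<in> Q" "q1 - t \<notin> K2"
    using complete_square_Q[OF q1(1,2)] .
  define q where "q = q1 - t"
  have q: "q \<in> Q" "q \<notin> K2" "q * q \<in> K2" unfolding q_def using t by auto
  define s where "s = t + \<tau> t"
  have sK: "s \<in> K2" unfolding s_def using t(1) tK2 divring_add[OF K2(1)] by blast
  have tq: "\<tau> q = - q - s" unfolding q_def s_def using q1(3) by (simp add: T.sig_diff)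
  \<comment> \<open>The cross term \<open>2 * s * q\<close> of \<open>\<tau> (q * q)\<close> lies in
    \<open>K2\<close>; for \<open>s \<noteq> 0\<close> this would put \<open>q\<close> into
    \<open>K2\<close>.\<close>
  have "s = 0"
  proof (rule ccontr)
    assume s0: "s \<noteq> 0"
    have qs: "q * s = s * q" using K2_central[OF sK q(1)] by simp
    have "\<tau> (q * q) = (- q - s) * (- q - s)" unfolding T.sig_mult tq ..
    also have "\<dots> = q * q + (s * q + s * q) + s * s" using qs by (simp add: algebra_simps)
    finally have "s * q + s * q = \<tau> (q * q) - q * q - s * s" by simp
    then have k: "s * q + s * q \<in> K2" using tK2[OF q(3)] q(3) sK K2(1) by (simp add: divring_diff divring_mult)
    obtain h where h: "h \<in> F" "h + h = 1" using half_ex .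
    have "inverse s * (h * (s * q + s * q)) = inverse s * ((h + h) * (s * q))" by (simp add: algebra_simps)
    also have "\<dots> = q" using h s0 by (simp flip: mult.assoc)
    finally have "q = inverse s * (h * (s * q + s * q))" by simp
    moreover have "inverse s * (h * (s * q + s * q)) \<in> K2"
      using sK k h K2(1,3) by (auto intro!: divring_mult divring_inverse)
    ultimately show False using q(2) by simp
  qed
  then have tq: "\<tau> q = - q" using tq by simp
  have "\<tau> (q * q) = q * q" by (simp add: T.sig_mult tq)
  then have qq: "q * q \<in> K1" using fix2[OF q(3)] by blast
  obtain u where u: "u \<in> Q" "u \<noteq> 0" "u * q = - (q * u)" using anticommuting_Q[OF q] .
  have "\<exists>v\<in>Q. v \<noteq> 0 \<and> v * q = - (q * v) \<and> \<tau> v = - v"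
  proof (cases "u - \<tau> u = 0")
    case False
    have "\<tau> (u * q) = \<tau> (- (q * u))" using u(3) by simp
    then have "\<tau> u * q = - (q * \<tau> u)" by (simp add: T.sig_mult T.sig_minus tq)
    then have "(u - \<tau> u) * q = - (q * (u - \<tau> u))" using u(3) by (simp add: algebra_simps)
    moreover have "\<tau> (u - \<tau> u) = - (u - \<tau> u)" by (simp add: T.sig_diff T.sig_sig)
    ultimately show ?thesis using False u(1) tQ divring_diff[OF Q(1)] by blast
  next
    case True
    then have tu: "\<tau> u = u" by simp
    have ju: "u * j = j * u" and jq: "q * j = j * q" using u(1) q(1) by (auto simp: Q_iff)
    have "\<tau> (j * u) = - (j * u)" using tu ju by (simp add: T.sig_mult tj)
    moreover have "j * u * q = - (q * (j * u))"
    proof -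
      have "j * u * q = - (j * q * u)" using u(3) by (simp add: mult.assoc)
      then show ?thesis using jq by (simp add: mult.assoc[symmetric])
    qed
    moreover have "j * u \<in> Q" using u(1) K2(4) K2_Q divring_mult[OF Q(1)] by blast
    ultimately show ?thesis using u(2) j0 by (intro bexI[of _ "j * u"]) auto
  qed
  then obtain v where v: "v \<in> Q" "v \<noteq> 0" "v * q = - (q * v)" "\<tau> v = - v" by blast
  have "v * v \<in> K2" by (rule anticommuting_square[OF q v(1-3)])
  moreover have "\<tau> (v * v) = v * v" by (simp add: T.sig_mult v(4))
  ultimately have "v * v \<in> K1" using fix2 by blast
  then show thesis using that q qq tw[OF tq] v tw[OF v(4)] by blast
qed

end

section \<open>Systems of quadratic forms\<close>

definition line :: "'d::times set \<Rightarrow> 'd \<Rightarrow> 'd set" where "line B e = (\<lambda>b. b * e) ` B"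

text \<open>For symmetric \<open>e\<close> the map
  \<open>v \<mapsto> \<beta> (v \<cdot> e) v\<close> is an ordinary quadratic form over
  \<open>F\<close>. So \<open>u\<close> can be the \<open>u\<close>-invariant of the field,
  simultaneously for all \<open>e\<close>.\<close>

locale form = rmod act + dinv F \<sigma>
  for act :: "'v::ab_group_add \<Rightarrow> 'd::division_ring \<Rightarrow> 'v" (infixl "\<cdot>" 80) and F :: "'d set" and \<sigma> +
  fixes V :: "'v set" and \<beta> :: "'v \<Rightarrow> 'v \<Rightarrow> 'd" and u :: nat
  assumes sV: "submod (\<cdot>) UNIV V"
    and \<beta>_F: "v \<in> V \<Longrightarrow> w \<in> V \<Longrightarrow> \<beta> v w \<in> F"
    and \<beta>_add: "v \<in> V \<Longrightarrow> v' \<in> V \<Longrightarrow> w \<in> V \<Longrightarrow> \<beta> (v + v') w = \<beta> v w + \<beta> v' w"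
    and \<beta>_scale: "v \<in> V \<Longrightarrow> w \<in> V \<Longrightarrow> c \<in> F \<Longrightarrow> \<beta> v (w \<cdot> c) = \<beta> v w * c"
    and \<beta>_sym: "v \<in> V \<Longrightarrow> w \<in> V \<Longrightarrow> \<beta> v w = \<beta> w v"
    and \<beta>_adj: "v \<in> V \<Longrightarrow> w \<in> V \<Longrightarrow> \<beta> (v \<cdot> d) w = \<beta> v (w \<cdot> \<sigma> d)"
    and isotropic: "\<sigma> e = e \<Longrightarrow> W \<subseteq> V \<Longrightarrow> fdim (\<cdot>) F m W \<Longrightarrow> u < m \<Longrightarrow>
      \<exists>v\<in>W. v \<noteq> 0 \<and> \<beta> (v \<cdot> e) v = 0"
begin

lemma V_act: "v \<in> V \<Longrightarrow> v \<cdot> d \<in> V" and V_add: "v \<in> V \<Longrightarrow> w \<in> V \<Longrightarrow> v + w \<in> V"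
  using sV unfolding submod_def by auto

text \<open>Adjunction and symmetry turn \<open>\<beta> (v \<cdot> x) v\<close> into its own
  negative.\<close>

lemma \<beta>_skew: "v \<in> V \<Longrightarrow> \<sigma> x = - x \<Longrightarrow> \<beta> (v \<cdot> x) v = 0"
proof -
  assume v: "v \<in> V" and x: "\<sigma> x = - x"
  have z: "\<beta> 0 v = 0" using \<beta>_add[OF V_act[OF v, of 0] V_act[OF v, of 0] v] by simp
  have "\<beta> (v \<cdot> x) v + \<beta> (v \<cdot> x) v = \<beta> (v \<cdot> x) v + \<beta> (v \<cdot> (- x)) v"
    using \<beta>_adj[OF v v, of x] \<beta>_sym[OF v V_act[OF v], of "- x"] x by simp
  also have "\<dots> = \<beta> (v \<cdot> x + v \<cdot> (- x)) v" by (rule \<beta>_add[symmetric]) (simp_all add: v V_act)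
  also have "\<dots> = 0" unfolding act_add_right[symmetric] by (simp add: z)
  finally show ?thesis by (rule double_0)
qed

text \<open>The least such \<open>c\<close> is a \<open>u\<close>-invariant of the system of forms \<open>v \<mapsto> \<beta> (v \<cdot> x) v\<close>, \<open>x \<in> X\<close>,
  restricted to \<open>B\<close>-subspaces.\<close>

definition Iso :: "'d set \<Rightarrow> 'd set \<Rightarrow> nat \<Rightarrow> bool" where
  "Iso B X c \<longleftrightarrow> (\<forall>W m. W \<subseteq> V \<longrightarrow> submod (\<cdot>) B W \<longrightarrow> fdim (\<cdot>) F m W \<longrightarrow> c < m \<longrightarrow>
     (\<exists>v\<in>W. v \<noteq> 0 \<and> (\<forall>x\<in>X. \<beta> (v \<cdot> x) v = 0)))"

text \<open>For fixed \<open>v\<close> the elements \<open>x\<close> with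
  \<open>\<beta> (v \<cdot> x) v = 0\<close> are closed under addition and include all skew
  elements. The quantification over \<open>N\<close> expresses that \<open>Y\<close> is generated in
  this way by \<open>X\<close> and skew elements.\<close>

lemma Iso_closure:
  assumes "Iso B X c" "B \<subseteq> B'" and Y: "\<And>N y. y \<in> Y \<Longrightarrow> X \<subseteq> N \<Longrightarrow>
    (\<And>x z. x \<in> N \<Longrightarrow> z \<in> N \<Longrightarrow> x + z \<in> N) \<Longrightarrow> (\<And>x. \<sigma> x = - x \<Longrightarrow> x \<in> N) \<Longrightarrow> y \<in> N"
  shows "Iso B' Y c"
  unfolding Iso_def
proof (intro allI impI)
  fix W m assume W: "W \<subseteq> V" "submod (\<cdot>) B' W" "fdim (\<cdot>) F m W" "c < m"
  then obtain v where v: "v \<in> W" "v \<noteq> 0" "\<forall>x\<in>X. \<beta> (v \<cdot> x) v = 0"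
    using assms(1) submod_mono[OF W(2) assms(2)] unfolding Iso_def by blast
  then have vV: "v \<in> V" using W by blast
  have "y \<in> {x. \<beta> (v \<cdot> x) v = 0}" if "y \<in> Y" for y
    by (rule Y[OF that]) (use v \<beta>_skew[OF vV] in \<open>auto simp: act_add_right \<beta>_add vV V_act\<close>)
  then show "\<exists>v\<in>W. v \<noteq> 0 \<and> (\<forall>y\<in>Y. \<beta> (v \<cdot> y) v = 0)" using v by blast
qed

lemma Iso_mono: "Iso B X c \<Longrightarrow> B \<subseteq> B' \<Longrightarrow> Y \<subseteq> X \<Longrightarrow> Iso B' Y c"
  by (rule Iso_closure) auto

text \<open>A factor from \<open>F\<close> merely scales the form, so \<open>line F e\<close> stands
  for a single quadratic form.\<close>

lemma Iso_line: assumes e: "\<sigma> e = e" and B: "F \<subseteq> B" shows "Iso B (line F e) u"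
proof (rule Iso_mono[of F])
  show "Iso F (line F e) u"
    unfolding Iso_def
  proof (intro allI impI)
    fix W m assume W: "W \<subseteq> V" "submod (\<cdot>) F W" "fdim (\<cdot>) F m W" "u < m"
    then obtain v where v: "v \<in> W" "v \<noteq> 0" "\<beta> (v \<cdot> e) v = 0" using isotropic[OF e] by blast
    then have vV: "v \<in> V" using W by blast
    have "\<beta> (v \<cdot> (c * e)) v = 0" if c: "c \<in> F" for c
    proof -
      have "\<beta> (v \<cdot> (c * e)) v = \<beta> (v \<cdot> e \<cdot> c) v" using F_comm[OF c, of e] by (simp add: act_mult)
      also have "\<dots> = \<beta> (v \<cdot> e) (v \<cdot> c)" using \<beta>_adj[OF V_act[OF vV] vV] J_E[OF c] by simp
      also have "\<dots> = 0" using \<beta>_scale[OF V_act[OF vV] vV c] v(3) by simp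
      finally show ?thesis .
    qed
    then show "\<exists>v\<in>W. v \<noteq> 0 \<and> (\<forall>x\<in>line F e. \<beta> (v \<cdot> x) v = 0)" using v by (auto simp: line_def)
  qed
qed (use B in auto)

text \<open>For invertible \<open>e\<close>: the adjoint map
  \<open>b \<mapsto> e * \<sigma> b * inverse e\<close> of the form
  \<open>\<beta> (x \<cdot> e) y\<close> sends \<open>B\<close> into itself. This is what
  \<open>adj\<close> in \<open>totally_isotropic_exists\<close> asks for.\<close>

definition normalizes :: "'d \<Rightarrow> 'd set \<Rightarrow> bool" where
  "normalizes e B \<longleftrightarrow> (\<forall>b\<in>B. \<exists>b'\<in>B. e * \<sigma> b = b' * e)"

lemma totally_isotropic:
  assumes B: "divring B" "F \<subseteq> B" and e: "\<sigma> e = e" "normalizes e B" and iso: "Iso B (line B e) c"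
    and W: "W \<subseteq> V" "submod (\<cdot>) B W" "fdim (\<cdot>) F m W"
  obtains T d where "T \<subseteq> W" "submod (\<cdot>) B T" "fdim (\<cdot>) F d T" "m \<le> c + 2 * d"
    "\<forall>v\<in>T. \<forall>b\<in>B. \<beta> (v \<cdot> (b * e)) v = 0"
proof -
  have WV: "x \<in> V" if "x \<in> W" for x using that W by blast
  have sym: "\<beta> (x \<cdot> e) y = \<beta> (y \<cdot> e) x" if "x \<in> W" "y \<in> W" for x y
    using \<beta>_adj[OF WV[OF that(1)] WV[OF that(2)], of e] \<beta>_sym[OF WV[OF that(1)] V_act[OF WV[OF that(2)]], of e] e
    by simp
  obtain T d where T: "T \<subseteq> W" "submod (\<cdot>) B T" "fdim (\<cdot>) F d T"
    "\<forall>x\<in>T. \<forall>y\<in>T. \<beta> (x \<cdot> e) y = 0" "m \<le> c + 2 * d"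
  proof (rule totally_isotropic_exists[OF F_div B W(3,2), where g = "\<lambda>x y. \<beta> (x \<cdot> e) y" and c = c])
    show "\<beta> (x \<cdot> e) y \<in> F" if "x \<in> W" "y \<in> W" for x y using that by (intro \<beta>_F V_act WV)
    show add: "\<beta> ((x + y) \<cdot> e) z = \<beta> (x \<cdot> e) z + \<beta> (y \<cdot> e) z" if "x \<in> W" "y \<in> W" "z \<in> W" for x y z
      unfolding act_add_left using that by (intro \<beta>_add V_act WV)
    show "\<beta> (x \<cdot> e) (y + z) = \<beta> (x \<cdot> e) y + \<beta> (x \<cdot> e) z" if "x \<in> W" "y \<in> W" "z \<in> W" for x y z
      using that \<beta>_sym[OF V_act[of x e], of "y + z"] \<beta>_sym[OF V_act[of x e], of y] \<beta>_sym[OF V_act[of x e], of z]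
      by (simp add: WV V_add V_act \<beta>_add)
    show "\<beta> (x \<cdot> e) (y \<cdot> k) = \<beta> (x \<cdot> e) y * k" if "x \<in> W" "y \<in> W" "k \<in> F" for x y k
      using that by (intro \<beta>_scale V_act WV)
    show "\<beta> (y \<cdot> e) x = 0" if "x \<in> W" "y \<in> W" "\<beta> (x \<cdot> e) y = 0" for x y using sym that by simp
    show "\<exists>b'\<in>B. \<forall>x\<in>W. \<forall>y\<in>W. \<beta> (x \<cdot> b \<cdot> e) y = \<beta> (x \<cdot> e) (y \<cdot> b')" if b: "b \<in> B" for b
    proof -
      obtain b' where b': "b' \<in> B" "e * \<sigma> b = b' * e" using e(2) b unfolding normalizes_def by blast
      have "\<sigma> (e * \<sigma> b) = \<sigma> (b' * e)" using b'(2) by simp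
      then have be: "b * e = e * \<sigma> b'" by (simp add: sig_mult sig_sig e(1))
      have "\<beta> (x \<cdot> b \<cdot> e) y = \<beta> (x \<cdot> e) (y \<cdot> b')" if xy: "x \<in> W" "y \<in> W" for x y
      proof -
        have "x \<cdot> b \<cdot> e = x \<cdot> e \<cdot> \<sigma> b'" using be by (simp flip: act_mult)
        then show ?thesis using \<beta>_adj[of "x \<cdot> e" y "\<sigma> b'"] xy by (simp add: WV V_act sig_sig)
      qed
      then show ?thesis using b'(1) by blast
    qed
    show "\<exists>v\<in>U. v \<noteq> 0 \<and> (\<forall>b\<in>B. \<beta> (v \<cdot> b \<cdot> e) v = 0)"
      if U: "U \<subseteq> W" "submod (\<cdot>) B U" "fdim (\<cdot>) F k U" "c < k" for U k
    proof -
      have "U \<subseteq> V" using U(1) W(1) by blast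
      then obtain v where "v \<in> U" "v \<noteq> 0" "\<forall>x\<in>line B e. \<beta> (v \<cdot> x) v = 0"
        using iso U(2-4) unfolding Iso_def by blast
      then show ?thesis by (intro bexI[of _ v]) (auto simp: line_def act_mult)
    qed
  qed blast
  moreover have "\<beta> (v \<cdot> (b * e)) v = 0" if "v \<in> T" "b \<in> B" for v b
    unfolding act_mult using T(2,4) that unfolding submod_def by blast
  ultimately show thesis using that by blast
qed

text \<open>The factor 2 is the price of a totally isotropic subspace, which has about half of the
  dimension beyond \<open>c\<close>.\<close>

lemma Iso_compose:
  assumes B: "divring B" "F \<subseteq> B" and e: "\<sigma> e = e" "normalizes e B" and iso: "Iso B (line B e) c"
    and iso': "Iso B' X c'" "B' \<subseteq> B"
  shows "Iso B (line B e \<union> X) (c + 2 * c')"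
  unfolding Iso_def
proof (intro allI impI)
  fix W m assume W: "W \<subseteq> V" "submod (\<cdot>) B W" "fdim (\<cdot>) F m W" "c + 2 * c' < m"
  obtain T d where T: "T \<subseteq> W" "submod (\<cdot>) B T" "fdim (\<cdot>) F d T" "m \<le> c + 2 * d"
    "\<forall>v\<in>T. \<forall>b\<in>B. \<beta> (v \<cdot> (b * e)) v = 0"
    by (rule totally_isotropic[OF B e iso W(1-3)])
  have "c' < d" using T(4) W(4) by linarith
  moreover have "T \<subseteq> V" using T(1) W(1) by blast
  ultimately obtain v where v: "v \<in> T" "v \<noteq> 0" "\<forall>x\<in>X. \<beta> (v \<cdot> x) v = 0"
    using iso'(1) submod_mono[OF T(2) iso'(2)] T(3) unfolding Iso_def by blast
  show "\<exists>v\<in>W. v \<noteq> 0 \<and> (\<forall>x\<in>line B e \<union> X. \<beta> (v \<cdot> x) v = 0)"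
    using v T(1,5) by (intro bexI[of _ v]) (auto simp: line_def)
qed

text \<open>Since \<open>p\<close> commutes with \<open>B\<close>, the element
  \<open>(a + p * b) * e\<close> is \<open>a * e + b * (p * e)\<close>, and two lines over
  \<open>B\<close> are enough. With equal costs the total is threefold.\<close>

lemma Iso_ext:
  assumes B: "divring B" "F \<subseteq> B" and e: "\<sigma> e = e" "normalizes e B"
    and p: "\<And>b. b \<in> B \<Longrightarrow> p * b = b * p"
    and iso: "Iso B (line B e) c" "Iso B (line B (p * e)) c'"
  shows "Iso B (line (ext B p) e) (c + 2 * c')"
proof (rule Iso_closure[OF Iso_compose[OF B e iso subset_refl] subset_refl])
  fix N y assume y: "y \<in> line (ext B p) e" and N: "line B e \<union> line B (p * e) \<subseteq> N"
    and add: "\<And>x z. x \<in> N \<Longrightarrow> z \<in> N \<Longrightarrow> x + z \<in> N"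
  obtain a b where ab: "a \<in> B" "b \<in> B" "y = (a + p * b) * e" using y unfolding line_def ext_def by blast
  have "y = a * e + b * (p * e)" using ab p by (simp add: distrib_right mult.assoc)
  moreover have "a * e \<in> N" "b * (p * e) \<in> N" using N ab(1,2) by (auto simp: line_def)
  ultimately show "y \<in> N" using add by simp
qed

lemma normalizes_F: "normalizes e F"
  unfolding normalizes_def using J_E F_comm[of _ e] by metis

lemma conj_ext:
  assumes B: "\<forall>b\<in>B. \<exists>b'\<in>N. e * \<sigma> b = b' * e" and p: "\<exists>b'\<in>N. e * \<sigma> p = b' * e" and N: "divring N"
  shows "\<forall>b\<in>ext B p. \<exists>b'\<in>N. e * \<sigma> b = b' * e"
proof
  fix x assume "x \<in> ext B p"
  then obtain a b where x: "x = a + p * b" "a \<in> B" "b \<in> B" unfolding ext_def by blast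
  obtain a' b' p' where r: "a' \<in> N" "e * \<sigma> a = a' * e" "b' \<in> N" "e * \<sigma> b = b' * e" "p' \<in> N" "e * \<sigma> p = p' * e"
    using B p x by meson
  have "e * \<sigma> x = e * \<sigma> a + e * \<sigma> b * \<sigma> p" unfolding x(1) by (simp add: sig_add sig_mult algebra_simps)
  also have "\<dots> = a' * e + b' * (e * \<sigma> p)" unfolding r(2,4) by (simp add: mult.assoc)
  also have "\<dots> = (a' + b' * p') * e" unfolding r(6) by (simp add: algebra_simps)
  finally show "\<exists>b'\<in>N. e * \<sigma> x = b' * e" using r(1,3,5) N by (intro bexI[of _ "a' + b' * p'"]) (auto intro!: divring_add divring_mult)
qed

end

section \<open>Costs of the graded pieces\<close>

locale qform = form act F \<sigma> V \<beta> u + biquad F \<sigma> i j r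
  for act :: "'v::ab_group_add \<Rightarrow> 'd::division_ring \<Rightarrow> 'v" (infixl "\<cdot>" 80) and F :: "'d set" and \<sigma> V \<beta> u i j r
begin

lemma K1_comm: "k \<in> K1 \<Longrightarrow> e * i = i * e \<Longrightarrow> k * e = e * k" by (rule K1(5))

lemma normalizes_K1: "e * i = i * e \<Longrightarrow> normalizes e K1"
  unfolding normalizes_def using sig_K1 K1_comm by metis

lemma normalizes_K2: "e \<in> Q \<Longrightarrow> normalizes e K2"
  unfolding normalizes_def using sig_K2 K2_central by metis

text \<open>Two symmetric directions over \<open>F\<close>, namely \<open>e\<close> and
  \<open>i * e\<close>: \<open>u + 2 * u\<close>.\<close>

lemma Iso_K1_line:
  assumes e: "\<sigma> e = e" "e * i = i * e"
  shows "Iso F (line K1 e) (3 * u)"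
proof -
  have "\<sigma> (i * e) = i * e" using e si by (simp add: sig_mult)
  then have "Iso F (line K1 e) (u + 2 * u)"
    unfolding K1_def using e
    by (intro Iso_ext[OF F_div subset_refl _ normalizes_F] Iso_line) (auto simp: F_comm[symmetric])
  then show ?thesis by simp
qed

text \<open>As \<open>e\<close> commutes with \<open>j\<close>, the direction \<open>j * e\<close>
  is symmetric too: \<open>3 * u + 2 * (3 * u)\<close>.\<close>

lemma Iso_K2_line:
  assumes e: "\<sigma> e = e" "e \<in> Q"
  shows "Iso K1 (line K2 e) (9 * u)"
proof -
  have ei: "e * i = i * e" "e * j = j * e" using e(2) by (auto simp: Q_iff)
  have je: "\<sigma> (j * e) = j * e" using e(1) ei sj by (simp add: sig_mult)
  have "j * e * i = j * i * e" using ei by (simp add: mult.assoc)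
  then have jei: "j * e * i = i * (j * e)" unfolding ji by (simp add: mult.assoc)
  have "Iso K1 (line K2 e) (3 * u + 2 * (3 * u))"
    unfolding K2_def
  proof (rule Iso_ext[OF K1(1,2) e(1) normalizes_K1[OF ei(1)]])
    show "j * b = b * j" if "b \<in> K1" for b using K1(5)[OF that ji] by simp
    show "Iso K1 (line K1 e) (3 * u)" by (rule Iso_mono[OF Iso_K1_line[OF e(1) ei(1)] K1(2) subset_refl])
    show "Iso K1 (line K1 (j * e)) (3 * u)" by (rule Iso_mono[OF Iso_K1_line[OF je jei] K1(2) subset_refl])
  qed
  then show ?thesis by simp
qed

lemma line_1: "line (B :: 'd set) 1 = B" by (simp add: line_def)

text \<open>With symmetric quaternion generators \<open>k\<close> and \<open>w\<close>, the pieces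
  \<open>K2(k)\<close> and \<open>K2 w\<close> cost \<open>27 * u\<close> and \<open>9 * u\<close>,
  while \<open>K2 k w\<close> consists of skew elements and costs nothing.\<close>

lemma Iso_Q: "Iso Q Q (45 * u)"
proof -
  obtain k w where k: "k \<in> Q" "k \<notin> K2" "k * k \<in> K2" "\<sigma> k = k"
    and w: "w \<in> Q" "w \<noteq> 0" "\<sigma> w = w" "w * k = - (k * w)" by (rule orthogonal_basis)
  have one: "1 \<in> Q" "\<sigma> 1 = 1" using divring_1[OF Q(1)] sig_1 by auto
  let ?K = "ext K2 k"
  note K = K3[OF k(1-3)]
  have "Iso K2 (line ?K 1) (9 * u + 2 * (9 * u))"
  proof (rule Iso_ext[OF K2(1,3) one(2) normalizes_K2[OF one(1)]])
    show "k * b = b * k" if "b \<in> K2" for b using K2_central[OF that k(1)] by simp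
    show "Iso K2 (line K2 1) (9 * u)" by (rule Iso_mono[OF Iso_K2_line[OF one(2,1)] K2(2) subset_refl])
    show "Iso K2 (line K2 (k * 1)) (9 * u)"
      using Iso_mono[OF Iso_K2_line[OF k(4,1)] K2(2) subset_refl] by simp
  qed
  then have "Iso ?K (line ?K 1) (27 * u)" by (intro Iso_mono[OF _ K(2) subset_refl]) simp
  moreover have "normalizes 1 ?K"
  proof -
    have "\<forall>b\<in>?K. \<exists>b'\<in>?K. 1 * \<sigma> b = b' * 1"
      by (rule conj_ext[OF _ _ K(1)]) (use sig_K2 K(2,4) k(4) in auto)
    then show ?thesis unfolding normalizes_def by blast
  qed
  ultimately have "Iso ?K (line ?K 1 \<union> line K2 w) (27 * u + 2 * (9 * u))"
    by (rule Iso_compose[OF K(1,3) one(2) _ _ Iso_mono[OF Iso_K2_line[OF w(3,1)] K2(2) subset_refl] K(2), rotated])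
  moreover have "?K \<subseteq> Q"
  proof
    fix x assume "x \<in> ?K"
    then obtain a b where "x = a + k * b" "a \<in> K2" "b \<in> K2" unfolding ext_def by blast
    then show "x \<in> Q" using k(1) K2_Q Q(1) by (auto intro!: divring_add divring_mult)
  qed
  ultimately have "Iso Q Q (27 * u + 2 * (9 * u))"
  proof (rule Iso_closure)
    fix N y assume y: "y \<in> Q" and N: "line ?K 1 \<union> line K2 w \<subseteq> N"
      and add: "\<And>x z. x \<in> N \<Longrightarrow> z \<in> N \<Longrightarrow> x + z \<in> N" and skew: "\<And>x. \<sigma> x = - x \<Longrightarrow> x \<in> N"
    obtain a b c d where y: "a \<in> K2" "b \<in> K2" "c \<in> K2" "d \<in> K2" "y = a + k * b + (c + k * d) * w"
      by (rule quaternion_decomp[OF k(1-3) w(1,2,4) y])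
    have "a + k * b \<in> ?K" by (rule extI[OF y(1,2)])
    then have "a + k * b \<in> N" using N by (auto simp: line_1)
    moreover have "c * w \<in> N" using N y(3) by (auto simp: line_def)
    moreover have "k * d * w \<in> N"
    proof (rule skew)
      have "\<sigma> (k * d * w) = w * (d * k)" using k w sig_K2[OF y(4)] by (simp add: sig_mult)
      also have "\<dots> = w * k * d" using K2_central[OF y(4) k(1)] by (simp add: mult.assoc)
      also have "\<dots> = - (k * d * w)" unfolding w(4) using K2_central[OF y(4) w(1)] by (simp add: mult.assoc)
      finally show "\<sigma> (k * d * w) = - (k * d * w)" .
    qed
    ultimately have "(a + k * b) + (c * w + k * d * w) \<in> N" using add by blast
    then show "y \<in> N" using y(5) by (simp add: distrib_right)
  qed
  then show ?thesis by simp
qed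

text \<open>In terms of the twist \<open>\<tau>\<close> by \<open>w\<close>, the element
  \<open>y * w\<close> is symmetric iff \<open>\<tau> y = y\<close>. This leaves the four directions
  \<open>w\<close>, \<open>e1\<close>, \<open>e2\<close>, \<open>e3\<close> over \<open>K1\<close>.
  They are ordered so that the division ring can grow: \<open>?M e2\<close> accounts for
  \<open>e2\<close> and \<open>e3\<close>, passing to \<open>?N e1\<close> requires only
  \<open>K1 e1\<close> in addition, and passing to \<open>Q w\<close> only \<open>K1 w\<close>, at
  \<open>2 * (3 * u)\<close> each.\<close>

lemma Iso_Qw:
  assumes w: "w \<noteq> 0" "\<sigma> w = w" "w * i = i * w" "w * j = - (j * w)"
  shows "Iso Q (line Q w) (21 * u)"
proof -
  obtain q v where q: "q \<in> Q" "q \<notin> K2" "q * q \<in> K1" "w * \<sigma> q = - (q * w)"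
    and v: "v \<in> Q" "v \<noteq> 0" "v * q = - (q * v)" "w * \<sigma> v = - (v * w)" "v * v \<in> K1"
    by (rule unitary_basis[OF w])
  have q2: "q * q \<in> K2" using q(3) K2(2) by blast
  have jq: "q * j = j * q" "q * i = i * q" and jv: "v * j = j * v" "v * i = i * v" using q(1) v(1) by (auto simp: Q_iff)
  have q0: "q \<noteq> 0" by (rule q0[OF q(1,2) q2])
  have swap: "q * (j * x) = j * (q * x)" "v * (j * x) = j * (v * x)" "w * (j * x) = - (j * (w * x))"
    "v * (q * x) = - (q * (v * x))" "w * (\<sigma> q * x) = - (q * (w * x))" "w * (\<sigma> v * x) = - (v * (w * x))"
    "q * (i * x) = i * (q * x)" "v * (i * x) = i * (v * x)" "w * (i * x) = i * (w * x)" "j * (i * x) = i * (j * x)" for x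
    using jq jv w(3,4) v(3,4) q(4) ji by (simp_all flip: mult.assoc)
  have K1c: "k * q = q * k" "k * v = v * k" "k * w = w * k" "k * j = j * k"
    "k * \<sigma> q = \<sigma> q * k" "k * \<sigma> v = \<sigma> v * k" if "k \<in> K1" for k
    using that jq jv w(3) ji sig_Q[OF q(1)] sig_Q[OF v(1)] by (auto intro: K1_comm simp: Q_iff)
  have K1s: "k * (q * x) = q * (k * x)" "k * (v * x) = v * (k * x)" "k * (w * x) = w * (k * x)" "k * (j * x) = j * (k * x)"
    "k * (\<sigma> q * x) = \<sigma> q * (k * x)" "k * (\<sigma> v * x) = \<sigma> v * (k * x)"
    if "k \<in> K1" for k x using K1c[OF that] by (simp_all flip: mult.assoc)
  \<comment> \<open>The elements \<open>q * w\<close> and \<open>v * w\<close> are skew; the factor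
    \<open>j\<close>, which anticommutes with \<open>w\<close>, makes them symmetric.\<close>
  define e1 e2 e3 where "e1 = j * q * w" and "e2 = j * v * w" and "e3 = q * e2"
  note defs = e1_def e2_def e3_def
  have sym: "\<sigma> e1 = e1" "\<sigma> e2 = e2" "\<sigma> e3 = e3"
    unfolding defs using w(4) by (simp_all add: sig_mult sj w(2) mult.assoc swap jq jv)
  have comm: "e1 * i = i * e1" "e2 * i = i * e2" "e3 * i = i * e3"
    unfolding defs by (simp_all add: mult.assoc swap w(3))
  have F_Iso: "Iso K1 (line K1 e) (3 * u)" if "\<sigma> e = e" "e * i = i * e" for e
    by (rule Iso_mono[OF Iso_K1_line[OF that] K1(2) subset_refl])
  let ?M = "ext K1 q"
  have "\<exists>b'\<in>K1. b * q = q * b'" if "b \<in> K1" for b using that K1c by blast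
  note M = ext_props[OF K1(1,2) q(3) this]
  let ?N = "ext ?M v"
  have "\<exists>b'\<in>?M. b * v = v * b'" if bM: "b \<in> ?M" for b
  proof -
    obtain a c where b: "b = a + q * c" "a \<in> K1" "c \<in> K1" using bM unfolding ext_def by blast
    have "b * v = v * (a + q * (- c))"
      unfolding b(1) using K1c[OF b(2)] K1c[OF b(3)] by (simp add: distrib_left distrib_right right_diff_distrib left_diff_distrib mult.assoc swap)
    then show ?thesis using extI[OF b(2) divring_uminus[OF K1(1) b(3)]] by blast
  qed
  note N = ext_props[OF M(1,3) subsetD[OF M(2) v(5)] this]
  have iso1: "Iso K1 (line ?M e2) (3 * u + 2 * (3 * u))"
  proof (rule Iso_ext[OF K1(1,2) sym(2) normalizes_K1[OF comm(2)]])
    show "q * b = b * q" if "b \<in> K1" for b using K1c(1)[OF that] by simp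
    show "Iso K1 (line K1 e2) (3 * u)" by (rule F_Iso[OF sym(2) comm(2)])
    show "Iso K1 (line K1 (q * e2)) (3 * u)" using F_Iso[OF sym(3) comm(3)] unfolding e3_def .
  qed
  have nK: "\<exists>b'\<in>K1. e * \<sigma> b = b' * e" if "b \<in> K1" "e * i = i * e" for b e
    using sig_K1[OF that(1)] K1_comm[OF that] that(1) by metis
  have n2: "normalizes e2 ?M"
    unfolding normalizes_def
  proof (rule conj_ext[OF _ _ M(1)])
    show "\<forall>b\<in>K1. \<exists>b'\<in>?M. e2 * \<sigma> b = b' * e2" using nK comm(2) M(2) by blast
    have "e2 * \<sigma> q = q * e2" unfolding defs by (simp add: mult.assoc swap q(4) v(3))
    then show "\<exists>b'\<in>?M. e2 * \<sigma> q = b' * e2" using M(4) by blast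
  qed
  have n1: "normalizes e1 ?N"
    unfolding normalizes_def
  proof (rule conj_ext[OF conj_ext[OF _ _ N(1)] _ N(1)])
    show "\<forall>b\<in>K1. \<exists>b'\<in>?N. e1 * \<sigma> b = b' * e1" using nK comm(1) M(2) N(2) by blast
    have "e1 * \<sigma> q = (- q) * e1" unfolding defs by (simp add: mult.assoc swap q(4))
    moreover have "- q \<in> ?N" using M(4) N(1,2) divring_uminus by blast
    ultimately show "\<exists>b'\<in>?N. e1 * \<sigma> q = b' * e1" by blast
    have "e1 * \<sigma> v = v * e1" unfolding defs by (simp add: mult.assoc swap v(4))
    then show "\<exists>b'\<in>?N. e1 * \<sigma> v = b' * e1" using N(4) by blast
  qed
  have iso2': "Iso ?M (line ?M e2) (9 * u)" using Iso_mono[OF iso1 M(2) subset_refl] by simp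
  have iso2: "Iso ?M (line ?M e2 \<union> line K1 e1) (9 * u + 2 * (3 * u))"
    by (rule Iso_compose[OF M(1,3) sym(2) n2 iso2' F_Iso[OF sym(1) comm(1)] M(2)])
  have "Iso ?N (line ?N e1) (9 * u + 2 * (3 * u))"
  proof (rule Iso_closure[OF iso2 N(2)])
    fix S y assume y: "y \<in> line ?N e1" and S: "line ?M e2 \<union> line K1 e1 \<subseteq> S"
      and add: "\<And>x z. x \<in> S \<Longrightarrow> z \<in> S \<Longrightarrow> x + z \<in> S" and skew: "\<And>x. \<sigma> x = - x \<Longrightarrow> x \<in> S"
    obtain m m' where m: "y = (m + v * m') * e1" "m \<in> ?M" "m' \<in> ?M" using y unfolding line_def ext_def by blast
    obtain a b where ab: "m = a + q * b" "a \<in> K1" "b \<in> K1" using m(2) unfolding ext_def by blast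
    obtain c d where cd: "m' = c + q * d" "c \<in> K1" "d \<in> K1" using m(3) unfolding ext_def by blast
    have "a * e1 \<in> S" using S ab(2) by (auto simp: line_def)
    \<comment> \<open>Up to a factor in \<open>K1\<close> this is \<open>j * w\<close>, which is
      skew.\<close>
    moreover have "q * b * e1 \<in> S"
    proof (rule skew)
      have qb: "b * (q * q) \<in> K1" by (rule divring_mult[OF K1(1) ab(3) q(3)])
      have "q * b * e1 = (b * (q * q)) * (j * w)"
        unfolding e1_def using K1s[OF ab(3)] by (simp add: mult.assoc swap)
      moreover have "\<sigma> (k * (j * w)) = - (k * (j * w))" if k: "k \<in> K1" for k
        using sig_K1[OF k] K1s[OF k] K1c[OF k] w(4) by (simp add: sig_mult w(2) sj mult.assoc swap)
      ultimately show "\<sigma> (q * b * e1) = - (q * b * e1)" using qb by simp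
    qed
    \<comment> \<open>Moving \<open>v\<close> past \<open>q\<close> turns \<open>v * e1\<close> into
      \<open>- q * e2\<close>, so this part is covered by \<open>line ?M e2\<close>.\<close>
    moreover have "v * m' * e1 \<in> S"
    proof -
      have dq: "d * (q * q) \<in> K1" by (rule divring_mult[OF K1(1) cd(3) q(3)])
      have "v * m' * e1 = (d * (q * q) + q * (- c)) * e2"
        unfolding cd(1) defs using K1s[OF cd(2)] K1s[OF cd(3)] K1c[OF cd(2)] K1c[OF cd(3)]
        by (simp add: mult.assoc swap distrib_left distrib_right right_diff_distrib left_diff_distrib)
      moreover have "d * (q * q) + q * (- c) \<in> ?M" by (rule extI[OF dq divring_uminus[OF K1(1) cd(2)]])
      ultimately show ?thesis using S by (auto simp: line_def)
    qed
    ultimately have "a * e1 + q * b * e1 + v * m' * e1 \<in> S" using add by blast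
    then show "y \<in> S" unfolding m(1) ab(1) by (simp add: distrib_right)
  qed
  then have iso3': "Iso ?N (line ?N e1) (15 * u)" by simp
  have iso3: "Iso ?N (line ?N e1 \<union> line K1 w) (15 * u + 2 * (3 * u))"
    by (rule Iso_compose[OF N(1,3) sym(1) n1 iso3' Iso_K1_line[OF w(2,3)] N(3)])
  have "?M \<subseteq> Q"
  proof
    fix x assume "x \<in> ?M"
    then obtain a b where "x = a + q * b" "a \<in> K1" "b \<in> K1" unfolding ext_def by blast
    then show "x \<in> Q" using q(1) K2_Q K2(2) Q(1) by (auto intro!: divring_add divring_mult)
  qed
  then have NQ: "?N \<subseteq> Q" using v(1) Q(1) unfolding ext_def[of ?M v] by (auto intro!: divring_add divring_mult)
  have "Iso Q (line Q w) (15 * u + 2 * (3 * u))"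
  proof (rule Iso_closure[OF iso3 NQ])
    fix S y assume y: "y \<in> line Q w" and S: "line ?N e1 \<union> line K1 w \<subseteq> S"
      and add: "\<And>x z. x \<in> S \<Longrightarrow> z \<in> S \<Longrightarrow> x + z \<in> S" and skew: "\<And>x. \<sigma> x = - x \<Longrightarrow> x \<in> S"
    obtain x where x: "x \<in> Q" "y = x * w" using y unfolding line_def by blast
    obtain a b c d where abcd: "a \<in> K2" "b \<in> K2" "c \<in> K2" "d \<in> K2" "x = a + q * b + (c + q * d) * v"
      by (rule quaternion_decomp[OF q(1,2) q2 v(1-3) x(1)])
    have split: "\<exists>k l. k \<in> K1 \<and> l \<in> K1 \<and> x = k + j * l" if "x \<in> K2" for x using that unfolding K2_def ext_def by blast
    obtain a1 a2 b1 b2 c1 c2 d1 d2 where s: "a1 \<in> K1" "a2 \<in> K1" "a = a1 + j * a2" "b1 \<in> K1" "b2 \<in> K1" "b = b1 + j * b2"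
      "c1 \<in> K1" "c2 \<in> K1" "c = c1 + j * c2" "d1 \<in> K1" "d2 \<in> K1" "d = d1 + j * d2"
      using split[OF abcd(1)] split[OF abcd(2)] split[OF abcd(3)] split[OF abcd(4)] by blast
    define n where "n = a2 + q * b2 + (c2 + q * d2) * v"
    have n: "n \<in> ?N"
    proof -
      have KN: "k \<in> ?N" if "k \<in> K1" for k using that M(2) N(2) by blast
      have "q \<in> ?N" using M(4) N(2) by blast
      then show ?thesis unfolding n_def using KN[OF s(2)] KN[OF s(5)] KN[OF s(8)] KN[OF s(11)] N(4)
        by (intro divring_add[OF N(1)] divring_mult[OF N(1)])
    qed
    have nj: "j * n = n * j"
    proof -
      have "n \<in> Q" using n NQ by blast
      then show ?thesis by (simp add: Q_iff)
    qed
    have "y = a1 * w + q * b1 * w + c1 * v * w + q * d1 * v * w + j * n * w"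
      unfolding x(2) abcd(5) s(3,6,9,12) n_def
      by (simp add: mult.assoc swap distrib_left distrib_right right_diff_distrib left_diff_distrib ac_simps)
    \<comment> \<open>Here \<open>j * w = inverse q * e1\<close>, and \<open>?N\<close> contains
      \<open>inverse q\<close>; so the half \<open>j ?N w\<close> of \<open>Q w\<close> is
      \<open>?N e1\<close>.\<close>
    moreover have "j * n * w \<in> S"
    proof -
      have "j * n * w = n * (inverse q * q) * j * w" unfolding nj using q0 by simp
      also have "\<dots> = n * inverse q * e1" unfolding e1_def by (simp only: mult.assoc jq swap)
      finally have "j * n * w = n * inverse q * e1" .
      moreover have "n * inverse q \<in> ?N"
        using n M(4) N(1,2) by (intro divring_mult divring_inverse) auto
      ultimately show ?thesis using S by (auto simp: line_def)
    qed
    moreover have "a1 * w \<in> S" using S s(1) by (auto simp: line_def)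
    moreover have "q * b1 * w \<in> S"
      by (rule skew) (use K1s[OF s(4)] K1c[OF s(4)] in \<open>simp add: sig_mult w(2) sig_K1[OF s(4)] mult.assoc swap q(4)\<close>)
    moreover have "c1 * v * w \<in> S"
      by (rule skew) (use K1s[OF s(7)] K1c[OF s(7)] in \<open>simp add: sig_mult w(2) sig_K1[OF s(7)] mult.assoc swap v(4)\<close>)
    moreover have "q * d1 * v * w \<in> S"
      by (rule skew) (use K1s[OF s(10)] K1c[OF s(10)] in \<open>simp add: sig_mult w(2) sig_K1[OF s(10)] mult.assoc swap q(4) v(4)\<close>)
    ultimately show "y \<in> S" using add by simp
  qed
  then show ?thesis by simp
qed

lemma Q_eqI:
  assumes "bq F a b" and "\<And>x. x * a = a * x \<and> x * b = b * x \<longleftrightarrow> x * i = i * x \<and> x * j = j * x"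
  shows "bq.Q a b = Q"
  unfolding bq.Q_def[OF assms(1)] Q_def using assms(2) by (auto simp: Cent_iff)

text \<open>Since \<open>w\<close> commutes or anticommutes with each of \<open>i\<close> and
  \<open>j\<close>, conjugation by \<open>w\<close> preserves their common centralizer.\<close>

lemma normalizes_Q:
  assumes w: "w \<noteq> 0" "w * i = i * w \<or> w * i = - (i * w)" "w * j = j * w \<or> w * j = - (j * w)"
  shows "normalizes w Q"
  unfolding normalizes_def
proof
  fix b assume b: "b \<in> Q"
  have c: "\<sigma> b * a = a * \<sigma> b" if "a = i \<or> a = j" for a using sig_Q[OF b] that by (auto simp: Q_iff)
  have "w * \<sigma> b * inverse w \<in> Q"
    unfolding Q_iff
  proof (intro conjI)
    have *: "w * \<sigma> b * inverse w * a = a * (w * \<sigma> b * inverse w)"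
      if "a = i \<or> a = j" "w * a = a * w \<or> w * a = - (a * w)" for a
    proof (rule quotient_commutes[OF w(1)])
      have "w * \<sigma> b * a = w * a * \<sigma> b" using c[OF that(1)] by (simp add: mult.assoc)
      moreover have "a * (w * \<sigma> b) = a * w * \<sigma> b" by (simp add: mult.assoc)
      ultimately show "w * \<sigma> b * a = a * (w * \<sigma> b) \<and> w * a = a * w \<or> w * \<sigma> b * a = - (a * (w * \<sigma> b)) \<and> w * a = - (a * w)"
        using that(2) by auto
    qed
    show "w * \<sigma> b * inverse w * i = i * (w * \<sigma> b * inverse w)" using *[of i] w(2) by blast
    show "w * \<sigma> b * inverse w * j = j * (w * \<sigma> b * inverse w)" using *[of j] w(3) by blast
  qed
  moreover have "w * \<sigma> b = (w * \<sigma> b * inverse w) * w" using w(1) by (simp add: mult.assoc)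
  ultimately show "\<exists>b'\<in>Q. w * \<sigma> b = b' * w" by blast
qed

text \<open>Under conjugation by \<open>i\<close> and \<open>j\<close>, \<open>D\<close> is graded by sign pairs, \<open>D = Q + Q w1 + Q w2 + Q w3\<close>;
  the first two summands make up the centralizer of \<open>i\<close>.\<close>

lemma common_isotropic:
  assumes V: "fdim (\<cdot>) F (64 * n) V" and n: "87 * u div 64 + 63 * u div 32 < n"
  shows "\<exists>v\<in>V. v \<noteq> 0 \<and> (\<forall>x. \<beta> (v \<cdot> x) v = 0)"
proof -
  interpret B2: biquad F \<sigma> j i r by (rule biquad_swap)
  interpret B3: biquad F \<sigma> "i * j" i r by (rule biquad_mult)
  interpret Q2: qform act F \<sigma> V \<beta> u j i r by unfold_locales
  interpret Q3: qform act F \<sigma> V \<beta> u "i * j" i r by unfold_locales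
  have Q2: "B2.Q = Q" by (rule Q_eqI[OF bq_swap]) auto
  have Q3: "B3.Q = Q"
  proof (rule Q_eqI[OF bq_mult])
    fix x
    have "x * (i * j) = i * j * x \<longleftrightarrow> x * j = j * x" if xi: "x * i = i * x"
    proof -
      have "x * (i * j) = i * (x * j)" using xi by (metis mult.assoc)
      moreover have "i * j * x = i * (j * x)" by (rule mult.assoc)
      ultimately show ?thesis using i0 by simp
    qed
    then show "x * (i * j) = i * j * x \<and> x * i = i * x \<longleftrightarrow> x * i = i * x \<and> x * j = j * x" by blast
  qed
  obtain w1 where w1: "w1 \<noteq> 0" "\<sigma> w1 = w1" "w1 * i = i * w1" "w1 * j = - (j * w1)" by (rule sym_w_pm)
  obtain w2 where w2: "w2 \<noteq> 0" "\<sigma> w2 = w2" "w2 * j = j * w2" "w2 * i = - (i * w2)" by (rule B2.sym_w_pm)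
  obtain w3 where w3: "w3 \<noteq> 0" "\<sigma> w3 = w3" "w3 * (i * j) = i * j * w3" "w3 * i = - (i * w3)" by (rule B3.sym_w_pm)
  have w3j: "w3 * j = - (j * w3)"
  proof -
    have "i * (j * w3) = w3 * i * j" using w3(3) by (simp add: mult.assoc)
    also have "\<dots> = i * (- (w3 * j))" unfolding w3(4) by (simp add: mult.assoc)
    finally have "j * w3 = - (w3 * j)" using mult_left_cancel[OF i0] by blast
    then show ?thesis by simp
  qed
  note I1 = Iso_Qw[OF w1] and I2 = Q2.Iso_Qw[OF w2, unfolded Q2] and I3 = Q3.Iso_Qw[OF w3, unfolded Q3]
  have one: "\<sigma> 1 = 1" by (rule sig_1)
  have nQ: "normalizes 1 Q" by (rule normalizes_Q) auto
  have I0: "Iso Q (line Q 1) (45 * u)" unfolding line_1 by (rule Iso_Q)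
  let ?C = "Cent {i}"
  have QC: "Q \<subseteq> ?C" by (auto simp: Q_iff Cent_iff)
  have IC: "Iso ?C (line ?C 1) (45 * u + 2 * (21 * u))"
  proof (rule Iso_closure[OF Iso_compose[OF Q one nQ I0 I1 subset_refl] QC])
    fix N y assume y: "y \<in> line ?C 1" and N: "line Q 1 \<union> line Q w1 \<subseteq> N"
      and add: "\<And>x z. x \<in> N \<Longrightarrow> z \<in> N \<Longrightarrow> x + z \<in> N"
    have yi: "y * i = i * y" using y unfolding line_1 by (simp add: Cent_iff)
    obtain c d where cd: "c \<in> Q" "d \<in> Q" "y = c + d * w1" by (rule C_decomp[OF w1(1,3,4) yi])
    have "c \<in> N" "d * w1 \<in> N" using N cd(1,2) unfolding line_1 by (auto simp: line_def)
    then show "y \<in> N" unfolding cd(3) by (rule add)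
  qed
  have I23: "Iso Q (line Q w2 \<union> line Q w3) (21 * u + 2 * (21 * u))"
    by (rule Iso_compose[OF Q w2(2) _ I2 I3 subset_refl]) (rule normalizes_Q, use w2 in auto)
  have nC: "normalizes 1 ?C"
    unfolding normalizes_def
  proof
    fix b assume "b \<in> ?C"
    then have "\<sigma> (b * i) = \<sigma> (i * b)" by (simp add: Cent_iff)
    then have "\<sigma> b \<in> ?C" by (simp add: Cent_iff sig_mult si)
    then show "\<exists>b'\<in>?C. 1 * \<sigma> b = b' * 1" by simp
  qed
  \<comment> \<open>\<open>T\<close> is a space over the centralizer of \<open>i\<close>, not just
    over \<open>Q\<close>, so its dimension is a multiple of 32 and the rounding below is
    sharper.\<close>
  obtain T d where T: "T \<subseteq> V" "submod (\<cdot>) ?C T" "fdim (\<cdot>) F d T" "64 * n \<le> 45 * u + 2 * (21 * u) + 2 * d"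
    "\<forall>v\<in>T. \<forall>b\<in>?C. \<beta> (v \<cdot> (b * 1)) v = 0"
    by (rule totally_isotropic[OF Cent_props one nC IC subset_refl submod_mono[OF sV subset_UNIV] V])
  obtain t where t: "fdim (\<cdot>) ?C t T" by (rule fdim_over_larger[OF T(3) F_div Cent_props T(2)])
  have "d = 32 * t"
    using fdim_unique[OF fdim_tower[OF quadratic_dim(7)[OF iF ii] F_div Cent_props t] T(3) F_div] .
  \<comment> \<open>Otherwise the integers \<open>t\<close> and \<open>n - t\<close> would be
    bounded by the two floors separately, against the choice of \<open>n\<close>.\<close>
  have "21 * u + 2 * (21 * u) < d"
  proof (rule ccontr)
    assume "\<not> ?thesis"
    then have "t * 32 \<le> 63 * u" "(n - t) * 64 \<le> 87 * u" using \<open>d = 32 * t\<close> T(4) by auto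
    then have "t \<le> 63 * u div 32" "n - t \<le> 87 * u div 64" by (simp_all add: less_eq_div_iff_mult_less_eq)
    then show False using n by linarith
  qed
  then obtain v where v: "v \<in> T" "v \<noteq> 0" "\<forall>x\<in>line Q w2 \<union> line Q w3. \<beta> (v \<cdot> x) v = 0"
    using I23 T(1,3) submod_mono[OF T(2) QC] unfolding Iso_def by blast
  have vV: "v \<in> V" using v T by blast
  have "\<beta> (v \<cdot> x) v = 0" for x
  proof -
    let ?N = "{x. \<beta> (v \<cdot> x) v = 0}"
    have add: "y + z \<in> ?N" if "y \<in> ?N" "z \<in> ?N" for y z using that by (simp add: act_add_right \<beta>_add vV V_act)
    obtain c e where ce: "c * i = i * c" "e * i = i * e" "x = c + e * w2"
      by (rule conj_decomp[OF D subset_UNIV _ i0 F_comm[OF ii] _ w2(1,4), of x]) auto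
    obtain a b where ab: "a \<in> Q" "b \<in> Q" "e = a + b * w1" by (rule C_decomp[OF w1(1,3,4) ce(2)])
    \<comment> \<open>\<open>w1 * w2\<close> has the same sign pair as \<open>w3\<close>, so
      \<open>Q w1 w2\<close> is the piece \<open>Q w3\<close>.\<close>
    define s where "s = w1 * w2 * inverse w3"
    have "s \<in> Q"
      unfolding Q_iff s_def
    proof (intro conjI)
      have "w1 * w2 * i = - (w1 * i * w2)" using w2(4) by (simp add: mult.assoc)
      then have "w1 * w2 * i = - (i * (w1 * w2))" unfolding w1(3) by (simp add: mult.assoc)
      then show "w1 * w2 * inverse w3 * i = i * (w1 * w2 * inverse w3)" using quotient_commutes[OF w3(1)] w3(4) by blast
      have "w1 * w2 * j = w1 * j * w2" using w2(3) by (simp add: mult.assoc)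
      then have "w1 * w2 * j = - (j * (w1 * w2))" unfolding w1(4) by (simp add: mult.assoc)
      then show "w1 * w2 * inverse w3 * j = j * (w1 * w2 * inverse w3)" using quotient_commutes[OF w3(1)] w3j by blast
    qed
    then have "b * s \<in> Q" by (rule divring_mult[OF Q(1) ab(2)])
    then have "b * s * w3 \<in> ?N" using v(3) by (auto simp: line_def)
    moreover have "a * w2 \<in> ?N" using v(3) ab(1) by (auto simp: line_def)
    moreover have "c \<in> ?N" using T(5) v(1) ce(1) by (auto simp: Cent_iff)
    ultimately have "c + (a * w2 + b * s * w3) \<in> ?N" using add by blast
    moreover have "x = c + (a * w2 + b * s * w3)"
      unfolding ce(3) ab(3) s_def using w3(1) by (simp add: distrib_right mult.assoc)
    ultimately show ?thesis by simp
  qed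
  then show ?thesis using v(2) vV by blast
qed

end

section \<open>From hermitian forms to systems of quadratic forms\<close>

lemma fdim_Dspace: "fdim (\<lambda>v d k. v k * d) UNIV n (Dspace n :: (nat \<Rightarrow> 'd::division_ring) set)"
proof (induction n)
  case 0
  have "(Dspace 0 :: (nat \<Rightarrow> 'd) set) = {0}" by (auto simp: Dspace_def fun_eq_iff zero_fun_def)
  then show ?case by (simp add: fdim_0)
next
  case (Suc n)
  let ?act = "\<lambda>v (d::'d) (k::nat). v k * d"
  let ?e = "\<lambda>k. if k = n then 1 else 0 :: 'd"
  have "?e \<notin> Dspace n" by (auto simp: Dspace_def)
  then have "fdim ?act UNIV (Suc n) (flag_step ?act UNIV (Dspace n) ?e)" by (rule fdim_Suc[OF Suc.IH])
  moreover have "flag_step ?act UNIV (Dspace n) ?e = Dspace (Suc n)"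
  proof (intro equalityI subsetI)
    fix v :: "nat \<Rightarrow> 'd" assume v: "v \<in> Dspace (Suc n)"
    have "v = (v(n := 0)) + ?act ?e (v n)" by (auto simp: fun_eq_iff)
    moreover have "v(n := 0) \<in> Dspace n" using v by (auto simp: Dspace_def)
    ultimately show "v \<in> flag_step ?act UNIV (Dspace n) ?e" unfolding flag_step_def by blast
  qed (auto simp: flag_step_def Dspace_def)
  ultimately show ?case by simp
qed

context deg8
begin

lemma iota_sum: "\<iota> (sum f I) = (\<Sum>i\<in>I. \<iota> (f i))"
  by (induction I rule: infinite_finite_induct) (auto simp: iota_0 iota_add)

text \<open>In a basis of \<open>W\<close> the form becomes a coefficient matrix over the field, and
  \<open>m > u\<close> excludes that this matrix is anisotropic.\<close>

lemma isotropic_vector: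
  assumes u: "u_inv TYPE('a) = enat u" and "rmod act" and W: "fdim act F m W" "u < m"
    and g_F: "\<And>v w. v \<in> W \<Longrightarrow> w \<in> W \<Longrightarrow> g v w \<in> F"
    and add_left: "\<And>v v' w. v \<in> W \<Longrightarrow> v' \<in> W \<Longrightarrow> w \<in> W \<Longrightarrow> g (v + v') w = g v w + g v' w"
    and add_right: "\<And>v v' w. v \<in> W \<Longrightarrow> v' \<in> W \<Longrightarrow> w \<in> W \<Longrightarrow> g w (v + v') = g w v + g w v'"
    and left: "\<And>v w c. v \<in> W \<Longrightarrow> w \<in> W \<Longrightarrow> c \<in> F \<Longrightarrow> g (act v c) w = g v w * c"
    and right: "\<And>v w c. v \<in> W \<Longrightarrow> w \<in> W \<Longrightarrow> c \<in> F \<Longrightarrow> g v (act w c) = g v w * c"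
  shows "\<exists>v\<in>W. v \<noteq> 0 \<and> g v v = 0"
proof -
  interpret M: rmod act by fact
  have sW: "submod act F W" by (rule M.fdim_submod[OF W(1) F_divring])
  obtain b where b: "\<forall>i<m. b i \<in> W"
    "\<forall>c. (\<forall>i<m. c i \<in> F) \<longrightarrow> (\<Sum>i<m. act (b i) (c i)) = 0 \<longrightarrow> (\<forall>i<m. c i = 0)"
    by (rule M.fdim_basisE[OF W(1) F_divring])
  have "\<forall>k l. \<exists>x. k < m \<longrightarrow> l < m \<longrightarrow> g (b k) (b l) = \<iota> x" using g_F b(1) by blast
  then obtain a where a: "\<And>k l. k < m \<Longrightarrow> l < m \<Longrightarrow> g (b k) (b l) = \<iota> (a k l)" by metis
  have "\<not> anisotropic_qf m a"
  proof
    assume "anisotropic_qf m a"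
    then have "enat m \<le> u_inv TYPE('a)" unfolding u_inv_def by (intro Sup_upper) blast
    then show False using u W(2) by simp
  qed
  then obtain x where x: "qf_eval m a x = 0" "\<exists>i<m. x i \<noteq> 0" unfolding anisotropic_qf_def by blast
  let ?f = "\<lambda>k. act (b k) (\<iota> (x k))"
  define v where "v = (\<Sum>k<m. ?f k)"
  have f: "?f k \<in> W" if "k < m" for k using b(1) that submod_act[OF sW] by blast
  have zero: "0 \<in> W" by (rule submod_0[OF sW])
  have vW: "v \<in> W" unfolding v_def using f by (intro submod_sum[OF sW]) auto
  have v0: "v \<noteq> 0"
  proof
    assume "v = 0"
    then have "\<forall>i<m. \<iota> (x i) = 0" using b(2)[rule_format, of "\<lambda>k. \<iota> (x k)"] unfolding v_def by blast
    then show False using x(2) iota_eq_0 by blast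
  qed
  have g0: "g 0 w = 0" "g w 0 = 0" if "w \<in> W" for w
    using add_left[OF zero zero that] add_right[OF zero zero that] by simp_all
  have suml: "g (\<Sum>k\<in>I. ?f k) w = (\<Sum>k\<in>I. g (?f k) w)" if "w \<in> W" "finite I" "I \<subseteq> {..<m}" for w I
    using that(2,3)
  proof (induction I rule: finite_induct)
    case (insert k I)
    have "(\<Sum>k\<in>I. ?f k) \<in> W" using f insert.prems by (intro submod_sum[OF sW]) auto
    then show ?case using insert f \<open>w \<in> W\<close> by (simp add: add_left)
  qed (simp add: g0 that)
  have sumr: "g w (\<Sum>k\<in>I. ?f k) = (\<Sum>k\<in>I. g w (?f k))" if "w \<in> W" "finite I" "I \<subseteq> {..<m}" for w I
    using that(2,3)
  proof (induction I rule: finite_induct)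
    case (insert k I)
    have "(\<Sum>k\<in>I. ?f k) \<in> W" using f insert.prems by (intro submod_sum[OF sW]) auto
    then show ?case using insert f \<open>w \<in> W\<close> by (simp add: add_right)
  qed (simp add: g0 that)
  have "g v v = (\<Sum>k<m. g (?f k) v)" unfolding v_def by (rule suml) (use vW v_def in auto)
  also have "\<dots> = (\<Sum>k<m. \<Sum>l<m. g (?f k) (?f l))"
    unfolding v_def by (intro sum.cong refl sumr) (use f in auto)
  also have "\<dots> = (\<Sum>k<m. \<Sum>l<m. \<iota> (a k l * x k * x l))"
    by (intro sum.cong refl) (use f b(1) in \<open>simp add: left right a iota_mult\<close>)
  also have "\<dots> = \<iota> (qf_eval m a x)" unfolding qf_eval_def by (simp add: iota_sum)
  finally show ?thesis using vW v0 x(1) iota_0 by auto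
qed

text \<open>The factor \<open>e\<close> in \<open>\<beta>\<close> adapts \<open>h\<close>, which is
  hermitian for \<open>\<gamma>\<close>, to the twisted involution \<open>\<sigma>\<close>. As
  \<open>l\<close> is nonzero and \<open>D\<close> is a division ring,
  \<open>l (e * \<gamma> x * h v v)\<close> can vanish for all \<open>x\<close> only if
  \<open>h v v = 0\<close>.\<close>

lemma anisotropic_rank_bound:
  assumes u: "u_inv TYPE('a) = enat u" and h: "anisotropic_hermitian \<gamma> n h"
  shows "n \<le> 87 * u div 64 + 63 * u div 32"
proof (rule ccontr)
  assume n: "\<not> ?thesis"
  interpret A: dinv F \<gamma> by unfold_locales
  obtain i where i: "i \<notin> F" "i * i \<in> F" using square_central_exists by blast
  obtain j where j: "j * i = i * j" "j \<notin> A.ext F i" "j * j \<in> F"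
    by (rule A.second_square_central[OF A.dinv_axioms i])
  interpret A: bqs F \<gamma> i j by unfold_locales (fact i j)+
  obtain e where e: "e \<noteq> 0" "\<gamma> e = e" "e * \<gamma> i = i * e" "e * \<gamma> j = j * e" using A.conjugator by blast
  define \<sigma> where "\<sigma> = (\<lambda>d. e * \<gamma> d * inverse e)"
  interpret S: dinv F \<sigma> unfolding \<sigma>_def by (rule A.conj_dinv) (use e in auto)
  obtain z r where z: "r \<le> 64" "\<forall>i<r. z i \<in> G.Sym" "\<forall>i. r \<le> i \<longrightarrow> i < 64 \<longrightarrow> z i \<in> G.Skew"
    "\<forall>x. \<exists>c. x = (\<Sum>i<64. z i * \<iota> (c i))" "fdim (*) F r G.Sym" "fdim (*) F (64 - r) G.Skew"
    by (rule sym_skew_basis)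
  have r: "36 \<le> r" using skew_dim_le[OF z(6)] by simp
  \<comment> \<open>Left multiplication by the symmetric \<open>e\<close> takes
    \<open>\<gamma>\<close>-symmetric elements to \<open>\<sigma>\<close>-symmetric ones, so
    \<open>\<sigma>\<close> is again of orthogonal type.\<close>
  have img: "fdim (*) F r ((*) e ` G.Sym)"
    by (rule fdim_image[OF z(5) rmod_times rmod_times F_divring]) (use e in \<open>auto simp: algebra_simps\<close>)
  obtain r' where r': "fdim (*) F r' S.Sym" using A.fdim_exists[OF S.Sym_submod] by blast
  have "\<sigma> (e * x) = e * x" if "\<gamma> x = x" for x
    unfolding \<sigma>_def using that e by (simp add: gamma_mult mult.assoc)
  then have "(*) e ` G.Sym \<subseteq> S.Sym" by (auto simp: S.Sym_def G.Sym_def)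
  then have "r \<le> r'" by (rule rmod.fdim_mono[OF rmod_times r' img F_divring])
  then have r'36: "36 \<le> r'" using r by simp
  have si: "\<sigma> i = i" "\<sigma> j = j" unfolding \<sigma>_def e(3,4) using e(1) by (simp_all add: mult.assoc)
  obtain l :: "'d \<Rightarrow> 'd" where l: "\<And>x. l x \<in> F" "\<And>x y. l (x + y) = l x + l y" "\<And>x c. c \<in> F \<Longrightarrow> l (x * c) = l x * c"
    "\<And>x y. l (x * y) = l (y * x)" "\<And>x. l (\<gamma> x) = l x" "\<exists>x. l x \<noteq> 0"
    using trace_functional by blast
  let ?act = "\<lambda>v (d::'d) (k::nat). v k * d"
  let ?V = "Dspace n :: (nat \<Rightarrow> 'd) set"
  interpret M: rmod ?act by unfold_locales (auto simp: fun_eq_iff algebra_simps)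
  have plus: "v + w = (\<lambda>i. v i + w i)" for v w :: "nat \<Rightarrow> 'd" by (auto simp: fun_eq_iff)
  have h_add: "h (v + v') w = h v w + h v' w" "h w (v + v') = h w v + h w v'"
    if "v \<in> ?V" "v' \<in> ?V" "w \<in> ?V" for v v' w
    unfolding plus using h that unfolding anisotropic_hermitian_def hermitian_form_def by blast+
  have h_act: "h (?act v a) (?act w b) = \<gamma> a * h v w * b" if "v \<in> ?V" "w \<in> ?V" for v w a b
    using h that unfolding anisotropic_hermitian_def hermitian_form_def by blast
  have h_left: "h (?act v a) w = \<gamma> a * h v w" and h_right: "h v (?act w b) = h v w * b"
    if "v \<in> ?V" "w \<in> ?V" for v w a b
    using h_act[OF that, of a 1] h_act[OF that, of 1 b] by (simp_all add: gamma_1)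
  have h_sym: "h w v = \<gamma> (h v w)" if "v \<in> ?V" "w \<in> ?V" for v w
    using h that unfolding anisotropic_hermitian_def hermitian_form_def by blast
  have h_aniso: "h v v \<noteq> 0" if "v \<in> ?V" "v \<noteq> 0" for v
    using h that unfolding anisotropic_hermitian_def zero_fun_def by blast
  have sV: "submod ?act UNIV ?V" by (auto simp: submod_def Dspace_def)
  have Vact: "?act v d \<in> ?V" if "v \<in> ?V" for v d using that by (auto simp: Dspace_def)
  define \<beta> where "\<beta> = (\<lambda>v w. l (e * h v w))"
  interpret Q: qform ?act F \<sigma> ?V \<beta> u i j r'
  proof
    fix v w assume v: "v \<in> ?V" and w: "w \<in> ?V"
    show "\<beta> v w \<in> F" unfolding \<beta>_def by (rule l(1))
    show "\<beta> (v + v') w = \<beta> v w + \<beta> v' w" if "v' \<in> ?V" for v'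
      unfolding \<beta>_def using h_add(1)[OF v that w] by (simp add: distrib_left l(2))
    show "\<beta> v (?act w c) = \<beta> v w * c" if "c \<in> F" for c
      unfolding \<beta>_def h_right[OF v w] using l(3)[OF that] by (simp flip: mult.assoc)
    have "\<beta> w v = l (\<gamma> (h v w * e))" unfolding \<beta>_def h_sym[OF v w] by (simp add: gamma_mult e(2))
    then show "\<beta> v w = \<beta> w v" unfolding \<beta>_def using l(4)[of e "h v w"] by (simp add: l(5))
    fix d
    have "\<beta> v (?act w (\<sigma> d)) = l ((e * h v w * e * \<gamma> d) * inverse e)"
      unfolding \<beta>_def h_right[OF v w] \<sigma>_def by (simp add: mult.assoc)
    also have "\<dots> = l (inverse e * (e * h v w * e * \<gamma> d))" by (rule l(4))
    also have "\<dots> = l (h v w * (e * \<gamma> d))" using e(1) by (simp flip: mult.assoc)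
    also have "\<dots> = l (e * \<gamma> d * h v w)" by (rule l(4))
    finally show "\<beta> (?act v d) w = \<beta> v (?act w (\<sigma> d))" unfolding \<beta>_def h_left[OF v w] by (simp add: mult.assoc)
  next
    fix s W m assume s: "\<sigma> s = s" and W: "W \<subseteq> ?V" "fdim ?act F m W" "u < m"
    have WV: "x \<in> ?V" if "x \<in> W" for x using that W(1) by blast
    show "\<exists>v\<in>W. v \<noteq> 0 \<and> \<beta> (?act v s) v = 0"
    proof (rule isotropic_vector[OF u M.rmod_axioms W(2,3), where g = "\<lambda>v w. \<beta> (?act v s) w"])
      fix v w assume v: "v \<in> W" and w: "w \<in> W"
      show "\<beta> (?act v s) w \<in> F" unfolding \<beta>_def by (rule l(1))
      have eq: "\<beta> (?act x s) y = l (e * \<gamma> s * h x y)" if "x \<in> ?V" "y \<in> ?V" for x y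
        unfolding \<beta>_def h_left[OF that] by (simp add: mult.assoc)
      have add: "x + y \<in> ?V" if "x \<in> ?V" "y \<in> ?V" for x y using that sV by (simp add: submod_def)
      note V = WV[OF v] WV[OF w]
      show "\<beta> (?act (v + v') s) w = \<beta> (?act v s) w + \<beta> (?act v' s) w" if "v' \<in> W" for v'
        unfolding eq[OF add[OF V(1) WV[OF that]] V(2)] eq[OF V] eq[OF WV[OF that] V(2)]
          h_add(1)[OF V(1) WV[OF that] V(2)] distrib_left l(2) ..
      show "\<beta> (?act w s) (v + v') = \<beta> (?act w s) v + \<beta> (?act w s) v'" if "v' \<in> W" for v'
        unfolding eq[OF V(2) add[OF V(1) WV[OF that]]] eq[OF V(2,1)] eq[OF V(2) WV[OF that]]
          h_add(2)[OF V(1) WV[OF that] V(2)] distrib_left l(2) ..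
      fix c assume c: "c \<in> F"
      have "\<gamma> c = c" by (rule G.J_E[OF c])
      then have "e * \<gamma> s * h (?act v c) w = e * \<gamma> s * h v w * c"
        unfolding h_left[OF V] using F_comm[OF c] by (simp add: mult.assoc)
      then show "\<beta> (?act (?act v c) s) w = \<beta> (?act v s) w * c"
        unfolding eq[OF Vact[OF V(1)] V(2)] eq[OF V] using l(3)[OF c] by simp
      show "\<beta> (?act v s) (?act w c) = \<beta> (?act v s) w * c"
        unfolding eq[OF V(1) Vact[OF V(2)]] eq[OF V] h_right[OF V] using l(3)[OF c] by (simp flip: mult.assoc)
    qed
  qed (use sV si r' r'36 in auto)
  have "fdim ?act F (64 * n) ?V"
    by (rule M.fdim_tower[OF dim_D F_divring C.D subset_UNIV fdim_Dspace])
  then obtain v where v: "v \<in> ?V" "v \<noteq> 0" "\<And>x. \<beta> (?act v x) v = 0" using Q.common_isotropic n by (meson not_le)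
  obtain y where y: "l y \<noteq> 0" using l(6) by blast
  let ?z = "h v v"
  \<comment> \<open>The argument is chosen so that \<open>e\<close> and \<open>h v v\<close> cancel
    and only \<open>l y\<close> remains.\<close>
  have "\<beta> (?act v (\<gamma> (inverse e * y * inverse ?z))) v = l (e * (inverse e * y * inverse ?z * ?z))"
    unfolding \<beta>_def h_left[OF v(1,1)] gamma_gamma ..
  also have "\<dots> = l y" using e(1) h_aniso[OF v(1,2)] by (simp add: mult.assoc) (simp flip: mult.assoc)
  finally show False using y v(3) by simp
qed

end

theorem theorem6p1:
  fixes \<iota> :: "'a::field \<Rightarrow> 'd::division_ring"
    and \<gamma> :: "'d \<Rightarrow> 'd"
    and \<kappa> :: "'a \<Rightarrow> 'k::field"
    and \<phi> :: "'d \<Rightarrow> 'k^8^8"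
    and u :: nat
  assumes nonreal: "nonreal_field TYPE('a)"
    and char: "(2::'a) \<noteq> 0"
    and u_fin: "u_inv TYPE('a) = enat u"
    and D: "central_division_algebra_deg8 \<iota>"
    and inv: "F_linear_involution \<iota> \<gamma>"
    and split: "splitting_deg8 \<iota> \<kappa> \<phi>"
    and orth: "orthogonal_wrt \<phi> \<gamma>"
  shows "u_plus \<gamma> \<le> enat (nat \<lfloor>87/64 * real u\<rfloor> + nat \<lfloor>63/32 * real u\<rfloor>)
    \<and> real_of_int (\<lfloor>87/64 * real u\<rfloor> + \<lfloor>63/32 * real u\<rfloor>) \<le> 213/64 * real u"
proof
  interpret deg8 \<iota> \<gamma> \<kappa> \<phi> by unfold_locales fact+
  \<comment> \<open>The floors are integer quotients, the form in which
    \<open>anisotropic_rank_bound\<close> states the bound.\<close>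
  have "87/64 * real u = real (87 * u) / real 64" "63/32 * real u = real (63 * u) / real 32" by simp_all
  then have f: "\<lfloor>87/64 * real u\<rfloor> = int (87 * u div 64)" "\<lfloor>63/32 * real u\<rfloor> = int (63 * u div 32)"
    by (simp_all only: floor_divide_of_nat_eq)
  show "u_plus \<gamma> \<le> enat (nat \<lfloor>87/64 * real u\<rfloor> + nat \<lfloor>63/32 * real u\<rfloor>)"
    unfolding u_plus_def f
  proof (rule Sup_least)
    fix x assume "x \<in> {enat n | n. \<exists>h. anisotropic_hermitian \<gamma> n h}"
    then obtain n h where "x = enat n" "anisotropic_hermitian \<gamma> n h" by blast
    then show "x \<le> enat (nat (int (87 * u div 64)) + nat (int (63 * u div 32)))"
      using anisotropic_rank_bound[OF u_fin] by simp
  qed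
  have "\<lfloor>87/64 * real u\<rfloor> \<le> 87/64 * real u" "\<lfloor>63/32 * real u\<rfloor> \<le> 63/32 * real u" by (rule of_int_floor_le)+
  then show "real_of_int (\<lfloor>87/64 * real u\<rfloor> + \<lfloor>63/32 * real u\<rfloor>) \<le> 213/64 * real u" by simp
qed

end
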